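(* Let $\mathbf I=\mathrm{diag}(I_1,I_2,I_2)$ with $I_1\ne I_2$, $0<I_i<\tfrac12$ and $I_1+2I_2=1$, and let $\psi\in S^1$ with $\psi\ne0,\pm\frac\pi2,\pi$. For $R>0$ large consider the conical relative equilibrium $((\mathrm{Id},\mathbf R),(\xi,\eta))$ of the axisymmetric second order model with angle $\psi$ and orbital radius $R$, given by $$\mathbf R=R(\cos\psi,\sin\psi,0),\qquad \xi=(\xi_1,\lambda R\sin\psi,0),\qquad \xi_1=\frac{3\cos\psi}{\lambda R^4}+\frac{I_1}{I_1-I_2}\eta,$$ $$\eta=\frac{\cos\psi\,(I_1-I_2)}{2\sin^2\psi\,\lambda I_1R^6}\Big((15\cos^2\psi-9)(I_1-I_2)-8R^2+6R^2\cos^2\psi+2\lambda^2R^7\sin^2\psi\Big),$$ $$\lambda^2=\frac{\cos^2\psi\,\big(2R^2+(9-15\cos^2\psi)(I_1-I_2)\big)^2}{2R^7\sin^2\psi\,\big(2R^2+(3-9\cos^2\psi)(I_1-I_2)\big)} .$$ If $R$ is large enough, then: (i) if $I_1<I_2$ (prolate body), the conical equilibrium is $G^{\mathrm{axi}}_\mu$-stable; (ii) if $I_1>I_2$ (oblate body) and $4I_2>3I_1$, the conical equilibrium is unstable.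
   Context: Axisymmetric second order satellite model. Units are chosen so that the satellite has mass $1$ and its inertia tensor $\mathbf I=\mathrm{diag}(I_1,I_2,I_2)$ has trace $1$; the first body axis $\mathbf e_1$ is the symmetry axis. The configuration space is $Q=SO(3)\times(\mathbb R^3\setminus\{0\})$ with points $(B,\mathbf R)$ in body coordinates. Tangent vectors are written $(\Omega,\dot{\mathbf R})\in\mathbb R^3\times\mathbb R^3$ with $\dot B=B\widehat\Omega$, where $\widehat\Omega u=\Omega\times u$. The kinetic energy is $K=\frac12(\Omega\cdot\mathbf I\Omega+|\dot{\mathbf R}+\Omega\times\mathbf R|^2)$, the potential is $$V_2(\mathbf R)=-\frac1R-\frac1{2R^3}+\frac{3}{2R^5}\,\mathbf R\cdot\mathbf I\mathbf R,\qquad R=|\mathbf R|,$$ and the system on $T^*Q$ has Hamiltonian $H_2=K+V_2$. Symmetry. Let $\Gamma^{\mathrm{axi}}\subset O(3)$ be the group of block matrices $\mathrm{diag}(s,O)$ with $s\in\{1,-1\}$, $O\in O(2)$, let $\chi(\mathrm{diag}(s,O))=\det O$, and let $G^{\mathrm{axi}}=SO(3)\times\Gamma^{\mathrm{axi}}$ act on $Q$ by $(M,N)\cdot(B,\mathbf R)=(MBN^T\det N,\,N\mathbf R)$, and on $T^*Q$ by cotangent lift. Its Lie algebra is identified with $\mathbb R^3\oplus\mathbb R$, where $(\xi,\eta)$ generates $(\exp(t\widehat\xi),\exp(t\eta\,\widehat{\mathbf e_1}))$, with infinitesimal generator $(\xi,\eta)_Q(B,\mathbf R)=(B^T\xi-\eta\mathbf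 e_1,\ \eta\,\mathbf e_1\times\mathbf R)$. The momentum map $\mathbf J:T^*Q\to\mathbb R^3\oplus\mathbb R$ is that of the cotangent lifted action, and the coadjoint action is $(M,N)\cdot(\mu,\nu)=(M\mu,\chi(N)\nu)$. A relative equilibrium with velocity $(\xi,\eta)$ is a phase space point whose evolution is the orbit of the one-parameter subgroup generated by $(\xi,\eta)$; the pair $(q,(\xi,\eta))$ denotes the point of $T^*_qQ$ that is the Legendre transform of $(\xi,\eta)_Q(q)$. $G^{\mathrm{axi}}_\mu$ is the stabilizer of its momentum value $\mu\in\mathbb R^3\oplus\mathbb R$. Stability. For a symmetry group $G$, a relative equilibrium $p$ with momentum $\mu$ is $G_\mu$-stable if for every $G_\mu$-invariant neighborhood $U$ of $G_\mu\cdot p$ there is a neighborhood $O$ of $p$ such that the Hamiltonian evolution of $O$ stays in $U$ for all time. It is called unstable when the linearization at $p$ of the Hamiltonian vector field of $H_2-\langle\mathbf J,(\xi,\eta)\rangle$, induced on the symplectic slice $\ker d\mathbf J(p)/(\mathfrak g_\mu\cdot p)$, has an eigenvalue with positive real part. *)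

theory Defs
  imports "HOL-Analysis.Analysis"
begin

unbundle cross3_syntax

section \<open>Rotations\<close>

definition hat :: "real^3 \<Rightarrow> real^3^3" where
  "hat u = matrix (cross3 u)"

definition mat_exp :: "real^3^3 \<Rightarrow> real^3^3" where
  "mat_exp A = (\<Sum>n. (((\<lambda>X. A ** X) ^^ n) (mat 1)) /\<^sub>R fact n)"

abbreviation e1 :: "real^3" where "e1 \<equiv> axis 1 1"


section \<open>Configuration space, phase space, Hamiltonian\<close>

text \<open>
  Everything on \<open>TQ\<close> and \<open>T\<^sup>*Q\<close> is expressed in the body (left) trivialisation of \<open>SO(3)\<close>:
  a tangent vector at \<open>(B, R)\<close> is a pair \<open>(\<Omega>, v)\<close>, standing for the velocities
  \<open>B ** hat \<Omega>\<close> and \<open>v\<close>; a covector is a pair \<open>(\<pi>, P)\<close> with the pairing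
  \<open>\<pi> \<bullet> \<Omega> + P \<bullet> v\<close>.  A point of \<open>T\<^sup>*Q\<close> is thus \<open>(B, R, \<pi>, P)\<close>, and a tangent vector
  of \<open>T\<^sup>*Q\<close> is a quadruple \<open>(\<Omega>, v, \<sigma>, \<rho>)\<close>.
\<close>

type_synonym config = "(real^3^3) \<times> (real^3)"
type_synonym velocity = "(real^3) \<times> (real^3)"
type_synonym phase = "(real^3^3) \<times> (real^3) \<times> (real^3) \<times> (real^3)"
type_synonym tangent = "(real^3) \<times> (real^3) \<times> (real^3) \<times> (real^3)"

definition config_space :: "config set" where
  "config_space = {(B, R). rotation_matrix B \<and> R \<noteq> 0}"

definition phase_space :: "phase set" where
  "phase_space = {(B, R, \<pi>, P). (B, R) \<in> config_space}"

definition inertia_axi :: "real \<Rightarrow> real \<Rightarrow> real^3^3" where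
  "inertia_axi I\<^sub>1 I\<^sub>2 = (\<chi> i j. if i = j then (if i = 1 then I\<^sub>1 else I\<^sub>2) else 0)"

definition kinetic :: "real^3^3 \<Rightarrow> real^3 \<Rightarrow> velocity \<Rightarrow> real" where
  "kinetic \<I> R = (\<lambda>(\<Omega>, v). (\<Omega> \<bullet> (\<I> *v \<Omega>) + (norm (v + \<Omega> \<times> R))\<^sup>2) / 2)"

definition potential2 :: "real^3^3 \<Rightarrow> real^3 \<Rightarrow> real" where
  "potential2 \<I> R = - 1 / norm R - 1 / (2 * norm R ^ 3)
      + 3 / (2 * norm R ^ 5) * (R \<bullet> (\<I> *v R))"

text \<open>The Legendre transform of the kinetic energy on the fibre over a configuration with
  position \<open>R\<close>, and its inverse.\<close>

definition legendre :: "real^3^3 \<Rightarrow> real^3 \<Rightarrow> velocity \<Rightarrow> velocity" where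
  "legendre \<I> R = (\<lambda>(\<Omega>, v). (\<I> *v \<Omega> + R \<times> (v + \<Omega> \<times> R), v + \<Omega> \<times> R))"

definition legendre_inv :: "real^3^3 \<Rightarrow> real^3 \<Rightarrow> velocity \<Rightarrow> velocity" where
  "legendre_inv \<I> R = (\<lambda>(\<pi>, P).
     let \<Omega> = matrix_inv \<I> *v (\<pi> - R \<times> P) in (\<Omega>, P - \<Omega> \<times> R))"

definition hamiltonian2 :: "real^3^3 \<Rightarrow> phase \<Rightarrow> real" where
  "hamiltonian2 \<I> = (\<lambda>(B, R, \<pi>, P). kinetic \<I> R (legendre_inv \<I> R (\<pi>, P)) + potential2 \<I> R)"

lemma legendre_fibre_derivative:
  assumes "transpose \<I> = \<I>"
  shows "(kinetic \<I> R has_derivative (\<lambda>w. legendre \<I> R u \<bullet> w)) (at u)"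
proof -
  have sym: "x \<bullet> (\<I> *v y) = (\<I> *v x) \<bullet> y" for x y :: "real^3"
    using dot_lmul_matrix[of x \<I> y] assms by (metis transpose_matrix_vector)
  have trip: "(R \<times> x) \<bullet> y = x \<bullet> (y \<times> R)" for x y :: "real^3"
    by (simp add: cross3_simps)
  define c :: "velocity \<Rightarrow> real^3" where "c w = snd w + fst w \<times> R" for w
  define m :: "velocity \<Rightarrow> real^3" where "m w = \<I> *v fst w" for w
  have "linear c"
    by (rule linearI) (simp_all add: c_def cross_add_left cross_mult_left scaleR_add_right)
  then have c': "(c has_derivative c) (at u)"
    by (simp add: bounded_linear_imp_has_derivative linear_linear)
  have "linear m"
    by (rule linearI)
       (simp_all add: m_def matrix_vector_right_distrib matrix_vector_mult_scaleR)
  then have m': "(m has_derivative m) (at u)"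
    by (simp add: bounded_linear_imp_has_derivative linear_linear)
  have f': "(fst has_derivative fst) (at u)"
    by (simp add: bounded_linear_fst bounded_linear_imp_has_derivative)
  have K: "kinetic \<I> R = (\<lambda>w. (1/2) * (fst w \<bullet> m w + c w \<bullet> c w))"
    by (auto simp: fun_eq_iff kinetic_def c_def m_def dot_square_norm split: prod.split)
  have "((\<lambda>w. (1/2) * (fst w \<bullet> m w + c w \<bullet> c w)) has_derivative
      (\<lambda>w. (1/2) * ((fst u \<bullet> m w + fst w \<bullet> m u) + (c u \<bullet> c w + c w \<bullet> c u)))) (at u)"
    by (intro has_derivative_mult_right has_derivative_add has_derivative_inner c' m' f')
  moreover have "(1/2) * ((fst u \<bullet> m w + fst w \<bullet> m u) + (c u \<bullet> c w + c w \<bullet> c u))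
      = legendre \<I> R u \<bullet> w" for w
  proof -
    have "legendre \<I> R u = (m u + R \<times> c u, c u)"
      by (simp add: legendre_def c_def m_def split: prod.split)
    moreover have "fst u \<bullet> m w = m u \<bullet> fst w" by (simp add: m_def sym)
    moreover have "(R \<times> c u) \<bullet> fst w + c u \<bullet> snd w = c u \<bullet> c w"
      by (simp add: trip c_def[of w] inner_add_right)
    ultimately show ?thesis
      by (cases w) (simp add: inner_add_left inner_commute[of "c (_, _)"] inner_commute[of _ "m u"])
  qed
  ultimately show ?thesis by (simp add: K)
qed

lemma matrix_inv_inverse:
  assumes "invertible A"
  shows "A ** matrix_inv A = mat 1" "matrix_inv A ** A = mat 1"
  using someI_ex[OF assms[unfolded invertible_def]] by (simp_all add: matrix_inv_def)

lemma legendre_legendre_inv: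
  assumes "invertible \<I>"
  shows "legendre \<I> R (legendre_inv \<I> R m) = m"
  by (cases m) (simp add: legendre_def legendre_inv_def Let_def matrix_vector_mul_assoc
      matrix_inv_inverse[OF assms])

lemma legendre_inv_legendre:
  assumes "invertible \<I>"
  shows "legendre_inv \<I> R (legendre \<I> R u) = u"
  by (cases u) (simp add: legendre_def legendre_inv_def Let_def matrix_vector_mul_assoc
      matrix_inv_inverse[OF assms])


section \<open>Hamiltonian dynamics\<close>

text \<open>The velocity in the ambient vector space that a trivialised tangent vector stands for.\<close>

definition ambient :: "phase \<Rightarrow> tangent \<Rightarrow> phase" where
  "ambient = (\<lambda>(B, R, \<pi>, P) (\<Omega>, v, \<sigma>, \<rho>). (B ** hat \<Omega>, v, \<sigma>, \<rho>))"

text \<open>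
  All functions differentiated below are given by formulas that are smooth near the phase space
  in the ambient vector space.  Only directions tangent to the phase space are used, so the
  result does not depend on this extension.
\<close>

definition directional :: "(phase \<Rightarrow> 'a::real_normed_vector) \<Rightarrow> phase \<Rightarrow> tangent \<Rightarrow> 'a" where
  "directional f p w = frechet_derivative f (at p) (ambient p w)"

text \<open>
  The canonical symplectic form \<open>-d\<theta>\<close>, where \<open>\<theta>\<close> is the canonical one-form
  \<open>\<theta> (\<Omega>, v, \<sigma>, \<rho>) = \<pi> \<bullet> \<Omega> + P \<bullet> v\<close>.  The term \<open>\<pi> \<bullet> (\<Omega> \<times> \<Omega>')\<close> comes from the
  bracket of left invariant vector fields, \<open>[hat \<Omega>, hat \<Omega>'] = hat (\<Omega> \<times> \<Omega>')\<close>.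
\<close>

definition symplectic :: "phase \<Rightarrow> tangent \<Rightarrow> tangent \<Rightarrow> real" where
  "symplectic = (\<lambda>(B, R, \<pi>, P) (\<Omega>, v, \<sigma>, \<rho>) (\<Omega>', v', \<sigma>', \<rho>').
     \<sigma>' \<bullet> \<Omega> - \<sigma> \<bullet> \<Omega>' + \<pi> \<bullet> (\<Omega> \<times> \<Omega>') + \<rho>' \<bullet> v - \<rho> \<bullet> v')"

definition ham_vf :: "(phase \<Rightarrow> real) \<Rightarrow> phase \<Rightarrow> tangent" where
  "ham_vf f p = (THE X. \<forall>w. symplectic p X w = directional f p w)"

lemma symplectic_nondegenerate:
  assumes "linear \<alpha>"
  shows "\<exists>!X. \<forall>w. symplectic p X w = \<alpha> w"
proof -
  obtain B R \<pi> P where p: "p = (B, R, \<pi>, P)" by (cases p)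
  obtain a r b c where ab: "adjoint \<alpha> 1 = (a, r, b, c)" by (cases "adjoint \<alpha> 1")
  have \<alpha>: "\<alpha> w = (a, r, b, c) \<bullet> w" for w
    using adjoint_works[OF assms, of w 1] ab by (simp add: inner_commute)
  have rot: "\<pi> \<bullet> (x \<times> y) = (\<pi> \<times> x) \<bullet> y" for x y by (simp add: cross3_simps)
  have val: "symplectic p (x, v, y, z) w = (\<pi> \<times> x - y, - z, x, v) \<bullet> w" for x v y z w
    by (cases w) (simp add: p symplectic_def inner_prod_def rot inner_diff_right inner_diff_left inner_commute)
  show ?thesis
  proof (rule ex1I)
    show "\<forall>w. symplectic p (b, c, \<pi> \<times> b - a, - r) w = \<alpha> w"
      by (simp add: val \<alpha>)
  next
    fix X assume X: "\<forall>w. symplectic p X w = \<alpha> w"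
    obtain x v y z where Xe: "X = (x, v, y, z)" by (cases X)
    have "(\<pi> \<times> x - y, - z, x, v) = (a, r, b, c)"
      using X by (metis Xe val \<alpha> vector_eq_rdot)
    then show "X = (b, c, \<pi> \<times> b - a, - r)" by (auto simp: Xe)
  qed
qed

definition integral_curve :: "(phase \<Rightarrow> tangent) \<Rightarrow> (real \<Rightarrow> phase) \<Rightarrow> bool" where
  "integral_curve X c \<longleftrightarrow>
     (\<forall>t. c t \<in> phase_space \<and> (c has_vector_derivative ambient (c t) (X (c t))) (at t))"

definition evolution :: "real^3^3 \<Rightarrow> phase \<Rightarrow> (real \<Rightarrow> phase) \<Rightarrow> bool" where
  "evolution \<I> p c \<longleftrightarrow> c 0 = p \<and> integral_curve (ham_vf (hamiltonian2 \<I>)) c"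


section \<open>Symmetry group\<close>

type_synonym group_elt = "(real^3^3) \<times> (real^3^3)"
type_synonym lie_elt = "(real^3) \<times> real"

definition block_diag :: "real \<Rightarrow> real^2^2 \<Rightarrow> real^3^3" where
  "block_diag s A = vector [vector [s, 0, 0], vector [0, A$1$1, A$1$2], vector [0, A$2$1, A$2$2]]"

definition Gamma_axi :: "(real^3^3) set" where
  "Gamma_axi = {block_diag s A | s A. s \<in> {1, -1} \<and> orthogonal_matrix A}"

definition chi_axi :: "real^3^3 \<Rightarrow> real" where
  "chi_axi N = det (vector [vector [N$2$2, N$2$3], vector [N$3$2, N$3$3]] :: real^2^2)"

definition G_axi :: "group_elt set" where
  "G_axi = {(M, N). rotation_matrix M \<and> N \<in> Gamma_axi}"

definition act_Q :: "group_elt \<Rightarrow> config \<Rightarrow> config" where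
  "act_Q = (\<lambda>(M, N) (B, R). (det N *\<^sub>R (M ** B ** transpose N), N *v R))"

text \<open>
  The tangent map of \<open>act_Q (M, N)\<close> is \<open>(\<Omega>, v) \<mapsto> (det N *\<^sub>R (N *v \<Omega>), N *v v)\<close>.  Its
  fibres are orthogonal maps, so the inverse transpose, which defines the cotangent lift, is
  given by the same matrices.
\<close>

definition act_T :: "group_elt \<Rightarrow> phase \<Rightarrow> phase" where
  "act_T = (\<lambda>(M, N) (B, R, \<pi>, P).
     (det N *\<^sub>R (M ** B ** transpose N), N *v R, det N *\<^sub>R (N *v \<pi>), N *v P))"

lemma tangent_map_act_Q:
  assumes "orthogonal_matrix N"
  shows "det N *\<^sub>R (M ** (B ** hat \<Omega>) ** transpose N)
       = (det N *\<^sub>R (M ** B ** transpose N)) ** hat (det N *\<^sub>R (N *v \<Omega>))"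
proof -
  have hatv: "hat u *v x = u \<times> x" for u x :: "real^3"
  proof -
    have "linear (cross3 u)" by (rule linearI) (simp_all add: cross_add_right cross_mult_right)
    then show ?thesis by (simp add: hat_def matrix_works)
  qed
  have 1: "transpose N ** N = mat 1" "N ** transpose N = mat 1"
    using assms by (auto simp: orthogonal_matrix_def)
  have "N *v (\<Omega> \<times> (transpose N *v x)) = hat (det N *\<^sub>R (N *v \<Omega>)) *v x" for x
  proof -
    have d: "det N * det N = 1" using det_orthogonal_matrix[OF assms] by auto
    have "(N *v \<Omega>) \<times> x = (N *v \<Omega>) \<times> (N *v (transpose N *v x))"
      by (simp only: matrix_vector_mul_assoc 1 matrix_vector_mul_lid)
    also have "\<dots> = det N *\<^sub>R (N *v (\<Omega> \<times> (transpose N *v x)))"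
      using cross_orthogonal_matrix[OF assms] .
    finally have "(det N *\<^sub>R (N *v \<Omega>)) \<times> x
        = (det N * det N) *\<^sub>R (N *v (\<Omega> \<times> (transpose N *v x)))"
      by (simp add: cross_mult_left)
    then show ?thesis by (simp only: d hatv scaleR_one)
  qed
  then have "N ** hat \<Omega> ** transpose N = hat (det N *\<^sub>R (N *v \<Omega>))"
    by (auto simp: matrix_eq hatv simp flip: matrix_vector_mul_assoc)
  moreover have "M ** B ** transpose N ** (N ** hat \<Omega> ** transpose N)
      = M ** (B ** hat \<Omega>) ** transpose N"
    by (metis 1(1) matrix_mul_assoc matrix_mul_rid)
  ultimately show ?thesis
    by (simp flip: scalar_matrix_assoc)
qed

lemma cotangent_lift_act_T:
  assumes "orthogonal_matrix N"
  shows "(det N *\<^sub>R (N *v \<pi>)) \<bullet> (det N *\<^sub>R (N *v \<Omega>)) + (N *v P) \<bullet> (N *v v) = \<pi> \<bullet> \<Omega> + P \<bullet> v"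
proof -
  have "(N *v x) \<bullet> (N *v y) = x \<bullet> y" for x y
    using assms by (metis dot_lmul_matrix matrix_vector_mul_assoc matrix_vector_mul_lid
        orthogonal_matrix_def transpose_matrix_vector inner_commute)
  moreover have "det N * det N = 1" using det_orthogonal_matrix[OF assms] by auto
  ultimately show ?thesis by (simp flip: mult.assoc)
qed

definition group_exp :: "lie_elt \<Rightarrow> group_elt" where
  "group_exp = (\<lambda>(\<xi>, \<eta>). (mat_exp (hat \<xi>), mat_exp (\<eta> *\<^sub>R hat e1)))"

definition generator_Q :: "lie_elt \<Rightarrow> config \<Rightarrow> velocity" where
  "generator_Q = (\<lambda>(\<xi>, \<eta>) (B, R). (transpose B *v \<xi> - \<eta> *\<^sub>R e1, \<eta> *\<^sub>R (e1 \<times> R)))"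

definition momentum :: "phase \<Rightarrow> lie_elt" where
  "momentum = (\<lambda>(B, R, \<pi>, P). (B *v \<pi>, e1 \<bullet> (R \<times> P) - e1 \<bullet> \<pi>))"

lemma momentum_pairing:
  "momentum (B, R, \<pi>, P) \<bullet> \<zeta> = (\<pi>, P) \<bullet> generator_Q \<zeta> (B, R)"
proof -
  obtain \<xi> \<eta> where z: "\<zeta> = (\<xi>, \<eta>)" by (cases \<zeta>)
  have "(B *v \<pi>) \<bullet> \<xi> = \<pi> \<bullet> (transpose B *v \<xi>)"
    by (metis dot_lmul_matrix inner_commute transpose_matrix_vector)
  moreover have "e1 \<bullet> (R \<times> P) = P \<bullet> (e1 \<times> R)" by (simp add: cross3_simps)
  ultimately show ?thesis
    by (simp add: z momentum_def generator_Q_def inner_prod_def inner_diff_right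
        inner_commute[of \<pi> e1] algebra_simps)
qed

definition coadjoint :: "group_elt \<Rightarrow> lie_elt \<Rightarrow> lie_elt" where
  "coadjoint = (\<lambda>(M, N) (\<mu>, \<nu>). (M *v \<mu>, chi_axi N * \<nu>))"

definition stabilizer :: "lie_elt \<Rightarrow> group_elt set" where
  "stabilizer \<mu> = {g \<in> G_axi. coadjoint g \<mu> = \<mu>}"

definition stabilizer_algebra :: "lie_elt \<Rightarrow> lie_elt set" where
  "stabilizer_algebra \<mu> = {\<zeta>. \<forall>t::real. group_exp (t *\<^sub>R \<zeta>) \<in> stabilizer \<mu>}"


section \<open>Relative equilibria and their stability\<close>

definition phase_point :: "real^3^3 \<Rightarrow> config \<Rightarrow> lie_elt \<Rightarrow> phase" where
  "phase_point \<I> = (\<lambda>(B, R) \<zeta>. (B, R, legendre \<I> R (generator_Q \<zeta> (B, R))))"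

definition relative_equilibrium :: "real^3^3 \<Rightarrow> lie_elt \<Rightarrow> phase \<Rightarrow> bool" where
  "relative_equilibrium \<I> \<zeta> p \<longleftrightarrow> evolution \<I> p (\<lambda>t. act_T (group_exp (t *\<^sub>R \<zeta>)) p)"

definition neighborhood :: "phase set \<Rightarrow> phase set \<Rightarrow> bool" where
  "neighborhood A U \<longleftrightarrow> U \<subseteq> phase_space \<and>
     (\<exists>W. openin (top_of_set phase_space) W \<and> A \<subseteq> W \<and> W \<subseteq> U)"

text \<open>The existence clause below says that no evolution starting in \<open>N\<close> breaks down in finite
  time.\<close>

definition Gmu_stable :: "real^3^3 \<Rightarrow> phase \<Rightarrow> bool" where
  "Gmu_stable \<I> p \<longleftrightarrow>
     (\<forall>U. neighborhood ((\<lambda>g. act_T g p) ` stabilizer (momentum p)) U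
          \<and> (\<forall>g \<in> stabilizer (momentum p). act_T g ` U \<subseteq> U)
        \<longrightarrow> (\<exists>N. neighborhood {p} N \<and>
              (\<forall>x \<in> N. (\<exists>c. evolution \<I> x c)
                 \<and> (\<forall>c. evolution \<I> x c \<longrightarrow> (\<forall>t. c t \<in> U)))))"

text \<open>The linearisation at a zero of a vector field is the same in every trivialisation of the
  tangent bundle, so it can be read off from the components.\<close>

definition linearization :: "(phase \<Rightarrow> tangent) \<Rightarrow> phase \<Rightarrow> tangent \<Rightarrow> tangent" where
  "linearization X p w = directional X p w"

definition ker_dJ :: "phase \<Rightarrow> tangent set" where
  "ker_dJ p = {w. directional momentum p w = 0}"

definition gmu_orbit_tangent :: "phase \<Rightarrow> tangent set" where
  "gmu_orbit_tangent p = {w. \<exists>\<zeta> \<in> stabilizer_algebra (momentum p).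
     ((\<lambda>t. act_T (group_exp (t *\<^sub>R \<zeta>)) p) has_vector_derivative ambient p w) (at 0)}"

text \<open>\<open>\<kappa>\<close> is an eigenvalue, with eigenvector represented by \<open>u + \<i> w\<close>, of the
  complexification of the map that \<open>L\<close> induces on the quotient space \<open>V / W\<close>.\<close>

definition quotient_eigenvalue ::
    "('v::real_vector \<Rightarrow> 'v) \<Rightarrow> 'v set \<Rightarrow> 'v set \<Rightarrow> complex \<Rightarrow> bool" where
  "quotient_eigenvalue L V W \<kappa> \<longleftrightarrow>
     (\<exists>u \<in> V. \<exists>w \<in> V. \<not> (u \<in> W \<and> w \<in> W)
        \<and> L u - (Re \<kappa> *\<^sub>R u - Im \<kappa> *\<^sub>R w) \<in> W
        \<and> L w - (Im \<kappa> *\<^sub>R u + Re \<kappa> *\<^sub>R w) \<in> W)"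

definition unstable :: "real^3^3 \<Rightarrow> lie_elt \<Rightarrow> phase \<Rightarrow> bool" where
  "unstable \<I> \<zeta> p \<longleftrightarrow>
     (\<exists>\<kappa>. Re \<kappa> > 0 \<and>
        quotient_eigenvalue
          (linearization (ham_vf (\<lambda>x. hamiltonian2 \<I> x - momentum x \<bullet> \<zeta>)) p)
          (ker_dJ p) (gmu_orbit_tangent p) \<kappa>)"


section \<open>The conical equilibria\<close>

definition conical_position :: "real \<Rightarrow> real \<Rightarrow> real^3" where
  "conical_position \<psi> R = R *\<^sub>R vector [cos \<psi>, sin \<psi>, 0]"

definition conical_lambda_squared :: "real \<Rightarrow> real \<Rightarrow> real \<Rightarrow> real \<Rightarrow> real" where
  "conical_lambda_squared I\<^sub>1 I\<^sub>2 \<psi> R =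
     ((cos \<psi>)\<^sup>2 * (2 * R\<^sup>2 + (9 - 15 * (cos \<psi>)\<^sup>2) * (I\<^sub>1 - I\<^sub>2))\<^sup>2)
     / (2 * R ^ 7 * (sin \<psi>)\<^sup>2 * (2 * R\<^sup>2 + (3 - 9 * (cos \<psi>)\<^sup>2) * (I\<^sub>1 - I\<^sub>2)))"

definition conical_eta :: "real \<Rightarrow> real \<Rightarrow> real \<Rightarrow> real \<Rightarrow> real \<Rightarrow> real" where
  "conical_eta I\<^sub>1 I\<^sub>2 \<psi> R l =
     (cos \<psi> * (I\<^sub>1 - I\<^sub>2)) / (2 * (sin \<psi>)\<^sup>2 * l * I\<^sub>1 * R ^ 6)
     * ((15 * (cos \<psi>)\<^sup>2 - 9) * (I\<^sub>1 - I\<^sub>2) - 8 * R\<^sup>2 + 6 * R\<^sup>2 * (cos \<psi>)\<^sup>2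
        + 2 * l\<^sup>2 * R ^ 7 * (sin \<psi>)\<^sup>2)"

definition conical_xi :: "real \<Rightarrow> real \<Rightarrow> real \<Rightarrow> real \<Rightarrow> real \<Rightarrow> real^3" where
  "conical_xi I\<^sub>1 I\<^sub>2 \<psi> R l =
     vector [3 * cos \<psi> / (l * R ^ 4) + I\<^sub>1 / (I\<^sub>1 - I\<^sub>2) * conical_eta I\<^sub>1 I\<^sub>2 \<psi> R l,
             l * R * sin \<psi>, 0]"

definition conical_velocity :: "real \<Rightarrow> real \<Rightarrow> real \<Rightarrow> real \<Rightarrow> real \<Rightarrow> lie_elt" where
  "conical_velocity I\<^sub>1 I\<^sub>2 \<psi> R l = (conical_xi I\<^sub>1 I\<^sub>2 \<psi> R l, conical_eta I\<^sub>1 I\<^sub>2 \<psi> R l)"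

definition conical_point :: "real \<Rightarrow> real \<Rightarrow> real \<Rightarrow> real \<Rightarrow> real \<Rightarrow> phase" where
  "conical_point I\<^sub>1 I\<^sub>2 \<psi> R l =
     phase_point (inertia_axi I\<^sub>1 I\<^sub>2) (mat 1, conical_position \<psi> R)
       (conical_velocity I\<^sub>1 I\<^sub>2 \<psi> R l)"

end

theory Submission
  imports Defs
begin

text \<open>
  Put \<open>R = S\<^sup>2\<close>, \<open>\<epsilon> = 1 / R\<^sup>2\<close> and rescale lengths by \<open>S\<^sup>2\<close>, velocities by \<open>1 / S\<close> and the spin
  of the body by \<open>1 / S\<^sup>3\<close>; the conical equilibria then form a smooth curve in \<open>\<epsilon>\<close> through the
  Kepler problem at \<open>\<epsilon> = 0\<close>.

  Prolate bodies: on a common level set of \<open>|m|\<close> and of the spin component along \<open>e1\<close> the energy is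
  bounded below by a function of three shape variables, with equality at the equilibrium.  For small
  \<open>\<epsilon>\<close> and \<open>I\<^sub>1 < I\<^sub>2\<close> this function is strictly convex, so the equilibrium is a strict minimum modulo
  rotations about \<open>e1\<close>, and compactness of the orbit turns this into a barrier for nearby motions.
  Since the barrier keeps motions away from collisions, they coincide with motions of a bounded
  Lipschitz field, which exist for all time.

  Oblate bodies: a real positive eigenvalue \<open>\<kappa>\<close> of the linearization is sought on the time scale of
  the orbit.  Eliminating the variation of the position leaves two equations for the rotation of the
  body, whose determinant at \<open>\<epsilon> = 0\<close> is negative for \<open>\<kappa>\<close> near \<open>0\<close> and positive for large \<open>\<kappa>\<close>; both
  signs persist for small \<open>\<epsilon> > 0\<close>.
\<close>

text \<open>The obstacle is that the limit is degenerate: at e = 0, with m fixed, the reduced energy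
  \<open>g\<close> is the Kepler energy and depends on the inverse distance alone; the attitude
  enters only at order e. The Hessian entries are therefore kept with their powers of e divided out,
  and eliminating the distance by a Schur complement changes the attitude block only by order e.
  With a = \<open>I\<^sub>1 - I\<^sub>2\<close>, the limit of that block has leading entry
  \<open>I\<^sub>2 - 3 * a * (cos \<psi>)\<^sup>2\<close> and determinant
  \<open>(cos \<psi>)\<^sup>2 * (1 - 3 * a / I\<^sub>2)\<close>, both positive for prolate bodies.
  The same gap in orders drives the oblate case: the torque equations carry an overall factor e, and
  the determinant left after dividing by it starts at \<kappa> = 0 with
  \<open>- 3 * a * (cos \<psi>)\<^sup>2 * (I\<^sub>2 - 3 * a)\<close>. This is where 4 I2 > 3 I1
  enters, since it says I2 > 3 a. The equations of the position become singular at \<kappa> = 0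
  (their limit determinant is \<open>\<kappa>\<^sup>2 * (\<kappa>\<^sup>2 + 1)\<^sup>2\<close>), so
  the search for \<kappa> starts at a positive number.\<close>

section \<open>Global flows of bounded Lipschitz fields\<close>

text \<open>An integral over an interval with reversed ends is 0, so for either sign of t at most
  one of the two terms survives, and the difference is the oriented integral from 0 to t.\<close>

definition signed_integral :: "(real \<Rightarrow> 'a::euclidean_space) \<Rightarrow> real \<Rightarrow> 'a" where
  "signed_integral g t = integral {0..t} g - integral {t..0} g"

text \<open>A base point to the left of both 0 and t turns the oriented integral into ordinary
  integrals with a fixed lower limit, so that differentiation needs no case split at t = 0.\<close>

lemma signed_integral_shift:
  fixes g :: "real \<Rightarrow> 'a::euclidean_space"
  assumes g: "continuous_on UNIV g" and "b \<le> t" "b \<le> 0"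
  shows "signed_integral g t = integral {b..t} g - integral {b..0} g"
proof -
  have ig: "g integrable_on {x..y}" for x y
    by (rule integrable_continuous_interval) (use g continuous_on_subset in blast)
  show ?thesis
  proof (cases "t \<ge> 0")
    case True
    have "integral {b..0} g + integral {0..t} g = integral {b..t} g"
      by (rule Henstock_Kurzweil_Integration.integral_combine) (use assms True ig in auto)
    moreover have "integral {t..0} g = 0" using True
      by (cases "t = 0") auto
    ultimately show ?thesis by (simp add: signed_integral_def algebra_simps)
  next
    case False
    have "integral {b..t} g + integral {t..0} g = integral {b..0} g"
      by (rule Henstock_Kurzweil_Integration.integral_combine) (use assms False ig in auto)
    moreover have "integral {0..t} g = 0" using False by auto
    ultimately show ?thesis by (simp add: signed_integral_def algebra_simps)
  qed
qed

lemma signed_integral_has_vector_derivative: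
  fixes g :: "real \<Rightarrow> 'a::euclidean_space"
  assumes g: "continuous_on UNIV g"
  shows "(signed_integral g has_vector_derivative g t) (at t)"
proof -
  define b where "b = - \<bar>t\<bar> - 1"
  define c where "c = \<bar>t\<bar> + 1"
  have gc: "continuous_on S g" for S using g continuous_on_subset by blast
  have "((\<lambda>u. integral {b..u} g) has_vector_derivative g t) (at t within {b..c})"
    by (rule integral_has_vector_derivative) (use gc in \<open>auto simp: b_def c_def\<close>)
  then have "((\<lambda>u. integral {b..u} g) has_vector_derivative g t) (at t within {b<..<c})"
    by (rule has_vector_derivative_within_subset) auto
  then have "((\<lambda>u. integral {b..u} g) has_vector_derivative g t) (at t)"
    by (subst (asm) at_within_open) (auto simp: b_def c_def)
  then have D: "((\<lambda>u. integral {b..u} g - integral {b..0} g) has_vector_derivative g t) (at t)"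
    by (auto intro!: derivative_eq_intros)
  have ev: "\<forall>\<^sub>F u in nhds t. integral {b..u} g - integral {b..0} g = signed_integral g u"
  proof -
    have "\<forall>\<^sub>F u in nhds t. u \<in> {b<..<c}"
      by (rule eventually_nhds_in_open) (auto simp: b_def c_def)
    then show ?thesis
      by eventually_elim (subst signed_integral_shift[OF g, of b], auto simp: b_def)
  qed
  show ?thesis
    using D unfolding has_vector_derivative_def
    by (rule has_derivative_transform_eventually)
       (use ev eventually_nhds_x_imp_x[OF ev] in \<open>auto simp: eventually_at_filter elim: eventually_mono\<close>)
qed

text \<open>The factor 1/k gained by integrating the exponential weight is what makes the Picard
  operator contract: with k twice the Lipschitz constant the contraction factor is 1/2.\<close>

lemma norm_signed_integral_exp_bound:
  fixes g :: "real \<Rightarrow> 'a::euclidean_space"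
  assumes g: "continuous_on UNIV g" and k: "k > 0" and C: "C \<ge> 0"
    and b: "\<And>s. norm (g s) \<le> C * exp (k * \<bar>s\<bar>)"
  shows "norm (signed_integral g t) \<le> C / k * exp (k * \<bar>t\<bar>)"
proof -
  have ig: "g integrable_on {x..y}" for x y
    by (rule integrable_continuous_interval) (use g continuous_on_subset in blast)
  show ?thesis
  proof (cases "t \<ge> 0")
    case True
    have I: "((\<lambda>s. C * exp (k * s)) has_integral (C / k * exp (k * t) - C / k * exp (k * 0))) {0..t}"
      by (rule fundamental_theorem_of_calculus)
         (use True k in \<open>auto intro!: derivative_eq_intros simp: has_real_derivative_iff_has_vector_derivative[symmetric]\<close>)
    have "norm (integral {0..t} g) \<le> integral {0..t} (\<lambda>s. C * exp (k * s))"
      proof (rule integral_norm_bound_integral)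
      show "g integrable_on {0..t}" by (rule ig)
      show "(\<lambda>s. C * exp (k * s)) integrable_on {0..t}" using I by (rule has_integral_integrable)
      show "norm (g s) \<le> C * exp (k * s)" if "s \<in> {0..t}" for s
        using b[of s] that by simp
    qed
    also have "\<dots> = C / k * exp (k * t) - C / k" using integral_unique[OF I] by simp
    also have "\<dots> \<le> C / k * exp (k * \<bar>t\<bar>)" using True C k by simp
    finally have "norm (integral {0..t} g) \<le> C / k * exp (k * \<bar>t\<bar>)" .
    moreover have "integral {t..0} g = 0" using True by (cases "t = 0") auto
    ultimately show ?thesis by (simp add: signed_integral_def)
  next
    case False
    have I: "((\<lambda>s. C * exp (- k * s)) has_integral (- C / k * exp (- k * 0) - (- C / k * exp (- k * t)))) {t..0}"
      by (rule fundamental_theorem_of_calculus)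
         (use False k in \<open>auto intro!: derivative_eq_intros simp: has_real_derivative_iff_has_vector_derivative[symmetric]\<close>)
    have "norm (integral {t..0} g) \<le> integral {t..0} (\<lambda>s. C * exp (- k * s))"
      proof (rule integral_norm_bound_integral)
      show "g integrable_on {t..0}" by (rule ig)
      show "(\<lambda>s. C * exp (- k * s)) integrable_on {t..0}" using I by (rule has_integral_integrable)
      show "norm (g s) \<le> C * exp (- k * s)" if "s \<in> {t..0}" for s
        using b[of s] that by simp
    qed
    also have "\<dots> = C / k * exp (- k * t) - C / k" using integral_unique[OF I] by simp
    also have "\<dots> \<le> C / k * exp (k * \<bar>t\<bar>)" using False C k by simp
    finally have "norm (integral {t..0} g) \<le> C / k * exp (k * \<bar>t\<bar>)" .
    moreover have "integral {0..t} g = 0" using False by auto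
    ultimately show ?thesis by (simp add: signed_integral_def)
  qed
qed

text \<open>In the weighted norm \<open>sup exp (-2 L \<bar>t\<bar>) \<bar>x t\<bar>\<close> the Picard operator is a contraction on
  the whole real line, so no continuation argument is needed.\<close>

theorem global_flow_exists:
  fixes f :: "'a::euclidean_space \<Rightarrow> 'a"
  assumes lip: "L-lipschitz_on UNIV f" and bd: "bounded (range f)"
  shows "\<exists>x. x 0 = x0 \<and> (\<forall>t. (x has_vector_derivative f (x t)) (at t))"
proof -
  obtain F0 where F0: "\<And>x. norm (f x) \<le> F0" using bd by (auto simp: bounded_iff)
  define F where "F = max F0 1"
  have F: "norm (f x) \<le> F" "F > 0" for x using F0[of x] by (auto simp: F_def)
  define K where "K = max L 1"
  have K: "K > 0" "norm (f x - f y) \<le> K * norm (x - y)" for x y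
  proof -
    have "norm (f x - f y) \<le> L * norm (x - y)" using lip by (auto simp: lipschitz_on_def dist_norm)
    also have "\<dots> \<le> K * norm (x - y)" by (intro mult_right_mono) (auto simp: K_def)
    finally show "norm (f x - f y) \<le> K * norm (x - y)" .
  qed (auto simp: K_def)
  have fc: "continuous_on UNIV f" using lip by (rule lipschitz_on_continuous_on)
  define k where "k = 2 * K"
  have k: "k > 0" using K(1) by (simp add: k_def)
  define E where "E t = exp (k * \<bar>t\<bar>)" for t
  have E: "E t > 0" "exp (- k * \<bar>t\<bar>) = inverse (E t)" for t by (auto simp: E_def exp_minus)
  have Ec: "continuous_on UNIV E" unfolding E_def by (intro continuous_intros)
  have E1: "1 \<le> E t" for t using k by (simp add: E_def)
  \<comment> \<open>The unknown is \<open>y\<close> with x = x0 + E y. In this variable the weighted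
    norm is the plain supremum norm, so the fixed point theorem runs in the complete space of
    bounded continuous functions; \<open>T\<close> is the Picard operator rewritten for
    \<open>y\<close>.\<close>
  define G where "G y s = f (x0 + E s *\<^sub>R y s)" for y :: "real \<Rightarrow> 'a" and s
  have Gc: "continuous_on UNIV (G y)" if "continuous_on UNIV y" for y
    unfolding G_def by (intro continuous_on_compose2[OF fc] continuous_intros Ec that) auto
  define T where "T y t = inverse (E t) *\<^sub>R signed_integral (G y) t" for y t
  have Tb: "T (apply_bcontfun y) \<in> bcontfun" for y :: "real \<Rightarrow>\<^sub>C 'a"
  proof -
    have yc: "continuous_on UNIV (apply_bcontfun y)" by (simp add: continuous_on_apply_bcontfun)
    have c1: "continuous_on UNIV (signed_integral (G y))"
      using signed_integral_has_vector_derivative[OF Gc[OF yc]]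
      by (meson continuous_at_imp_continuous_on has_vector_derivative_continuous)
    have c2: "continuous_on UNIV (\<lambda>t. inverse (E t))"
      using Ec E(1) by (intro continuous_intros) (auto simp: less_imp_neq[symmetric])
    have "continuous_on UNIV (T y)"
      unfolding T_def by (rule continuous_on_scaleR[OF c2 c1])
    moreover have "norm (T y t) \<le> F / k" for t
    proof -
      have "norm (signed_integral (G y) t) \<le> F / k * exp (k * \<bar>t\<bar>)"
      proof (rule norm_signed_integral_exp_bound[OF Gc[OF yc] k])
        show "norm (G y s) \<le> F * exp (k * \<bar>s\<bar>)" for s
        proof -
          have "norm (G y s) \<le> F * 1" using F by (simp add: G_def)
          also have "\<dots> \<le> F * E s" using E1 F(2) by (intro mult_left_mono) auto
          finally show ?thesis by (simp add: E_def)
        qed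
      qed (use F(2) in auto)
      then have "inverse (E t) * norm (signed_integral (G y) t) \<le> inverse (E t) * (F / k * E t)"
        using E(1)[of t] by (intro mult_left_mono) (auto simp: E_def)
      also have "\<dots> = F / k" using E(1)[of t] by (simp add: mult.left_commute[of "inverse (E t)"])
      finally show ?thesis using E(1)[of t] by (simp add: T_def)
    qed
    ultimately show ?thesis by (auto simp: bcontfun_def bounded_iff)
  qed
  define TT where "TT y = Bcontfun (T (apply_bcontfun y))" for y
  have TT: "apply_bcontfun (TT y) = T (apply_bcontfun y)" for y
    unfolding TT_def by (rule Bcontfun_inverse[OF Tb])
  have contr: "dist (TT y) (TT z) \<le> 1/2 * dist y z" for y z
  proof (rule dist_bound)
    fix t
    have yc: "continuous_on UNIV (apply_bcontfun y)" "continuous_on UNIV (apply_bcontfun z)"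
      by (simp_all add: continuous_on_apply_bcontfun)
    define H where "H s = G y s - G z s" for s
    have Hc: "continuous_on UNIV H" unfolding H_def by (intro continuous_intros Gc yc)
    have "norm (signed_integral H t) \<le> (K * dist y z) / k * exp (k * \<bar>t\<bar>)"
    proof (rule norm_signed_integral_exp_bound[OF Hc k])
      fix s
      have "norm (H s) \<le> K * norm ((x0 + E s *\<^sub>R y s) - (x0 + E s *\<^sub>R z s))"
        unfolding H_def G_def by (rule K)
      also have "\<dots> = K * (E s * dist (y s) (z s))"
        using E(1)[of s] by (simp add: dist_norm flip: scaleR_diff_right)
      also have "\<dots> \<le> K * (E s * dist y z)"
        using K(1) E(1)[of s] dist_bounded[of y s z] by (intro mult_left_mono) auto
      finally show "norm (H s) \<le> K * dist y z * exp (k * \<bar>s\<bar>)" by (simp add: E_def mult_ac)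
    qed (use K(1) in auto)
    moreover have "signed_integral H t = signed_integral (G y) t - signed_integral (G z) t"
    proof -
      have "G w integrable_on {u..v}" if "w = apply_bcontfun y \<or> w = apply_bcontfun z" for w u v
        by (rule integrable_continuous_interval) (use Gc yc that continuous_on_subset in blast)
      then have "integral {u..v} H = integral {u..v} (G y) - integral {u..v} (G z)" for u v
        unfolding H_def by (intro Henstock_Kurzweil_Integration.integral_diff) blast+
      then show ?thesis by (simp add: signed_integral_def)
    qed
    ultimately have S: "norm (signed_integral (G y) t - signed_integral (G z) t) \<le> 1/2 * dist y z * E t"
      using K(1) by (simp add: k_def E_def)
    have "dist (T y t) (T z t) = inverse (E t) * norm (signed_integral (G y) t - signed_integral (G z) t)"
      using E(1)[of t] by (simp add: T_def dist_norm flip: scaleR_diff_right)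
    also have "\<dots> \<le> inverse (E t) * (1/2 * dist y z * E t)"
      using E(1)[of t] S by (intro mult_left_mono) auto
    also have "\<dots> = 1/2 * dist y z" using E(1)[of t] by (simp add: mult.left_commute[of "inverse (E t)"])
    finally have "dist (T y t) (T z t) \<le> 1/2 * dist y z" .
    then show "dist (TT y t) (TT z t) \<le> 1/2 * dist y z" by (simp add: TT)
  qed
  have "\<exists>!y. TT y = y"
    by (rule banach_fix_type[where c = "1/2"]) (use contr in auto)
  then obtain y where y: "TT y = y" by blast
  define x where "x t = x0 + E t *\<^sub>R y t" for t
  have yc: "continuous_on UNIV (apply_bcontfun y)" by (simp add: continuous_on_apply_bcontfun)
  have "y t = T y t" for t using TT[of y] y by metis
  then have x: "x t = x0 + signed_integral (G y) t" for t
    using E(1)[of t] by (simp add: x_def T_def)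
  have "(x has_vector_derivative f (x t)) (at t)" for t
  proof -
    have "((\<lambda>t. x0 + signed_integral (G y) t) has_vector_derivative G y t) (at t)"
      using signed_integral_has_vector_derivative[OF Gc[OF yc]]
      by (auto intro!: derivative_eq_intros)
    moreover have "(\<lambda>t. x0 + signed_integral (G y) t) = x" by (auto simp: x)
    moreover have "G y t = f (x t)" by (simp add: G_def x_def)
    ultimately show ?thesis by simp
  qed
  moreover have "x 0 = x0" by (simp add: x signed_integral_def)
  ultimately show ?thesis by blast
qed

section \<open>Calculus of matrix and cross products, and Hamiltonian vector fields\<close>

lemma bounded_bilinear_cross3: "bounded_bilinear cross3"
  using bilinear_cross bilinear_conv_bounded_bilinear by blast

lemma bounded_bilinear_matrix_vector_mult:
  "bounded_bilinear ((*v) :: real^'n^'m \<Rightarrow> real^'n \<Rightarrow> real^'m)"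
  unfolding bilinear_conv_bounded_bilinear[symmetric] bilinear_def
  by (auto intro!: linearI simp: matrix_vector_right_distrib matrix_vector_mult_add_rdistrib
      matrix_vector_mult_scaleR scaleR_matrix_vector_assoc)

lemma matrix_add_rdistrib': "(B + C) ** A = (B ** A) + (C ** A)" for A :: "'a::semiring_1^'n^'m"
  by (vector matrix_matrix_mult_def sum.distrib[symmetric] field_simps)

lemma bounded_bilinear_matrix_matrix_mult:
  "bounded_bilinear ((**) :: real^'n^'m \<Rightarrow> real^'k^'n \<Rightarrow> real^'k^'m)"
  unfolding bilinear_conv_bounded_bilinear[symmetric] bilinear_def
  by (auto intro!: linearI simp: matrix_add_ldistrib matrix_add_rdistrib'
      scalar_matrix_assoc matrix_scalar_ac)

lemmas has_derivative_cross3 [derivative_intros] =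
  bounded_bilinear.FDERIV[OF bounded_bilinear_cross3]
lemmas has_derivative_matrix_vector_mult [derivative_intros] =
  bounded_bilinear.FDERIV[OF bounded_bilinear_matrix_vector_mult]
lemmas has_derivative_matrix_matrix_mult [derivative_intros] =
  bounded_bilinear.FDERIV[OF bounded_bilinear_matrix_matrix_mult]
lemmas has_vector_derivative_matrix_vector_mult =
  bounded_bilinear.has_vector_derivative[OF bounded_bilinear_matrix_vector_mult]
lemmas has_vector_derivative_matrix_matrix_mult =
  bounded_bilinear.has_vector_derivative[OF bounded_bilinear_matrix_matrix_mult]
lemmas has_vector_derivative_cross3 =
  bounded_bilinear.has_vector_derivative[OF bounded_bilinear_cross3]

lemma hat_mult: "hat u *v x = u \<times> x"
proof -
  have "linear (cross3 u)" by (rule linearI) (simp_all add: cross_add_right cross_mult_right)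
  then show ?thesis by (simp add: hat_def matrix_works)
qed

lemma matrix_vector_inner_transpose: "(A *v x) \<bullet> y = x \<bullet> (transpose A *v y)"
  for A :: "real^'n^'m"
  by (metis dot_lmul_matrix inner_commute transpose_matrix_vector)

lemma cross_triple: "x \<bullet> (y \<times> z) = (x \<times> y) \<bullet> z" "x \<bullet> (y \<times> z) = y \<bullet> (z \<times> x)" "x \<bullet> (y \<times> z) = z \<bullet> (x \<times> y)"
  by (simp_all add: cross3_simps)

text \<open>The symplectic form is inverted by hand once the differential is written as an inner
  product. The term \<open>m \<times> b\<close> comes from the bracket term of the form in the left
  trivialisation.\<close>

lemma ham_vf_eqI:
  assumes D: "(f has_derivative D) (at p)"
    and eq: "\<And>w. D (ambient p w) = (a, r, b, c) \<bullet> w"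
    and p: "p = (B, R, m, P)"
  shows "ham_vf f p = (b, c, m \<times> b - a, - r)"
proof -
  have dir: "directional f p w = (a, r, b, c) \<bullet> w" for w
    using frechet_derivative_at[OF D] eq by (simp add: directional_def)
  have "linear (directional f p)" unfolding dir
    by (rule linearI) (simp_all add: inner_add_right)
  then have ex: "\<exists>!X. \<forall>w. symplectic p X w = directional f p w"
    by (rule symplectic_nondegenerate)
  have rot: "m \<bullet> (x \<times> y) = (m \<times> x) \<bullet> y" for x y by (rule cross_triple)
  have "symplectic p (b, c, m \<times> b - a, - r) w = directional f p w" for w
    unfolding dir by (cases w) (simp add: p symplectic_def inner_prod_def inner_diff_right inner_diff_left
        rot inner_commute)
  then show ?thesis unfolding ham_vf_def
    by (intro the1_equality[OF ex]) blast
qed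

section \<open>The axisymmetric Hamiltonian\<close>

lemma e1_nth [simp]: "e1 $ 1 = 1" "e1 $ 2 = 0" "e1 $ 3 = 0"
  by (simp_all add: axis_def)

lemma inner_e1: "e1 \<bullet> x = x $ 1" "x \<bullet> e1 = x $ 1"
  by (simp_all add: inner_axis inner_axis')

lemma inertia_axi_mult: "inertia_axi I\<^sub>1 I\<^sub>2 *v x = I\<^sub>2 *\<^sub>R x + ((I\<^sub>1 - I\<^sub>2) * (e1 \<bullet> x)) *\<^sub>R e1"
  by (simp add: inertia_axi_def matrix_vector_mult_def vec_eq_iff sum_3 forall_3 inner_e1 algebra_simps)

lemma matrix_inv_inertia_axi:
  assumes "I\<^sub>1 \<noteq> 0" "I\<^sub>2 \<noteq> 0"
  shows "matrix_inv (inertia_axi I\<^sub>1 I\<^sub>2) = inertia_axi (1 / I\<^sub>1) (1 / I\<^sub>2)"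
proof -
  have 1: "inertia_axi I\<^sub>1 I\<^sub>2 ** inertia_axi (1 / I\<^sub>1) (1 / I\<^sub>2) = mat 1"
    "inertia_axi (1 / I\<^sub>1) (1 / I\<^sub>2) ** inertia_axi I\<^sub>1 I\<^sub>2 = mat 1"
    using assms by (auto simp: inertia_axi_def matrix_matrix_mult_def vec_eq_iff sum_3 forall_3 mat_def)
  then have "invertible (inertia_axi I\<^sub>1 I\<^sub>2)" by (auto simp: invertible_def)
  from matrix_inv_inverse(2)[OF this] 1(1) show ?thesis
    by (metis matrix_mul_assoc matrix_mul_lid matrix_mul_rid)
qed

lemma inertia_axi_sym: "x \<bullet> (inertia_axi I\<^sub>1 I\<^sub>2 *v y) = (inertia_axi I\<^sub>1 I\<^sub>2 *v x) \<bullet> y"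
  by (simp add: inertia_axi_mult inner_add_left inner_add_right inner_commute)

text \<open>The angular velocity as a function on phase space, that is, the first component of
  \<open>legendre_inv\<close>; \<open>m - R \<times> P\<close> is the spin of the body, the total
  angular momentum minus its orbital part.\<close>

definition body_rate :: "real \<Rightarrow> real \<Rightarrow> real^3 \<Rightarrow> real^3 \<Rightarrow> real^3 \<Rightarrow> real^3" where
  "body_rate I\<^sub>1 I\<^sub>2 R m P = inertia_axi (1 / I\<^sub>1) (1 / I\<^sub>2) *v (m - R \<times> P)"

definition grad_potential :: "real \<Rightarrow> real^3 \<Rightarrow> real^3" where
  "grad_potential a R =
     (1 / norm R ^ 3 + 3 * a / (2 * norm R ^ 5) - 15 * a * (e1 \<bullet> R)\<^sup>2 / (2 * norm R ^ 7)) *\<^sub>R R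
     + (3 * a * (e1 \<bullet> R) / norm R ^ 5) *\<^sub>R e1"

text \<open>With trace 1 the coefficient \<open>3 * I\<^sub>2 - 1\<close> of the isotropic inverse
  cube equals \<open>I\<^sub>2 - I\<^sub>1\<close>, so the inertia enters the potential through the
  difference of the moments only.\<close>

lemma potential2_axi:
  assumes "I\<^sub>1 + 2 * I\<^sub>2 = 1" and "R \<noteq> 0"
  shows "potential2 (inertia_axi I\<^sub>1 I\<^sub>2) R
    = - 1 / norm R - (I\<^sub>1 - I\<^sub>2) / (2 * norm R ^ 3) + 3 * (I\<^sub>1 - I\<^sub>2) * (e1 \<bullet> R)\<^sup>2 / (2 * norm R ^ 5)"
proof -
  have "R \<bullet> (inertia_axi I\<^sub>1 I\<^sub>2 *v R) = I\<^sub>2 * norm R ^ 2 + (I\<^sub>1 - I\<^sub>2) * (e1 \<bullet> R)\<^sup>2"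
    by (simp add: inertia_axi_mult inner_add_right power2_norm_eq_inner inner_commute[of R e1] power2_eq_square[of "e1 \<bullet> R"])
  moreover have "I\<^sub>1 = 1 - 2 * I\<^sub>2" using assms(1) by simp
  ultimately show ?thesis using assms(2) unfolding potential2_def
    by (simp add: divide_simps) (simp add: algebra_simps power2_eq_square eval_nat_numeral)
qed

lemma has_derivative_inverse_norm_power:
  fixes R :: "'a::real_inner"
  assumes "R \<noteq> 0"
  shows "((\<lambda>x. 1 / norm x ^ n) has_derivative (\<lambda>h. - real n / norm R ^ (n + 2) * (R \<bullet> h))) (at R)"
proof -
  have "(norm has_derivative (\<lambda>h. R \<bullet> h / norm R)) (at R)"
    using has_derivative_norm[OF assms] by (simp add: sgn_div_norm inner_commute divide_inverse mult.commute)
  from has_derivative_power[OF this, of n]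
  have "((\<lambda>x. norm x ^ n) has_derivative (\<lambda>h. real n * (R \<bullet> h / norm R) * norm R ^ (n - 1))) (at R)"
    by (simp add: mult_ac)
  from Deriv.has_derivative_inverse[OF _ this]
  have "((\<lambda>x. inverse (norm x ^ n)) has_derivative
     (\<lambda>h. - (inverse (norm R ^ n) * (real n * (R \<bullet> h / norm R) * norm R ^ (n - 1)) * inverse (norm R ^ n)))) (at R)"
    using assms by simp
  moreover have "- (inverse (norm R ^ n) * (real n * (R \<bullet> h / norm R) * norm R ^ (n - 1)) * inverse (norm R ^ n))
      = - real n / norm R ^ (n + 2) * (R \<bullet> h)" for h
    using assms by (cases n) (simp_all add: field_simps)
  ultimately show ?thesis by (simp only: inverse_eq_divide)
qed

lemma potential2_has_derivative:
  assumes tr: "I\<^sub>1 + 2 * I\<^sub>2 = 1" and R: "R \<noteq> 0"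
  shows "(potential2 (inertia_axi I\<^sub>1 I\<^sub>2) has_derivative (\<lambda>h. grad_potential (I\<^sub>1 - I\<^sub>2) R \<bullet> h)) (at R)"
proof -
  define a where "a = I\<^sub>1 - I\<^sub>2"
  define V where "V x = - 1 * (1 / norm x ^ 1) - a / 2 * (1 / norm x ^ 3) + 3 * a / 2 * ((e1 \<bullet> x)\<^sup>2 * (1 / norm x ^ 5))" for x :: "real^3"
  have e: "((\<lambda>x. (e1 \<bullet> x)\<^sup>2) has_derivative (\<lambda>h. 2 * (e1 \<bullet> R) * (e1 \<bullet> h))) (at R)"
    by (auto intro!: derivative_eq_intros)
  have "(V has_derivative (\<lambda>h. - 1 * (- real 1 / norm R ^ (1 + 2) * (R \<bullet> h))
      - a / 2 * (- real 3 / norm R ^ (3 + 2) * (R \<bullet> h))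
      + 3 * a / 2 * ((e1 \<bullet> R)\<^sup>2 * (- real 5 / norm R ^ (5 + 2) * (R \<bullet> h))
           + 2 * (e1 \<bullet> R) * (e1 \<bullet> h) * (1 / norm R ^ 5)))) (at R)"
    unfolding V_def
    by (intro has_derivative_add has_derivative_diff has_derivative_mult_right has_derivative_mult e
         has_derivative_inverse_norm_power[OF R])
  moreover have "- 1 * (- real 1 / norm R ^ (1 + 2) * (R \<bullet> h))
      - a / 2 * (- real 3 / norm R ^ (3 + 2) * (R \<bullet> h))
      + 3 * a / 2 * ((e1 \<bullet> R)\<^sup>2 * (- real 5 / norm R ^ (5 + 2) * (R \<bullet> h))
           + 2 * (e1 \<bullet> R) * (e1 \<bullet> h) * (1 / norm R ^ 5)) = grad_potential a R \<bullet> h" for h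
    by (simp add: grad_potential_def inner_add_left algebra_simps eval_nat_numeral)
  ultimately have "(V has_derivative (\<lambda>h. grad_potential a R \<bullet> h)) (at R)" by simp
  moreover have "V x = potential2 (inertia_axi I\<^sub>1 I\<^sub>2) x" if "x \<in> - {0}" for x
    using that potential2_axi[OF tr, of x] by (simp add: V_def a_def)
  ultimately show ?thesis
    unfolding a_def[symmetric] using R
    by (elim has_derivative_transform_within_open[where s = "- {0}"]) auto
qed

lemma hamiltonian2_axi:
  assumes "I\<^sub>1 \<noteq> 0" "I\<^sub>2 \<noteq> 0"
  shows "hamiltonian2 (inertia_axi I\<^sub>1 I\<^sub>2) (B, R, m, P)
    = (1/2) * (body_rate I\<^sub>1 I\<^sub>2 R m P \<bullet> (m - R \<times> P) + P \<bullet> P) + potential2 (inertia_axi I\<^sub>1 I\<^sub>2) R"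
proof -
  have "inertia_axi I\<^sub>1 I\<^sub>2 *v (inertia_axi (1 / I\<^sub>1) (1 / I\<^sub>2) *v x) = x" for x
    using assms by (simp add: vec_eq_iff inertia_axi_mult forall_3 inner_e1 field_simps)
  then show ?thesis
    by (simp add: hamiltonian2_def kinetic_def legendre_inv_def Let_def matrix_inv_inertia_axi[OF assms]
      body_rate_def power2_norm_eq_inner)
qed

lemma hamiltonian2_has_derivative:
  fixes R m P :: "real^3"
  assumes I: "I\<^sub>1 \<noteq> 0" "I\<^sub>2 \<noteq> 0" "I\<^sub>1 + 2 * I\<^sub>2 = 1" and R: "R \<noteq> 0"
  defines "\<Omega> \<equiv> body_rate I\<^sub>1 I\<^sub>2 R m P"
  shows "(hamiltonian2 (inertia_axi I\<^sub>1 I\<^sub>2) has_derivative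
     (\<lambda>(b, r, q, y). \<Omega> \<bullet> (q - r \<times> P - R \<times> y) + P \<bullet> y + grad_potential (I\<^sub>1 - I\<^sub>2) R \<bullet> r)) (at (B, R, m, P))"
proof -
  define J where "J = inertia_axi (1 / I\<^sub>1) (1 / I\<^sub>2)"
  have H: "hamiltonian2 (inertia_axi I\<^sub>1 I\<^sub>2) = (\<lambda>z. (1/2) * ((J *v (fst (snd (snd z)) - fst (snd z) \<times> snd (snd (snd z))))
     \<bullet> (fst (snd (snd z)) - fst (snd z) \<times> snd (snd (snd z))) + snd (snd (snd z)) \<bullet> snd (snd (snd z)))
     + potential2 (inertia_axi I\<^sub>1 I\<^sub>2) (fst (snd z)))"
    by (auto simp: fun_eq_iff hamiltonian2_axi[OF I(1,2)] body_rate_def J_def)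
  have J': "((\<lambda>z. J *v f z) has_derivative (\<lambda>h. J *v f' h)) F" if "(f has_derivative f') F"
    for f :: "phase \<Rightarrow> real^3" and f' F
    using bounded_linear.has_derivative[OF _ that, of "(*v) J"] by (simp add: matrix_vector_mul_linear linear_linear)
  have V': "((\<lambda>z. potential2 (inertia_axi I\<^sub>1 I\<^sub>2) (fst (snd z))) has_derivative
     (\<lambda>h. grad_potential (I\<^sub>1 - I\<^sub>2) R \<bullet> fst (snd h))) (at (B, R, m, P))"
  proof -
    have "((\<lambda>z. fst (snd z)) has_derivative (\<lambda>h. fst (snd h))) (at (B, R, m, P))"
      by (intro has_derivative_fst has_derivative_snd has_derivative_ident)
    from has_derivative_compose[OF this, of "potential2 (inertia_axi I\<^sub>1 I\<^sub>2)" "\<lambda>h. grad_potential (I\<^sub>1 - I\<^sub>2) R \<bullet> h"]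
    show ?thesis using potential2_has_derivative[OF I(3) R] by simp
  qed
  define L where "L z = fst (snd (snd z)) - fst (snd z) \<times> snd (snd (snd z))" for z :: phase
  define L' where "L' h = fst (snd (snd h)) - (R \<times> snd (snd (snd h)) + fst (snd h) \<times> P)" for h :: phase
  define y :: "phase \<Rightarrow> real^3" where "y z = snd (snd (snd z))" for z
  have L0: "L (B, R, m, P) = m - R \<times> P" "y (B, R, m, P) = P" by (simp_all add: L_def y_def)
  have LD: "(L has_derivative L') (at (B, R, m, P))"
    unfolding L_def L'_def by (auto intro!: derivative_eq_intros)
  have yD: "(y has_derivative y) (at (B, R, m, P))"
    unfolding y_def by (auto intro!: derivative_eq_intros)
  have "((\<lambda>z. (1/2) * ((J *v L z) \<bullet> L z + y z \<bullet> y z) + potential2 (inertia_axi I\<^sub>1 I\<^sub>2) (fst (snd z)))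
     has_derivative (\<lambda>h. (1/2) * (((J *v L (B, R, m, P)) \<bullet> L' h + (J *v L' h) \<bullet> L (B, R, m, P))
        + (y (B, R, m, P) \<bullet> y h + y h \<bullet> y (B, R, m, P)))
        + grad_potential (I\<^sub>1 - I\<^sub>2) R \<bullet> fst (snd h))) (at (B, R, m, P))"
    by (intro has_derivative_add has_derivative_mult_right has_derivative_inner J' LD yD V')
  note this[unfolded L0]
  moreover have "(1/2) * (((J *v (m - R \<times> P)) \<bullet> L' h + (J *v L' h) \<bullet> (m - R \<times> P)) + (P \<bullet> y h + y h \<bullet> P))
      = \<Omega> \<bullet> (fst (snd (snd h)) - fst (snd h) \<times> P - R \<times> snd (snd (snd h))) + P \<bullet> snd (snd (snd h))" for h
  proof -
    have 1: "J *v (m - R \<times> P) = \<Omega>" by (simp only: J_def \<Omega>_def body_rate_def)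
    have "(J *v L' h) \<bullet> (m - R \<times> P) = L' h \<bullet> \<Omega>"
      unfolding 1[symmetric] J_def by (rule inertia_axi_sym[symmetric])
    moreover have "L' h = fst (snd (snd h)) - fst (snd h) \<times> P - R \<times> snd (snd (snd h))"
      by (simp add: L'_def)
    moreover have "P \<bullet> y h + y h \<bullet> P = 2 * (P \<bullet> snd (snd (snd h)))"
      by (simp only: y_def inner_commute[of "snd (snd (snd h))" P])
    ultimately show ?thesis by (simp add: 1 inner_commute[of _ \<Omega>])
  qed
  moreover have "hamiltonian2 (inertia_axi I\<^sub>1 I\<^sub>2)
      = (\<lambda>z. (1/2) * ((J *v L z) \<bullet> L z + y z \<bullet> y z) + potential2 (inertia_axi I\<^sub>1 I\<^sub>2) (fst (snd z)))"
    unfolding L_def y_def by (rule H)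
  ultimately show ?thesis by (simp only: case_prod_beta')
qed

lemma ham_vf_hamiltonian2:
  fixes R m P :: "real^3"
  assumes I: "I\<^sub>1 \<noteq> 0" "I\<^sub>2 \<noteq> 0" "I\<^sub>1 + 2 * I\<^sub>2 = 1" and R: "R \<noteq> 0"
  defines "\<Omega> \<equiv> body_rate I\<^sub>1 I\<^sub>2 R m P"
  shows "ham_vf (hamiltonian2 (inertia_axi I\<^sub>1 I\<^sub>2)) (B, R, m, P)
    = (\<Omega>, P - \<Omega> \<times> R, m \<times> \<Omega>, P \<times> \<Omega> - grad_potential (I\<^sub>1 - I\<^sub>2) R)"
proof -
  have t1: "\<Omega> \<bullet> (r \<times> P) = (P \<times> \<Omega>) \<bullet> r" and t2: "\<Omega> \<bullet> (R \<times> y) = (\<Omega> \<times> R) \<bullet> y" for r y :: "real^3"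
    by (rule trans[OF cross_triple(2)], rule inner_commute, rule trans[OF cross_triple(3)], rule inner_commute)
  have "ham_vf (hamiltonian2 (inertia_axi I\<^sub>1 I\<^sub>2)) (B, R, m, P)
    = (\<Omega>, P - \<Omega> \<times> R, m \<times> \<Omega> - 0, - (grad_potential (I\<^sub>1 - I\<^sub>2) R - P \<times> \<Omega>))"
    by (rule ham_vf_eqI[OF hamiltonian2_has_derivative[OF I R]])
       (auto simp: ambient_def inner_prod_def \<Omega>_def[symmetric] inner_diff_left inner_diff_right t1 t2)
  then show ?thesis by simp
qed

text \<open>The Hamiltonian itself is independent of the attitude; here the attitude enters through
  \<open>transpose B *v \<xi>\<close>, the body frame form of the spatial velocity. In the third
  component the two contributions of this term cancel.\<close>

lemma ham_vf_augmented:
  fixes R m P :: "real^3"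
  assumes I: "I\<^sub>1 \<noteq> 0" "I\<^sub>2 \<noteq> 0" "I\<^sub>1 + 2 * I\<^sub>2 = 1" and R: "R \<noteq> 0"
  defines "\<Omega> \<equiv> body_rate I\<^sub>1 I\<^sub>2 R m P"
  shows "ham_vf (\<lambda>x. hamiltonian2 (inertia_axi I\<^sub>1 I\<^sub>2) x - momentum x \<bullet> (\<xi>, \<eta>)) (B, R, m, P)
    = (\<Omega> - transpose B *v \<xi> + \<eta> *\<^sub>R e1, P - \<Omega> \<times> R - \<eta> *\<^sub>R (e1 \<times> R),
       m \<times> \<Omega> - \<eta> *\<^sub>R (e1 \<times> m), P \<times> \<Omega> - grad_potential (I\<^sub>1 - I\<^sub>2) R - \<eta> *\<^sub>R (e1 \<times> P))"
proof -
  have M: "(\<lambda>x. momentum x \<bullet> (\<xi>, \<eta>)) = (\<lambda>x. (fst x *v fst (snd (snd x))) \<bullet> \<xi>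
      + (e1 \<bullet> (fst (snd x) \<times> snd (snd (snd x))) - e1 \<bullet> fst (snd (snd x))) * \<eta>)"
    by (auto simp: fun_eq_iff momentum_def inner_prod_def)
  have "((\<lambda>x. momentum x \<bullet> (\<xi>, \<eta>)) has_derivative
     (\<lambda>(b, r, q, y). (B *v q + b *v m) \<bullet> \<xi> + (e1 \<bullet> (R \<times> y + r \<times> P) - e1 \<bullet> q) * \<eta>)) (at (B, R, m, P))"
    unfolding M by (auto intro!: derivative_eq_intros simp: case_prod_beta')
  from has_derivative_diff[OF hamiltonian2_has_derivative[OF I R] this, folded \<Omega>_def]
  have D: "((\<lambda>x. hamiltonian2 (inertia_axi I\<^sub>1 I\<^sub>2) x - momentum x \<bullet> (\<xi>, \<eta>)) has_derivative
     (\<lambda>(b, r, q, y). \<Omega> \<bullet> (q - r \<times> P - R \<times> y) + P \<bullet> y + grad_potential (I\<^sub>1 - I\<^sub>2) R \<bullet> r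
        - ((B *v q + b *v m) \<bullet> \<xi> + (e1 \<bullet> (R \<times> y + r \<times> P) - e1 \<bullet> q) * \<eta>))) (at (B, R, m, P))"
    by (rule has_derivative_eq_rhs) auto
  have "ham_vf (\<lambda>x. hamiltonian2 (inertia_axi I\<^sub>1 I\<^sub>2) x - momentum x \<bullet> (\<xi>, \<eta>)) (B, R, m, P)
    = (\<Omega> - transpose B *v \<xi> + \<eta> *\<^sub>R e1, P - \<Omega> \<times> R - \<eta> *\<^sub>R (e1 \<times> R),
       m \<times> (\<Omega> - transpose B *v \<xi> + \<eta> *\<^sub>R e1) - (- (m \<times> (transpose B *v \<xi>))),
       - (grad_potential (I\<^sub>1 - I\<^sub>2) R - P \<times> \<Omega> - \<eta> *\<^sub>R (P \<times> e1)))"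
  proof (rule ham_vf_eqI[OF D])
    fix w :: tangent
    obtain x r q y where w: "w = (x, r, q, y)" by (cases w)
    have 1: "\<xi> \<bullet> (b *v x) = x \<bullet> (transpose b *v \<xi>)" "(b *v x) \<bullet> \<xi> = x \<bullet> (transpose b *v \<xi>)"
      for b :: "real^3^3" and x
      using matrix_vector_inner_transpose by (simp_all add: inner_commute)
    have "((B ** hat x) *v m) \<bullet> \<xi> = (x \<times> m) \<bullet> (transpose B *v \<xi>)"
      by (simp add: 1 hat_mult del: transpose_matrix_vector flip: matrix_vector_mul_assoc)
    also have "\<dots> = (m \<times> (transpose B *v \<xi>)) \<bullet> x" by (simp add: cross3_simps)
    finally have 2: "((B ** hat x) *v m) \<bullet> \<xi> = (m \<times> (transpose B *v \<xi>)) \<bullet> x" .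
    have 3: "(B *v q) \<bullet> \<xi> = (transpose B *v \<xi>) \<bullet> q"
      using matrix_vector_inner_transpose[of B q \<xi>] by (simp add: inner_commute)
    have t: "\<Omega> \<bullet> (r \<times> P) = (P \<times> \<Omega>) \<bullet> r" "\<Omega> \<bullet> (R \<times> y) = (\<Omega> \<times> R) \<bullet> y"
      "e1 \<bullet> (r \<times> P) = (P \<times> e1) \<bullet> r" "e1 \<bullet> (R \<times> y) = (e1 \<times> R) \<bullet> y"
      by (metis cross_triple inner_commute)+
    show "(case ambient (B, R, m, P) w of (b, r, q, y) \<Rightarrow> \<Omega> \<bullet> (q - r \<times> P - R \<times> y) + P \<bullet> y + grad_potential (I\<^sub>1 - I\<^sub>2) R \<bullet> r
        - ((B *v q + b *v m) \<bullet> \<xi> + (e1 \<bullet> (R \<times> y + r \<times> P) - e1 \<bullet> q) * \<eta>))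
      = (- (m \<times> (transpose B *v \<xi>)), grad_potential (I\<^sub>1 - I\<^sub>2) R - P \<times> \<Omega> - \<eta> *\<^sub>R (P \<times> e1),
          \<Omega> - transpose B *v \<xi> + \<eta> *\<^sub>R e1, P - \<Omega> \<times> R - \<eta> *\<^sub>R (e1 \<times> R)) \<bullet> w"
      by (simp add: w ambient_def inner_prod_def 2 3 t inner_add_left inner_diff_left inner_add_right
          inner_diff_right ring_distribs del: transpose_matrix_vector)
  qed simp
  then show ?thesis by (simp add: Cross3.right_diff_distrib cross_add_right cross_mult_right cross_skew[of m e1] cross_skew[of P e1])
qed

section \<open>Rotation matrices and the hat map\<close>

lemma rotation_matrix_mult_transpose:
  assumes "rotation_matrix A"
  shows "A ** transpose A = mat 1" "transpose A ** A = mat 1" "det A = 1"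
  using assms by (auto simp: rotation_matrix_def orthogonal_matrix_def)

lemma rotation_matrix_mul:
  "rotation_matrix A \<Longrightarrow> rotation_matrix B \<Longrightarrow> rotation_matrix (A ** B)" for A B :: "real^'n^'n"
  by (simp add: rotation_matrix_def orthogonal_matrix_mul det_mul)

lemma rotation_matrix_transpose:
  "rotation_matrix A \<Longrightarrow> rotation_matrix (transpose A)" for A :: "real^'n^'n"
  by (simp add: rotation_matrix_def det_transpose orthogonal_matrix_def)

lemma rotation_matrix_inner:
  fixes N :: "real^'n^'n"
  assumes "rotation_matrix N" shows "(N *v x) \<bullet> (N *v y) = x \<bullet> y"
proof -
  have "(N *v x) \<bullet> (N *v y) = x \<bullet> (transpose N *v (N *v y))"
    by (rule matrix_vector_inner_transpose)
  also have "transpose N *v (N *v y) = y"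
    by (simp only: matrix_vector_mul_assoc rotation_matrix_mult_transpose[OF assms] matrix_vector_mul_lid)
  finally show ?thesis .
qed

lemma rotation_matrix_norm: "rotation_matrix N \<Longrightarrow> norm (N *v x) = norm x" for N :: "real^'n^'n"
  by (simp add: norm_eq_sqrt_inner rotation_matrix_inner)

lemma rotation_matrix_conj_hat:
  assumes "rotation_matrix N"
  shows "N ** hat u ** transpose N = hat (N *v u)"
proof -
  have "N *v (u \<times> (transpose N *v x)) = (N *v u) \<times> x" for x
  proof -
    have "(N *v u) \<times> (N *v (transpose N *v x)) = N *v (u \<times> (transpose N *v x))"
      by (rule cross_rotation_matrix[OF assms])
    then show ?thesis
      by (simp add: matrix_vector_mul_assoc rotation_matrix_mult_transpose[OF assms] del: transpose_matrix_vector)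
  qed
  then show ?thesis
    by (auto simp: matrix_eq hat_mult simp del: transpose_matrix_vector simp flip: matrix_vector_mul_assoc)
qed

lemmas matrix_mult_scaleR =
  bounded_bilinear.scaleR_left[OF bounded_bilinear_matrix_matrix_mult]
  bounded_bilinear.scaleR_right[OF bounded_bilinear_matrix_matrix_mult]
lemmas matrix_mult_minus =
  bounded_bilinear.minus_left[OF bounded_bilinear_matrix_matrix_mult]
  bounded_bilinear.minus_right[OF bounded_bilinear_matrix_matrix_mult]
lemmas matrix_vector_mult_minus =
  bounded_bilinear.minus_left[OF bounded_bilinear_matrix_vector_mult]
  bounded_bilinear.minus_right[OF bounded_bilinear_matrix_vector_mult]

lemma hat_scaleR: "hat (t *\<^sub>R u) = t *\<^sub>R hat u"
  by (auto simp: matrix_eq hat_mult cross_mult_left simp flip: scaleR_matrix_vector_assoc)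

lemma hat_add: "hat (u + v) = hat u + hat v"
  by (auto simp: matrix_eq hat_mult cross_add_left matrix_vector_mult_add_rdistrib)

lemma transpose_hat: "transpose (hat u) = - hat u"
proof -
  have "transpose (hat u) *v x = - hat u *v x" for x
  proof (rule vector_eq_ldot[THEN iffD1], rule allI)
    fix z
    have "z \<bullet> (transpose (hat u) *v x) = (u \<times> z) \<bullet> x"
      using matrix_vector_inner_transpose[of "hat u" z x] by (simp add: hat_mult)
    also have "\<dots> = z \<bullet> (- (u \<times> x))" by (simp add: cross3_simps)
    also have "- (u \<times> x) = - hat u *v x"
      using scaleR_matrix_vector_assoc[of "-1" "hat u" x] by (simp add: hat_mult)
    finally show "z \<bullet> (transpose (hat u) *v x) = z \<bullet> (- hat u *v x)" .
  qed
  then show ?thesis by (simp add: matrix_eq)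
qed

section \<open>The matrix exponential\<close>

lemma matrix_power_norm_bound:
  fixes A :: "real^3^3"
  obtains K where "K \<ge> 0" "\<And>n. norm (((\<lambda>X. A ** X) ^^ n) (mat 1)) \<le> norm (mat 1 :: real^3^3) * K ^ n"
proof -
  obtain k where k: "\<And>(X :: real^3^3) (Y :: real^3^3). norm (X ** Y) \<le> norm X * norm Y * k" "k > 0"
    using bounded_bilinear.pos_bounded[OF bounded_bilinear_matrix_matrix_mult[where 'n=3 and 'm=3 and 'k=3]]
    by blast
  have "norm (((\<lambda>X. A ** X) ^^ n) (mat 1)) \<le> norm (mat 1 :: real^3^3) * (norm A * k) ^ n" for n
  proof (induction n)
    case (Suc n)
    have "norm (((\<lambda>X. A ** X) ^^ Suc n) (mat 1)) \<le> norm A * norm (((\<lambda>X. A ** X) ^^ n) (mat 1)) * k"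
      using k(1) by simp
    also have "\<dots> \<le> norm A * (norm (mat 1 :: real^3^3) * (norm A * k) ^ n) * k"
      using Suc k(2) by (intro mult_right_mono mult_left_mono) auto
    finally show ?case by (simp add: mult_ac)
  qed simp
  then show ?thesis using that[of "norm A * k"] k(2) by simp
qed

lemma matrix_power_scaleR:
  "((\<lambda>X. (t *\<^sub>R A) ** X) ^^ n) (mat 1) = t ^ n *\<^sub>R ((\<lambda>X. A ** X) ^^ n) (mat 1)" for A :: "real^3^3"
  by (induction n) (simp_all add: matrix_mult_scaleR mult.commute)

lemma matrix_power_commute:
  "A ** ((\<lambda>X. A ** X) ^^ n) (mat 1) = ((\<lambda>X. A ** X) ^^ n) (mat 1) ** A" for A :: "real^3^3"
proof (induction n)
  case (Suc n)
  then show ?case by (metis comp_apply funpow.simps(2) matrix_mul_assoc)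
qed simp

lemma mat_exp_sums:
  fixes A :: "real^3^3"
  shows "(\<lambda>n. ((\<lambda>X. A ** X) ^^ n) (mat 1) /\<^sub>R fact n) sums mat_exp A"
proof -
  obtain K where K: "K \<ge> 0" "\<And>n. norm (((\<lambda>X. A ** X) ^^ n) (mat 1)) \<le> norm (mat 1 :: real^3^3) * K ^ n"
    using matrix_power_norm_bound[of A] by blast
  have "summable (\<lambda>n. norm (mat 1 :: real^3^3) * (inverse (fact n) * K ^ n))"
    by (intro summable_mult summable_exp)
  then have "summable (\<lambda>n. ((\<lambda>X. A ** X) ^^ n) (mat 1) /\<^sub>R fact n)"
  proof (rule summable_comparison_test[rotated], intro exI allI impI)
    fix n
    have "norm (((\<lambda>X. A ** X) ^^ n) (mat 1) /\<^sub>R fact n) = inverse (fact n) * norm (((\<lambda>X. A ** X) ^^ n) (mat 1))"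
      by simp
    also have "\<dots> \<le> inverse (fact n) * (norm (mat 1 :: real^3^3) * K ^ n)"
      by (intro mult_left_mono K) auto
    finally show "norm (((\<lambda>X. A ** X) ^^ n) (mat 1) /\<^sub>R fact n) \<le> norm (mat 1 :: real^3^3) * (inverse (fact n) * K ^ n)"
      by (simp add: mult_ac)
  qed
  then show ?thesis unfolding mat_exp_def by (rule summable_sums)
qed

lemma mat_exp_zero [simp]: "mat_exp 0 = mat 1"
proof -
  have "(\<lambda>n. ((\<lambda>X. (0 *\<^sub>R 0) ** X) ^^ n) (mat 1) /\<^sub>R fact n) sums mat_exp (0 :: real^3^3)"
    using mat_exp_sums[of 0] by simp
  then have "(\<lambda>n. (0 ^ n *\<^sub>R ((\<lambda>X. 0 ** X) ^^ n) (mat 1 :: real^3^3)) /\<^sub>R fact n) sums mat_exp 0"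
    unfolding matrix_power_scaleR .
  moreover have "(\<lambda>n. (0 ^ n *\<^sub>R ((\<lambda>X. 0 ** X) ^^ n) (mat 1 :: real^3^3)) /\<^sub>R fact n)
      = (\<lambda>n. if n = 0 then mat 1 else 0)" by auto
  ultimately show ?thesis using sums_single[of 0 "\<lambda>_. mat 1 :: real^3^3"] sums_unique2 by fastforce
qed

lemma mat_exp_commute: "A ** mat_exp A = mat_exp A ** A"
proof -
  interpret bounded_bilinear "(**) :: real^3^3 \<Rightarrow> real^3^3 \<Rightarrow> real^3^3"
    by (rule bounded_bilinear_matrix_matrix_mult)
  have 1: "(\<lambda>n. A ** (((\<lambda>X. A ** X) ^^ n) (mat 1) /\<^sub>R fact n)) sums (A ** mat_exp A)"
    by (rule bounded_linear.sums[OF bounded_linear_right mat_exp_sums])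
  have 2: "(\<lambda>n. (((\<lambda>X. A ** X) ^^ n) (mat 1) /\<^sub>R fact n) ** A) sums (mat_exp A ** A)"
    by (rule bounded_linear.sums[OF bounded_linear_left mat_exp_sums])
  have "(((\<lambda>X. A ** X) ^^ n) (mat 1) /\<^sub>R fact n) ** A = A ** (((\<lambda>X. A ** X) ^^ n) (mat 1) /\<^sub>R fact n)" for n
    using matrix_power_commute[of A n] by (simp add: matrix_mult_scaleR)
  with 2 have "(\<lambda>n. A ** (((\<lambda>X. A ** X) ^^ n) (mat 1) /\<^sub>R fact n)) sums (mat_exp A ** A)" by simp
  with 1 show ?thesis by (rule sums_unique2)
qed

text \<open>Each component is a scalar power series in t that converges everywhere, so termwise
  differentiation of real power series is enough.\<close>

lemma mat_exp_has_vector_derivative: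
  fixes A :: "real^3^3"
  shows "((\<lambda>t. mat_exp (t *\<^sub>R A)) has_vector_derivative A ** mat_exp (t *\<^sub>R A)) (at t)"
  unfolding has_vector_derivative_def
proof (subst has_derivative_componentwise_within, rule ballI)
  fix b :: "real^3^3" assume "b \<in> Basis"
  define p where "p n = ((\<lambda>X. A ** X) ^^ n) (mat 1)" for n
  define c where "c n = (p n \<bullet> b) / fact n" for n
  have S: "(\<lambda>n. c n * x ^ n) sums (mat_exp (x *\<^sub>R A) \<bullet> b)" for x
  proof -
    have "(\<lambda>n. (((\<lambda>X. (x *\<^sub>R A) ** X) ^^ n) (mat 1) /\<^sub>R fact n) \<bullet> b) sums (mat_exp (x *\<^sub>R A) \<bullet> b)"
      by (rule bounded_linear.sums[OF bounded_linear_inner_left mat_exp_sums])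
    then show ?thesis by (simp add: matrix_power_scaleR c_def p_def divide_inverse mult_ac)
  qed
  have D: "((\<lambda>x. \<Sum>n. c n * x ^ n) has_real_derivative (\<Sum>n. diffs c n * t ^ n)) (at t)"
    by (rule termdiffs_strong_converges_everywhere) (use S sums_summable in blast)
  have "diffs c n * t ^ n = (A ** (((\<lambda>X. (t *\<^sub>R A) ** X) ^^ n) (mat 1) /\<^sub>R fact n)) \<bullet> b" for n
  proof -
    have "diffs c n = (p (Suc n) \<bullet> b) / fact n"
      by (simp add: diffs_def c_def divide_simps del: of_nat_Suc)
    also have "p (Suc n) = A ** p n" by (simp add: p_def)
    finally show ?thesis
      unfolding matrix_power_scaleR p_def[symmetric] by (simp add: matrix_mult_scaleR divide_inverse)
  qed
  moreover have "(\<lambda>n. (A ** (((\<lambda>X. (t *\<^sub>R A) ** X) ^^ n) (mat 1) /\<^sub>R fact n)) \<bullet> b) sums ((A ** mat_exp (t *\<^sub>R A)) \<bullet> b)"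
    by (intro bounded_linear.sums[OF bounded_linear_inner_left] mat_exp_sums
        bounded_linear.sums[OF bounded_bilinear.bounded_linear_right[OF bounded_bilinear_matrix_matrix_mult]])
  ultimately have "(\<Sum>n. diffs c n * t ^ n) = (A ** mat_exp (t *\<^sub>R A)) \<bullet> b"
    by (simp add: sums_unique[symmetric])
  moreover have "(\<lambda>x. \<Sum>n. c n * x ^ n) = (\<lambda>x. mat_exp (x *\<^sub>R A) \<bullet> b)"
    using S by (auto simp: sums_unique[symmetric])
  ultimately show "((\<lambda>x. mat_exp (x *\<^sub>R A) \<bullet> b) has_derivative (\<lambda>x. x *\<^sub>R (A ** mat_exp (t *\<^sub>R A)) \<bullet> b)) (at t)"
    using D by (simp add: has_field_derivative_def mult.commute[of _ "(A ** mat_exp (t *\<^sub>R A)) \<bullet> b"])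
qed

lemma mat_exp_commute_scaled: "A ** mat_exp (t *\<^sub>R A) = mat_exp (t *\<^sub>R A) ** A"
proof (cases "t = 0")
  case False
  have "t *\<^sub>R (A ** mat_exp (t *\<^sub>R A)) = t *\<^sub>R (mat_exp (t *\<^sub>R A) ** A)"
    using mat_exp_commute[of "t *\<^sub>R A"] by (simp add: matrix_mult_scaleR)
  then show ?thesis using False by simp
qed simp

lemma mat_exp_hat_has_vector_derivative:
  "((\<lambda>t. mat_exp (t *\<^sub>R hat u)) has_vector_derivative mat_exp (t *\<^sub>R hat u) ** hat u) (at t)"
  using mat_exp_has_vector_derivative[of "hat u" t] by (simp add: mat_exp_commute_scaled)

lemma bounded_linear_transpose: "bounded_linear (transpose :: real^'n^'m \<Rightarrow> real^'m^'n)"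
  by (rule linear_conv_bounded_linear[THEN iffD1], rule linearI) (simp_all add: transpose_def vec_eq_iff)

lemma continuous_det3: "continuous_on S (\<lambda>t. det (f t))" if "continuous_on S f" for f :: "'a::topological_space \<Rightarrow> real^3^3"
  unfolding det_3 by (intro continuous_intros that)

text \<open>An orthogonal matrix has determinant 1 or -1, and a continuous function with finite
  range on the connected line is constant.\<close>

lemma rotation_matrix_connected:
  fixes f :: "real \<Rightarrow> real^3^3"
  assumes "continuous_on UNIV f" "\<And>t. orthogonal_matrix (f t)" "det (f 0) = 1"
  shows "rotation_matrix (f t)"
proof -
  have c: "continuous_on UNIV (\<lambda>t. det (f t))" by (rule continuous_det3[OF assms(1)])
  have "det (f t) \<in> {1, -1}" for t using det_orthogonal_matrix[OF assms(2)] by auto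
  then have "range (\<lambda>t. det (f t)) \<subseteq> {1, -1}" by auto
  then have "finite (range (\<lambda>t. det (f t)))" by (rule finite_subset) auto
  then have "(\<lambda>t. det (f t)) constant_on UNIV"
    using continuous_finite_range_constant[OF connected_UNIV c] by blast
  then have "det (f t) = det (f 0)" by (auto simp: constant_on_def)
  then show ?thesis using assms by (auto simp: rotation_matrix_def)
qed

text \<open>Since \<open>hat u\<close> is antisymmetric, the product of the exponential with its
  transpose has derivative 0 and keeps its value at t = 0; continuity then excludes determinant
  -1.\<close>

lemma rotation_matrix_mat_exp: "rotation_matrix (mat_exp (t *\<^sub>R hat u))"
proof -
  define E where "E t = mat_exp (t *\<^sub>R hat u)" for t
  have D: "(E has_vector_derivative E t ** hat u) (at t)" for t
    unfolding E_def by (rule mat_exp_hat_has_vector_derivative)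
  have DT: "((\<lambda>t. transpose (E t)) has_vector_derivative transpose (E t ** hat u)) (at t)" for t
    by (rule bounded_linear.has_vector_derivative[OF bounded_linear_transpose D])
  have "((\<lambda>t. E t ** transpose (E t)) has_vector_derivative 0) (at t)" for t
  proof -
    have "((\<lambda>t. E t ** transpose (E t)) has_vector_derivative
        (E t ** transpose (E t ** hat u) + (E t ** hat u) ** transpose (E t))) (at t)"
      by (rule has_vector_derivative_matrix_matrix_mult[OF D DT])
    moreover have "transpose (E t ** hat u) = - (hat u ** transpose (E t))"
      by (simp add: matrix_transpose_mul transpose_hat matrix_mult_minus)
    moreover have "E t ** - (hat u ** transpose (E t)) = - (E t ** (hat u ** transpose (E t)))"
      by (rule matrix_mult_minus)
    ultimately show ?thesis by (simp add: matrix_mul_assoc)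
  qed
  then obtain C where C: "\<And>t. E t ** transpose (E t) = C"
    using has_vector_derivative_zero_constant[of UNIV "\<lambda>t. E t ** transpose (E t)"] by auto
  have "C = mat 1" using C[of 0] by (simp add: E_def)
  then have o: "orthogonal_matrix (E t)" for t
    unfolding orthogonal_matrix_def using C[of t] matrix_left_right_inverse by metis
  have "continuous_on UNIV E"
    using D has_vector_derivative_continuous continuous_at_imp_continuous_on by blast
  moreover have "det (E 0) = 1" by (simp add: E_def)
  ultimately show ?thesis using rotation_matrix_connected[of E t] o by (simp add: E_def)
qed

lemma mat_exp_hat_fixes: "u \<times> v = 0 \<Longrightarrow> mat_exp (t *\<^sub>R hat u) *v v = v"
proof -
  assume uv: "u \<times> v = 0"
  have "((\<lambda>t. mat_exp (t *\<^sub>R hat u) *v v) has_vector_derivative 0) (at t)" for t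
    using has_vector_derivative_matrix_vector_mult[OF mat_exp_hat_has_vector_derivative[of u t] has_vector_derivative_const[of v "at t"]]
    by (simp add: hat_mult uv flip: matrix_vector_mul_assoc)
  then obtain C where C: "\<And>t. mat_exp (t *\<^sub>R hat u) *v v = C"
    using has_vector_derivative_zero_constant[of UNIV "\<lambda>t. mat_exp (t *\<^sub>R hat u) *v v"] by auto
  have "C = v" using C[of 0] by simp
  with C show ?thesis by simp
qed

section \<open>Relative equilibria\<close>

lemma body_rate_equivariant:
  assumes N: "rotation_matrix N" and e: "N *v e1 = e1"
  shows "body_rate I\<^sub>1 I\<^sub>2 (N *v R) (N *v m) (N *v P) = N *v body_rate I\<^sub>1 I\<^sub>2 R m P"
proof -
  have "e1 \<bullet> (N *v x) = e1 \<bullet> x" for x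
    using rotation_matrix_inner[OF N, of e1 x] e by simp
  then show ?thesis
    by (simp add: body_rate_def cross_rotation_matrix[OF N] inertia_axi_mult matrix_vector_right_distrib
        matrix_vector_mult_scaleR e flip: matrix_vector_mult_diff_distrib)
qed

lemma grad_potential_equivariant:
  assumes N: "rotation_matrix N" and e: "N *v e1 = e1"
  shows "grad_potential a (N *v R) = N *v grad_potential a R"
proof -
  have "e1 \<bullet> (N *v R) = e1 \<bullet> R" using rotation_matrix_inner[OF N, of e1 R] e by simp
  then show ?thesis
    by (simp add: grad_potential_def rotation_matrix_norm[OF N] matrix_vector_right_distrib
        matrix_vector_mult_scaleR e)
qed

text \<open>The Hamiltonian field commutes with rotations about the symmetry axis. Along the group
  orbit it is therefore the image under such a rotation of its value at time 0, and the differential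
  equation reduces to algebraic equations at time 0. Written with \<xi> instead of the body rate,
  they no longer contain \<eta>.\<close>

lemma relative_equilibrium_criterion:
  fixes R m P :: "real^3"
  assumes I: "I\<^sub>1 \<noteq> 0" "I\<^sub>2 \<noteq> 0" "I\<^sub>1 + 2 * I\<^sub>2 = 1" and R: "R \<noteq> 0"
    and \<xi>: "\<xi> = body_rate I\<^sub>1 I\<^sub>2 R m P + \<eta> *\<^sub>R e1"
    and eqR: "P = \<xi> \<times> R" and eqm: "m \<times> \<xi> = 0"
    and eqP: "P \<times> \<xi> = grad_potential (I\<^sub>1 - I\<^sub>2) R"
  shows "relative_equilibrium (inertia_axi I\<^sub>1 I\<^sub>2) (\<xi>, \<eta>) (mat 1, R, m, P)"
proof -
  define \<Omega> where "\<Omega> = body_rate I\<^sub>1 I\<^sub>2 R m P"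
  have \<Omega>: "\<Omega> = \<xi> - \<eta> *\<^sub>R e1" using \<xi> by (simp add: \<Omega>_def)
  define M where "M t = mat_exp (t *\<^sub>R hat \<xi>)" for t
  define N where "N t = mat_exp (t *\<^sub>R hat (\<eta> *\<^sub>R e1))" for t
  have rot: "rotation_matrix (M t)" "rotation_matrix (N t)" for t
    by (simp_all add: M_def N_def rotation_matrix_mat_exp)
  have Ne: "N t *v e1 = e1" for t
    unfolding N_def by (rule mat_exp_hat_fixes) (simp add: cross_mult_left)
  have c: "act_T (group_exp (t *\<^sub>R (\<xi>, \<eta>))) (mat 1, R, m, P)
      = (M t ** transpose (N t), N t *v R, N t *v m, N t *v P)" for t
    using rotation_matrix_mult_transpose(3)[OF rot(2)[of t]]
    by (simp add: act_T_def group_exp_def M_def N_def hat_scaleR)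
  have DM: "(M has_vector_derivative M t ** hat \<xi>) (at t)"
    and DN: "(N has_vector_derivative N t ** hat (\<eta> *\<^sub>R e1)) (at t)" for t
    unfolding M_def N_def by (rule mat_exp_hat_has_vector_derivative)+
  have X: "ham_vf (hamiltonian2 (inertia_axi I\<^sub>1 I\<^sub>2)) (M t ** transpose (N t), N t *v R, N t *v m, N t *v P)
    = (N t *v \<Omega>, N t *v (\<eta> *\<^sub>R (e1 \<times> R)), N t *v (\<eta> *\<^sub>R (e1 \<times> m)), N t *v (\<eta> *\<^sub>R (e1 \<times> P)))" for t
  proof -
    have "N t *v R \<noteq> 0" using R rotation_matrix_norm[OF rot(2)] by (metis norm_eq_zero)
    moreover have "P - \<Omega> \<times> R = \<eta> *\<^sub>R (e1 \<times> R)"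
      by (simp add: eqR \<Omega> left_diff_distrib cross_mult_left Cross3.left_diff_distrib)
    moreover have "m \<times> \<Omega> = \<eta> *\<^sub>R (e1 \<times> m)"
      by (simp add: eqm \<Omega> cross_mult_right cross_skew[of m e1] Cross3.right_diff_distrib)
    moreover have "P \<times> \<Omega> - grad_potential (I\<^sub>1 - I\<^sub>2) R = \<eta> *\<^sub>R (e1 \<times> P)"
      by (simp add: eqP[symmetric] \<Omega> cross_mult_right cross_skew[of P e1] Cross3.right_diff_distrib)
    ultimately show ?thesis
      by (simp add: ham_vf_hamiltonian2[OF I] body_rate_equivariant[OF rot(2) Ne] grad_potential_equivariant[OF rot(2) Ne]
         cross_rotation_matrix[OF rot(2)] \<Omega>_def[symmetric] flip: matrix_vector_mult_diff_distrib)
  qed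
  have D: "((\<lambda>t. (M t ** transpose (N t), N t *v R, N t *v m, N t *v P)) has_vector_derivative
     ambient (M t ** transpose (N t), N t *v R, N t *v m, N t *v P)
       (ham_vf (hamiltonian2 (inertia_axi I\<^sub>1 I\<^sub>2)) (M t ** transpose (N t), N t *v R, N t *v m, N t *v P))) (at t)" for t
  proof -
    have v: "((\<lambda>t. N t *v x) has_vector_derivative N t *v (\<eta> *\<^sub>R (e1 \<times> x))) (at t)" for x
      using has_vector_derivative_matrix_vector_mult[OF DN[of t] has_vector_derivative_const[of x "at t"]]
      by (simp add: hat_mult cross_mult_left flip: matrix_vector_mul_assoc)
    have "((\<lambda>t. M t ** transpose (N t)) has_vector_derivative
       (M t ** transpose (N t ** hat (\<eta> *\<^sub>R e1)) + (M t ** hat \<xi>) ** transpose (N t))) (at t)"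
      by (intro has_vector_derivative_matrix_matrix_mult DM
          bounded_linear.has_vector_derivative[OF bounded_linear_transpose DN])
    \<comment> \<open>The left trivialisation needs the velocity as a right factor:
      \<open>hat \<xi>\<close> minus the axial generator is \<open>hat \<Omega>\<close>, and
      conjugation by \<open>N t\<close> carries it past \<open>transpose (N t)\<close>.\<close>
    moreover have "M t ** transpose (N t ** hat (\<eta> *\<^sub>R e1)) + (M t ** hat \<xi>) ** transpose (N t)
        = (M t ** transpose (N t)) ** hat (N t *v \<Omega>)"
    proof -
      have "(M t ** transpose (N t)) ** hat (N t *v \<Omega>)
          = M t ** (transpose (N t) ** N t) ** hat \<Omega> ** transpose (N t)"
        unfolding rotation_matrix_conj_hat[OF rot(2), symmetric] by (simp add: matrix_mul_assoc)
      also have "\<dots> = M t ** (hat \<xi> + hat (- (\<eta> *\<^sub>R e1))) ** transpose (N t)"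
        by (simp add: rotation_matrix_mult_transpose[OF rot(2)] \<Omega> hat_add[symmetric])
      also have "hat (- (\<eta> *\<^sub>R e1)) = transpose (hat (\<eta> *\<^sub>R e1))"
        using hat_scaleR[of "-1"] by (simp add: transpose_hat)
      finally show ?thesis
        by (simp add: matrix_transpose_mul matrix_add_ldistrib matrix_add_rdistrib' matrix_mul_assoc)
    qed
    ultimately have "((\<lambda>t. M t ** transpose (N t)) has_vector_derivative
        (M t ** transpose (N t)) ** hat (N t *v \<Omega>)) (at t)" by simp
    then show ?thesis unfolding X
      by (auto simp: ambient_def intro!: has_vector_derivative_Pair v)
  qed
  have "(M t ** transpose (N t), N t *v R, N t *v m, N t *v P) \<in> phase_space" for t
    using R rotation_matrix_norm[OF rot(2), of t R]
    by (auto simp: phase_space_def config_space_def rotation_matrix_mul rotation_matrix_transpose rot)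
  with D show ?thesis
    unfolding relative_equilibrium_def evolution_def integral_curve_def c by (simp add: M_def N_def)
qed

section \<open>The reduced energy\<close>

text \<open>In rescaled units, \<open>m\<close> is the norm of the total angular momentum, \<open>w\<close> the inverse distance,
  \<open>\<theta>\<close> the angle between the position and the symmetry axis, and \<open>L\<close>, \<open>\<tau>\<close> are the components of the
  spin along the symmetry axis and along the orthogonal axis in the plane of the position.  If the
  remaining components of spin and linear momentum vanish, \<open>m\<close> determines the azimuthal linear
  momentum as \<open>w * ell\<close>, and \<open>g\<close> is the resulting energy.\<close>

locale reduced_energy =
  fixes I\<^sub>2 a :: real
  assumes I2: "I\<^sub>2 > 0"
begin

text \<open>\<open>al\<close> is the component of the spin along the position and \<open>ga\<close>
  the one along the orbital angular momentum. The latter is orthogonal to the position, so the total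
  angular momentum has component \<open>e * al\<close> along the position; \<open>Mm\<close> is what
  remains of its norm m across, and \<open>ell\<close> is the orbital share of
  \<open>Mm\<close>.\<close>

definition al :: "real \<Rightarrow> real \<Rightarrow> real \<Rightarrow> real" where
  "al L \<theta> \<tau> = L * cos \<theta> + \<tau> * sin \<theta>"

definition ga :: "real \<Rightarrow> real \<Rightarrow> real \<Rightarrow> real" where
  "ga L \<theta> \<tau> = L * sin \<theta> - \<tau> * cos \<theta>"

definition Mm :: "real \<Rightarrow> real \<Rightarrow> real \<Rightarrow> real \<Rightarrow> real \<Rightarrow> real" where
  "Mm e m L \<theta> \<tau> = sqrt (m\<^sup>2 - e\<^sup>2 * (al L \<theta> \<tau>)\<^sup>2)"

definition ell :: "real \<Rightarrow> real \<Rightarrow> real \<Rightarrow> real \<Rightarrow> real \<Rightarrow> real" where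
  "ell e m L \<theta> \<tau> = Mm e m L \<theta> \<tau> - e * ga L \<theta> \<tau>"

definition g :: "real \<Rightarrow> real \<Rightarrow> real \<Rightarrow> real \<Rightarrow> real \<Rightarrow> real \<Rightarrow> real" where
  "g e m L w \<theta> \<tau> = w\<^sup>2 * (ell e m L \<theta> \<tau>)\<^sup>2 / 2 - w
     + e * (\<tau>\<^sup>2 / (2 * I\<^sub>2) + a / 2 * (3 * (cos \<theta>)\<^sup>2 - 1) * w ^ 3)"

text \<open>The partial derivatives of \<open>ell\<close> in \<theta> and \<tau> are
  \<open>- e * eq\<close> and \<open>- e * er\<close>, and its second ones are
  \<open>- e * fqq\<close>, \<open>- e * fqr\<close>, \<open>- e * frr\<close>. The letters p, q, r
  stand for the directions of w, \<theta>, \<tau>.\<close>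

definition eq where "eq e m L \<theta> \<tau> = al L \<theta> \<tau> - e * al L \<theta> \<tau> * ga L \<theta> \<tau> / Mm e m L \<theta> \<tau>"
definition er where "er e m L \<theta> \<tau> = e * al L \<theta> \<tau> * sin \<theta> / Mm e m L \<theta> \<tau> - cos \<theta>"
definition fqq where "fqq e m L \<theta> \<tau> = e / Mm e m L \<theta> \<tau> * ((ga L \<theta> \<tau>)\<^sup>2 - (al L \<theta> \<tau>)\<^sup>2)
   + e ^ 3 * (al L \<theta> \<tau>)\<^sup>2 / Mm e m L \<theta> \<tau> ^ 3 * (ga L \<theta> \<tau>)\<^sup>2 - ga L \<theta> \<tau>"
definition fqr where "fqr e m L \<theta> \<tau> = e / Mm e m L \<theta> \<tau> * (al L \<theta> \<tau> * cos \<theta> - ga L \<theta> \<tau> * sin \<theta>)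
   - e ^ 3 * (al L \<theta> \<tau>)\<^sup>2 / Mm e m L \<theta> \<tau> ^ 3 * (ga L \<theta> \<tau> * sin \<theta>) + sin \<theta>"
definition frr where "frr e m L \<theta> \<tau> = e / Mm e m L \<theta> \<tau> * (sin \<theta>)\<^sup>2
   + e ^ 3 * (al L \<theta> \<tau>)\<^sup>2 / Mm e m L \<theta> \<tau> ^ 3 * (sin \<theta>)\<^sup>2"

text \<open>The Hessian of \<open>g\<close> with powers of e removed: the entry in w is
  \<open>Cpp\<close>, the mixed ones are \<open>- e * Cpq\<close> and \<open>- e * Cpr\<close>, and
  the block in \<theta>, \<tau> is e times \<open>Cqq\<close>, \<open>Cqr\<close>,
  \<open>Crr\<close>. At e = 0 this block of the true Hessian vanishes, while the reduced entries
  keep a usable limit.\<close>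

definition Cpp where "Cpp e m L w \<theta> \<tau> = (ell e m L \<theta> \<tau>)\<^sup>2 + 3 * e * a * w * (3 * (cos \<theta>)\<^sup>2 - 1)"
definition Cpq where "Cpq e m L w \<theta> \<tau> = 2 * w * ell e m L \<theta> \<tau> * eq e m L \<theta> \<tau> + 9 * a * w\<^sup>2 * cos \<theta> * sin \<theta>"
definition Cpr where "Cpr e m L w \<theta> \<tau> = 2 * w * ell e m L \<theta> \<tau> * er e m L \<theta> \<tau>"
definition Cqq where "Cqq e m L w \<theta> \<tau> = w\<^sup>2 * (e * (eq e m L \<theta> \<tau>)\<^sup>2 - ell e m L \<theta> \<tau> * fqq e m L \<theta> \<tau>)
   - 3 * a * w ^ 3 * ((cos \<theta>)\<^sup>2 - (sin \<theta>)\<^sup>2)"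
definition Cqr where "Cqr e m L w \<theta> \<tau> = w\<^sup>2 * (e * eq e m L \<theta> \<tau> * er e m L \<theta> \<tau> - ell e m L \<theta> \<tau> * fqr e m L \<theta> \<tau>)"
definition Crr where "Crr e m L w \<theta> \<tau> = w\<^sup>2 * (e * (er e m L \<theta> \<tau>)\<^sup>2 - ell e m L \<theta> \<tau> * frr e m L \<theta> \<tau>) + 1 / I\<^sub>2"

text \<open>The convexity argument runs along segments, so derivatives along straight lines are all
  it needs, and gradients and Hessians never have to be formed as linear maps.\<close>

lemma line_derivatives:
  fixes e m L w \<theta> \<tau> p q r t :: real
  defines "W \<equiv> \<lambda>t. w + t * p" and "T \<equiv> \<lambda>t. \<theta> + t * q" and "U \<equiv> \<lambda>t. \<tau> + t * r"
  assumes pos: "m\<^sup>2 - e\<^sup>2 * (al L (T t) (U t))\<^sup>2 > 0"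
  shows al': "((\<lambda>t. al L (T t) (U t)) has_real_derivative (r * sin (T t) - q * ga L (T t) (U t))) (at t)"
    and ga': "((\<lambda>t. ga L (T t) (U t)) has_real_derivative (q * al L (T t) (U t) - r * cos (T t))) (at t)"
    and Mm': "((\<lambda>t. Mm e m L (T t) (U t)) has_real_derivative
          - (e\<^sup>2 * al L (T t) (U t) * (r * sin (T t) - q * ga L (T t) (U t)) / Mm e m L (T t) (U t))) (at t)"
    and ell': "((\<lambda>t. ell e m L (T t) (U t)) has_real_derivative
          - e * (q * eq e m L (T t) (U t) + r * er e m L (T t) (U t))) (at t)"
proof -
  show 1: "((\<lambda>t. al L (T t) (U t)) has_real_derivative (r * sin (T t) - q * ga L (T t) (U t))) (at t)"
    unfolding al_def ga_def T_def U_def by (auto intro!: derivative_eq_intros simp: algebra_simps)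
  show 2: "((\<lambda>t. ga L (T t) (U t)) has_real_derivative (q * al L (T t) (U t) - r * cos (T t))) (at t)"
    unfolding al_def ga_def T_def U_def by (auto intro!: derivative_eq_intros simp: algebra_simps)
  show 3: "((\<lambda>t. Mm e m L (T t) (U t)) has_real_derivative
          - (e\<^sup>2 * al L (T t) (U t) * (r * sin (T t) - q * ga L (T t) (U t)) / Mm e m L (T t) (U t))) (at t)"
    unfolding Mm_def using pos
    by (auto intro!: derivative_eq_intros 1 simp: field_simps)
  have "((\<lambda>t. ell e m L (T t) (U t)) has_real_derivative
      - (e\<^sup>2 * al L (T t) (U t) * (r * sin (T t) - q * ga L (T t) (U t)) / Mm e m L (T t) (U t))
      - e * (q * al L (T t) (U t) - r * cos (T t))) (at t)"
    unfolding ell_def by (intro DERIV_diff 3 DERIV_cmult 2)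
  then show "((\<lambda>t. ell e m L (T t) (U t)) has_real_derivative
          - e * (q * eq e m L (T t) (U t) + r * er e m L (T t) (U t))) (at t)"
    by (rule DERIV_cong) (simp add: eq_def er_def ring_distribs power2_eq_square divide_inverse)
qed

lemma line_derivative_g:
  fixes e m L w \<theta> \<tau> p q r t :: real
  defines "W \<equiv> \<lambda>t. w + t * p" and "T \<equiv> \<lambda>t. \<theta> + t * q" and "U \<equiv> \<lambda>t. \<tau> + t * r"
  assumes pos: "m\<^sup>2 - e\<^sup>2 * (al L (T t) (U t))\<^sup>2 > 0"
  shows "((\<lambda>t. g e m L (W t) (T t) (U t)) has_real_derivative
      p * (W t * (ell e m L (T t) (U t))\<^sup>2 - 1 + 3 * e * a / 2 * (W t)\<^sup>2 * (3 * (cos (T t))\<^sup>2 - 1))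
      + e * q * (- (W t)\<^sup>2 * ell e m L (T t) (U t) * eq e m L (T t) (U t) - 3 * a * W t ^ 3 * cos (T t) * sin (T t))
      + e * r * (- (W t)\<^sup>2 * ell e m L (T t) (U t) * er e m L (T t) (U t) + U t / I\<^sub>2)) (at t)"
proof -
  define l where "l t = ell e m L (\<theta> + t * q) (\<tau> + t * r)" for t
  define S where "S = q * eq e m L (T t) (U t) + r * er e m L (T t) (U t)"
  define k where "k = 1 / (2 * I\<^sub>2)"
  define b where "b = a / 2"
  have l': "(l has_real_derivative (- e * S)) (at t)"
    using ell'[OF pos[unfolded T_def U_def]] by (simp add: l_def[abs_def] S_def T_def U_def)
  have eq: "(\<lambda>t. g e m L (W t) (T t) (U t)) = (\<lambda>t. (1/2) * ((w + t * p)\<^sup>2 * (l t)\<^sup>2) - (w + t * p)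
     + e * (k * (\<tau> + t * r)\<^sup>2 + b * ((3 * (cos (\<theta> + t * q))\<^sup>2 - 1) * (w + t * p) ^ 3)))"
    by (auto simp: fun_eq_iff g_def W_def T_def U_def l_def k_def b_def)
  have "((\<lambda>t. g e m L (W t) (T t) (U t)) has_real_derivative
     p * W t * (l t)\<^sup>2 - e * (W t)\<^sup>2 * l t * S - p
     + e * (2 * k * U t * r + b * (3 * p * (W t)\<^sup>2 * (3 * (cos (T t))\<^sup>2 - 1) - 6 * q * cos (T t) * sin (T t) * W t ^ 3))) (at t)"
    unfolding eq
    apply (rule DERIV_cong)
     apply (rule derivative_eq_intros refl l' | (simp; fail))+
    unfolding W_def T_def U_def by (simp add: algebra_simps eval_nat_numeral)
  then show ?thesis
    by (rule DERIV_cong) (simp add: S_def k_def b_def l_def T_def U_def algebra_simps add_divide_distrib eval_nat_numeral)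
qed

lemma line_derivative_slope:
  fixes e m L \<theta> \<tau> q r t :: real
  defines "T \<equiv> \<lambda>t. \<theta> + t * q" and "U \<equiv> \<lambda>t. \<tau> + t * r"
  assumes pos: "m\<^sup>2 - e\<^sup>2 * (al L (T t) (U t))\<^sup>2 > 0"
  shows "((\<lambda>t. q * eq e m L (T t) (U t) + r * er e m L (T t) (U t)) has_real_derivative
     q\<^sup>2 * fqq e m L (T t) (U t) + 2 * q * r * fqr e m L (T t) (U t) + r\<^sup>2 * frr e m L (T t) (U t)) (at t)"
proof -
  define A where "A t = al L (\<theta> + t * q) (\<tau> + t * r)" for t
  define G where "G t = ga L (\<theta> + t * q) (\<tau> + t * r)" for t
  define M where "M t = Mm e m L (\<theta> + t * q) (\<tau> + t * r)" for t
  note pos' = pos[unfolded T_def U_def]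
  have M: "M t > 0" using pos' by (simp add: M_def Mm_def)
  have A': "(A has_real_derivative (r * sin (\<theta> + t * q) - q * G t)) (at t)"
    using al'[OF pos'] by (simp add: A_def[abs_def] G_def)
  have G': "(G has_real_derivative (q * A t - r * cos (\<theta> + t * q))) (at t)"
    using ga'[OF pos'] by (simp add: A_def G_def[abs_def])
  have M': "(M has_real_derivative - (e\<^sup>2 * A t * (r * sin (\<theta> + t * q) - q * G t) / M t)) (at t)"
    using Mm'[OF pos'] by (simp add: A_def G_def M_def[abs_def])
  have eq: "(\<lambda>t. q * eq e m L (T t) (U t) + r * er e m L (T t) (U t))
     = (\<lambda>t. e * A t * (r * sin (\<theta> + t * q) - q * G t) / M t + (q * A t - r * cos (\<theta> + t * q)))"
    by (auto simp: fun_eq_iff eq_def er_def A_def G_def M_def T_def U_def ring_distribs divide_inverse)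
  have "((\<lambda>t. e * A t * (r * sin (\<theta> + t * q) - q * G t) / M t + (q * A t - r * cos (\<theta> + t * q))) has_real_derivative
     ((e * (r * sin (\<theta> + t * q) - q * G t) * (r * sin (\<theta> + t * q) - q * G t)
        + e * A t * (r * cos (\<theta> + t * q) * q - q * (q * A t - r * cos (\<theta> + t * q)))) * M t
       + e * A t * (r * sin (\<theta> + t * q) - q * G t) * (e\<^sup>2 * A t * (r * sin (\<theta> + t * q) - q * G t) / M t)) / (M t * M t)
     + (q * (r * sin (\<theta> + t * q) - q * G t) + r * sin (\<theta> + t * q) * q)) (at t)"
    apply (rule DERIV_cong)
     apply (rule derivative_eq_intros refl A' G' M' | (use M in \<open>simp; fail\<close>))+
    done
  then show ?thesis unfolding eq
  proof (rule DERIV_cong)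
    have F: "fqq e m L (T t) (U t) = e / M t * ((G t)\<^sup>2 - (A t)\<^sup>2) + e ^ 3 * (A t)\<^sup>2 / M t ^ 3 * (G t)\<^sup>2 - G t"
      "fqr e m L (T t) (U t) = e / M t * (A t * cos (\<theta> + t * q) - G t * sin (\<theta> + t * q))
          - e ^ 3 * (A t)\<^sup>2 / M t ^ 3 * (G t * sin (\<theta> + t * q)) + sin (\<theta> + t * q)"
      "frr e m L (T t) (U t) = e / M t * (sin (\<theta> + t * q))\<^sup>2 + e ^ 3 * (A t)\<^sup>2 / M t ^ 3 * (sin (\<theta> + t * q))\<^sup>2"
      by (simp_all add: fqq_def fqr_def frr_def A_def G_def M_def T_def U_def)
    show "((e * (r * sin (\<theta> + t * q) - q * G t) * (r * sin (\<theta> + t * q) - q * G t)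
        + e * A t * (r * cos (\<theta> + t * q) * q - q * (q * A t - r * cos (\<theta> + t * q)))) * M t
       + e * A t * (r * sin (\<theta> + t * q) - q * G t) * (e\<^sup>2 * A t * (r * sin (\<theta> + t * q) - q * G t) / M t)) / (M t * M t)
     + (q * (r * sin (\<theta> + t * q) - q * G t) + r * sin (\<theta> + t * q) * q)
     = q\<^sup>2 * fqq e m L (T t) (U t) + 2 * q * r * fqr e m L (T t) (U t) + r\<^sup>2 * frr e m L (T t) (U t)"
      unfolding F using M by (simp add: field_simps eval_nat_numeral)
  qed
qed

lemma line_second_derivative_g:
  fixes e m L w \<theta> \<tau> p q r t :: real
  defines "W \<equiv> \<lambda>t. w + t * p" and "T \<equiv> \<lambda>t. \<theta> + t * q" and "U \<equiv> \<lambda>t. \<tau> + t * r"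
  assumes pos: "m\<^sup>2 - e\<^sup>2 * (al L (T t) (U t))\<^sup>2 > 0"
  shows "((\<lambda>t. p * (W t * (ell e m L (T t) (U t))\<^sup>2 - 1 + 3 * e * a / 2 * (W t)\<^sup>2 * (3 * (cos (T t))\<^sup>2 - 1))
      + e * q * (- (W t)\<^sup>2 * ell e m L (T t) (U t) * eq e m L (T t) (U t) - 3 * a * W t ^ 3 * cos (T t) * sin (T t))
      + e * r * (- (W t)\<^sup>2 * ell e m L (T t) (U t) * er e m L (T t) (U t) + U t / I\<^sub>2)) has_real_derivative
      p\<^sup>2 * Cpp e m L (W t) (T t) (U t)
      - 2 * e * p * (q * Cpq e m L (W t) (T t) (U t) + r * Cpr e m L (W t) (T t) (U t))
      + e * (q\<^sup>2 * Cqq e m L (W t) (T t) (U t) + 2 * q * r * Cqr e m L (W t) (T t) (U t)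
             + r\<^sup>2 * Crr e m L (W t) (T t) (U t))) (at t)"
proof -
  define l where "l t = ell e m L (\<theta> + t * q) (\<tau> + t * r)" for t
  define s where "s t = q * eq e m L (\<theta> + t * q) (\<tau> + t * r) + r * er e m L (\<theta> + t * q) (\<tau> + t * r)" for t
  note pos' = pos[unfolded T_def U_def]
  have l': "(l has_real_derivative (- e * s t)) (at t)"
    using ell'[OF pos'] by (simp add: l_def[abs_def] s_def)
  have s': "(s has_real_derivative (q\<^sup>2 * fqq e m L (T t) (U t) + 2 * q * r * fqr e m L (T t) (U t) + r\<^sup>2 * frr e m L (T t) (U t))) (at t)"
    using line_derivative_slope[OF pos'] by (simp add: s_def[abs_def] T_def U_def)
  define k where "k = 1 / I\<^sub>2"
  define b where "b = a / 2"
  have eq: "(\<lambda>t. p * (W t * (ell e m L (T t) (U t))\<^sup>2 - 1 + 3 * e * a / 2 * (W t)\<^sup>2 * (3 * (cos (T t))\<^sup>2 - 1))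
      + e * q * (- (W t)\<^sup>2 * ell e m L (T t) (U t) * eq e m L (T t) (U t) - 3 * a * W t ^ 3 * cos (T t) * sin (T t))
      + e * r * (- (W t)\<^sup>2 * ell e m L (T t) (U t) * er e m L (T t) (U t) + U t / I\<^sub>2))
     = (\<lambda>t. p * ((w + t * p) * (l t)\<^sup>2 - 1 + 3 * e * b * ((w + t * p)\<^sup>2 * (3 * (cos (\<theta> + t * q))\<^sup>2 - 1)))
        - e * ((w + t * p)\<^sup>2 * (l t * s t))
        - 6 * b * e * q * ((w + t * p) ^ 3 * (cos (\<theta> + t * q) * sin (\<theta> + t * q)))
        + e * r * (k * (\<tau> + t * r)))"
    by (auto simp: fun_eq_iff W_def T_def U_def l_def s_def k_def b_def ring_distribs add_divide_distrib)
  show ?thesis unfolding eq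
  proof (rule DERIV_cong)
    define s2 where "s2 = q\<^sup>2 * fqq e m L (T t) (U t) + 2 * q * r * fqr e m L (T t) (U t) + r\<^sup>2 * frr e m L (T t) (U t)"
    show "((\<lambda>t. p * ((w + t * p) * (l t)\<^sup>2 - 1 + 3 * e * b * ((w + t * p)\<^sup>2 * (3 * (cos (\<theta> + t * q))\<^sup>2 - 1)))
        - e * ((w + t * p)\<^sup>2 * (l t * s t))
        - 6 * b * e * q * ((w + t * p) ^ 3 * (cos (\<theta> + t * q) * sin (\<theta> + t * q)))
        + e * r * (k * (\<tau> + t * r))) has_real_derivative
        p\<^sup>2 * ((l t)\<^sup>2 + 6 * e * b * (W t * (3 * (cos (T t))\<^sup>2 - 1)))
        - 4 * e * p * W t * l t * s t - 36 * e * b * p * q * (W t)\<^sup>2 * cos (T t) * sin (T t)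
        + e * ((W t)\<^sup>2 * (e * (s t)\<^sup>2 - l t * s2) - 6 * b * q\<^sup>2 * W t ^ 3 * ((cos (T t))\<^sup>2 - (sin (T t))\<^sup>2) + r\<^sup>2 * k)) (at t)"
      apply (rule DERIV_cong)
       apply (rule derivative_eq_intros refl l' s'[folded s2_def] | (simp; fail))+
      unfolding W_def T_def U_def
      by (simp add: algebra_simps eval_nat_numeral)
    show "p\<^sup>2 * ((l t)\<^sup>2 + 6 * e * b * (W t * (3 * (cos (T t))\<^sup>2 - 1)))
        - 4 * e * p * W t * l t * s t - 36 * e * b * p * q * (W t)\<^sup>2 * cos (T t) * sin (T t)
        + e * ((W t)\<^sup>2 * (e * (s t)\<^sup>2 - l t * s2) - 6 * b * q\<^sup>2 * W t ^ 3 * ((cos (T t))\<^sup>2 - (sin (T t))\<^sup>2) + r\<^sup>2 * k)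
      = p\<^sup>2 * Cpp e m L (W t) (T t) (U t)
      - 2 * e * p * (q * Cpq e m L (W t) (T t) (U t) + r * Cpr e m L (W t) (T t) (U t))
      + e * (q\<^sup>2 * Cqq e m L (W t) (T t) (U t) + 2 * q * r * Cqr e m L (W t) (T t) (U t)
             + r\<^sup>2 * Crr e m L (W t) (T t) (U t))"
    proof -
      have s: "s t = q * eq e m L (T t) (U t) + r * er e m L (T t) (U t)" and l: "l t = ell e m L (T t) (U t)"
        by (simp_all add: s_def l_def T_def U_def)
      show ?thesis
        unfolding Cpp_def Cpq_def Cpr_def Cqq_def Cqr_def Crr_def s l s2_def k_def b_def
        by (simp add: algebra_simps eval_nat_numeral)
    qed
  qed
qed

lemma binary_form_pos:
  fixes A B C q r :: real
  assumes "A > 0" "A * C - B\<^sup>2 > 0" "q \<noteq> 0 \<or> r \<noteq> 0"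
  shows "A * q\<^sup>2 + 2 * B * q * r + C * r\<^sup>2 > 0"
proof -
  have "A * (A * q\<^sup>2 + 2 * B * q * r + C * r\<^sup>2) = (A * q + B * r)\<^sup>2 + (A * C - B\<^sup>2) * r\<^sup>2"
    by (simp add: algebra_simps power2_eq_square)
  also have "\<dots> > 0"
  proof (cases "r = 0")
    case True
    then show ?thesis using assms by simp
  next
    case False
    then show ?thesis using assms by (intro add_nonneg_pos) auto
  qed
  finally show ?thesis using assms(1) by (simp add: zero_less_mult_iff)
qed

text \<open>Completing the square in p leaves e times a binary form. Because the mixed terms are
  already of order e, the Schur correction to that form is again of order e, so the form stays
  definite as e tends to 0.\<close>

lemma second_derivative_pos:
  fixes A B C D E F e p q r :: real
  assumes A: "A > 0" and e: "e > 0" and D: "D - e * B\<^sup>2 / A > 0"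
    and det: "(D - e * B\<^sup>2 / A) * (F - e * C\<^sup>2 / A) - (E - e * B * C / A)\<^sup>2 > 0"
    and nz: "p \<noteq> 0 \<or> q \<noteq> 0 \<or> r \<noteq> 0"
  shows "p\<^sup>2 * A - 2 * e * p * (q * B + r * C) + e * (q\<^sup>2 * D + 2 * q * r * E + r\<^sup>2 * F) > 0"
proof -
  define Q where "Q = (D - e * B\<^sup>2 / A) * q\<^sup>2 + 2 * (E - e * B * C / A) * q * r + (F - e * C\<^sup>2 / A) * r\<^sup>2"
  have eq: "p\<^sup>2 * A - 2 * e * p * (q * B + r * C) + e * (q\<^sup>2 * D + 2 * q * r * E + r\<^sup>2 * F)
      = A * (p - e * (q * B + r * C) / A)\<^sup>2 + e * Q"
    using A by (simp add: Q_def field_simps power2_eq_square)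
  show ?thesis
  proof (cases "q = 0 \<and> r = 0")
    case True
    then show ?thesis using nz A by simp
  next
    case False
    then have "Q > 0" unfolding Q_def by (intro binary_form_pos D det) auto
    then show ?thesis unfolding eq using A e by (intro add_nonneg_pos) auto
  qed
qed

text \<open>Open conditions for the minimum. The lower bound on \<open>ga\<close> controls the
  directions transverse to the reduced variables: it is the discriminant condition for the binary
  form in \<open>mu3\<close> and \<open>l3\<close> in \<open>coordinate_minimum\<close>. The last
  three conditions are the hypotheses of \<open>second_derivative_pos\<close>.\<close>

definition good :: "real \<times> real \<times> real \<times> real \<times> real \<times> real \<Rightarrow> bool" where
  "good = (\<lambda>(e, m, L, w, \<theta>, \<tau>). w > 0 \<and> m\<^sup>2 - e\<^sup>2 * (al L \<theta> \<tau>)\<^sup>2 > 0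
     \<and> ga L \<theta> \<tau> > Mm e m L \<theta> \<tau> * I\<^sub>2 * w\<^sup>2
     \<and> Cpp e m L w \<theta> \<tau> > 0
     \<and> Cqq e m L w \<theta> \<tau> - e * (Cpq e m L w \<theta> \<tau>)\<^sup>2 / Cpp e m L w \<theta> \<tau> > 0
     \<and> (Cqq e m L w \<theta> \<tau> - e * (Cpq e m L w \<theta> \<tau>)\<^sup>2 / Cpp e m L w \<theta> \<tau>)
        * (Crr e m L w \<theta> \<tau> - e * (Cpr e m L w \<theta> \<tau>)\<^sup>2 / Cpp e m L w \<theta> \<tau>)
       - (Cqr e m L w \<theta> \<tau> - e * Cpq e m L w \<theta> \<tau> * Cpr e m L w \<theta> \<tau> / Cpp e m L w \<theta> \<tau>)\<^sup>2 > 0)"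

text \<open>The limit \<open>e = 0\<close> of the arguments \<open>(e, m, L, w, \<theta>, \<tau>)\<close> along the conical equilibria.\<close>

definition centre :: "real \<Rightarrow> real \<times> real \<times> real \<times> real \<times> real \<times> real" where
  "centre \<psi> = (0, 1, (I\<^sub>2 - 3 * a) * sin \<psi>, 1, \<psi>, - I\<^sub>2 * cos \<psi>)"

text \<open>Every condition is a strict inequality between continuous functions, so it suffices to
  evaluate at the centre. The conditions that are not immediate become
  \<open>- 3 * a * (sin \<psi>)\<^sup>2 > 0\<close>,
  \<open>I\<^sub>2 - 3 * a * (cos \<psi>)\<^sup>2 > 0\<close> and
  \<open>(cos \<psi>)\<^sup>2 * (1 - 3 * a / I\<^sub>2) > 0\<close>; this is where a < 0 and the
  excluded angles enter.\<close>

lemma good_near_centre: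
  assumes a: "a < 0" and c: "cos \<psi> \<noteq> 0" and s: "sin \<psi> \<noteq> 0"
  shows "\<forall>\<^sub>F x in nhds (centre \<psi>). good x"
proof -
  let ?x = "centre \<psi>"
  define e m L w \<theta> \<tau> where "e = (fst :: real \<times> real \<times> real \<times> real \<times> real \<times> real \<Rightarrow> real)"
    and "m = (\<lambda>x :: real \<times> real \<times> real \<times> real \<times> real \<times> real. fst (snd x))"
    and "L = (\<lambda>x :: real \<times> real \<times> real \<times> real \<times> real \<times> real. fst (snd (snd x)))"
    and "w = (\<lambda>x :: real \<times> real \<times> real \<times> real \<times> real \<times> real. fst (snd (snd (snd x))))"
    and "\<theta> = (\<lambda>x :: real \<times> real \<times> real \<times> real \<times> real \<times> real. fst (snd (snd (snd (snd x)))))"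
    and "\<tau> = (\<lambda>x :: real \<times> real \<times> real \<times> real \<times> real \<times> real. snd (snd (snd (snd (snd x)))))"
  have [simp]: "e ?x = 0" "m ?x = 1" "L ?x = (I\<^sub>2 - 3 * a) * sin \<psi>" "w ?x = 1" "\<theta> ?x = \<psi>" "\<tau> ?x = - I\<^sub>2 * cos \<psi>"
    by (simp_all add: e_def m_def L_def w_def \<theta>_def \<tau>_def centre_def)
  have base: "isCont e ?x" "isCont m ?x" "isCont L ?x" "isCont w ?x" "isCont \<theta> ?x" "isCont \<tau> ?x"
    unfolding e_def m_def L_def w_def \<theta>_def \<tau>_def by (intro continuous_intros)+
  have sc: "(sin \<psi>)\<^sup>2 = 1 - (cos \<psi>)\<^sup>2" by (simp add: sin_squared_eq)
  have al: "isCont (\<lambda>x. al (L x) (\<theta> x) (\<tau> x)) ?x" unfolding al_def by (intro continuous_intros base)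
  have ga: "isCont (\<lambda>x. ga (L x) (\<theta> x) (\<tau> x)) ?x" unfolding ga_def by (intro continuous_intros base)
  have Mm: "isCont (\<lambda>x. Mm (e x) (m x) (L x) (\<theta> x) (\<tau> x)) ?x" unfolding Mm_def by (intro continuous_intros base al)
  have [simp]: "Mm 0 1 L \<theta> \<tau> = 1" for L \<theta> \<tau> by (simp add: Mm_def)
  have ell: "isCont (\<lambda>x. ell (e x) (m x) (L x) (\<theta> x) (\<tau> x)) ?x" unfolding ell_def by (intro continuous_intros base Mm ga)
  have [simp]: "ell 0 1 L \<theta> \<tau> = 1" for L \<theta> \<tau> by (simp add: ell_def)
  have eq: "isCont (\<lambda>x. eq (e x) (m x) (L x) (\<theta> x) (\<tau> x)) ?x" unfolding eq_def by (intro continuous_intros base Mm ga al) simp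
  have er: "isCont (\<lambda>x. er (e x) (m x) (L x) (\<theta> x) (\<tau> x)) ?x" unfolding er_def by (intro continuous_intros base Mm ga al) simp
  have fqq: "isCont (\<lambda>x. fqq (e x) (m x) (L x) (\<theta> x) (\<tau> x)) ?x" unfolding fqq_def by (intro continuous_intros base Mm ga al) simp_all
  have fqr: "isCont (\<lambda>x. fqr (e x) (m x) (L x) (\<theta> x) (\<tau> x)) ?x" unfolding fqr_def by (intro continuous_intros base Mm ga al) simp_all
  have frr: "isCont (\<lambda>x. frr (e x) (m x) (L x) (\<theta> x) (\<tau> x)) ?x" unfolding frr_def by (intro continuous_intros base Mm ga al) simp_all
  have Cpp: "isCont (\<lambda>x. Cpp (e x) (m x) (L x) (w x) (\<theta> x) (\<tau> x)) ?x" unfolding Cpp_def by (intro continuous_intros base ell)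
  have Cpq: "isCont (\<lambda>x. Cpq (e x) (m x) (L x) (w x) (\<theta> x) (\<tau> x)) ?x" unfolding Cpq_def by (intro continuous_intros base ell eq)
  have Cpr: "isCont (\<lambda>x. Cpr (e x) (m x) (L x) (w x) (\<theta> x) (\<tau> x)) ?x" unfolding Cpr_def by (intro continuous_intros base ell er)
  have Cqq: "isCont (\<lambda>x. Cqq (e x) (m x) (L x) (w x) (\<theta> x) (\<tau> x)) ?x" unfolding Cqq_def by (intro continuous_intros base ell eq fqq)
  have Cqr: "isCont (\<lambda>x. Cqr (e x) (m x) (L x) (w x) (\<theta> x) (\<tau> x)) ?x" unfolding Cqr_def by (intro continuous_intros base ell eq er fqr)
  have Crr: "isCont (\<lambda>x. Crr (e x) (m x) (L x) (w x) (\<theta> x) (\<tau> x)) ?x" unfolding Crr_def by (intro continuous_intros base ell er frr)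
  have ga0: "ga ((I\<^sub>2 - 3 * a) * sin \<psi>) \<psi> (- I\<^sub>2 * cos \<psi>) = I\<^sub>2 - 3 * a * (sin \<psi>)\<^sup>2"
    by (simp add: ga_def sc algebra_simps power2_eq_square)
       (simp add: sc flip: power2_eq_square, simp add: algebra_simps)
  have Cpp0: "Cpp 0 1 L 1 \<theta> \<tau> = 1" for L \<theta> \<tau> by (simp add: Cpp_def)
  have Cqq0: "Cqq 0 1 ((I\<^sub>2 - 3 * a) * sin \<psi>) 1 \<psi> (- I\<^sub>2 * cos \<psi>) = I\<^sub>2 - 3 * a * (cos \<psi>)\<^sup>2"
    unfolding Cqq_def fqq_def ga0 by (simp add: algebra_simps)
  have Cqr0: "Cqr 0 1 L 1 \<psi> \<tau> = - sin \<psi>" for L \<tau>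
    by (simp add: Cqr_def fqr_def)
  have Crr0: "Crr 0 1 L 1 \<psi> \<tau> = 1 / I\<^sub>2" for L \<tau>
    by (simp add: Crr_def frr_def)
  have ev: "\<forall>\<^sub>F x in nhds ?x. 0 < F x" if "isCont F ?x" "0 < F ?x" for F :: "real \<times> real \<times> real \<times> real \<times> real \<times> real \<Rightarrow> real"
    using that order_tendstoD(1)[of F "F ?x" "nhds ?x" 0] by (simp add: isCont_def tendsto_at_iff_tendsto_nhds)
  have 1: "\<forall>\<^sub>F x in nhds ?x. 0 < w x" by (rule ev) (use base in auto)
  have 2: "\<forall>\<^sub>F x in nhds ?x. 0 < (m x)\<^sup>2 - (e x)\<^sup>2 * (al (L x) (\<theta> x) (\<tau> x))\<^sup>2"
    by (rule ev) (auto intro!: continuous_intros base al)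
  have 3: "\<forall>\<^sub>F x in nhds ?x. 0 < ga (L x) (\<theta> x) (\<tau> x) - Mm (e x) (m x) (L x) (\<theta> x) (\<tau> x) * I\<^sub>2 * (w x)\<^sup>2"
  proof (rule ev)
    show "isCont (\<lambda>x. ga (L x) (\<theta> x) (\<tau> x) - Mm (e x) (m x) (L x) (\<theta> x) (\<tau> x) * I\<^sub>2 * (w x)\<^sup>2) ?x"
      by (intro continuous_intros base ga Mm)
    have "0 < - (a * (sin \<psi>)\<^sup>2)" using a s by (simp add: mult_neg_pos)
    then show "0 < ga (L ?x) (\<theta> ?x) (\<tau> ?x) - Mm (e ?x) (m ?x) (L ?x) (\<theta> ?x) (\<tau> ?x) * I\<^sub>2 * (w ?x)\<^sup>2"
      using ga0 by simp
  qed
  have 4: "\<forall>\<^sub>F x in nhds ?x. 0 < Cpp (e x) (m x) (L x) (w x) (\<theta> x) (\<tau> x)"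
    by (rule ev[OF Cpp]) (simp add: Cpp0)
  have Cpp_nz: "Cpp (e ?x) (m ?x) (L ?x) (w ?x) (\<theta> ?x) (\<tau> ?x) \<noteq> 0" by (simp add: Cpp0)
  have pos: "0 < I\<^sub>2 - 3 * a * (cos \<psi>)\<^sup>2"
    using a I2 mult_nonpos_nonneg[of "3 * a" "(cos \<psi>)\<^sup>2"] by simp
  have 5: "\<forall>\<^sub>F x in nhds ?x. 0 < Cqq (e x) (m x) (L x) (w x) (\<theta> x) (\<tau> x)
      - e x * (Cpq (e x) (m x) (L x) (w x) (\<theta> x) (\<tau> x))\<^sup>2 / Cpp (e x) (m x) (L x) (w x) (\<theta> x) (\<tau> x)"
  proof (rule ev)
    show "isCont (\<lambda>x. Cqq (e x) (m x) (L x) (w x) (\<theta> x) (\<tau> x)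
      - e x * (Cpq (e x) (m x) (L x) (w x) (\<theta> x) (\<tau> x))\<^sup>2 / Cpp (e x) (m x) (L x) (w x) (\<theta> x) (\<tau> x)) ?x"
      by (intro continuous_intros base Cqq Cpq Cpp Cpp_nz)
  qed (use Cqq0 pos in simp)
  have 6: "\<forall>\<^sub>F x in nhds ?x. 0 < (Cqq (e x) (m x) (L x) (w x) (\<theta> x) (\<tau> x)
      - e x * (Cpq (e x) (m x) (L x) (w x) (\<theta> x) (\<tau> x))\<^sup>2 / Cpp (e x) (m x) (L x) (w x) (\<theta> x) (\<tau> x))
     * (Crr (e x) (m x) (L x) (w x) (\<theta> x) (\<tau> x)
        - e x * (Cpr (e x) (m x) (L x) (w x) (\<theta> x) (\<tau> x))\<^sup>2 / Cpp (e x) (m x) (L x) (w x) (\<theta> x) (\<tau> x))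
     - (Cqr (e x) (m x) (L x) (w x) (\<theta> x) (\<tau> x) - e x * Cpq (e x) (m x) (L x) (w x) (\<theta> x) (\<tau> x)
         * Cpr (e x) (m x) (L x) (w x) (\<theta> x) (\<tau> x) / Cpp (e x) (m x) (L x) (w x) (\<theta> x) (\<tau> x))\<^sup>2"
    (is "\<forall>\<^sub>F x in nhds ?x. 0 < ?F x")
  proof (rule ev)
    show "isCont ?F ?x"
      by (intro continuous_intros base Cqq Cpq Cpp Cpr Cqr Crr Cpp_nz)
    have "?F ?x = (I\<^sub>2 - 3 * a * (cos \<psi>)\<^sup>2) / I\<^sub>2 - (sin \<psi>)\<^sup>2"
      using Cqq0 by (simp add: Cqr0 Crr0)
    also have "\<dots> = (cos \<psi>)\<^sup>2 * (1 - 3 * a / I\<^sub>2)"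
      using I2 by (simp add: sc field_simps)
    also have "\<dots> > 0" using a c I2 by (intro mult_pos_pos) (auto simp: field_simps)
    finally show "0 < ?F ?x" .
  qed
  from 1 2 3 4 5 6 show ?thesis
    by eventually_elim
       (simp add: good_def case_prod_beta e_def m_def L_def w_def \<theta>_def \<tau>_def)
qed

text \<open>A ball is convex, so \<open>good\<close> holds on the whole segment between the two
  points. Along it the first derivative vanishes at the critical point and has a positive
  derivative, hence becomes positive at once.\<close>

lemma strict_minimum:
  assumes ball: "\<And>x. x \<in> ball X d \<Longrightarrow> good x"
    and x0: "(e, m, L, w0, \<theta>0, \<tau>0) \<in> ball X d" and x1: "(e, m, L, w, \<theta>, \<tau>) \<in> ball X d"
    and e: "e > 0" and ne: "(w, \<theta>, \<tau>) \<noteq> (w0, \<theta>0, \<tau>0)"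
    and crit: "w0 * (ell e m L \<theta>0 \<tau>0)\<^sup>2 - 1 + 3 * e * a / 2 * w0\<^sup>2 * (3 * (cos \<theta>0)\<^sup>2 - 1) = 0"
      "- w0\<^sup>2 * ell e m L \<theta>0 \<tau>0 * eq e m L \<theta>0 \<tau>0 - 3 * a * w0 ^ 3 * cos \<theta>0 * sin \<theta>0 = 0"
      "- w0\<^sup>2 * ell e m L \<theta>0 \<tau>0 * er e m L \<theta>0 \<tau>0 + \<tau>0 / I\<^sub>2 = 0"
  shows "g e m L w0 \<theta>0 \<tau>0 < g e m L w \<theta> \<tau>"
proof -
  define p q r where "p = w - w0" and "q = \<theta> - \<theta>0" and "r = \<tau> - \<tau>0"
  have nz: "p \<noteq> 0 \<or> q \<noteq> 0 \<or> r \<noteq> 0" using ne by (auto simp: p_def q_def r_def)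
  define h where "h t = g e m L (w0 + t * p) (\<theta>0 + t * q) (\<tau>0 + t * r)" for t
  define h1 where "h1 t = p * ((w0 + t * p) * (ell e m L (\<theta>0 + t * q) (\<tau>0 + t * r))\<^sup>2 - 1
        + 3 * e * a / 2 * (w0 + t * p)\<^sup>2 * (3 * (cos (\<theta>0 + t * q))\<^sup>2 - 1))
      + e * q * (- (w0 + t * p)\<^sup>2 * ell e m L (\<theta>0 + t * q) (\<tau>0 + t * r) * eq e m L (\<theta>0 + t * q) (\<tau>0 + t * r)
          - 3 * a * (w0 + t * p) ^ 3 * cos (\<theta>0 + t * q) * sin (\<theta>0 + t * q))
      + e * r * (- (w0 + t * p)\<^sup>2 * ell e m L (\<theta>0 + t * q) (\<tau>0 + t * r) * er e m L (\<theta>0 + t * q) (\<tau>0 + t * r)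
          + (\<tau>0 + t * r) / I\<^sub>2)" for t
  have good: "good (e, m, L, w0 + t * p, \<theta>0 + t * q, \<tau>0 + t * r)" if "0 \<le> t" "t \<le> 1" for t
  proof (rule ball)
    have "(1 - t) *\<^sub>R (e, m, L, w0, \<theta>0, \<tau>0) + t *\<^sub>R (e, m, L, w, \<theta>, \<tau>) \<in> ball X d"
      using convex_ball[of X d] x0 x1 that unfolding convex_alt by blast
    moreover have "(1 - t) *\<^sub>R (e, m, L, w0, \<theta>0, \<tau>0) + t *\<^sub>R (e, m, L, w, \<theta>, \<tau>)
       = (e, m, L, w0 + t * p, \<theta>0 + t * q, \<tau>0 + t * r)"
      by (simp add: p_def q_def r_def algebra_simps)
    ultimately show "(e, m, L, w0 + t * p, \<theta>0 + t * q, \<tau>0 + t * r) \<in> ball X d" by simp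
  qed
  have h': "(h has_real_derivative h1 t) (at t)" if "0 \<le> t" "t \<le> 1" for t
    unfolding h_def h1_def by (rule line_derivative_g) (use good[OF that] in \<open>simp add: good_def\<close>)
  have h'': "\<exists>D. (h1 has_real_derivative D) (at t) \<and> D > 0" if "0 \<le> t" "t \<le> 1" for t
    unfolding h1_def
  proof (rule exI, rule conjI, rule line_second_derivative_g)
    note G = good[OF that, unfolded good_def prod.case]
    show "0 < m\<^sup>2 - e\<^sup>2 * (al L (\<theta>0 + t * q) (\<tau>0 + t * r))\<^sup>2" using G by blast
    show "0 < p\<^sup>2 * Cpp e m L (w0 + t * p) (\<theta>0 + t * q) (\<tau>0 + t * r)
      - 2 * e * p * (q * Cpq e m L (w0 + t * p) (\<theta>0 + t * q) (\<tau>0 + t * r) + r * Cpr e m L (w0 + t * p) (\<theta>0 + t * q) (\<tau>0 + t * r))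
      + e * (q\<^sup>2 * Cqq e m L (w0 + t * p) (\<theta>0 + t * q) (\<tau>0 + t * r) + 2 * q * r * Cqr e m L (w0 + t * p) (\<theta>0 + t * q) (\<tau>0 + t * r)
             + r\<^sup>2 * Crr e m L (w0 + t * p) (\<theta>0 + t * q) (\<tau>0 + t * r))"
      using G e nz by (intro second_derivative_pos) blast+
  qed
  have h10: "h1 0 = 0" using crit by (simp add: h1_def)
  have inc: "0 < h1 t" if "0 < t" "t \<le> 1" for t
    using DERIV_pos_imp_increasing[of 0 t h1] h'' h10 that by force
  have "h 0 < h 1"
    using DERIV_pos_imp_increasing_open[of 0 1 h] h' inc
    by (metis (no_types, lifting) DERIV_isCont atLeastAtMost_iff continuous_at_imp_continuous_on less_eq_real_def zero_less_one)
  then show ?thesis by (simp add: h_def p_def q_def r_def)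
qed

text \<open>The energy in excess of \<open>g\<close> is half the square of the radial momentum plus
  \<open>e * w\<^sup>2 * (Q + e * l3\<^sup>2 / 2)\<close>, where \<open>Q\<close> is bounded below
  by a definite binary form in \<open>mu3\<close> and \<open>l3\<close>. Equality thus forces all
  transverse variables to vanish, and \<open>strict_minimum\<close> settles the others. The
  hypothesis \<open>dir\<close> selects the positive root for the component of the angular momentum
  across the position.\<close>

lemma coordinate_minimum:
  fixes p1 p2 p3 \<tau> l3 :: real
  assumes ball: "\<And>x. x \<in> ball X d \<Longrightarrow> good x"
    and x0: "(e, m, L, w0, \<theta>0, \<tau>0) \<in> ball X d" and x1: "(e, m, L, w, \<theta>, \<tau>) \<in> ball X d"
    and e: "e > 0"
    and crit: "w0 * (ell e m L \<theta>0 \<tau>0)\<^sup>2 - 1 + 3 * e * a / 2 * w0\<^sup>2 * (3 * (cos \<theta>0)\<^sup>2 - 1) = 0"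
      "- w0\<^sup>2 * ell e m L \<theta>0 \<tau>0 * eq e m L \<theta>0 \<tau>0 - 3 * a * w0 ^ 3 * cos \<theta>0 * sin \<theta>0 = 0"
      "- w0\<^sup>2 * ell e m L \<theta>0 \<tau>0 * er e m L \<theta>0 \<tau>0 + \<tau>0 / I\<^sub>2 = 0"
    and m: "m\<^sup>2 = (sin \<theta> * p3 / w + e * L)\<^sup>2 + (- cos \<theta> * p3 / w + e * \<tau>)\<^sup>2
        + ((cos \<theta> * p2 - sin \<theta> * p1) / w + e * l3)\<^sup>2"
    and dir: "p3 / w + e * ga L \<theta> \<tau> > 0"
    and le: "(p1\<^sup>2 + p2\<^sup>2 + p3\<^sup>2) / 2 + e * (\<tau>\<^sup>2 + l3\<^sup>2) / (2 * I\<^sub>2) - w + e * (a / 2 * (3 * (cos \<theta>)\<^sup>2 - 1) * w ^ 3)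
       \<le> g e m L w0 \<theta>0 \<tau>0"
  shows "w = w0 \<and> \<theta> = \<theta>0 \<and> \<tau> = \<tau>0 \<and> l3 = 0 \<and> p1 = 0 \<and> p2 = 0 \<and> p3 = w0 * ell e m L \<theta>0 \<tau>0"
proof -
  define M where "M = Mm e m L \<theta> \<tau>"
  define G where "G = ga L \<theta> \<tau>"
  define mu1 where "mu1 = p3 / w + e * G"
  define mu3 where "mu3 = (cos \<theta> * p2 - sin \<theta> * p1) / w + e * l3"
  have gd: "w > 0" "m\<^sup>2 - e\<^sup>2 * (al L \<theta> \<tau>)\<^sup>2 > 0" "G > M * I\<^sub>2 * w\<^sup>2"
    using ball[OF x1] by (auto simp: good_def M_def G_def)
  have M: "M > 0" "M\<^sup>2 = m\<^sup>2 - e\<^sup>2 * (al L \<theta> \<tau>)\<^sup>2" using gd(2) by (simp_all add: M_def Mm_def)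
  \<comment> \<open>Passing to axes along and across the position: the orbital part x contributes
    only across.\<close>
  have "(sin \<theta> * x + e * L)\<^sup>2 + (- cos \<theta> * x + e * \<tau>)\<^sup>2 = (x + e * G)\<^sup>2 + e\<^sup>2 * (al L \<theta> \<tau>)\<^sup>2" for x
  proof -
    have "(sin \<theta> * x + e * L)\<^sup>2 + (- cos \<theta> * x + e * \<tau>)\<^sup>2
      = ((sin \<theta>)\<^sup>2 + (cos \<theta>)\<^sup>2) * x\<^sup>2 + 2 * e * x * G + e\<^sup>2 * (L\<^sup>2 + \<tau>\<^sup>2)"
      unfolding G_def ga_def by algebra
    also have "L\<^sup>2 + \<tau>\<^sup>2 = ((sin \<theta>)\<^sup>2 + (cos \<theta>)\<^sup>2) * (L\<^sup>2 + \<tau>\<^sup>2)" by simp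
    also have "\<dots> = G\<^sup>2 + (al L \<theta> \<tau>)\<^sup>2"
      unfolding G_def ga_def al_def by algebra
    finally show ?thesis by (simp add: power2_eq_square algebra_simps)
  qed
  from this[of "p3 / w"] have M2: "M\<^sup>2 = mu1\<^sup>2 + mu3\<^sup>2"
    using m M(2) by (simp add: mu1_def mu3_def)
  have mu1: "mu1 > 0" using dir by (simp add: mu1_def G_def)
  have "mu1\<^sup>2 \<le> M\<^sup>2" using M2 by simp
  then have mu1_le: "mu1 \<le> M" using M(1) mu1 by (meson less_imp_le power2_le_imp_le)
  have p3: "p3 = w * (mu1 - e * G)" using gd(1) by (simp add: mu1_def)
  have q: "cos \<theta> * p2 - sin \<theta> * p1 = w * (mu3 - e * l3)" using gd(1) by (simp add: mu3_def)
  have pp: "p1\<^sup>2 + p2\<^sup>2 = (cos \<theta> * p1 + sin \<theta> * p2)\<^sup>2 + (cos \<theta> * p2 - sin \<theta> * p1)\<^sup>2"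
  proof -
    have "(cos \<theta> * p1 + sin \<theta> * p2)\<^sup>2 + (cos \<theta> * p2 - sin \<theta> * p1)\<^sup>2 = ((sin \<theta>)\<^sup>2 + (cos \<theta>)\<^sup>2) * (p1\<^sup>2 + p2\<^sup>2)"
      by algebra
    then show ?thesis by simp
  qed
  define Q where "Q = G * (M - mu1) - mu3 * l3 + l3\<^sup>2 / (2 * I\<^sub>2 * w\<^sup>2)"
  have diff: "(p1\<^sup>2 + p2\<^sup>2 + p3\<^sup>2) / 2 + e * (\<tau>\<^sup>2 + l3\<^sup>2) / (2 * I\<^sub>2) - w + e * (a / 2 * (3 * (cos \<theta>)\<^sup>2 - 1) * w ^ 3)
     - g e m L w \<theta> \<tau> = (cos \<theta> * p1 + sin \<theta> * p2)\<^sup>2 / 2 + e * w\<^sup>2 * (Q + e * l3\<^sup>2 / 2)"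
  proof -
    have 1: "e * w\<^sup>2 * (Q + e * l3\<^sup>2 / 2) = e * w\<^sup>2 * (G * (M - mu1) - mu3 * l3 + e * l3\<^sup>2 / 2) + e * l3\<^sup>2 / (2 * I\<^sub>2)"
      using gd(1) I2 by (simp add: Q_def field_simps)
    define Z where "Z = e * w\<^sup>2 * (G * (M - mu1) - mu3 * l3 + e * l3\<^sup>2 / 2)"
    have "(w * (mu1 - e * G))\<^sup>2 + (w * (mu3 - e * l3))\<^sup>2 - w\<^sup>2 * (M - e * G)\<^sup>2
       = e * w\<^sup>2 * (2 * G * (M - mu1) - 2 * mu3 * l3 + e * l3\<^sup>2)"
      using M2 by algebra
    then have 2: "(w * (mu1 - e * G))\<^sup>2 + (w * (mu3 - e * l3))\<^sup>2 - w\<^sup>2 * (M - e * G)\<^sup>2 = 2 * Z"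
      by (simp add: Z_def algebra_simps)
    have 3: "g e m L w \<theta> \<tau> = w\<^sup>2 * (M - e * G)\<^sup>2 / 2 - w + e * \<tau>\<^sup>2 / (2 * I\<^sub>2) + e * (a / 2 * (3 * (cos \<theta>)\<^sup>2 - 1) * w ^ 3)"
      by (simp add: g_def ell_def M_def G_def ring_distribs)
    have 4: "e * (\<tau>\<^sup>2 + l3\<^sup>2) / (2 * I\<^sub>2) = e * \<tau>\<^sup>2 / (2 * I\<^sub>2) + e * l3\<^sup>2 / (2 * I\<^sub>2)"
      by (simp add: ring_distribs add_divide_distrib)
    have lin: "(U + X + Y) / 2 + (t1 + t2) - w + t3 - (N / 2 - w + t1 + t3) = U / 2 + (z + t2)"
      if "Y + X - N = 2 * z" for U X Y N t1 t2 t3 z :: real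
      using that by argo
    show ?thesis unfolding 1 3 4 pp q p3 Z_def[symmetric] by (rule lin[OF 2])
  qed
  have Q: "Q \<ge> 0 \<and> (Q = 0 \<longrightarrow> mu3 = 0 \<and> l3 = 0)"
  proof -
    have G: "G > 0" using gd M(1) I2 by (smt (verit) mult_pos_pos zero_less_power)
    \<comment> \<open>As \<open>M\<^sup>2 = mu1\<^sup>2 + mu3\<^sup>2\<close>, the defect
      \<open>M - mu1\<close> controls the square of \<open>mu3\<close>. This turns the linear term
      of \<open>Q\<close> into a quadratic one that can compete with
      \<open>mu3 * l3\<close>.\<close>
    have "mu3\<^sup>2 = (M - mu1) * (M + mu1)" using M2 by algebra
    also have "\<dots> \<le> (M - mu1) * (2 * M)" using mu1_le M(1) by (intro mult_left_mono) auto
    finally have "mu3\<^sup>2 / (2 * M) \<le> M - mu1" using M(1) by (simp add: pos_divide_le_eq)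
    then have "G * (M - mu1) \<ge> G * (mu3\<^sup>2 / (2 * M))" using G by (intro mult_left_mono) auto
    moreover define A where "A = G / (2 * M)"
    ultimately have Q1: "Q \<ge> A * mu3\<^sup>2 + 2 * (-1/2) * mu3 * l3 + 1 / (2 * I\<^sub>2 * w\<^sup>2) * l3\<^sup>2"
      by (simp add: Q_def)
    have "A > 0" using G M(1) by (simp add: A_def)
    moreover have "A * (1 / (2 * I\<^sub>2 * w\<^sup>2)) - (-1/2)\<^sup>2 > 0"
    proof -
      have "A * (1 / (2 * I\<^sub>2 * w\<^sup>2)) = G / (4 * (M * I\<^sub>2 * w\<^sup>2))" by (simp add: A_def)
      moreover have "1 / 4 < G / (4 * (M * I\<^sub>2 * w\<^sup>2))"
        using gd M(1) I2 by (simp add: field_simps)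
      ultimately show ?thesis by (simp add: power2_eq_square)
    qed
    ultimately have "mu3 \<noteq> 0 \<or> l3 \<noteq> 0 \<Longrightarrow> A * mu3\<^sup>2 + 2 * (-1/2) * mu3 * l3 + 1 / (2 * I\<^sub>2 * w\<^sup>2) * l3\<^sup>2 > 0"
      by (rule binary_form_pos)
    with Q1 show ?thesis by (cases "mu3 = 0 \<and> l3 = 0") auto
  qed
  have nn: "(cos \<theta> * p1 + sin \<theta> * p2)\<^sup>2 / 2 \<ge> 0" "e * w\<^sup>2 * (Q + e * l3\<^sup>2 / 2) \<ge> 0"
    using e Q by auto
  have "g e m L w \<theta> \<tau> \<le> g e m L w0 \<theta>0 \<tau>0" using diff nn le by linarith
  then have eqs: "w = w0" "\<theta> = \<theta>0" "\<tau> = \<tau>0"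
    using strict_minimum[OF ball x0 x1 e _ crit] by force+
  then have "(cos \<theta> * p1 + sin \<theta> * p2)\<^sup>2 / 2 + e * w\<^sup>2 * (Q + e * l3\<^sup>2 / 2) \<le> 0" using diff le by simp
  then have z: "(cos \<theta> * p1 + sin \<theta> * p2)\<^sup>2 / 2 = 0" "e * w\<^sup>2 * (Q + e * l3\<^sup>2 / 2) = 0" using nn by linarith+
  then have "Q + e * l3\<^sup>2 / 2 = 0" using e gd(1) by simp
  moreover have "e * l3\<^sup>2 / 2 \<ge> 0" using e by simp
  ultimately have "Q = 0" using Q by linarith
  with Q have l: "mu3 = 0" "l3 = 0" by auto
  then have "p1\<^sup>2 + p2\<^sup>2 = 0" using z(1) pp q by simp
  then have p: "p1 = 0" "p2 = 0" by (simp_all add: sum_power2_eq_zero_iff)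
  have "mu1 = M" using M2 l(1) mu1 M(1) by (simp add: power2_eq_iff_nonneg)
  then show ?thesis using eqs l p p3 by (simp add: M_def G_def ell_def)
qed

end

section \<open>The conical equilibria\<close>

lemma vec3_eq_iff: "(x :: real^3) = y \<longleftrightarrow> x $ 1 = y $ 1 \<and> x $ 2 = y $ 2 \<and> x $ 3 = y $ 3"
  by (simp add: vec_eq_iff forall_3)

text \<open>Two expressions for the axial angular velocity are matched: \<open>f * s / k\<close>
  comes from the force balance, the other one occurs in \<open>conical_eta\<close>. Multiplied by A,
  the identity is a polynomial consequence of the two hypotheses.\<close>

lemma conical_rate_identity:
  fixes A c f k l s :: real
  assumes l: "l = - A * c / (2 * k * s)" and f: "2 * k\<^sup>2 - A * c\<^sup>2 = 2 * s\<^sup>2 * f"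
    and nz: "A \<noteq> 0" "c \<noteq> 0" "k \<noteq> 0" "s \<noteq> 0"
  shows "f * s / k = c * (2 * l\<^sup>2 * s\<^sup>2 - A) / (2 * s\<^sup>2 * l)"
proof -
  have l0: "l \<noteq> 0" using l nz by simp
  have kl: "2 * k * s * l = - A * c" using l nz by simp
  then have "A * (f * s * (2 * s\<^sup>2 * l)) = A * (k * (c * (2 * l\<^sup>2 * s\<^sup>2 - A)))" using f by algebra
  then have "f * s * (2 * s\<^sup>2 * l) = k * (c * (2 * l\<^sup>2 * s\<^sup>2 - A))" using nz by simp
  then show ?thesis using nz l0 by (simp add: frac_eq_eq mult_ac)
qed

text \<open>The paper's radius and \<open>\<lambda>\<close> are \<open>R = S\<^sup>2\<close> and \<open>\<lambda> = \<Lambda> / S ^ 5\<close>, which makes \<open>\<Lambda>\<close> depend on \<open>S\<close> only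
  through \<open>1 / S ^ 4\<close>.\<close>

locale conical =
  fixes I\<^sub>1 I\<^sub>2 \<psi> S \<Lambda> :: real
  assumes I: "I\<^sub>1 > 0" "I\<^sub>2 > 0" "I\<^sub>1 + 2 * I\<^sub>2 = 1" "I\<^sub>1 \<noteq> I\<^sub>2"
    and cs: "cos \<psi> \<noteq> 0" "sin \<psi> \<noteq> 0"
    and S: "S > 0"
    and AB: "2 + (9 - 15 * (cos \<psi>)\<^sup>2) * (I\<^sub>1 - I\<^sub>2) / S ^ 4 > 0" "2 + (3 - 9 * (cos \<psi>)\<^sup>2) * (I\<^sub>1 - I\<^sub>2) / S ^ 4 > 0"
    and \<Lambda>2: "\<Lambda>\<^sup>2 = (cos \<psi>)\<^sup>2 * (2 + (9 - 15 * (cos \<psi>)\<^sup>2) * (I\<^sub>1 - I\<^sub>2) / S ^ 4)\<^sup>2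
        / (2 * (sin \<psi>)\<^sup>2 * (2 + (3 - 9 * (cos \<psi>)\<^sup>2) * (I\<^sub>1 - I\<^sub>2) / S ^ 4))"
begin

abbreviation "c \<equiv> cos \<psi>"
abbreviation "s \<equiv> sin \<psi>"
definition "a = I\<^sub>1 - I\<^sub>2"
definition "\<epsilon> = 1 / S ^ 4"
text \<open>Rescaled data of the equilibrium. The gradient of the potential has components
  proportional to \<open>A * c / 2\<close> along the symmetry axis and \<open>f * s\<close> across
  it; k is the linear momentum, which is normal to the plane of position and axis;
  \<open>\<omega>\<^sub>1\<close>, \<open>\<omega>\<^sub>2\<close> are the components of the angular
  velocity and \<open>L\<^sub>1\<close> is the axial spin.\<close>

definition "A = 2 + (9 - 15 * c\<^sup>2) * a * \<epsilon>"
definition "f = 1 + (3 - 15 * c\<^sup>2) / 2 * a * \<epsilon>"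
definition "k = - A * c / (2 * \<Lambda> * s)"
definition "\<omega>\<^sub>1 = f * s / k"
definition "\<omega>\<^sub>2 = - A * c / (2 * k)"
definition "L\<^sub>1 = I\<^sub>2 * \<omega>\<^sub>1 - 6 * a * s * k / A"

lemma A_pos: "A > 0" using AB(1) by (simp add: A_def a_def \<epsilon>_def)

lemma \<epsilon>_pos: "\<epsilon> > 0" using S by (simp add: \<epsilon>_def)

lemma s2: "s\<^sup>2 = 1 - c\<^sup>2" by (simp add: sin_squared_eq)

lemma \<Lambda>_nz: "\<Lambda> \<noteq> 0"
proof
  assume "\<Lambda> = 0"
  then have "c\<^sup>2 * A\<^sup>2 / (2 * s\<^sup>2 * (2 + (3 - 9 * c\<^sup>2) * (I\<^sub>1 - I\<^sub>2) / S ^ 4)) = 0"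
    using \<Lambda>2 by (simp add: A_def a_def \<epsilon>_def)
  then show False using cs A_pos AB(2) by simp
qed

lemma k_nz: "k \<noteq> 0" using A_pos cs \<Lambda>_nz by (simp add: k_def)

lemma k2: "k\<^sup>2 = 1 + (3 - 9 * c\<^sup>2) / 2 * a * \<epsilon>"
proof -
  define D where "D = 2 + (3 - 9 * c\<^sup>2) * a * \<epsilon>"
  have D: "D > 0" using AB(2) by (simp add: D_def a_def \<epsilon>_def)
  have L: "\<Lambda>\<^sup>2 = c\<^sup>2 * A\<^sup>2 / (2 * s\<^sup>2 * D)" using \<Lambda>2 by (simp add: D_def A_def a_def \<epsilon>_def)
  have "k\<^sup>2 = A\<^sup>2 * c\<^sup>2 / (4 * \<Lambda>\<^sup>2 * s\<^sup>2)" by (simp add: k_def power_mult_distrib power_divide)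
  also have "\<dots> = D / 2" unfolding L using A_pos cs D by (simp add: field_simps)
  finally show ?thesis by (simp add: D_def)
qed

lemma \<Lambda>_eq: "\<Lambda> = - A * c / (2 * k * s)"
  using A_pos cs \<Lambda>_nz by (simp add: k_def field_simps)

text \<open>The radial force balance: k squared is the component
  \<open>f * s\<^sup>2 + A * c\<^sup>2 / 2\<close> of the rescaled force along the position. The
  prescribed value of \<lambda> squared is exactly what makes it hold.\<close>

lemma k2_A: "2 * k\<^sup>2 - A * c\<^sup>2 = 2 * s\<^sup>2 * f"
proof -
  have "2 * k\<^sup>2 = 2 + (3 - 9 * c\<^sup>2) * a * \<epsilon>" unfolding k2 by simp
  moreover have "2 * f = 2 + (3 - 15 * c\<^sup>2) * a * \<epsilon>" by (simp add: f_def)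
  moreover have "2 * s\<^sup>2 * f = s\<^sup>2 * (2 * f)" by simp
  ultimately show ?thesis using s2 unfolding A_def by algebra
qed

lemma \<omega>\<^sub>1_alt: "\<omega>\<^sub>1 = c * (2 * \<Lambda>\<^sup>2 * s\<^sup>2 - A) / (2 * s\<^sup>2 * \<Lambda>)"
  unfolding \<omega>\<^sub>1_def by (rule conical_rate_identity[OF \<Lambda>_eq k2_A]) (use A_pos cs k_nz in auto)

lemma k_eq: "\<omega>\<^sub>1 * s - \<omega>\<^sub>2 * c = k"
proof -
  have 1: "f * x / k * x - - A * y / (2 * k) * y = (2 * x\<^sup>2 * f + A * y\<^sup>2) / (2 * k)" for x y
    using k_nz by (simp add: field_simps power2_eq_square)
  have "(2 * s\<^sup>2 * f + A * c\<^sup>2) / (2 * k) = (2 * k\<^sup>2) / (2 * k)"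
    unfolding k2_A[symmetric] by simp
  also have "\<dots> = k" using k_nz by (simp add: power2_eq_square)
  finally show ?thesis unfolding \<omega>\<^sub>1_def \<omega>\<^sub>2_def 1 .
qed

text \<open>The rate about the symmetry axis for which the axial spin
  \<open>I\<^sub>1 * (\<omega>\<^sub>1 - \<eta>')\<close> equals \<open>L\<^sub>1\<close>.\<close>

definition "\<eta>' = a / I\<^sub>1 * (\<omega>\<^sub>1 + 6 * s * k / A)"

lemma c_over_\<Lambda>: "3 * c / \<Lambda> = - 6 * s * k / A"
proof -
  have "3 * c / l = - 6 * s * k / A" if "l = - A * c / (2 * k * s)" for l
    using A_pos cs k_nz by (simp add: that field_simps)
  from this[OF \<Lambda>_eq] show ?thesis .
qed

lemma \<omega>\<^sub>2_alt: "\<omega>\<^sub>2 = \<Lambda> * s"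
proof -
  have "\<omega>\<^sub>2 = l * s" if "l = - A * c / (2 * k * s)" for l
    using cs k_nz by (simp add: that \<omega>\<^sub>2_def field_simps)
  from this[OF \<Lambda>_eq] show ?thesis .
qed

lemma conical_eta_eq: "conical_eta I\<^sub>1 I\<^sub>2 \<psi> (S\<^sup>2) (\<Lambda> / S ^ 5) = \<eta>' / S ^ 3"
proof -
  have "conical_eta I\<^sub>1 I\<^sub>2 \<psi> (S\<^sup>2) (\<Lambda> / S ^ 5)
    = c * a / (2 * s\<^sup>2 * \<Lambda> * I\<^sub>1 * S ^ 3) * ((15 * c\<^sup>2 - 9) * a * \<epsilon> - 8 + 6 * c\<^sup>2 + 2 * \<Lambda>\<^sup>2 * s\<^sup>2)"
    unfolding conical_eta_def a_def \<epsilon>_def using S cs I \<Lambda>_nz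
    by (simp add: divide_simps) (simp add: algebra_simps eval_nat_numeral)
  also have "(15 * c\<^sup>2 - 9) * a * \<epsilon> - 8 + 6 * c\<^sup>2 + 2 * \<Lambda>\<^sup>2 * s\<^sup>2 = 2 * \<Lambda>\<^sup>2 * s\<^sup>2 - A - 6 * s\<^sup>2"
    unfolding A_def s2 by (simp add: algebra_simps)
  also have "c * a / (2 * s\<^sup>2 * \<Lambda> * I\<^sub>1 * S ^ 3) * (2 * \<Lambda>\<^sup>2 * s\<^sup>2 - A - 6 * s\<^sup>2)
      = a / I\<^sub>1 * (c * (2 * \<Lambda>\<^sup>2 * s\<^sup>2 - A) / (2 * s\<^sup>2 * \<Lambda>) - 3 * c / \<Lambda>) / S ^ 3"
    using S cs I \<Lambda>_nz by (simp add: field_simps)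
  also have "\<dots> = \<eta>' / S ^ 3" by (simp add: \<omega>\<^sub>1_alt[symmetric] c_over_\<Lambda> \<eta>'_def)
  finally show ?thesis .
qed

lemma conical_xi_eq: "conical_xi I\<^sub>1 I\<^sub>2 \<psi> (S\<^sup>2) (\<Lambda> / S ^ 5) = vector [\<omega>\<^sub>1 / S ^ 3, \<omega>\<^sub>2 / S ^ 3, 0]"
proof -
  have "3 * c / ((\<Lambda> / S ^ 5) * (S\<^sup>2) ^ 4) = (3 * c / \<Lambda>) / S ^ 3"
    using S \<Lambda>_nz by (simp add: field_simps eval_nat_numeral)
  moreover have "I\<^sub>1 / (I\<^sub>1 - I\<^sub>2) * (\<eta>' / S ^ 3) = (\<omega>\<^sub>1 + 6 * s * k / A) / S ^ 3"
    using I by (simp add: \<eta>'_def a_def)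
  ultimately have "3 * c / ((\<Lambda> / S ^ 5) * (S\<^sup>2) ^ 4) + I\<^sub>1 / (I\<^sub>1 - I\<^sub>2) * (\<eta>' / S ^ 3) = \<omega>\<^sub>1 / S ^ 3"
    unfolding c_over_\<Lambda> by (simp add: add_divide_distrib)
  moreover have "\<Lambda> / S ^ 5 * S\<^sup>2 * s = \<omega>\<^sub>2 / S ^ 3"
    unfolding \<omega>\<^sub>2_alt using S by (simp add: field_simps eval_nat_numeral)
  ultimately show ?thesis unfolding conical_xi_def conical_eta_eq by simp
qed

definition R\<^sub>0 :: "real^3" where "R\<^sub>0 = vector [S\<^sup>2 * c, S\<^sup>2 * s, 0]"
definition P\<^sub>0 :: "real^3" where "P\<^sub>0 = vector [0, 0, k / S]"
definition m\<^sub>0 :: "real^3" where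
  "m\<^sub>0 = vector [S * (s * k + \<epsilon> * L\<^sub>1), S * (\<epsilon> * I\<^sub>2 * \<omega>\<^sub>2 - c * k), 0]"
definition \<xi>\<^sub>0 :: "real^3" where "\<xi>\<^sub>0 = vector [\<omega>\<^sub>1 / S ^ 3, \<omega>\<^sub>2 / S ^ 3, 0]"
definition "\<eta>\<^sub>0 = \<eta>' / S ^ 3"

lemma R\<^sub>0_nz: "R\<^sub>0 \<noteq> 0" using S cs by (simp add: R\<^sub>0_def vec3_eq_iff)

lemma norm_R\<^sub>0: "norm R\<^sub>0 = S\<^sup>2"
proof -
  have "R\<^sub>0 \<bullet> R\<^sub>0 = (S\<^sup>2)\<^sup>2 * (s\<^sup>2 + c\<^sup>2)"
    by (simp add: R\<^sub>0_def inner_vec_def sum_3 del: sin_cos_squared_add) algebra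
  then show ?thesis using S by (simp only: norm_eq_sqrt_inner sin_cos_squared_add mult_1_right real_sqrt_abs abs_power2)
qed

lemma P\<^sub>0_eq: "P\<^sub>0 = \<xi>\<^sub>0 \<times> R\<^sub>0"
  using S k_eq by (simp add: P\<^sub>0_def \<xi>\<^sub>0_def R\<^sub>0_def vec3_eq_iff cross_components field_simps eval_nat_numeral)

lemma L\<^sub>1_eq: "L\<^sub>1 = I\<^sub>1 * (\<omega>\<^sub>1 - \<eta>')"
  using I A_pos by (simp add: L\<^sub>1_def \<eta>'_def a_def field_simps)

lemma m\<^sub>0_eq: "m\<^sub>0 = inertia_axi I\<^sub>1 I\<^sub>2 *v (\<xi>\<^sub>0 - \<eta>\<^sub>0 *\<^sub>R e1) + R\<^sub>0 \<times> P\<^sub>0"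
  using S unfolding m\<^sub>0_def L\<^sub>1_eq
  by (simp add: inertia_axi_mult inner_e1 P\<^sub>0_def \<xi>\<^sub>0_def R\<^sub>0_def \<eta>\<^sub>0_def vec3_eq_iff cross_components \<epsilon>_def
      field_simps eval_nat_numeral)

lemma conical_point_eq: "conical_point I\<^sub>1 I\<^sub>2 \<psi> (S\<^sup>2) (\<Lambda> / S ^ 5) = (mat 1, R\<^sub>0, m\<^sub>0, P\<^sub>0)"
proof -
  have R: "conical_position \<psi> (S\<^sup>2) = R\<^sub>0" by (simp add: conical_position_def R\<^sub>0_def vec3_eq_iff)
  have "\<eta>\<^sub>0 *\<^sub>R (e1 \<times> R\<^sub>0) + (\<xi>\<^sub>0 - \<eta>\<^sub>0 *\<^sub>R e1) \<times> R\<^sub>0 = P\<^sub>0"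
    by (simp add: P\<^sub>0_eq Cross3.left_diff_distrib cross_mult_left)
  then show ?thesis
    by (simp add: conical_point_def phase_point_def conical_velocity_def conical_xi_eq conical_eta_eq
       generator_Q_def legendre_def R \<xi>\<^sub>0_def[symmetric] \<eta>\<^sub>0_def[symmetric] m\<^sub>0_eq)
qed

lemma conical_velocity_eq: "conical_velocity I\<^sub>1 I\<^sub>2 \<psi> (S\<^sup>2) (\<Lambda> / S ^ 5) = (\<xi>\<^sub>0, \<eta>\<^sub>0)"
  by (simp add: conical_velocity_def conical_xi_eq conical_eta_eq \<xi>\<^sub>0_def \<eta>\<^sub>0_def)

lemma body_rate_0: "body_rate I\<^sub>1 I\<^sub>2 R\<^sub>0 m\<^sub>0 P\<^sub>0 = \<xi>\<^sub>0 - \<eta>\<^sub>0 *\<^sub>R e1"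
proof -
  have "inertia_axi (1 / I\<^sub>1) (1 / I\<^sub>2) *v (inertia_axi I\<^sub>1 I\<^sub>2 *v x) = x" for x
    using I by (simp add: vec3_eq_iff inertia_axi_mult inner_e1 field_simps)
  then show ?thesis by (simp add: body_rate_def m\<^sub>0_eq)
qed

text \<open>Total angular momentum and angular velocity have to be parallel, and this equation fixes
  \<open>L\<^sub>1\<close>: the spin contributes \<open>3 * a * c * s\<close> times \<epsilon>, the
  orbit \<open>(f - A / 2) * c * s\<close>, and the two cancel.\<close>

lemma parallel: "\<epsilon> * (\<omega>\<^sub>2 * L\<^sub>1 - I\<^sub>2 * \<omega>\<^sub>1 * \<omega>\<^sub>2) + k * (\<omega>\<^sub>1 * c + \<omega>\<^sub>2 * s) = 0"
proof -
  have "\<omega>\<^sub>2 * L\<^sub>1 - I\<^sub>2 * \<omega>\<^sub>1 * \<omega>\<^sub>2 = 3 * a * c * s"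
    using A_pos k_nz by (simp add: L\<^sub>1_def \<omega>\<^sub>2_def field_simps)
  moreover have "k * (\<omega>\<^sub>1 * c + \<omega>\<^sub>2 * s) = f * s * c - A * c * s / 2"
    using k_nz by (simp add: \<omega>\<^sub>1_def \<omega>\<^sub>2_def field_simps)
  moreover have "f - A / 2 = - 3 * a * \<epsilon>" by (simp add: f_def A_def field_simps)
  ultimately show ?thesis by algebra
qed

lemma m\<^sub>0_cross_\<xi>\<^sub>0: "m\<^sub>0 \<times> \<xi>\<^sub>0 = 0"
proof -
  have "(s * k + \<epsilon> * L\<^sub>1) * \<omega>\<^sub>2 - (\<epsilon> * I\<^sub>2 * \<omega>\<^sub>2 - c * k) * \<omega>\<^sub>1 = 0"
    using parallel by (simp add: algebra_simps)
  then have "S * (s * k + \<epsilon> * L\<^sub>1) * (\<omega>\<^sub>2 / S ^ 3) - (\<omega>\<^sub>1 / S ^ 3) * (S * (\<epsilon> * I\<^sub>2 * \<omega>\<^sub>2 - c * k)) = 0"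
  proof -
    have "S * X * (\<omega>\<^sub>2 / S ^ 3) - (\<omega>\<^sub>1 / S ^ 3) * (S * Y) = S / S ^ 3 * (X * \<omega>\<^sub>2 - Y * \<omega>\<^sub>1)" for X Y
      by (simp add: algebra_simps)
    then show ?thesis by (simp only: \<open>(s * k + \<epsilon> * L\<^sub>1) * \<omega>\<^sub>2 - (\<epsilon> * I\<^sub>2 * \<omega>\<^sub>2 - c * k) * \<omega>\<^sub>1 = 0\<close>)
  qed
  then show ?thesis by (simp add: m\<^sub>0_def \<xi>\<^sub>0_def vec3_eq_iff cross_components)
qed

lemma P\<^sub>0_cross_\<xi>\<^sub>0: "P\<^sub>0 \<times> \<xi>\<^sub>0 = grad_potential (I\<^sub>1 - I\<^sub>2) R\<^sub>0"
proof -
  have kw: "k * \<omega>\<^sub>1 = f * s" "k * \<omega>\<^sub>2 = - A * c / 2" using k_nz by (simp_all add: \<omega>\<^sub>1_def \<omega>\<^sub>2_def)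
  have g: "1 / (S\<^sup>2) ^ 3 + 3 * a / (2 * (S\<^sup>2) ^ 5) - 15 * a * (S\<^sup>2 * c)\<^sup>2 / (2 * (S\<^sup>2) ^ 7) = f / S ^ 6"
    using S by (simp add: f_def \<epsilon>_def field_simps eval_nat_numeral)
  have "c * S\<^sup>2 * (f / S ^ 6) + 3 * a * (S\<^sup>2 * c) / (S\<^sup>2) ^ 5 = A * c / 2 / S ^ 4"
    using S by (simp add: f_def A_def \<epsilon>_def field_simps eval_nat_numeral)
  moreover have "f / S ^ 6 * (S\<^sup>2 * s) = f * s / S ^ 4" using S by (simp add: field_simps eval_nat_numeral)
  ultimately show ?thesis
    unfolding grad_potential_def norm_R\<^sub>0 a_def[symmetric]
    using S kw g
    by (simp add: inner_e1 P\<^sub>0_def \<xi>\<^sub>0_def R\<^sub>0_def vec3_eq_iff cross_components mult_ac)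
       (simp add: field_simps eval_nat_numeral)?
qed

theorem conical_relative_equilibrium:
  "relative_equilibrium (inertia_axi I\<^sub>1 I\<^sub>2) (\<xi>\<^sub>0, \<eta>\<^sub>0) (mat 1, R\<^sub>0, m\<^sub>0, P\<^sub>0)"
proof (rule relative_equilibrium_criterion)
  show "\<xi>\<^sub>0 = body_rate I\<^sub>1 I\<^sub>2 R\<^sub>0 m\<^sub>0 P\<^sub>0 + \<eta>\<^sub>0 *\<^sub>R e1" by (simp add: body_rate_0)
qed (use I R\<^sub>0_nz P\<^sub>0_eq m\<^sub>0_cross_\<xi>\<^sub>0 P\<^sub>0_cross_\<xi>\<^sub>0 in auto)

end

section \<open>Rotations about the symmetry axis and the planar normal form\<close>

text \<open>The elements of \<open>Gamma_axi\<close> whose determinant and whose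
  \<open>chi_axi\<close> are both 1. They are enough to turn any position into the plane of the
  first two axes.\<close>

definition axial_rotations :: "(real^3^3) set" where
  "axial_rotations = {N. rotation_matrix N \<and> N *v e1 = e1}"

lemma hamiltonian2_equivariant:
  assumes I: "I\<^sub>1 \<noteq> 0" "I\<^sub>2 \<noteq> 0" and N: "rotation_matrix N" "N *v e1 = e1"
  shows "hamiltonian2 (inertia_axi I\<^sub>1 I\<^sub>2) (B, N *v R, N *v m, N *v P) = hamiltonian2 (inertia_axi I\<^sub>1 I\<^sub>2) (B', R, m, P)"
proof -
  have "e1 \<bullet> (N *v R) = e1 \<bullet> R" using rotation_matrix_inner[OF N(1), of e1 R] N(2) by simp
  then have "(N *v R) \<bullet> (inertia_axi I\<^sub>1 I\<^sub>2 *v (N *v R)) = R \<bullet> (inertia_axi I\<^sub>1 I\<^sub>2 *v R)"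
    using rotation_matrix_inner[OF N(1), of R e1] N(2)
    by (simp add: inertia_axi_mult inner_add_right rotation_matrix_inner[OF N(1)])
  then have "potential2 (inertia_axi I\<^sub>1 I\<^sub>2) (N *v R) = potential2 (inertia_axi I\<^sub>1 I\<^sub>2) R"
    by (simp add: potential2_def rotation_matrix_norm[OF N(1)])
  moreover have "body_rate I\<^sub>1 I\<^sub>2 (N *v R) (N *v m) (N *v P) \<bullet> (N *v m - (N *v R) \<times> (N *v P))
     = body_rate I\<^sub>1 I\<^sub>2 R m P \<bullet> (m - R \<times> P)"
    by (simp add: body_rate_equivariant[OF N] cross_rotation_matrix[OF N(1)] rotation_matrix_inner[OF N(1)]
       flip: matrix_vector_mult_diff_distrib)
  ultimately show ?thesis
    by (simp add: hamiltonian2_axi[OF I] rotation_matrix_inner[OF N(1)])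
qed

lemma hamiltonian2_planar:
  assumes I: "I\<^sub>1 \<noteq> 0" "I\<^sub>2 \<noteq> 0" "I\<^sub>1 + 2 * I\<^sub>2 = 1" and x: "x1\<^sup>2 + x2\<^sup>2 = r\<^sup>2" "r > 0"
  shows "hamiltonian2 (inertia_axi I\<^sub>1 I\<^sub>2) (B, vector [x1, x2, 0], vector [m1, m2, m3], vector [p1, p2, p3])
    = ((m1 - x2 * p3)\<^sup>2 / I\<^sub>1 + ((m2 + x1 * p3)\<^sup>2 + (m3 - (x1 * p2 - x2 * p1))\<^sup>2) / I\<^sub>2 + (p1\<^sup>2 + p2\<^sup>2 + p3\<^sup>2)) / 2
      - 1 / r + (I\<^sub>1 - I\<^sub>2) / 2 * (3 * (x1 / r)\<^sup>2 - 1) / r ^ 3"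
proof -
  let ?R = "vector [x1, x2, 0] :: real^3"
  have n: "norm ?R = r" using x by (simp add: norm_eq_sqrt_inner inner_vec_def sum_3 flip: power2_eq_square)
  then have R: "?R \<noteq> 0" using x by auto
  have e: "e1 \<bullet> ?R = x1" by (simp add: inner_e1)
  have J: "(inertia_axi (1 / I\<^sub>1) (1 / I\<^sub>2) *v L) \<bullet> L = (L$1)\<^sup>2 / I\<^sub>1 + ((L$2)\<^sup>2 + (L$3)\<^sup>2) / I\<^sub>2" for L
    by (simp add: inertia_axi_mult inner_e1 inner_vec_def sum_3 power2_eq_square algebra_simps add_divide_distrib)
  have V: "- 1 / r - (I\<^sub>1 - I\<^sub>2) / (2 * r ^ 3) + 3 * (I\<^sub>1 - I\<^sub>2) * x1\<^sup>2 / (2 * r ^ 5)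
     = - 1 / r + (I\<^sub>1 - I\<^sub>2) / 2 * (3 * (x1 / r)\<^sup>2 - 1) / r ^ 3"
  proof -
    have "3 * b * x1\<^sup>2 / (2 * r ^ 5) - b / (2 * r ^ 3) = b / 2 * (3 * (x1 / r)\<^sup>2 - 1) / r ^ 3" for b
      using x(2) by (simp add: power_divide divide_simps) (simp add: algebra_simps eval_nat_numeral)
    from this[of "I\<^sub>1 - I\<^sub>2"] show ?thesis by linarith
  qed
  have P: "vector [p1, p2, p3] \<bullet> (vector [p1, p2, p3] :: real^3) = p1\<^sup>2 + p2\<^sup>2 + p3\<^sup>2"
    by (simp add: inner_vec_def sum_3 power2_eq_square)
  show ?thesis
    unfolding hamiltonian2_axi[OF I(1,2)] potential2_axi[OF I(3) R] n e body_rate_def J V P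
    by (simp add: cross_components mult.commute)
qed

text \<open>The rotation about the axis that takes \<open>vector [R$1, x2, 0]\<close> to R. Here x2
  is a signed distance from the axis, so that the normalised position can lie on the same side as
  the equilibrium, where the second coordinate has the sign of sin \<psi>.\<close>

definition axial_frame :: "real \<Rightarrow> real^3 \<Rightarrow> real^3^3" where
  "axial_frame x2 R = vector [vector [1, 0, 0], vector [0, R$2 / x2, - R$3 / x2], vector [0, R$3 / x2, R$2 / x2]]"

definition axial_slice :: "real \<Rightarrow> real^3 \<Rightarrow> real^3 \<Rightarrow> real^3" where
  "axial_slice x2 R v = vector [v$1, (v$2 * R$2 + v$3 * R$3) / x2, (v$3 * R$2 - v$2 * R$3) / x2]"

lemma axial_frame_mult: "axial_frame x2 R *v v
    = vector [v$1, R$2 / x2 * v$2 - R$3 / x2 * v$3, R$3 / x2 * v$2 + R$2 / x2 * v$3]"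
  by (simp add: axial_frame_def vec3_eq_iff matrix_vector_mult_def sum_3)

lemma axial_frame:
  assumes x2: "x2\<^sup>2 = (R$2)\<^sup>2 + (R$3)\<^sup>2" "x2 \<noteq> 0"
  shows "axial_frame x2 R \<in> axial_rotations" "axial_frame x2 R *v axial_slice x2 R v = v"
    "axial_slice x2 R R = vector [R$1, x2, 0]"
proof -
  have q: "(R$2 / x2)\<^sup>2 + (R$3 / x2)\<^sup>2 = 1"
  proof -
    have "(R$2 / x2)\<^sup>2 + (R$3 / x2)\<^sup>2 = ((R$2)\<^sup>2 + (R$3)\<^sup>2) / x2\<^sup>2"
      by (simp add: power_divide add_divide_distrib)
    also have "\<dots> = 1" unfolding x2(1)[symmetric] using x2(2) by simp
    finally show ?thesis .
  qed
  have "orthogonal_matrix (axial_frame x2 R)"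
    unfolding orthogonal_matrix using q
    by (simp add: axial_frame_def matrix_matrix_mult_def transpose_def mat_def vec_eq_iff forall_3 sum_3 power2_eq_square
        algebra_simps)
  moreover have "det (axial_frame x2 R) = 1"
    using q by (simp add: det_3 axial_frame_def power2_eq_square)
  moreover have "axial_frame x2 R *v e1 = e1"
    by (simp add: axial_frame_mult vec3_eq_iff)
  ultimately show "axial_frame x2 R \<in> axial_rotations" by (simp add: axial_rotations_def rotation_matrix_def)
  have "u / x2 * ((v2 * u + v3 * w) / x2) - w / x2 * ((v3 * u - v2 * w) / x2) = v2"
    "w / x2 * ((v2 * u + v3 * w) / x2) + u / x2 * ((v3 * u - v2 * w) / x2) = v3"
    if "x2\<^sup>2 = u\<^sup>2 + w\<^sup>2" for u w v2 v3
  proof -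
    have "u * (v2 * u + v3 * w) - w * (v3 * u - v2 * w) = v2 * x2\<^sup>2"
      "w * (v2 * u + v3 * w) + u * (v3 * u - v2 * w) = v3 * x2\<^sup>2" using that by algebra+
    then show "u / x2 * ((v2 * u + v3 * w) / x2) - w / x2 * ((v3 * u - v2 * w) / x2) = v2"
      "w / x2 * ((v2 * u + v3 * w) / x2) + u / x2 * ((v3 * u - v2 * w) / x2) = v3"
      using x2(2) by (simp_all add: power2_eq_square flip: diff_divide_distrib add_divide_distrib)
  qed
  from this[OF x2(1)] show "axial_frame x2 R *v axial_slice x2 R v = v"
    by (simp add: axial_frame_mult axial_slice_def vec3_eq_iff)
  show "axial_slice x2 R R = vector [R$1, x2, 0]"
    using x2 by (simp add: axial_slice_def vec3_eq_iff field_simps power2_eq_square)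
qed

section \<open>The conical equilibria as strict minima modulo axial rotations\<close>

context conical
begin

sublocale E: reduced_energy I\<^sub>2 a by unfold_locales (rule I(2))

text \<open>\<open>Mm\<close> is a nonnegative root, so the reduced variables presuppose a positive
  orbital angular momentum. The sign \<sigma> reverses momentum and spin when k is negative, which
  covers both square roots for \<lambda>.\<close>

definition "\<sigma> = sgn k"
definition "L\<^sub>r = \<sigma> * L\<^sub>1"
definition "\<tau>\<^sub>r = \<sigma> * I\<^sub>2 * \<omega>\<^sub>2"
definition "m\<^sub>r = norm m\<^sub>0 / S"
definition "x\<^sub>r = (\<epsilon>, m\<^sub>r, L\<^sub>r, 1 :: real, \<psi>, \<tau>\<^sub>r)"

lemma \<sigma>: "\<sigma> * \<sigma> = 1" "\<sigma>\<^sup>2 = 1" "\<sigma> * k = \<bar>k\<bar>" "\<sigma> \<noteq> 0"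
  using k_nz by (auto simp: \<sigma>_def sgn_if)

lemma m\<^sub>r_sq: "m\<^sub>r\<^sup>2 = (\<bar>k\<bar> + \<epsilon> * E.ga L\<^sub>r \<psi> \<tau>\<^sub>r)\<^sup>2 + \<epsilon>\<^sup>2 * (E.al L\<^sub>r \<psi> \<tau>\<^sub>r)\<^sup>2"
proof -
  have "m\<^sub>r\<^sup>2 = (m\<^sub>0 \<bullet> m\<^sub>0) / S\<^sup>2" by (simp add: m\<^sub>r_def power_divide power2_norm_eq_inner)
  also have "m\<^sub>0 \<bullet> m\<^sub>0 = S\<^sup>2 * ((s * k + \<epsilon> * L\<^sub>1)\<^sup>2 + (\<epsilon> * I\<^sub>2 * \<omega>\<^sub>2 - c * k)\<^sup>2)"
    by (simp add: m\<^sub>0_def inner_vec_def sum_3 power2_eq_square algebra_simps)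
  also have "\<dots> / S\<^sup>2 = (s * k + \<epsilon> * L\<^sub>1)\<^sup>2 + (\<epsilon> * I\<^sub>2 * \<omega>\<^sub>2 - c * k)\<^sup>2" using S by simp
  also have "\<dots> = (k + \<epsilon> * (L\<^sub>1 * s - I\<^sub>2 * \<omega>\<^sub>2 * c))\<^sup>2 + \<epsilon>\<^sup>2 * (L\<^sub>1 * c + I\<^sub>2 * \<omega>\<^sub>2 * s)\<^sup>2"
    using s2 by algebra
  also have "\<dots> = \<sigma>\<^sup>2 * (k + \<epsilon> * (L\<^sub>1 * s - I\<^sub>2 * \<omega>\<^sub>2 * c))\<^sup>2 + \<epsilon>\<^sup>2 * (\<sigma>\<^sup>2 * (L\<^sub>1 * c + I\<^sub>2 * \<omega>\<^sub>2 * s)\<^sup>2)"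
    using \<sigma>(2) by simp
  also have "\<dots> = (\<bar>k\<bar> + \<epsilon> * E.ga L\<^sub>r \<psi> \<tau>\<^sub>r)\<^sup>2 + \<epsilon>\<^sup>2 * (E.al L\<^sub>r \<psi> \<tau>\<^sub>r)\<^sup>2"
    unfolding \<sigma>(3)[symmetric] E.ga_def E.al_def L\<^sub>r_def \<tau>\<^sub>r_def by algebra
  finally show ?thesis .
qed

context
  assumes good: "E.good x\<^sub>r"
begin

lemma ga_pos: "E.ga L\<^sub>r \<psi> \<tau>\<^sub>r > 0"
proof -
  have "E.ga L\<^sub>r \<psi> \<tau>\<^sub>r > E.Mm \<epsilon> m\<^sub>r L\<^sub>r \<psi> \<tau>\<^sub>r * I\<^sub>2 * 1\<^sup>2" "m\<^sub>r\<^sup>2 - \<epsilon>\<^sup>2 * (E.al L\<^sub>r \<psi> \<tau>\<^sub>r)\<^sup>2 > 0"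
    using good unfolding E.good_def x\<^sub>r_def prod.case by blast+
  moreover from this(2) have "E.Mm \<epsilon> m\<^sub>r L\<^sub>r \<psi> \<tau>\<^sub>r > 0" by (simp add: E.Mm_def)
  ultimately show ?thesis using I(2) by (smt (verit) mult_pos_pos one_power2 mult_1_right)
qed

lemma Mm_eq: "E.Mm \<epsilon> m\<^sub>r L\<^sub>r \<psi> \<tau>\<^sub>r = \<bar>k\<bar> + \<epsilon> * E.ga L\<^sub>r \<psi> \<tau>\<^sub>r"
proof -
  have "\<bar>k\<bar> + \<epsilon> * E.ga L\<^sub>r \<psi> \<tau>\<^sub>r \<ge> 0" using ga_pos \<epsilon>_pos by simp
  then show ?thesis by (simp add: E.Mm_def m\<^sub>r_sq)
qed

lemma Mm_pos: "E.Mm \<epsilon> m\<^sub>r L\<^sub>r \<psi> \<tau>\<^sub>r > 0"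
  unfolding Mm_eq using ga_pos \<epsilon>_pos k_nz by (simp add: add_pos_pos)

lemma ell_eq: "E.ell \<epsilon> m\<^sub>r L\<^sub>r \<psi> \<tau>\<^sub>r = \<bar>k\<bar>"
  by (simp add: E.ell_def Mm_eq)

text \<open>Angular momentum and angular velocity are parallel, so their components along and across
  the position are in the same ratio; the component of the angular velocity across the position is k
  by \<open>k_eq\<close>.\<close>

lemma al_over_Mm: "\<epsilon> * E.al L\<^sub>r \<psi> \<tau>\<^sub>r / E.Mm \<epsilon> m\<^sub>r L\<^sub>r \<psi> \<tau>\<^sub>r = (\<omega>\<^sub>1 * c + \<omega>\<^sub>2 * s) / k"
proof -
  define \<alpha> \<gamma> where "\<alpha> = L\<^sub>1 * c + I\<^sub>2 * \<omega>\<^sub>2 * s" and "\<gamma> = L\<^sub>1 * s - I\<^sub>2 * \<omega>\<^sub>2 * c"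
  have al: "E.al L\<^sub>r \<psi> \<tau>\<^sub>r = \<sigma> * \<alpha>" "E.ga L\<^sub>r \<psi> \<tau>\<^sub>r = \<sigma> * \<gamma>"
    by (simp_all add: E.al_def E.ga_def L\<^sub>r_def \<tau>\<^sub>r_def \<alpha>_def \<gamma>_def algebra_simps)
  have M: "E.Mm \<epsilon> m\<^sub>r L\<^sub>r \<psi> \<tau>\<^sub>r = \<sigma> * (k + \<epsilon> * \<gamma>)"
    unfolding Mm_eq al \<sigma>(3)[symmetric] by (simp add: algebra_simps)
  have nz: "k + \<epsilon> * \<gamma> \<noteq> 0" using Mm_pos unfolding M by auto
  have "\<epsilon> * \<alpha> * k = (\<omega>\<^sub>1 * c + \<omega>\<^sub>2 * s) * (k + \<epsilon> * \<gamma>)"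
    using parallel k_eq s2 unfolding \<alpha>_def \<gamma>_def by algebra
  then show ?thesis unfolding al M using \<sigma>(4) nz k_nz by (simp add: frac_eq_eq mult_ac)
qed

lemma k_parallel: "k * (\<omega>\<^sub>1 * c + \<omega>\<^sub>2 * s) = - 3 * a * \<epsilon> * c * s"
proof -
  have "k * (\<omega>\<^sub>1 * c + \<omega>\<^sub>2 * s) = f * s * c - A * c * s / 2"
    using k_nz by (simp add: \<omega>\<^sub>1_def \<omega>\<^sub>2_def field_simps)
  moreover have "f - A / 2 = - 3 * a * \<epsilon>" by (simp add: f_def A_def field_simps)
  ultimately show ?thesis by algebra
qed

text \<open>The three derivatives vanish for mechanical reasons: the first is the radial force
  balance \<open>k2\<close>, the second the gravity gradient torque of \<open>k_parallel\<close>
  after cancelling \<epsilon>, and the third identifies \<open>\<tau>\<^sub>r / I\<^sub>2\<close>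
  with the transverse angular velocity.\<close>

lemma critical:
  "1 * (E.ell \<epsilon> m\<^sub>r L\<^sub>r \<psi> \<tau>\<^sub>r)\<^sup>2 - 1 + 3 * \<epsilon> * a / 2 * 1\<^sup>2 * (3 * c\<^sup>2 - 1) = 0" (is ?A)
  "- 1\<^sup>2 * E.ell \<epsilon> m\<^sub>r L\<^sub>r \<psi> \<tau>\<^sub>r * E.eq \<epsilon> m\<^sub>r L\<^sub>r \<psi> \<tau>\<^sub>r - 3 * a * 1 ^ 3 * c * s = 0" (is ?B)
  "- 1\<^sup>2 * E.ell \<epsilon> m\<^sub>r L\<^sub>r \<psi> \<tau>\<^sub>r * E.er \<epsilon> m\<^sub>r L\<^sub>r \<psi> \<tau>\<^sub>r + \<tau>\<^sub>r / I\<^sub>2 = 0" (is ?C)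
proof -
  show ?A unfolding ell_eq using k2 by (simp add: field_simps)
  define M where "M = E.Mm \<epsilon> m\<^sub>r L\<^sub>r \<psi> \<tau>\<^sub>r"
  define \<alpha> where "\<alpha> = E.al L\<^sub>r \<psi> \<tau>\<^sub>r"
  define w where "w = \<omega>\<^sub>1 * c + \<omega>\<^sub>2 * s"
  have M: "M > 0" and aM: "\<epsilon> * \<alpha> / M = w / k" and Mk: "M - \<epsilon> * E.ga L\<^sub>r \<psi> \<tau>\<^sub>r = \<bar>k\<bar>"
    using Mm_pos al_over_Mm Mm_eq by (simp_all add: M_def \<alpha>_def w_def)
  have "E.eq \<epsilon> m\<^sub>r L\<^sub>r \<psi> \<tau>\<^sub>r = \<alpha> / M * (M - \<epsilon> * E.ga L\<^sub>r \<psi> \<tau>\<^sub>r)"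
    using M by (simp add: E.eq_def M_def[symmetric] \<alpha>_def[symmetric] field_simps)
  then have "\<epsilon> * (\<bar>k\<bar> * E.eq \<epsilon> m\<^sub>r L\<^sub>r \<psi> \<tau>\<^sub>r) = \<epsilon> * \<alpha> / M * (\<bar>k\<bar> * \<bar>k\<bar>)" unfolding Mk by simp
  also have "\<dots> = w / k * (k * k)" by (simp only: aM abs_mult_self_eq)
  also have "\<dots> = k * w"
  proof -
    have "w / y * (y * y) = y * w" if "y \<noteq> 0" for y using that by simp
    from this[OF k_nz] show ?thesis .
  qed
  also have "\<dots> = \<epsilon> * (- 3 * a * c * s)"
  proof -
    have "- 3 * a * \<epsilon> * c * s = \<epsilon> * (- 3 * a * c * s)" by (simp only: mult_ac)
    then show ?thesis using k_parallel unfolding w_def by (rule trans[rotated])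
  qed
  finally have "\<bar>k\<bar> * E.eq \<epsilon> m\<^sub>r L\<^sub>r \<psi> \<tau>\<^sub>r = - 3 * a * c * s"
    using \<epsilon>_pos by (metis mult_left_cancel less_irrefl)
  then show ?B by (simp add: ell_eq)
  have "E.er \<epsilon> m\<^sub>r L\<^sub>r \<psi> \<tau>\<^sub>r = w / k * s - c"
    unfolding aM[symmetric] by (simp add: E.er_def M_def[symmetric] \<alpha>_def[symmetric])
  then have "k * E.er \<epsilon> m\<^sub>r L\<^sub>r \<psi> \<tau>\<^sub>r = w * s - k * c"
    using k_nz by (simp add: field_simps)
  then have "\<bar>k\<bar> * E.er \<epsilon> m\<^sub>r L\<^sub>r \<psi> \<tau>\<^sub>r = \<sigma> * (w * s - k * c)"
    unfolding \<sigma>(3)[symmetric] by (simp only: mult.assoc)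
  also have "w * s - k * c = \<omega>\<^sub>2" unfolding w_def k_eq[symmetric] using s2 by algebra
  finally have "\<bar>k\<bar> * E.er \<epsilon> m\<^sub>r L\<^sub>r \<psi> \<tau>\<^sub>r = \<sigma> * \<omega>\<^sub>2" .
  moreover have "\<tau>\<^sub>r / I\<^sub>2 = \<sigma> * \<omega>\<^sub>2" using I(2) by (simp add: \<tau>\<^sub>r_def)
  ultimately show ?C unfolding ell_eq by simp
qed

end

text \<open>The axial spin is conserved, so its energy is a constant that \<open>g\<close> omits; it
  appears here as the offset
  \<open>\<epsilon> * L\<^sub>r\<^sup>2 / (2 * I\<^sub>1)\<close>.\<close>

lemma hamiltonian_at_equilibrium:
  assumes good: "E.good x\<^sub>r"
  shows "S\<^sup>2 * hamiltonian2 (inertia_axi I\<^sub>1 I\<^sub>2) (mat 1, R\<^sub>0, m\<^sub>0, P\<^sub>0) = E.g \<epsilon> m\<^sub>r L\<^sub>r 1 \<psi> \<tau>\<^sub>r + \<epsilon> * L\<^sub>r\<^sup>2 / (2 * I\<^sub>1)"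
proof -
  have r: "(S\<^sup>2 * c)\<^sup>2 + (S\<^sup>2 * s)\<^sup>2 = (S\<^sup>2)\<^sup>2" "S\<^sup>2 > 0" using s2 S by (algebra, simp)
  have 1: "S * (s * k + \<epsilon> * L\<^sub>1) - S\<^sup>2 * s * (k / S) = L\<^sub>1 / S ^ 3"
    and 2: "S * (\<epsilon> * I\<^sub>2 * \<omega>\<^sub>2 - c * k) + S\<^sup>2 * c * (k / S) = I\<^sub>2 * \<omega>\<^sub>2 / S ^ 3"
    using S by (simp_all add: \<epsilon>_def field_simps eval_nat_numeral)
  define K where "K = a / 2 * (3 * c\<^sup>2 - 1)"
  have "hamiltonian2 (inertia_axi I\<^sub>1 I\<^sub>2) (mat 1, R\<^sub>0, m\<^sub>0, P\<^sub>0)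
    = ((L\<^sub>1 / S ^ 3)\<^sup>2 / I\<^sub>1 + (I\<^sub>2 * \<omega>\<^sub>2 / S ^ 3)\<^sup>2 / I\<^sub>2 + (k / S)\<^sup>2) / 2 - 1 / S\<^sup>2 + K / (S\<^sup>2) ^ 3"
    unfolding R\<^sub>0_def m\<^sub>0_def P\<^sub>0_def K_def
    using hamiltonian2_planar[OF _ _ I(3) r, of "mat 1" "S * (s * k + \<epsilon> * L\<^sub>1)" "S * (\<epsilon> * I\<^sub>2 * \<omega>\<^sub>2 - c * k)" 0 0 0 "k / S"] I S
    unfolding 1 2 by (simp add: a_def)
  note H = this
  have "S\<^sup>2 * hamiltonian2 (inertia_axi I\<^sub>1 I\<^sub>2) (mat 1, R\<^sub>0, m\<^sub>0, P\<^sub>0)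
    = \<epsilon> * L\<^sub>1\<^sup>2 / (2 * I\<^sub>1) + \<epsilon> * (I\<^sub>2 * \<omega>\<^sub>2)\<^sup>2 / (2 * I\<^sub>2) + k\<^sup>2 / 2 - 1 + \<epsilon> * K"
    unfolding H using S I by (simp add: \<epsilon>_def field_simps eval_nat_numeral)
  moreover have "L\<^sub>r\<^sup>2 = L\<^sub>1\<^sup>2" "\<tau>\<^sub>r\<^sup>2 = (I\<^sub>2 * \<omega>\<^sub>2)\<^sup>2"
    using \<sigma>(2) by (simp_all add: L\<^sub>r_def \<tau>\<^sub>r_def power_mult_distrib)
  ultimately show ?thesis by (simp add: E.g_def ell_eq[OF good] K_def algebra_simps)
qed

text \<open>A nearby point is rotated about the axis into the plane of the equilibrium. There its
  rescaled coordinates depend continuously on the point and satisfy the hypotheses of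
  \<open>coordinate_minimum\<close>, whose conclusion gives back the equilibrium up to that
  rotation.\<close>

lemma conical_local_minimum:
  assumes ball: "\<And>x. x \<in> ball X d \<Longrightarrow> E.good x" and xr: "x\<^sub>r \<in> ball X d"
  shows "\<exists>\<delta>>0. \<forall>R m P. dist (R, m, P) (R\<^sub>0, m\<^sub>0, P\<^sub>0) < \<delta> \<longrightarrow> norm m = norm m\<^sub>0
     \<longrightarrow> e1 \<bullet> (m - R \<times> P) = e1 \<bullet> (m\<^sub>0 - R\<^sub>0 \<times> P\<^sub>0)
     \<longrightarrow> hamiltonian2 (inertia_axi I\<^sub>1 I\<^sub>2) (mat 1, R, m, P) \<le> hamiltonian2 (inertia_axi I\<^sub>1 I\<^sub>2) (mat 1, R\<^sub>0, m\<^sub>0, P\<^sub>0)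
     \<longrightarrow> (\<exists>N\<in>axial_rotations. R = N *v R\<^sub>0 \<and> m = N *v m\<^sub>0 \<and> P = N *v P\<^sub>0)"
proof -
  note good = ball[OF xr]
  let ?z = "(R\<^sub>0, m\<^sub>0, P\<^sub>0)"
  define sg where "sg = sgn s"
  have sg: "sg * \<bar>s\<bar> = s" "sg\<^sup>2 = 1" using cs(2) by (auto simp: sg_def sgn_if)
  \<comment> \<open>\<open>X2\<close> carries the sign of sin \<psi>, so that it equals the second
    coordinate of the position at the equilibrium.\<close>
  define X1 X2 RR where "X1 z = fst z $ 1" and "X2 z = sg * sqrt ((fst z $ 2)\<^sup>2 + (fst z $ 3)\<^sup>2)"
    and "RR z = sqrt ((X1 z)\<^sup>2 + (X2 z)\<^sup>2)" for z :: "(real^3) \<times> (real^3) \<times> (real^3)"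
  define Q3 where "Q3 z = axial_slice (X2 z) (fst z) (snd (snd z)) $ 3" for z :: "(real^3) \<times> (real^3) \<times> (real^3)"
  define M2 where "M2 z = axial_slice (X2 z) (fst z) (fst (snd z)) $ 2" for z :: "(real^3) \<times> (real^3) \<times> (real^3)"
  \<comment> \<open>The argument of arcsin is the sine of the deviation of the angle from \<psi>.
    Measuring the angle relative to \<psi> keeps it continuous at the equilibrium in whichever
    quadrant \<psi> lies.\<close>
  define W Th T where "W z = S\<^sup>2 / RR z" and "Th z = \<psi> + arcsin ((c * X2 z - s * X1 z) / RR z)"
    and "T z = \<sigma> * S ^ 3 * (M2 z + X1 z * Q3 z)" for z
  have [simp]: "R\<^sub>0 $ 1 = S\<^sup>2 * c" "R\<^sub>0 $ 2 = S\<^sup>2 * s" "R\<^sub>0 $ 3 = 0" "P\<^sub>0 $ 1 = 0" "P\<^sub>0 $ 2 = 0" "P\<^sub>0 $ 3 = k / S"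
    by (simp_all add: R\<^sub>0_def P\<^sub>0_def)
  have X10: "X1 ?z = S\<^sup>2 * c" by (simp add: X1_def)
  have X20: "X2 ?z = S\<^sup>2 * s" using sg(1) S by (simp add: X2_def abs_mult mult.left_commute[of sg])
  have RR0: "RR ?z = S\<^sup>2"
  proof -
    have "(S\<^sup>2 * c)\<^sup>2 + (S\<^sup>2 * s)\<^sup>2 = (S\<^sup>2)\<^sup>2" using s2 by algebra
    then show ?thesis unfolding RR_def X10 X20 by (simp only: real_sqrt_abs abs_power2)
  qed
  have nz0: "X2 ?z \<noteq> 0" "RR ?z \<noteq> 0" using X20 RR0 S cs by auto
  have Q30: "Q3 ?z = k / S" using S cs by (simp add: Q3_def axial_slice_def X20)
  have M20: "M2 ?z = m\<^sub>0 $ 2" using S cs by (simp add: M2_def axial_slice_def X20)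
  have W0: "W ?z = 1" using S by (simp add: W_def RR0)
  have arg0: "(c * X2 ?z - s * X1 ?z) / RR ?z = 0" by (simp add: X10 X20)
  have Th0: "Th ?z = \<psi>" unfolding Th_def arg0 by simp
  have T0: "T ?z = \<tau>\<^sub>r"
    unfolding T_def M20 Q30 X10 using S
    by (simp add: m\<^sub>0_def \<tau>\<^sub>r_def \<epsilon>_def field_simps eval_nat_numeral)
  have cont: "isCont X1 ?z" "isCont X2 ?z"
    unfolding X1_def[abs_def] X2_def[abs_def] by (intro continuous_intros isCont_vec_nth)+
  have cRR: "isCont RR ?z" unfolding RR_def[abs_def] by (intro continuous_intros cont)
  have Q3_alt: "Q3 = (\<lambda>z. (snd (snd z) $ 3 * fst z $ 2 - snd (snd z) $ 2 * fst z $ 3) / X2 z)"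
    and M2_alt: "M2 = (\<lambda>z. (fst (snd z) $ 2 * fst z $ 2 + fst (snd z) $ 3 * fst z $ 3) / X2 z)"
    by (auto simp: fun_eq_iff Q3_def M2_def axial_slice_def)
  have cQ3: "isCont Q3 ?z" unfolding Q3_alt
    by (intro continuous_intros isCont_vec_nth cont nz0)
  have cM2: "isCont M2 ?z" unfolding M2_alt
    by (intro continuous_intros isCont_vec_nth cont nz0)
  have cW: "isCont W ?z" unfolding W_def[abs_def] by (intro continuous_intros cRR nz0)
  have cTh: "isCont Th ?z"
  proof -
    have "isCont (\<lambda>z. (c * X2 z - s * X1 z) / RR z) ?z" by (intro continuous_intros cont cRR nz0)
    moreover have "isCont arcsin ((c * X2 ?z - s * X1 ?z) / RR ?z)" unfolding arg0 by (rule isCont_arcsin) auto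
    ultimately have "isCont (\<lambda>z. arcsin ((c * X2 z - s * X1 z) / RR z)) ?z" by (rule isCont_o2)
    then show ?thesis unfolding Th_def[abs_def] by (intro continuous_intros)
  qed
  have cT: "isCont T ?z" unfolding T_def[abs_def] by (intro continuous_intros cM2 cQ3 cont)
  \<comment> \<open>Positivity of \<open>D\<close> is the hypothesis \<open>dir\<close> of
    \<open>coordinate_minimum\<close>: the total angular momentum keeps the orientation it has at
    the equilibrium.\<close>
  define D where "D z = \<sigma> * S * Q3 z / W z + \<epsilon> * E.ga L\<^sub>r (Th z) (T z)" for z
  have cD: "isCont D ?z" unfolding D_def[abs_def] E.ga_def
    by (intro continuous_intros cQ3 cW cTh cT) (simp add: W0)
  have D0: "D ?z > 0"
    unfolding D_def Q30 W0 Th0 T0 using \<sigma>(3) S ga_pos[OF good] \<epsilon>_pos k_nz by (simp add: add_pos_pos)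
  define U where "U z = (\<epsilon>, m\<^sub>r, L\<^sub>r, W z, Th z, T z)" for z
  have cU: "isCont U ?z" unfolding U_def[abs_def] by (intro continuous_intros cW cTh cT)
  have U0: "U ?z = x\<^sub>r" by (simp add: U_def W0 Th0 T0 x\<^sub>r_def)
  have ev: "\<forall>\<^sub>F z in nhds ?z. 0 < F z" if "isCont F ?z" "0 < F ?z" for F :: "_ \<Rightarrow> real"
    using that order_tendstoD(1)[of F "F ?z" "nhds ?z" 0] by (simp add: isCont_def tendsto_at_iff_tendsto_nhds)
  have e1: "\<forall>\<^sub>F z in nhds ?z. 0 < s * X2 z"
  proof (rule ev)
    have "s * X2 ?z = S\<^sup>2 * s\<^sup>2" by (simp add: X20 power2_eq_square)
    then show "0 < s * X2 ?z" using S cs by simp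
  qed (intro continuous_intros cont)
  \<comment> \<open>This is the distance times the cosine of the deviation from \<psi>; its
    positivity selects the branch on which arcsin recovers the angle.\<close>
  have e2: "\<forall>\<^sub>F z in nhds ?z. 0 < c * X1 z + s * X2 z"
  proof (rule ev)
    have "c * (S\<^sup>2 * c) + s * (S\<^sup>2 * s) = S\<^sup>2" using s2 by algebra
    then show "0 < c * X1 ?z + s * X2 ?z" unfolding X10 X20 using S by simp
  qed (intro continuous_intros cont)
  have e3: "\<forall>\<^sub>F z in nhds ?z. U z \<in> ball X d"
  proof -
    have "(U \<longlongrightarrow> U ?z) (nhds ?z)" using cU by (simp add: isCont_def tendsto_at_iff_tendsto_nhds)
    then show ?thesis using topological_tendstoD[of U "U ?z" "nhds ?z" "ball X d"] xr U0 by simp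
  qed
  from e1 e2 e3 ev[OF cD D0]
  have "\<forall>\<^sub>F z in nhds ?z. 0 < s * X2 z \<and> 0 < c * X1 z + s * X2 z \<and> U z \<in> ball X d \<and> 0 < D z"
    by eventually_elim simp
  then obtain \<delta> where \<delta>: "\<delta> > 0" "\<And>z. dist z ?z < \<delta> \<Longrightarrow> 0 < s * X2 z \<and> 0 < c * X1 z + s * X2 z \<and> U z \<in> ball X d \<and> 0 < D z"
    unfolding eventually_nhds_metric by blast
  show ?thesis
  proof (rule exI[of _ \<delta>], intro conjI allI impI \<delta>(1))
    fix R m P :: "real^3"
    assume dist: "dist (R, m, P) ?z < \<delta>" and nm: "norm m = norm m\<^sub>0"
      and l1: "e1 \<bullet> (m - R \<times> P) = e1 \<bullet> (m\<^sub>0 - R\<^sub>0 \<times> P\<^sub>0)"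
      and le: "hamiltonian2 (inertia_axi I\<^sub>1 I\<^sub>2) (mat 1, R, m, P) \<le> hamiltonian2 (inertia_axi I\<^sub>1 I\<^sub>2) (mat 1, R\<^sub>0, m\<^sub>0, P\<^sub>0)"
    define x1 x2 r w th t where "x1 = X1 (R, m, P)" and "x2 = X2 (R, m, P)" and "r = RR (R, m, P)"
      and "w = W (R, m, P)" and "th = Th (R, m, P)" and "t = T (R, m, P)"
    note defs = x1_def x2_def r_def w_def th_def t_def
    have near: "0 < s * x2" "0 < c * x1 + s * x2" "(\<epsilon>, m\<^sub>r, L\<^sub>r, w, th, t) \<in> ball X d" "0 < D (R, m, P)"
      using \<delta>(2)[OF dist] by (simp_all add: defs U_def)
    have x2_nz: "x2 \<noteq> 0" using near(1) by auto
    have x2sq: "x2\<^sup>2 = (R$2)\<^sup>2 + (R$3)\<^sup>2" using sg(2) by (simp add: x2_def X2_def power_mult_distrib)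
    define N where "N = axial_frame x2 R"
    note fr = axial_frame[OF x2sq x2_nz, folded N_def]
    define Pt mt where "Pt = axial_slice x2 R P" and "mt = axial_slice x2 R m"
    define Rt :: "real^3" where "Rt = vector [x1, x2, 0]"
    have Rt: "axial_slice x2 R R = Rt" using fr(3) by (simp add: Rt_def x1_def X1_def)
    have unslice: "R = N *v Rt" "P = N *v Pt" "m = N *v mt"
      using fr(2)[of R] fr(2)[of P] fr(2)[of m] by (simp_all add: Rt Pt_def mt_def)
    have rotN: "rotation_matrix N" "N *v e1 = e1" using fr(1) by (auto simp: axial_rotations_def)
    have r: "r > 0" "r\<^sup>2 = x1\<^sup>2 + x2\<^sup>2"
    proof -
      have "x1\<^sup>2 + x2\<^sup>2 > 0" using x2_nz by (simp add: add_nonneg_pos)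
      then show "r > 0" "r\<^sup>2 = x1\<^sup>2 + x2\<^sup>2" by (simp_all add: r_def RR_def flip: x1_def x2_def)
    qed
    have w: "w = S\<^sup>2 / r" by (simp add: w_def W_def r_def)
    have trig: "cos th = x1 / r" "sin th = x2 / r"
    proof -
      define u where "u = (c * x2 - s * x1) / r"
      define v where "v = (c * x1 + s * x2) / r"
      have "u\<^sup>2 + v\<^sup>2 = 1"
      proof -
        have "(c * x2 - s * x1)\<^sup>2 + (c * x1 + s * x2)\<^sup>2 = r\<^sup>2" using r(2) s2 by algebra
        then show ?thesis using r(1) by (simp add: u_def v_def power_divide flip: add_divide_distrib)
      qed
      moreover have v: "v > 0" using near(2) r(1) by (simp add: v_def)
      ultimately have u: "- 1 \<le> u" "u \<le> 1" and v2: "sqrt (1 - u\<^sup>2) = v"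
      proof -
        assume uv: "u\<^sup>2 + v\<^sup>2 = 1" and v: "v > 0"
        have "u\<^sup>2 \<le> 1" using uv zero_le_power2[of v] by linarith
        then show "- 1 \<le> u" "u \<le> 1" using abs_le_square_iff[of u 1] by auto
        have "1 - u\<^sup>2 = v\<^sup>2" using uv by simp
        then show "sqrt (1 - u\<^sup>2) = v" using v by simp
      qed
      have th: "th = \<psi> + arcsin u" by (simp add: th_def Th_def u_def defs)
      have "cos th = c * v - s * u" "sin th = s * v + c * u"
        unfolding th cos_add sin_add using u v2 by (simp_all add: cos_arcsin)
      moreover have "c * v - s * u = (c * (c * x1 + s * x2) - s * (c * x2 - s * x1)) / r"
        "s * v + c * u = (s * (c * x1 + s * x2) + c * (c * x2 - s * x1)) / r"

      proof -
        have "y * (z / r) - y' * (z' / r) = (y * z - y' * z') / r" "y * (z / r) + y' * (z' / r) = (y * z + y' * z') / r"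
          for y z y' z' by (simp_all add: diff_divide_distrib add_divide_distrib)
        then show "c * v - s * u = (c * (c * x1 + s * x2) - s * (c * x2 - s * x1)) / r"
          "s * v + c * u = (s * (c * x1 + s * x2) + c * (c * x2 - s * x1)) / r"
          unfolding u_def v_def by blast+
      qed
      moreover have "c * (c * x1 + s * x2) - s * (c * x2 - s * x1) = x1"
        "s * (c * x1 + s * x2) + c * (c * x2 - s * x1) = x2" using s2 by algebra+
      ultimately show "cos th = x1 / r" "sin th = x2 / r" by simp_all
    qed
    \<comment> \<open>The factors \<open>\<sigma> * S\<close> and \<open>\<sigma> * S ^ 3\<close>
      pass to rescaled momenta and spins, with \<sigma> chosen so that \<open>p3\<close> is
      \<open>\<bar>k\<bar>\<close> at the equilibrium.\<close>
    define p1 p2 p3 l2 l3 where "p1 = \<sigma> * S * Pt$1" and "p2 = \<sigma> * S * Pt$2" and "p3 = \<sigma> * S * Pt$3"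
      and "l2 = mt$2 + x1 * Pt$3" and "l3 = \<sigma> * S ^ 3 * (mt$3 - (x1 * Pt$2 - x2 * Pt$1))"
    have t: "t = \<sigma> * S ^ 3 * l2"
      by (simp add: t_def T_def M2_def Q3_def l2_def mt_def Pt_def x1_def x2_def)
    have l10: "e1 \<bullet> (m\<^sub>0 - R\<^sub>0 \<times> P\<^sub>0) = L\<^sub>1 / S ^ 3"
      using S by (simp add: inner_e1 cross_components m\<^sub>0_def \<epsilon>_def field_simps eval_nat_numeral)
    have "e1 \<bullet> (m - R \<times> P) = mt$1 - x2 * Pt$3"
    proof -
      have "m - R \<times> P = N *v (mt - Rt \<times> Pt)"
        unfolding unslice by (simp add: cross_rotation_matrix[OF rotN(1)] matrix_vector_mult_diff_distrib)
      then have "e1 \<bullet> (m - R \<times> P) = e1 \<bullet> (mt - Rt \<times> Pt)"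
        using rotation_matrix_inner[OF rotN(1), of e1] rotN(2) by metis
      then show ?thesis by (simp add: inner_e1 cross_components Rt_def mult.commute)
    qed
    then have m1: "mt$1 = L\<^sub>1 / S ^ 3 + x2 * Pt$3" using l1 l10 by simp
    have \<epsilon>S: "\<epsilon> * S ^ 3 = 1 / S" "\<epsilon> = 1 / S ^ 4" using S by (simp_all add: \<epsilon>_def field_simps eval_nat_numeral)
    have xw: "sin th / w = x2 / S\<^sup>2" "cos th / w = x1 / S\<^sup>2"
      unfolding trig w using r(1) S by simp_all
    have mS: "sin th * p3 / w + \<epsilon> * L\<^sub>r = \<sigma> * mt$1 / S" "- cos th * p3 / w + \<epsilon> * t = \<sigma> * mt$2 / S"
      "(cos th * p2 - sin th * p1) / w + \<epsilon> * l3 = \<sigma> * mt$3 / S"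
    proof -
      have "sin th * p3 / w + \<epsilon> * L\<^sub>r = (sin th / w) * p3 + \<epsilon> * L\<^sub>r" by simp
      also have "\<dots> = \<sigma> * mt$1 / S"
        unfolding xw m1 p3_def L\<^sub>r_def \<epsilon>S using S by (simp add: field_simps eval_nat_numeral)
      finally show "sin th * p3 / w + \<epsilon> * L\<^sub>r = \<sigma> * mt$1 / S" .
      have "- cos th * p3 / w + \<epsilon> * t = - (cos th / w) * p3 + \<epsilon> * t" by simp
      also have "\<dots> = \<sigma> * mt$2 / S"
        unfolding xw t l2_def p3_def \<epsilon>S using S by (simp add: field_simps eval_nat_numeral)
      finally show "- cos th * p3 / w + \<epsilon> * t = \<sigma> * mt$2 / S" .
      have "(cos th * p2 - sin th * p1) / w + \<epsilon> * l3 = (cos th / w) * p2 - (sin th / w) * p1 + \<epsilon> * l3"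
        by (simp add: diff_divide_distrib)
      also have "\<dots> = \<sigma> * mt$3 / S"
        unfolding xw l3_def p2_def p1_def \<epsilon>S using S by (simp add: field_simps eval_nat_numeral)
      finally show "(cos th * p2 - sin th * p1) / w + \<epsilon> * l3 = \<sigma> * mt$3 / S" .
    qed
    have mr: "m\<^sub>r\<^sup>2 = (sin th * p3 / w + \<epsilon> * L\<^sub>r)\<^sup>2 + (- cos th * p3 / w + \<epsilon> * t)\<^sup>2
        + ((cos th * p2 - sin th * p1) / w + \<epsilon> * l3)\<^sup>2"
    proof -
      have "norm mt = norm m\<^sub>0" using nm rotation_matrix_norm[OF rotN(1), of mt] unslice(3) by simp
      then have "m\<^sub>r\<^sup>2 = (mt \<bullet> mt) / S\<^sup>2" by (simp add: m\<^sub>r_def power_divide power2_norm_eq_inner[symmetric])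
      then show ?thesis unfolding mS using \<sigma>(2)
        by (simp add: power_mult_distrib power_divide inner_vec_def sum_3 add_divide_distrib power2_eq_square[symmetric])
    qed
    have dirp: "p3 / w + \<epsilon> * E.ga L\<^sub>r th t > 0"
      using near(4) by (simp add: D_def p3_def Q3_def Pt_def x2_def w_def th_def t_def)
    have wS: "S\<^sup>2 / r = w" "1 / r = w / S\<^sup>2" using w S r by (simp_all add: field_simps)
    have H: "S\<^sup>2 * hamiltonian2 (inertia_axi I\<^sub>1 I\<^sub>2) (mat 1, R, m, P)
      = (p1\<^sup>2 + p2\<^sup>2 + p3\<^sup>2) / 2 + \<epsilon> * (t\<^sup>2 + l3\<^sup>2) / (2 * I\<^sub>2) - w + \<epsilon> * (a / 2 * (3 * (cos th)\<^sup>2 - 1) * w ^ 3)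
        + \<epsilon> * L\<^sub>r\<^sup>2 / (2 * I\<^sub>1)"
    proof -
      have vec: "Rt = vector [x1, x2, 0]" "mt = vector [mt$1, mt$2, mt$3]" "Pt = vector [Pt$1, Pt$2, Pt$3]"
        by (simp_all add: Rt_def vec3_eq_iff)
      have "hamiltonian2 (inertia_axi I\<^sub>1 I\<^sub>2) (mat 1, R, m, P) = hamiltonian2 (inertia_axi I\<^sub>1 I\<^sub>2) (mat 1, Rt, mt, Pt)"
      proof -
        have "hamiltonian2 (inertia_axi I\<^sub>1 I\<^sub>2) (mat 1, N *v Rt, N *v mt, N *v Pt)
          = hamiltonian2 (inertia_axi I\<^sub>1 I\<^sub>2) (mat 1, Rt, mt, Pt)"
          by (rule hamiltonian2_equivariant[OF _ _ rotN]) (use I in auto)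
        then show ?thesis by (simp only: unslice[symmetric])
      qed
      also have "\<dots> = ((mt$1 - x2 * Pt$3)\<^sup>2 / I\<^sub>1 + (l2\<^sup>2 + (mt$3 - (x1 * Pt$2 - x2 * Pt$1))\<^sup>2) / I\<^sub>2
          + ((Pt$1)\<^sup>2 + (Pt$2)\<^sup>2 + (Pt$3)\<^sup>2)) / 2 - 1 / r + (I\<^sub>1 - I\<^sub>2) / 2 * (3 * (x1 / r)\<^sup>2 - 1) / r ^ 3"
      proof -
        have "I\<^sub>1 \<noteq> 0" "I\<^sub>2 \<noteq> 0" using I by auto
        from hamiltonian2_planar[OF this I(3) r(2)[symmetric] r(1), of "mat 1" "mt$1" "mt$2" "mt$3" "Pt$1" "Pt$2" "Pt$3"]
        show ?thesis unfolding l2_def vec[symmetric] .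
      qed
      also have "\<dots> = ((L\<^sub>1 / S ^ 3)\<^sup>2 / I\<^sub>1 + (l2\<^sup>2 + (mt$3 - (x1 * Pt$2 - x2 * Pt$1))\<^sup>2) / I\<^sub>2
          + ((Pt$1)\<^sup>2 + (Pt$2)\<^sup>2 + (Pt$3)\<^sup>2)) / 2 - w / S\<^sup>2 + a / 2 * (3 * (cos th)\<^sup>2 - 1) * (w / S\<^sup>2) ^ 3"
        unfolding trig a_def m1 wS(2)[symmetric] by (simp add: power_divide)
      finally have H: "hamiltonian2 (inertia_axi I\<^sub>1 I\<^sub>2) (mat 1, R, m, P) = \<dots>" .
      define K where "K = a / 2 * (3 * (cos th)\<^sup>2 - 1)"
      have sq: "p1\<^sup>2 = S\<^sup>2 * (Pt$1)\<^sup>2" "p2\<^sup>2 = S\<^sup>2 * (Pt$2)\<^sup>2" "p3\<^sup>2 = S\<^sup>2 * (Pt$3)\<^sup>2"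
        "t\<^sup>2 = S ^ 6 * l2\<^sup>2" "l3\<^sup>2 = S ^ 6 * (mt$3 - (x1 * Pt$2 - x2 * Pt$1))\<^sup>2" "L\<^sub>r\<^sup>2 = L\<^sub>1\<^sup>2"
        unfolding p1_def p2_def p3_def t l3_def L\<^sub>r_def using \<sigma>(2) by (simp_all add: power_mult_distrib flip: power_mult)
      show ?thesis unfolding H sq \<epsilon>S(2) K_def[symmetric] using S I by (simp add: field_simps eval_nat_numeral)
    qed
    have H0: "S\<^sup>2 * hamiltonian2 (inertia_axi I\<^sub>1 I\<^sub>2) (mat 1, R\<^sub>0, m\<^sub>0, P\<^sub>0) = E.g \<epsilon> m\<^sub>r L\<^sub>r 1 \<psi> \<tau>\<^sub>r + \<epsilon> * L\<^sub>r\<^sup>2 / (2 * I\<^sub>1)"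
      by (rule hamiltonian_at_equilibrium[OF good])
    have "(p1\<^sup>2 + p2\<^sup>2 + p3\<^sup>2) / 2 + \<epsilon> * (t\<^sup>2 + l3\<^sup>2) / (2 * I\<^sub>2) - w + \<epsilon> * (a / 2 * (3 * (cos th)\<^sup>2 - 1) * w ^ 3)
       \<le> E.g \<epsilon> m\<^sub>r L\<^sub>r 1 \<psi> \<tau>\<^sub>r"
      using mult_left_mono[OF le, of "S\<^sup>2"] unfolding H H0 by simp
    from E.coordinate_minimum[OF ball xr[unfolded x\<^sub>r_def] near(3) \<epsilon>_pos critical[OF good] mr dirp this]
    have eqs: "w = 1" "th = \<psi>" "t = \<tau>\<^sub>r" "l3 = 0" "p1 = 0" "p2 = 0" "p3 = \<bar>k\<bar>"
      by (auto simp: ell_eq[OF good])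
    have "r = S\<^sup>2" using eqs(1) w r by simp
    then have x: "x1 = S\<^sup>2 * c" "x2 = S\<^sup>2 * s" using trig eqs(2) r(1) S by (simp_all add: field_simps)
    have P: "Pt$1 = 0" "Pt$2 = 0" "Pt$3 = k / S"
      using eqs(5-7) \<sigma>(4) S unfolding p1_def p2_def p3_def \<sigma>(3)[symmetric] by (simp_all add: field_simps)
    have "mt$3 = 0" using eqs(4) \<sigma>(4) S P unfolding l3_def by simp
    moreover have "mt$2 = I\<^sub>2 * \<omega>\<^sub>2 / S ^ 3 - S * c * k"
    proof -
      have "\<sigma> * (S ^ 3 * l2) = \<sigma> * (I\<^sub>2 * \<omega>\<^sub>2)" using eqs(3) t by (simp add: \<tau>\<^sub>r_def mult.assoc)
      then have "S ^ 3 * l2 = I\<^sub>2 * \<omega>\<^sub>2" using \<sigma>(4) by simp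
      then have "l2 = I\<^sub>2 * \<omega>\<^sub>2 / S ^ 3" using S by (simp add: field_simps)
      then show ?thesis using S by (simp add: l2_def x P field_simps eval_nat_numeral)
    qed
    moreover have "mt$1 = L\<^sub>1 / S ^ 3 + S * s * k" using m1 S by (simp add: x P field_simps eval_nat_numeral)
    moreover have "m\<^sub>0 $ 1 = L\<^sub>1 / S ^ 3 + S * s * k" "m\<^sub>0 $ 2 = I\<^sub>2 * \<omega>\<^sub>2 / S ^ 3 - S * c * k" "m\<^sub>0 $ 3 = 0"
      using S by (simp_all add: m\<^sub>0_def \<epsilon>_def field_simps eval_nat_numeral)
    ultimately have "mt = m\<^sub>0" by (simp add: vec3_eq_iff)
    moreover have "Pt = P\<^sub>0" using P by (simp add: vec3_eq_iff)
    moreover have "Rt = R\<^sub>0" by (simp add: Rt_def R\<^sub>0_def x)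
    ultimately show "\<exists>N\<in>axial_rotations. R = N *v R\<^sub>0 \<and> m = N *v m\<^sub>0 \<and> P = N *v P\<^sub>0"
      using unslice fr(1) by auto
  qed
qed

end

section \<open>Bounded Lipschitz functions\<close>

text \<open>Boundedness is carried along because the product of two Lipschitz functions is Lipschitz
  in general only if both are bounded. The class is then closed under all operations that occur in
  the Hamiltonian field.\<close>

definition bounded_lipschitz :: "('a::metric_space \<Rightarrow> 'b::real_normed_vector) \<Rightarrow> bool" where
  "bounded_lipschitz f \<longleftrightarrow> (\<exists>L C. \<forall>x y. norm (f x) \<le> C \<and> norm (f x - f y) \<le> L * dist x y)"

lemma bounded_lipschitzI:
  assumes "\<And>x. norm (f x) \<le> C" "\<And>x y. norm (f x - f y) \<le> L * dist x y"
  shows "bounded_lipschitz f"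
  using assms unfolding bounded_lipschitz_def by blast

lemma bounded_lipschitzD:
  assumes "bounded_lipschitz f"
  shows "\<exists>L C. L \<ge> 0 \<and> C \<ge> 0 \<and> (\<forall>x. norm (f x) \<le> C) \<and> (\<forall>x y. norm (f x - f y) \<le> L * dist x y)"
proof -
  obtain L C where LC: "\<And>x y. norm (f x) \<le> C" "\<And>x y. norm (f x - f y) \<le> L * dist x y"
    using assms unfolding bounded_lipschitz_def by blast
  have "norm (f x - f y) \<le> \<bar>L\<bar> * dist x y" for x y
    using LC(2)[of x y] mult_right_mono[of L "\<bar>L\<bar>" "dist x y"]
    by (meson abs_ge_self order_trans zero_le_dist)
  moreover have "norm (f x) \<le> \<bar>C\<bar>" for x using LC(1)[of x] by simp
  ultimately show ?thesis by (intro exI[of _ "\<bar>L\<bar>"] exI[of _ "\<bar>C\<bar>"]) simp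
qed

lemma bounded_lipschitz_const: "bounded_lipschitz (\<lambda>x. c)"
  by (rule bounded_lipschitzI[of _ "norm c" 0]) auto

lemma bounded_lipschitz_bilinear:
  assumes "bounded_bilinear bil" "bounded_lipschitz f" "bounded_lipschitz g"
  shows "bounded_lipschitz (\<lambda>x. bil (f x) (g x))"
proof -
  obtain L C where f: "L \<ge> 0" "C \<ge> 0" "\<And>x. norm (f x) \<le> C" "\<And>x y. norm (f x - f y) \<le> L * dist x y"
    using bounded_lipschitzD[OF assms(2)] by blast
  obtain L' C' where g: "L' \<ge> 0" "C' \<ge> 0" "\<And>x. norm (g x) \<le> C'" "\<And>x y. norm (g x - g y) \<le> L' * dist x y"
    using bounded_lipschitzD[OF assms(3)] by blast
  obtain K where K: "K > 0" "\<And>a b. norm (bil a b) \<le> norm a * norm b * K"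
    using bounded_bilinear.pos_bounded[OF assms(1)] by blast
  show ?thesis
  proof (rule bounded_lipschitzI[of _ "C * C' * K" "(L * C' + C * L') * K"])
    fix x y
    have b: "norm (bil u v) \<le> p * q * K" if "norm u \<le> p" "norm v \<le> q" "p \<ge> 0" for u v p q
    proof -
      have "norm (bil u v) \<le> norm u * norm v * K" by (rule K)
      also have "\<dots> \<le> p * q * K" using that K(1) by (intro mult_right_mono mult_mono) auto
      finally show ?thesis .
    qed
    show "norm (bil (f x) (g x)) \<le> C * C' * K" by (rule b[OF f(3) g(3) f(2)])
    have "bil (f x) (g x) - bil (f y) (g y) = bil (f x - f y) (g x) + bil (f y) (g x - g y)"
      by (simp add: bounded_bilinear.diff_left[OF assms(1)] bounded_bilinear.diff_right[OF assms(1)])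
    also have "norm \<dots> \<le> norm (bil (f x - f y) (g x)) + norm (bil (f y) (g x - g y))" by (rule norm_triangle_ineq)
    also have "\<dots> \<le> (L * dist x y) * C' * K + C * (L' * dist x y) * K"
      by (intro add_mono b f g mult_nonneg_nonneg) auto
    finally show "norm (bil (f x) (g x) - bil (f y) (g y)) \<le> (L * C' + C * L') * K * dist x y"
      by (simp add: algebra_simps)
  qed
qed

lemma bounded_lipschitz_linear:
  assumes "bounded_linear h" "bounded_lipschitz f"
  shows "bounded_lipschitz (\<lambda>x. h (f x))"
proof -
  obtain L C where f: "L \<ge> 0" "C \<ge> 0" "\<And>x. norm (f x) \<le> C" "\<And>x y. norm (f x - f y) \<le> L * dist x y"
    using bounded_lipschitzD[OF assms(2)] by blast
  obtain K where K: "K > 0" "\<And>a. norm (h a) \<le> norm a * K"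
    using bounded_linear.pos_bounded[OF assms(1)] by blast
  show ?thesis
  proof (rule bounded_lipschitzI[of _ "C * K" "L * K"])
    fix x y
    show "norm (h (f x)) \<le> C * K"
      by (rule order_trans[OF K(2) mult_right_mono[OF f(3)]]) (use K(1) in simp)
    have "norm (h (f x) - h (f y)) = norm (h (f x - f y))" by (simp add: bounded_linear.linear[OF assms(1)] linear_diff)
    also have "\<dots> \<le> norm (f x - f y) * K" by (rule K)
    also have "\<dots> \<le> L * dist x y * K" by (intro mult_right_mono f) (use K in auto)
    finally show "norm (h (f x) - h (f y)) \<le> L * K * dist x y" by (simp add: mult_ac)
  qed
qed

lemma bounded_lipschitz_add:
  assumes "bounded_lipschitz f" "bounded_lipschitz g"
  shows "bounded_lipschitz (\<lambda>x. f x + g x)"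
proof -
  obtain L C where f: "\<And>x. norm (f x) \<le> C" "\<And>x y. norm (f x - f y) \<le> L * dist x y"
    using bounded_lipschitzD[OF assms(1)] by blast
  obtain L' C' where g: "\<And>x. norm (g x) \<le> C'" "\<And>x y. norm (g x - g y) \<le> L' * dist x y"
    using bounded_lipschitzD[OF assms(2)] by blast
  show ?thesis
  proof (rule bounded_lipschitzI[of _ "C + C'" "L + L'"])
    fix x y
    show "norm (f x + g x) \<le> C + C'" by (rule norm_triangle_le) (intro add_mono f g)
    have "f x + g x - (f y + g y) = (f x - f y) + (g x - g y)" by simp
    also have "norm \<dots> \<le> L * dist x y + L' * dist x y" by (rule norm_triangle_le) (intro add_mono f g)
    finally show "norm (f x + g x - (f y + g y)) \<le> (L + L') * dist x y" by (simp add: ring_distribs)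
  qed
qed

lemma bounded_lipschitz_minus:
  "bounded_lipschitz f \<Longrightarrow> bounded_lipschitz (\<lambda>x. - f x)"
  by (rule bounded_lipschitz_linear[OF bounded_linear_minus[OF bounded_linear_ident]])

lemma bounded_lipschitz_diff:
  "bounded_lipschitz f \<Longrightarrow> bounded_lipschitz g \<Longrightarrow> bounded_lipschitz (\<lambda>x. f x - g x)"
  using bounded_lipschitz_add[of f "\<lambda>x. - g x"] bounded_lipschitz_minus[of g] by simp

lemma bounded_lipschitz_Pair:
  assumes "bounded_lipschitz f" "bounded_lipschitz g"
  shows "bounded_lipschitz (\<lambda>x. (f x, g x))"
proof -
  have "bounded_lipschitz (\<lambda>x. (f x, 0) + (0, g x))"
    by (intro bounded_lipschitz_add bounded_lipschitz_linear[OF _ assms(1)] bounded_lipschitz_linear[OF _ assms(2)]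
        bounded_linear_Pair bounded_linear_ident bounded_linear_zero)
  then show ?thesis by simp
qed

lemma bounded_lipschitz_power:
  fixes f :: "'a::metric_space \<Rightarrow> real"
  shows "bounded_lipschitz f \<Longrightarrow> bounded_lipschitz (\<lambda>x. f x ^ n)"
  by (induction n) (auto intro: bounded_lipschitz_const bounded_lipschitz_bilinear[OF bounded_bilinear_mult])

lemma bounded_lipschitz_compose:
  fixes g :: "'c::real_normed_vector \<Rightarrow> 'a::real_normed_vector"
  assumes "bounded_lipschitz f" "bounded_linear g"
  shows "bounded_lipschitz (\<lambda>x. f (g x))"
proof -
  obtain L C where f: "L \<ge> 0" "\<And>x. norm (f x) \<le> C" "\<And>x y. norm (f x - f y) \<le> L * dist x y"
    using bounded_lipschitzD[OF assms(1)] by blast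
  obtain K where K: "K > 0" "\<And>a. norm (g a) \<le> norm a * K"
    using bounded_linear.pos_bounded[OF assms(2)] by blast
  show ?thesis
  proof (rule bounded_lipschitzI[of _ C "L * K"])
    fix x y
    have "dist (g x) (g y) = norm (g (x - y))" by (simp add: dist_norm bounded_linear.linear[OF assms(2)] linear_diff)
    also have "\<dots> \<le> dist x y * K" using K(2)[of "x - y"] by (simp add: dist_norm)
    finally have "L * dist (g x) (g y) \<le> L * (dist x y * K)" by (rule mult_left_mono) (rule f)
    then show "norm (f (g x) - f (g y)) \<le> L * K * dist x y" using f(3)[of "g x" "g y"] by (simp add: mult_ac)
  qed (rule f)
qed

definition clip :: "real \<Rightarrow> 'a::euclidean_space \<Rightarrow> 'a" where
  "clip K = closest_point (cball 0 K)"

lemma clip_id: "norm x \<le> K \<Longrightarrow> clip K x = x"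
  by (simp add: clip_def closest_point_self)

lemma bounded_lipschitz_clip:
  assumes "K \<ge> 0" shows "bounded_lipschitz (clip K)"
proof (rule bounded_lipschitzI[of _ K 1])
  fix x y :: 'a
  have "clip K x \<in> cball 0 K" unfolding clip_def by (rule closest_point_in_set) (use assms in auto)
  then show "norm (clip K x) \<le> K" by simp
  have "dist (clip K x) (clip K y) \<le> dist x y"
    unfolding clip_def by (rule closest_point_lipschitz) (use assms in auto)
  then show "norm (clip K x - clip K y) \<le> 1 * dist x y" by (simp add: dist_norm)
qed

lemma bounded_lipschitz_inverse_norm:
  assumes "r > 0" shows "bounded_lipschitz (\<lambda>x :: 'a::real_normed_vector. 1 / max (norm x) r)"
proof (rule bounded_lipschitzI[of _ "1 / r" "1 / r\<^sup>2"])
  fix x y :: 'a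
  show "norm (1 / max (norm x) r) \<le> 1 / r" using assms by (simp add: frac_le)
  define u v where "u = max (norm x) r" and "v = max (norm y) r"
  have uv: "u \<ge> r" "v \<ge> r" by (auto simp: u_def v_def)
  have "\<bar>u - v\<bar> \<le> \<bar>norm x - norm y\<bar>" unfolding u_def v_def by (auto simp: max_def)
  also have "\<dots> \<le> dist x y" unfolding dist_norm by (rule norm_triangle_ineq3)
  finally have 1: "\<bar>u - v\<bar> \<le> dist x y" .
  have "\<bar>1 / u - 1 / v\<bar> = \<bar>u - v\<bar> / (u * v)"
    using uv assms by (simp add: field_simps abs_divide abs_mult abs_minus_commute)
  also have "\<dots> \<le> dist x y / (r * r)"
    using uv assms 1 by (intro frac_le mult_mono) auto
  finally show "norm (1 / u - 1 / v) \<le> 1 / r\<^sup>2 * dist x y" by (simp add: power2_eq_square)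
qed

lemma global_flow_bounded_lipschitz:
  fixes f :: "'a::euclidean_space \<Rightarrow> 'a"
  assumes "bounded_lipschitz f"
  shows "\<exists>x. x 0 = x0 \<and> (\<forall>t. (x has_vector_derivative f (x t)) (at t))"
proof -
  obtain L C where f: "L \<ge> 0" "\<And>x. norm (f x) \<le> C" "\<And>x y. norm (f x - f y) \<le> L * dist x y"
    using bounded_lipschitzD[OF assms] by blast
  show ?thesis
    by (rule global_flow_exists[of L]) (use f in \<open>auto simp: lipschitz_on_def dist_norm bounded_iff\<close>)
qed

section \<open>A globally integrable field that agrees with the Hamiltonian field away from collisions\<close>

lemma linear_hat: "bounded_linear hat"
  by (rule linear_conv_bounded_linear[THEN iffD1], rule linearI) (simp_all add: hat_add hat_scaleR)

text \<open>After clipping every coordinate and replacing the inverse distance by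
  \<open>1 / max (norm R) r\<close>, the field is a polynomial in bounded Lipschitz functions. The
  matrix is clipped too, since the flow is taken in the ambient vector space.\<close>

lemma cutoff_field_exists:
  assumes I: "I\<^sub>1 \<noteq> 0" "I\<^sub>2 \<noteq> 0" "I\<^sub>1 + 2 * I\<^sub>2 = 1" and K: "K \<ge> 0" and r: "r > 0"
  obtains F :: "phase \<Rightarrow> phase" where "bounded_lipschitz F"
    "\<And>B R m P. norm B \<le> K \<Longrightarrow> norm R \<le> K \<Longrightarrow> norm m \<le> K \<Longrightarrow> norm P \<le> K \<Longrightarrow> r \<le> norm R
       \<Longrightarrow> F (B, R, m, P) = ambient (B, R, m, P) (ham_vf (hamiltonian2 (inertia_axi I\<^sub>1 I\<^sub>2)) (B, R, m, P))"
proof -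
  define a where "a = I\<^sub>1 - I\<^sub>2"
  define cB where "cB x = clip K (fst x)" for x :: phase
  define cR where "cR x = clip K (fst (snd x))" for x :: phase
  define cm where "cm x = clip K (fst (snd (snd x)))" for x :: phase
  define cP where "cP x = clip K (snd (snd (snd x)))" for x :: phase
  define u where "u x = 1 / max (norm (fst (snd x))) r" for x :: phase
  define om where "om x = inertia_axi (1 / I\<^sub>1) (1 / I\<^sub>2) *v (cm x - cR x \<times> cP x)" for x
  define gr where "gr x = (u x ^ 3 + 3 * a / 2 * u x ^ 5 - 15 * a / 2 * ((e1 \<bullet> cR x) ^ 2 * u x ^ 7)) *\<^sub>R cR x
     + (3 * a * ((e1 \<bullet> cR x) * u x ^ 5)) *\<^sub>R e1" for x
  define F where "F x = (cB x ** hat (om x), cP x - om x \<times> cR x, cm x \<times> om x, cP x \<times> om x - gr x)" for x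
  note bl = bounded_lipschitz_add bounded_lipschitz_diff bounded_lipschitz_const bounded_lipschitz_power
    bounded_lipschitz_bilinear[OF bounded_bilinear_mult]
    bounded_lipschitz_bilinear[OF bounded_bilinear_scaleR]
    bounded_lipschitz_bilinear[OF bounded_bilinear_cross3]
    bounded_lipschitz_bilinear[OF bounded_bilinear_matrix_matrix_mult]
    bounded_lipschitz_bilinear[OF bounded_bilinear_matrix_vector_mult]
    bounded_lipschitz_bilinear[OF bounded_bilinear_inner]
    bounded_lipschitz_linear[OF linear_hat] bounded_lipschitz_Pair
  have proj: "bounded_linear (\<lambda>x :: phase. fst x)" "bounded_linear (\<lambda>x :: phase. fst (snd x))"
    "bounded_linear (\<lambda>x :: phase. fst (snd (snd x)))" "bounded_linear (\<lambda>x :: phase. snd (snd (snd x)))"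
    by (intro bounded_linear_intros)+
  have c: "bounded_lipschitz cB" "bounded_lipschitz cR" "bounded_lipschitz cm" "bounded_lipschitz cP" "bounded_lipschitz u"
    unfolding cB_def[abs_def] cR_def[abs_def] cm_def[abs_def] cP_def[abs_def] u_def[abs_def]
    by (intro bounded_lipschitz_compose[OF bounded_lipschitz_clip[OF K]]
        bounded_lipschitz_compose[OF bounded_lipschitz_inverse_norm[OF r]] proj)+
  have om: "bounded_lipschitz om" unfolding om_def[abs_def] by (intro bl c)
  have gr: "bounded_lipschitz gr" unfolding gr_def[abs_def] by (intro bl c)
  have "bounded_lipschitz F" unfolding F_def[abs_def] by (intro bl c om gr)
  moreover have "F (B, R, m, P) = ambient (B, R, m, P) (ham_vf (hamiltonian2 (inertia_axi I\<^sub>1 I\<^sub>2)) (B, R, m, P))"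
    if n: "norm B \<le> K" "norm R \<le> K" "norm m \<le> K" "norm P \<le> K" "r \<le> norm R" for B R m P
  proof -
    have R: "R \<noteq> 0" using n(5) r by auto
    have [simp]: "cB (B, R, m, P) = B" "cR (B, R, m, P) = R" "cm (B, R, m, P) = m" "cP (B, R, m, P) = P"
      "u (B, R, m, P) = 1 / norm R"
      using n by (simp_all add: cB_def cR_def cm_def cP_def clip_id u_def max_def)
    have "gr (B, R, m, P) = grad_potential a R"
      by (simp add: gr_def grad_potential_def power_one_over)
    then show ?thesis
      by (simp add: F_def ham_vf_hamiltonian2[OF I R] ambient_def om_def body_rate_def a_def)
  qed
  ultimately show ?thesis by (rule that)
qed

section \<open>Compactness of the rotation groups and conserved quantities\<close>

text \<open>The three rows are unit vectors. The crude bound 3 leaves room below the threshold 4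
  used in \<open>confined\<close>.\<close>

lemma rotation_matrix_norm_le:
  fixes B :: "real^3^3"
  assumes "transpose B ** B = mat 1"
  shows "norm B \<le> 3"
proof -
  have o: "B ** transpose B = mat 1" using assms matrix_left_right_inverse by metis
  have n: "norm (transpose B *v x) = norm x" for x
  proof -
    have "(transpose B *v x) \<bullet> (transpose B *v x) = x \<bullet> (B *v (transpose B *v x))"
      using matrix_vector_inner_transpose[of "transpose B" x "transpose B *v x"] by (simp del: transpose_matrix_vector)
    also have "\<dots> = x \<bullet> x" by (simp only: matrix_vector_mul_assoc o matrix_vector_mul_lid)
    finally show ?thesis by (simp only: norm_eq_sqrt_inner)
  qed
  have "norm (B $ i) = 1" for i
  proof -
    have "norm (transpose B *v axis i 1) = norm (axis i 1 :: real^3)"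
      by (rule n)
    moreover have "transpose B *v axis i 1 = B $ i"
      by (simp add: matrix_vector_mult_basis column_def transpose_def vec_eq_iff del: transpose_matrix_vector)
    ultimately show ?thesis by simp
  qed
  then show ?thesis
    using L2_set_le_sum[of UNIV "\<lambda>i. norm (B $ i)"] by (simp add: norm_vec_def sum_3)
qed

lemma closed_rotation_matrix: "closed {B :: real^3^3. rotation_matrix B}"
proof -
  have c: "continuous_on UNIV (\<lambda>B :: real^3^3. transpose B ** B)" "continuous_on UNIV (\<lambda>B :: real^3^3. B ** transpose B)"
    by (intro bounded_bilinear.continuous_on[OF bounded_bilinear_matrix_matrix_mult] continuous_on_id
        bounded_linear.continuous_on[OF bounded_linear_transpose])+
  have "{B :: real^3^3. rotation_matrix B} = {B. transpose B ** B = mat 1} \<inter> {B. B ** transpose B = mat 1} \<inter> {B. det B = 1}"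
    by (auto simp: rotation_matrix_def orthogonal_matrix_def)
  moreover have "closed {B :: real^3^3. transpose B ** B = mat 1}" "closed {B :: real^3^3. B ** transpose B = mat 1}"
    "closed {B :: real^3^3. det B = 1}"
    using continuous_closed_preimage_constant[OF c(1) closed_UNIV] continuous_closed_preimage_constant[OF c(2) closed_UNIV]
      continuous_closed_preimage_constant[OF continuous_det3[OF continuous_on_id] closed_UNIV] by auto
  ultimately show ?thesis by auto
qed

lemma compact_rotation_matrix: "compact {B :: real^3^3. rotation_matrix B}"
  unfolding compact_eq_bounded_closed
proof
  show "bounded {B :: real^3^3. rotation_matrix B}"
    by (rule boundedI[of _ 3]) (auto intro!: rotation_matrix_norm_le rotation_matrix_mult_transpose)
qed (rule closed_rotation_matrix)

lemma compact_axial_rotations: "compact axial_rotations"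
proof -
  have eq: "axial_rotations = {B. rotation_matrix B} \<inter> {B. B *v e1 = e1}" by (auto simp: axial_rotations_def)
  have "continuous_on UNIV (\<lambda>B :: real^3^3. B *v e1)"
    by (intro bounded_bilinear.continuous_on[OF bounded_bilinear_matrix_vector_mult] continuous_on_id continuous_on_const)
  then have "closed {B :: real^3^3. B *v e1 = e1}"
    using continuous_closed_preimage_constant[OF _ closed_UNIV] by fastforce
  then show ?thesis unfolding eq by (rule compact_Int_closed[OF compact_rotation_matrix])
qed

lemma axial_rotation_entries:
  assumes "N \<in> axial_rotations"
  shows "N$1$1 = 1" "N$1$2 = 0" "N$1$3 = 0" "N$2$1 = 0" "N$3$1 = 0"
proof -
  have N: "rotation_matrix N" "N *v e1 = e1" using assms by (auto simp: axial_rotations_def)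
  have c: "(N *v e1) $ i = N $ i $ 1" for i by (simp add: matrix_vector_mult_def sum_3)
  show "N$1$1 = 1" "N$2$1 = 0" "N$3$1 = 0" using c[of 1] c[of 2] c[of 3] unfolding N(2) by simp_all
  have "transpose N *v e1 = transpose N *v (N *v e1)" by (simp only: N(2))
  also have "\<dots> = e1" by (simp add: matrix_vector_mul_assoc rotation_matrix_mult_transpose[OF N(1)] del: transpose_matrix_vector)
  finally have t: "transpose N *v e1 = e1" .
  have c: "(transpose N *v e1) $ i = N $ 1 $ i" for i by (simp add: matrix_vector_mult_def sum_3 transpose_def del: transpose_matrix_vector)
  show "N$1$2 = 0" "N$1$3 = 0" using c[of 2] c[of 3] unfolding t by simp_all
qed

lemma axial_rotation_Gamma:
  assumes "N \<in> axial_rotations"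
  shows "N \<in> Gamma_axi" "chi_axi N = 1"
proof -
  note e = axial_rotation_entries[OF assms]
  have N: "rotation_matrix N" using assms by (auto simp: axial_rotations_def)
  define A :: "real^2^2" where "A = vector [vector [N$2$2, N$2$3], vector [N$3$2, N$3$3]]"
  have A: "A$1$1 = N$2$2" "A$1$2 = N$2$3" "A$2$1 = N$3$2" "A$2$2 = N$3$3" by (simp_all add: A_def)
  have "block_diag 1 A = N"
    using e by (simp add: block_diag_def A vec_eq_iff forall_3)
  moreover have "orthogonal_matrix A"
  proof -
    have "transpose N ** N = mat 1" using N by (rule rotation_matrix_mult_transpose)
    then have "(transpose N ** N) $ i $ j = mat 1 $ i $ j" for i j by simp
    from this[of 2 2] this[of 2 3] this[of 3 2] this[of 3 3] show ?thesis
      unfolding orthogonal_matrix using e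
      by (simp add: matrix_matrix_mult_def transpose_def mat_def sum_3 vec_eq_iff forall_2 sum_2 A)
  qed
  ultimately show "N \<in> Gamma_axi" unfolding Gamma_axi_def by force
  have "det N = 1" using N by (rule rotation_matrix_mult_transpose)
  then show "chi_axi N = 1" using e by (simp add: chi_axi_def det_2 det_3)
qed

text \<open>The statement is pointwise in t and allows an arbitrary matrix as attitude. It therefore
  applies to curves in the ambient space before they are known to stay in phase space; the last
  conclusion is what keeps the attitude orthogonal.\<close>

lemma hamiltonian2_conserved:
  assumes I: "I\<^sub>1 \<noteq> 0" "I\<^sub>2 \<noteq> 0" "I\<^sub>1 + 2 * I\<^sub>2 = 1" and R: "fst (snd (c t)) \<noteq> 0"
    and c: "(c has_vector_derivative ambient (c t) (ham_vf (hamiltonian2 (inertia_axi I\<^sub>1 I\<^sub>2)) (c t))) (at t)"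
  shows "((\<lambda>t. hamiltonian2 (inertia_axi I\<^sub>1 I\<^sub>2) (c t)) has_vector_derivative 0) (at t)" (is ?H)
    and "((\<lambda>t. fst (c t) *v fst (snd (snd (c t)))) has_vector_derivative 0) (at t)" (is ?J)
    and "((\<lambda>t. fst (snd (snd (c t))) \<bullet> fst (snd (snd (c t)))) has_vector_derivative 0) (at t)" (is ?m)
    and "((\<lambda>t. e1 \<bullet> (fst (snd (snd (c t))) - fst (snd (c t)) \<times> snd (snd (snd (c t))))) has_vector_derivative 0) (at t)" (is ?l)
    and "((\<lambda>t. fst (c t) ** transpose (fst (c t))) has_vector_derivative 0) (at t)" (is ?B)
proof -
  obtain B R m P where ct: "c t = (B, R, m, P)" by (cases "c t")
  have R: "R \<noteq> 0" using R ct by simp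
  define \<Omega> where "\<Omega> = body_rate I\<^sub>1 I\<^sub>2 R m P"
  define G where "G = grad_potential (I\<^sub>1 - I\<^sub>2) R"
  have X: "ambient (c t) (ham_vf (hamiltonian2 (inertia_axi I\<^sub>1 I\<^sub>2)) (c t))
     = (B ** hat \<Omega>, P - \<Omega> \<times> R, m \<times> \<Omega>, P \<times> \<Omega> - G)"
    by (simp add: ct ham_vf_hamiltonian2[OF I R] ambient_def \<Omega>_def G_def)
  note c' = c[unfolded X]
  have cB: "((\<lambda>t. fst (c t)) has_vector_derivative B ** hat \<Omega>) (at t)"
    using bounded_linear.has_vector_derivative[OF bounded_linear_fst c'] by simp
  have s: "((\<lambda>t. snd (c t)) has_vector_derivative (P - \<Omega> \<times> R, m \<times> \<Omega>, P \<times> \<Omega> - G)) (at t)"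
    using bounded_linear.has_vector_derivative[OF bounded_linear_snd c'] by simp
  have cR: "((\<lambda>t. fst (snd (c t))) has_vector_derivative P - \<Omega> \<times> R) (at t)"
    using bounded_linear.has_vector_derivative[OF bounded_linear_fst s] by simp
  have s2: "((\<lambda>t. snd (snd (c t))) has_vector_derivative (m \<times> \<Omega>, P \<times> \<Omega> - G)) (at t)"
    using bounded_linear.has_vector_derivative[OF bounded_linear_snd s] by simp
  have cm: "((\<lambda>t. fst (snd (snd (c t)))) has_vector_derivative m \<times> \<Omega>) (at t)"
    using bounded_linear.has_vector_derivative[OF bounded_linear_fst s2] by simp
  have cP: "((\<lambda>t. snd (snd (snd (c t)))) has_vector_derivative P \<times> \<Omega> - G) (at t)"
    using bounded_linear.has_vector_derivative[OF bounded_linear_snd s2] by simp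
  show ?H
  proof -
    have "((\<lambda>t. hamiltonian2 (inertia_axi I\<^sub>1 I\<^sub>2) (c t)) has_derivative
        (\<lambda>h. (\<lambda>(b, r, q, y). \<Omega> \<bullet> (q - r \<times> P - R \<times> y) + P \<bullet> y + G \<bullet> r) (h *\<^sub>R (B ** hat \<Omega>, P - \<Omega> \<times> R, m \<times> \<Omega>, P \<times> \<Omega> - G)))) (at t)"
      using has_derivative_compose[OF c'[unfolded has_vector_derivative_def]
          hamiltonian2_has_derivative[OF I R, where B = B and m = m and P = P, folded ct, folded \<Omega>_def G_def]] .
    moreover have "\<Omega> \<bullet> (m \<times> \<Omega> - (P - \<Omega> \<times> R) \<times> P - R \<times> (P \<times> \<Omega> - G)) + P \<bullet> (P \<times> \<Omega> - G) + G \<bullet> (P - \<Omega> \<times> R) = 0"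
      by (simp add: cross3_simps)
    then have "h * (\<Omega> \<bullet> (m \<times> \<Omega> - (P - \<Omega> \<times> R) \<times> P - R \<times> (P \<times> \<Omega> - G)) + P \<bullet> (P \<times> \<Omega> - G) + G \<bullet> (P - \<Omega> \<times> R)) = 0" for h
      by simp
    then have "(\<lambda>(b, r, q, y). \<Omega> \<bullet> (q - r \<times> P - R \<times> y) + P \<bullet> y + G \<bullet> r) (h *\<^sub>R (B ** hat \<Omega>, P - \<Omega> \<times> R, m \<times> \<Omega>, P \<times> \<Omega> - G)) = 0" for h
      by (simp add: cross_mult_left cross_mult_right ring_distribs flip: scaleR_diff_right)
    ultimately show ?thesis by (simp add: has_vector_derivative_def)
  qed
  show ?J
    using has_vector_derivative_matrix_vector_mult[OF cB cm]
    by (simp add: ct hat_mult cross_skew[of m \<Omega>] matrix_vector_mult_minus flip: matrix_vector_mul_assoc)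
  show ?m
    using bounded_bilinear.has_vector_derivative[OF bounded_bilinear_inner cm cm]
    by (simp add: ct inner_commute[of m] dot_cross_self)
  show ?l
  proof -
    have "((\<lambda>t. fst (snd (snd (c t))) - fst (snd (c t)) \<times> snd (snd (snd (c t)))) has_vector_derivative
        m \<times> \<Omega> - (R \<times> (P \<times> \<Omega> - G) + (P - \<Omega> \<times> R) \<times> P)) (at t)"
      using has_vector_derivative_diff[OF cm has_vector_derivative_cross3[OF cR cP]] by (simp add: ct)
    from bounded_linear.has_vector_derivative[OF bounded_linear_inner_right this, of e1]
    have "((\<lambda>t. e1 \<bullet> (fst (snd (snd (c t))) - fst (snd (c t)) \<times> snd (snd (snd (c t))))) has_vector_derivative
        e1 \<bullet> (m \<times> \<Omega> - (R \<times> (P \<times> \<Omega> - G) + (P - \<Omega> \<times> R) \<times> P))) (at t)" .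
    \<comment> \<open>Axial symmetry: the body rate is a combination of the spin and
      \<open>e1\<close>, and the gradient is a combination of R and \<open>e1\<close>, so both
      torques are orthogonal to \<open>e1\<close>.\<close>
    moreover have "e1 \<bullet> (m \<times> \<Omega> - (R \<times> (P \<times> \<Omega> - G) + (P - \<Omega> \<times> R) \<times> P)) = 0"
    proof -
      define L where "L = m - R \<times> P"
      have "e1 \<bullet> (m \<times> \<Omega> - (R \<times> (P \<times> \<Omega> - G) + (P - \<Omega> \<times> R) \<times> P)) = e1 \<bullet> (L \<times> \<Omega>) + e1 \<bullet> (R \<times> G)"
        by (simp add: L_def cross3_simps)
      moreover have "e1 \<bullet> (L \<times> \<Omega>) = 0"
        unfolding \<Omega>_def body_rate_def L_def[symmetric]
        by (simp add: inertia_axi_mult inner_e1 cross_components algebra_simps)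
      moreover have "e1 \<bullet> (R \<times> G) = 0"
        by (simp add: G_def grad_potential_def inner_e1 cross_components algebra_simps)
      ultimately show ?thesis by simp
    qed
    ultimately show ?thesis by simp
  qed
  show ?B
    using has_vector_derivative_matrix_matrix_mult[OF cB bounded_linear.has_vector_derivative[OF bounded_linear_transpose cB]]
    by (simp add: ct matrix_transpose_mul transpose_hat matrix_mult_minus matrix_mul_assoc)
qed

section \<open>Stability of an orbit that minimises the energy\<close>

text \<open>Only nearby points with exactly the conserved values of the equilibrium enter the
  hypothesis; compactness extends the barrier to nearby values.\<close>

locale orbit_minimum =
  fixes I\<^sub>1 I\<^sub>2 :: real and R\<^sub>0 m\<^sub>0 P\<^sub>0 :: "real^3"
  assumes I: "I\<^sub>1 \<noteq> 0" "I\<^sub>2 \<noteq> 0" "I\<^sub>1 + 2 * I\<^sub>2 = 1" and R0: "R\<^sub>0 \<noteq> 0"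
    and local_min: "\<exists>\<delta>>0. \<forall>R m P. dist (R, m, P) (R\<^sub>0, m\<^sub>0, P\<^sub>0) < \<delta> \<longrightarrow> norm m = norm m\<^sub>0
     \<longrightarrow> e1 \<bullet> (m - R \<times> P) = e1 \<bullet> (m\<^sub>0 - R\<^sub>0 \<times> P\<^sub>0)
     \<longrightarrow> hamiltonian2 (inertia_axi I\<^sub>1 I\<^sub>2) (mat 1, R, m, P) \<le> hamiltonian2 (inertia_axi I\<^sub>1 I\<^sub>2) (mat 1, R\<^sub>0, m\<^sub>0, P\<^sub>0)
     \<longrightarrow> (\<exists>N\<in>axial_rotations. R = N *v R\<^sub>0 \<and> m = N *v m\<^sub>0 \<and> P = N *v P\<^sub>0)"
begin

type_synonym reduced = "(real^3) \<times> (real^3) \<times> (real^3)"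

definition h :: "reduced \<Rightarrow> real" where "h z = hamiltonian2 (inertia_axi I\<^sub>1 I\<^sub>2) (mat 1, z)"
definition l :: "reduced \<Rightarrow> real" where "l = (\<lambda>(R, m, P). e1 \<bullet> (m - R \<times> P))"
definition z\<^sub>0 :: reduced where "z\<^sub>0 = (R\<^sub>0, m\<^sub>0, P\<^sub>0)"
definition rot :: "real^3^3 \<Rightarrow> reduced \<Rightarrow> reduced" where "rot N = (\<lambda>(R, m, P). (N *v R, N *v m, N *v P))"
definition Orb :: "reduced set" where "Orb = (\<lambda>N. rot N z\<^sub>0) ` axial_rotations"

lemma hamiltonian2_h: "hamiltonian2 (inertia_axi I\<^sub>1 I\<^sub>2) x = h (snd x)"
  by (cases x) (simp add: h_def hamiltonian2_axi[OF I(1,2)])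

lemma continuous_rot: "continuous_on UNIV (\<lambda>x. rot (fst x) (snd x))"
  unfolding rot_def case_prod_beta
  by (intro continuous_on_Pair bounded_bilinear.continuous_on[OF bounded_bilinear_matrix_vector_mult] continuous_intros)

lemma compact_Orb: "compact Orb" "closed Orb" "Orb \<noteq> {}"
proof -
  have "continuous_on axial_rotations (\<lambda>N. rot N z\<^sub>0)"
    using continuous_on_compose2[OF continuous_rot, of axial_rotations "\<lambda>N. (N, z\<^sub>0)"]
    by (simp add: continuous_intros)
  then show "compact Orb" unfolding Orb_def by (rule compact_continuous_image[OF _ compact_axial_rotations])
  then show "closed Orb" by (rule compact_imp_closed)
  have "mat 1 \<in> axial_rotations" by (simp add: axial_rotations_def rotation_matrix_def orthogonal_matrix_id)
  then show "Orb \<noteq> {}" by (auto simp: Orb_def)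
qed

lemma rot_isometry:
  assumes "N \<in> axial_rotations"
  shows "dist (rot N x) (rot N y) = dist x y"
proof -
  have N: "rotation_matrix N" using assms by (simp add: axial_rotations_def)
  have "dist (N *v u) (N *v v) = dist u v" for u v
    unfolding dist_norm by (simp add: rotation_matrix_norm[OF N] flip: matrix_vector_mult_diff_distrib)
  then show ?thesis by (cases x; cases y) (simp add: rot_def dist_Pair_Pair)
qed

lemma rot_invariant:
  assumes "N \<in> axial_rotations"
  shows "h (rot N x) = h x" "l (rot N x) = l x" "norm (fst (snd (rot N x))) = norm (fst (snd x))"
    "norm (fst (rot N x)) = norm (fst x)"
proof -
  have N: "rotation_matrix N" "N *v e1 = e1" using assms by (auto simp: axial_rotations_def)
  obtain R m P where x: "x = (R, m, P)" by (cases x)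
  show "h (rot N x) = h x" by (simp add: x h_def rot_def hamiltonian2_equivariant[OF I(1,2) N])
  have "N *v m - (N *v R) \<times> (N *v P) = N *v (m - R \<times> P)"
    by (simp add: cross_rotation_matrix[OF N(1)] matrix_vector_mult_diff_distrib)
  then show "l (rot N x) = l x"
    using rotation_matrix_inner[OF N(1), of e1 "m - R \<times> P"] N(2) by (simp add: x l_def rot_def)
  show "norm (fst (snd (rot N x))) = norm (fst (snd x))" "norm (fst (rot N x)) = norm (fst x)"
    by (simp_all add: x rot_def rotation_matrix_norm[OF N(1)])
qed

lemma rot_inverse:
  assumes "N \<in> axial_rotations"
  shows "transpose N \<in> axial_rotations" "rot (transpose N) (rot N x) = x" "rot N (rot (transpose N) x) = x"
proof -
  have N: "rotation_matrix N" "N *v e1 = e1" using assms by (auto simp: axial_rotations_def)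
  have i: "transpose N *v (N *v v) = v" "N *v (transpose N *v v) = v" for v
    by (simp_all only: matrix_vector_mul_assoc rotation_matrix_mult_transpose[OF N(1)] matrix_vector_mul_lid)
  show "transpose N \<in> axial_rotations"
    using i(1)[of e1] N by (simp add: axial_rotations_def rotation_matrix_transpose del: transpose_matrix_vector)
  show "rot (transpose N) (rot N x) = x" "rot N (rot (transpose N) x) = x"
    using i by (cases x, simp add: rot_def del: transpose_matrix_vector)+
qed

lemma near_orbit:
  assumes "infdist z Orb < d"
  obtains N where "N \<in> axial_rotations" "dist z (rot N z\<^sub>0) < d"
proof -
  obtain x where x: "x \<in> Orb" "infdist z Orb = dist z x"
    using infdist_attains_inf[OF compact_Orb(2,3)] by metis
  then obtain N where "N \<in> axial_rotations" "x = rot N z\<^sub>0" by (auto simp: Orb_def)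
  then show ?thesis using x assms that by simp
qed

text \<open>The width of a tube around the orbit that stays away from collisions and in which the
  orbit is the whole sublevel set of the energy on the level of the other conserved
  quantities.\<close>

definition \<delta> :: real where
  "\<delta> = (SOME d. 0 < d \<and> (\<forall>z. infdist z Orb < d \<longrightarrow> norm (fst z) > norm R\<^sub>0 / 2)
     \<and> (\<forall>z. infdist z Orb < d \<longrightarrow> norm (fst (snd z)) = norm m\<^sub>0 \<longrightarrow> l z = l z\<^sub>0 \<longrightarrow> h z \<le> h z\<^sub>0 \<longrightarrow> z \<in> Orb))"

lemma \<delta>: "0 < \<delta>" "infdist z Orb < \<delta> \<Longrightarrow> norm (fst z) > norm R\<^sub>0 / 2"
  "infdist z Orb < \<delta> \<Longrightarrow> norm (fst (snd z)) = norm m\<^sub>0 \<Longrightarrow> l z = l z\<^sub>0 \<Longrightarrow> h z \<le> h z\<^sub>0 \<Longrightarrow> z \<in> Orb"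
proof -
  obtain d where d: "d > 0" "\<And>R m P. dist (R, m, P) z\<^sub>0 < d \<Longrightarrow> norm m = norm m\<^sub>0 \<Longrightarrow> l (R, m, P) = l z\<^sub>0
     \<Longrightarrow> h (R, m, P) \<le> h z\<^sub>0 \<Longrightarrow> (\<exists>N\<in>axial_rotations. (R, m, P) = rot N z\<^sub>0)"
    using local_min unfolding h_def l_def z\<^sub>0_def rot_def by auto
  define d' where "d' = min d (norm R\<^sub>0 / 2)"
  have "\<exists>d. 0 < d \<and> (\<forall>z. infdist z Orb < d \<longrightarrow> norm (fst z) > norm R\<^sub>0 / 2)
     \<and> (\<forall>z. infdist z Orb < d \<longrightarrow> norm (fst (snd z)) = norm m\<^sub>0 \<longrightarrow> l z = l z\<^sub>0 \<longrightarrow> h z \<le> h z\<^sub>0 \<longrightarrow> z \<in> Orb)"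
  proof (intro exI[of _ d'] conjI allI impI)
    show "0 < d'" using d(1) R0 by (simp add: d'_def)
  next
    fix z assume "infdist z Orb < d'"
    then obtain N where N: "N \<in> axial_rotations" "dist z (rot N z\<^sub>0) < d'" by (rule near_orbit)
    have "norm (fst (rot N z\<^sub>0)) = norm R\<^sub>0" using rot_invariant(4)[OF N(1), of z\<^sub>0] by (simp add: z\<^sub>0_def)
    moreover have "dist (fst z) (fst (rot N z\<^sub>0)) < norm R\<^sub>0 / 2"
      using dist_fst_le[of z "rot N z\<^sub>0"] N(2) by (simp add: d'_def)
    ultimately show "norm (fst z) > norm R\<^sub>0 / 2"
      using norm_triangle_ineq2[of "fst (rot N z\<^sub>0)" "fst z"] by (simp add: dist_norm norm_minus_commute)
  next
    fix z assume "infdist z Orb < d'" and v: "norm (fst (snd z)) = norm m\<^sub>0" "l z = l z\<^sub>0" "h z \<le> h z\<^sub>0"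
    then obtain N where N: "N \<in> axial_rotations" "dist z (rot N z\<^sub>0) < d'" by (meson near_orbit)
    \<comment> \<open>The hypothesis speaks only about a neighbourhood of the equilibrium itself, so
      z is rotated back there by the axial rotation that realises its distance bound.\<close>
    define y where "y = rot (transpose N) z"
    note Nt = rot_inverse[OF N(1)]
    have "dist y z\<^sub>0 = dist z (rot N z\<^sub>0)"
      using rot_isometry[OF N(1), of y z\<^sub>0] Nt(3)[of z] by (simp add: y_def)
    then have "dist y z\<^sub>0 < d" using N(2) by (simp add: d'_def)
    moreover have "norm (fst (snd y)) = norm m\<^sub>0" "l y = l z\<^sub>0" "h y \<le> h z\<^sub>0"
      using v rot_invariant[OF Nt(1), of z] by (simp_all add: y_def)
    ultimately obtain N' where N': "N' \<in> axial_rotations" "y = rot N' z\<^sub>0"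
      using d(2)[of "fst y" "fst (snd y)" "snd (snd y)"] by auto
    have "z = rot N y" using Nt(3) by (simp add: y_def)
    also have "\<dots> = rot (N ** N') z\<^sub>0"
      by (cases "z\<^sub>0") (simp add: N'(2) rot_def matrix_vector_mul_assoc)
    finally show "z \<in> Orb"
      using N(1) N'(1) by (auto simp: Orb_def axial_rotations_def rotation_matrix_mul simp flip: matrix_vector_mul_assoc)
  qed
  from someI_ex[OF this, folded \<delta>_def]
  show "0 < \<delta>" "infdist z Orb < \<delta> \<Longrightarrow> norm (fst z) > norm R\<^sub>0 / 2"
    "infdist z Orb < \<delta> \<Longrightarrow> norm (fst (snd z)) = norm m\<^sub>0 \<Longrightarrow> l z = l z\<^sub>0 \<Longrightarrow> h z \<le> h z\<^sub>0 \<Longrightarrow> z \<in> Orb"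
    by blast+
qed

lemma continuous_h: "continuous_on {z. fst z \<noteq> 0} h"
proof (intro continuous_at_imp_continuous_on ballI)
  fix z :: reduced assume z: "z \<in> {z. fst z \<noteq> 0}"
  obtain R m P where ze: "z = (R, m, P)" by (cases z)
  have R: "R \<noteq> 0" using z ze by simp
  have c: "isCont (hamiltonian2 (inertia_axi I\<^sub>1 I\<^sub>2)) (mat 1, z)"
    unfolding ze by (rule has_derivative_continuous[OF hamiltonian2_has_derivative[OF I R]])
  have "isCont (\<lambda>z. hamiltonian2 (inertia_axi I\<^sub>1 I\<^sub>2) ((mat 1, z) :: phase)) z"
    by (rule isCont_o2[where f = "\<lambda>z. (mat 1, z)", OF _ c]) (intro continuous_intros)
  then show "isCont h z" unfolding h_def[abs_def] .
qed

lemma continuous_l: "continuous_on UNIV l"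
  unfolding l_def case_prod_beta
  by (intro continuous_intros bounded_bilinear.continuous_on[OF bounded_bilinear_cross3])

text \<open>The barrier: on the boundary of a tube around the orbit the conserved quantities stay away
  from their values at the equilibrium.\<close>

lemma barrier:
  assumes d: "0 < d" "d < \<delta>"
  shows "\<exists>\<eta>>0. \<forall>z. infdist z Orb = d \<longrightarrow> \<not> (\<bar>norm (fst (snd z)) - norm m\<^sub>0\<bar> < \<eta> \<and> \<bar>l z - l z\<^sub>0\<bar> < \<eta> \<and> h z < h z\<^sub>0 + \<eta>)"
proof -
  define K where "K = {z. infdist z Orb = d}"
  \<comment> \<open>Largest violation of the conserved values, one-sided in the energy. It is
    positive on the boundary of the tube, and by compactness its minimum there is the barrier
    height.\<close>
  define b where "b z = max \<bar>norm (fst (snd z)) - norm m\<^sub>0\<bar> (max \<bar>l z - l z\<^sub>0\<bar> (h z - h z\<^sub>0))" for z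
  have "closed K"
    unfolding K_def using continuous_closed_preimage_constant[of UNIV "\<lambda>z. infdist z Orb" d]
    by (simp add: continuous_on_infdist continuous_on_id)
  moreover have "bounded K"
  proof -
    obtain C where C: "\<And>x. x \<in> Orb \<Longrightarrow> norm x \<le> C" using compact_imp_bounded[OF compact_Orb(1)] by (auto simp: bounded_iff)
    have "norm z \<le> C + d" if "z \<in> K" for z
    proof -
      obtain x where "x \<in> Orb" "infdist z Orb = dist z x" using infdist_attains_inf[OF compact_Orb(2,3)] by metis
      then show ?thesis using C[of x] that norm_triangle_sub[of z x] by (simp add: K_def dist_norm)
    qed
    then show ?thesis by (rule boundedI)
  qed
  ultimately have K: "compact K" by (simp add: compact_eq_bounded_closed)
  have KR: "K \<subseteq> {z. fst z \<noteq> 0}" using \<delta>(2) d R0 by (force simp: K_def)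
  have cb: "continuous_on K b"
    unfolding b_def by (intro continuous_intros continuous_on_subset[OF continuous_h KR] continuous_on_subset[OF continuous_l]) auto
  have pos: "b z > 0" if "z \<in> K" for z
  proof (rule ccontr)
    assume "\<not> b z > 0"
    then have "norm (fst (snd z)) = norm m\<^sub>0" "l z = l z\<^sub>0" "h z \<le> h z\<^sub>0" by (auto simp: b_def max_def split: if_splits)
    then have "z \<in> Orb" using \<delta>(3)[of z] that d by (simp add: K_def)
    then show False using that d by (simp add: K_def)
  qed
  show ?thesis
  proof (cases "K = {}")
    case True
    then show ?thesis by (intro exI[of _ 1]) (auto simp: K_def)
  next
    case False
    then obtain y where y: "y \<in> K" "\<And>z. z \<in> K \<Longrightarrow> b y \<le> b z"
      using continuous_attains_inf[OF K _ cb] by auto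
    have "\<not> (\<bar>norm (fst (snd z)) - norm m\<^sub>0\<bar> < b y \<and> \<bar>l z - l z\<^sub>0\<bar> < b y \<and> h z < h z\<^sub>0 + b y)"
      if "infdist z Orb = d" for z
    proof
      assume "\<bar>norm (fst (snd z)) - norm m\<^sub>0\<bar> < b y \<and> \<bar>l z - l z\<^sub>0\<bar> < b y \<and> h z < h z\<^sub>0 + b y"
      then have "b z < b y" unfolding b_def[of z] by simp
      with y(2)[of z] that show False by (simp add: K_def)
    qed
    then show ?thesis using pos[OF y(1)] by blast
  qed
qed

text \<open>A continuity argument on the connected line. The differential equation is assumed only
  inside the tube and for attitudes of norm below 4, so the lemma serves both true evolutions and
  solutions of the cut-off field.\<close>

lemma confined:
  assumes d: "0 < d" "d < \<delta>"
    and \<eta>: "\<And>z. infdist z Orb = d \<Longrightarrow> \<not> (\<bar>norm (fst (snd z)) - norm m\<^sub>0\<bar> < \<eta> \<and> \<bar>l z - l z\<^sub>0\<bar> < \<eta> \<and> h z < h z\<^sub>0 + \<eta>)"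
    and cont: "continuous_on UNIV c"
    and ode: "\<And>t. infdist (snd (c t)) Orb < d \<Longrightarrow> norm (fst (c t)) < 4 \<Longrightarrow>
       (c has_vector_derivative ambient (c t) (ham_vf (hamiltonian2 (inertia_axi I\<^sub>1 I\<^sub>2)) (c t))) (at t)"
    and init: "rotation_matrix (fst (c 0))" "infdist (snd (c 0)) Orb < d"
      "\<bar>norm (fst (snd (snd (c 0)))) - norm m\<^sub>0\<bar> < \<eta>" "\<bar>l (snd (c 0)) - l z\<^sub>0\<bar> < \<eta>" "h (snd (c 0)) < h z\<^sub>0 + \<eta>"
  shows "infdist (snd (c t)) Orb < d \<and> rotation_matrix (fst (c t))
     \<and> fst (c t) *v fst (snd (snd (c t))) = fst (c 0) *v fst (snd (snd (c 0)))"
proof -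
  define q where "q t = (h (snd (c t)), fst (snd (snd (c t))) \<bullet> fst (snd (snd (c t))), l (snd (c t)),
      fst (c t) *v fst (snd (snd (c t))))" for t
  \<comment> \<open>The weak inequality makes this set closed. The barrier sharpens it to a strict
    one at every time in the set, and then the conservation laws show that the set is open.\<close>
  define T where "T = {t. infdist (snd (c t)) Orb \<le> d \<and> q t = q 0 \<and> fst (c t) ** transpose (fst (c t)) = mat 1}"
  have inT: "infdist (snd (c t)) Orb < d \<and> norm (fst (c t)) < 4" if "t \<in> T" for t
  proof -
    have "norm (fst (snd (snd (c t)))) = norm (fst (snd (snd (c 0))))"
      using that by (simp add: T_def q_def norm_eq_sqrt_inner)
    then have "infdist (snd (c t)) Orb \<noteq> d"
      using \<eta>[of "snd (c t)"] that init by (auto simp: T_def q_def)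
    moreover have "norm (fst (c t)) \<le> 3"
      using that matrix_left_right_inverse by (intro rotation_matrix_norm_le) (auto simp: T_def)
    ultimately show ?thesis using that by (auto simp: T_def)
  qed
  have ci: "continuous_on UNIV (\<lambda>t. infdist (snd (c t)) Orb)"
    by (intro continuous_on_infdist continuous_on_snd cont)
  have "open T"
  proof (rule openI)
    fix t0 assume t0: "t0 \<in> T"
    \<comment> \<open>On this open set of times the differential equation is available; it contains
      a neighbourhood of t0 because orthogonal matrices have norm at most 3.\<close>
    have "open {t. infdist (snd (c t)) Orb < d \<and> norm (fst (c t)) < 4}"
      by (intro open_Collect_conj open_Collect_less ci continuous_intros continuous_on_norm cont)
    then obtain e where e: "e > 0" "\<And>t. t \<in> ball t0 e \<Longrightarrow> infdist (snd (c t)) Orb < d \<and> norm (fst (c t)) < 4"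
      using inT[OF t0] unfolding open_contains_ball by blast
    have R: "fst (snd (c t)) \<noteq> 0" if "t \<in> ball t0 e" for t
      using \<delta>(2)[of "snd (c t)"] e(2)[OF that] d R0 by auto
    have ode': "(c has_vector_derivative ambient (c t) (ham_vf (hamiltonian2 (inertia_axi I\<^sub>1 I\<^sub>2)) (c t))) (at t)"
      if "t \<in> ball t0 e" for t using e(2)[OF that] ode by blast
    note cons = hamiltonian2_conserved[OF I R ode']
    have const: "f t = f t0" if f: "\<And>t. t \<in> ball t0 e \<Longrightarrow> (f has_vector_derivative 0) (at t)" and t: "t \<in> ball t0 e"
      for f :: "real \<Rightarrow> 'b::real_normed_vector" and t
    proof -
      have "(f has_vector_derivative 0) (at x within ball t0 e)" if "x \<in> ball t0 e" for x
        using f[OF that] by (rule has_vector_derivative_at_within)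
      then obtain C where "\<And>x. x \<in> ball t0 e \<Longrightarrow> f x = C"
        using has_vector_derivative_zero_constant[OF convex_ball] by blast
      then show ?thesis using t e(1) by simp
    qed
    have "t \<in> T" if t: "t \<in> ball t0 e" for t
    proof -
      have "h (snd (c t)) = h (snd (c t0))"
        by (rule const[OF _ t]) (use cons(1) in \<open>simp add: hamiltonian2_h\<close>)
      moreover have "fst (c t) *v fst (snd (snd (c t))) = fst (c t0) *v fst (snd (snd (c t0)))"
        by (rule const[OF cons(2) t])
      moreover have "fst (snd (snd (c t))) \<bullet> fst (snd (snd (c t))) = fst (snd (snd (c t0))) \<bullet> fst (snd (snd (c t0)))"
        by (rule const[OF cons(3) t])
      moreover have "l (snd (c t)) = l (snd (c t0))"
        using const[OF cons(4) t] by (simp add: l_def case_prod_beta)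
      moreover have "fst (c t) ** transpose (fst (c t)) = mat 1"
        using const[OF cons(5) t] t0 by (simp add: T_def)
      ultimately show ?thesis using t0 e(2)[OF t] by (simp add: T_def q_def)
    qed
    then show "\<exists>e>0. ball t0 e \<subseteq> T" using e(1) by blast
  qed
  moreover have "closed T"
  proof -
    define F where "F = {t. infdist (snd (c t)) Orb \<le> d}"
    have F: "closed F" unfolding F_def by (intro closed_Collect_le ci continuous_intros)
    have hF: "continuous_on F (\<lambda>t. h (snd (c t)))"
    proof (rule continuous_on_compose2[OF continuous_h])
      show "continuous_on F (\<lambda>t. snd (c t))" using cont by (intro continuous_intros) (auto intro: continuous_on_subset)
      show "(\<lambda>t. snd (c t)) ` F \<subseteq> {z. fst z \<noteq> 0}"
      proof (rule image_subsetI, rule CollectI)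
        fix t assume "t \<in> F"
        then show "fst (snd (c t)) \<noteq> 0" using \<delta>(2)[of "snd (c t)"] d R0 by (auto simp: F_def)
      qed
    qed
    have cF: "continuous_on F c" using cont by (rule continuous_on_subset) simp
    have "continuous_on F q"
      unfolding q_def
      by (intro continuous_on_Pair hF bounded_bilinear.continuous_on[OF bounded_bilinear_inner]
          bounded_bilinear.continuous_on[OF bounded_bilinear_matrix_vector_mult]
          continuous_on_compose2[OF continuous_l, of F] continuous_on_fst continuous_on_snd cF) auto
    then have "closed {t \<in> F. q t = q 0}" by (rule continuous_closed_preimage_constant[OF _ F])
    moreover have "continuous_on F (\<lambda>t. fst (c t) ** transpose (fst (c t)))"
      by (intro bounded_bilinear.continuous_on[OF bounded_bilinear_matrix_matrix_mult]
          bounded_linear.continuous_on[OF bounded_linear_transpose] continuous_on_fst cF)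
    then have "closed {t \<in> F. fst (c t) ** transpose (fst (c t)) = mat 1}"
      by (rule continuous_closed_preimage_constant[OF _ F])
    moreover have "T = {t \<in> F. q t = q 0} \<inter> {t \<in> F. fst (c t) ** transpose (fst (c t)) = mat 1}"
      by (auto simp: T_def F_def)
    ultimately show ?thesis by auto
  qed
  moreover have "0 \<in> T" using init(1,2) by (simp add: T_def rotation_matrix_mult_transpose)
  ultimately have T: "T = UNIV" using clopen[of T] by auto
  have o: "orthogonal_matrix (fst (c t))" for t
    using T matrix_left_right_inverse[of "fst (c t)"] by (auto simp: T_def orthogonal_matrix_def)
  have "rotation_matrix (fst (c t))"
    by (rule rotation_matrix_connected) (use cont init(1) o in \<open>auto intro: continuous_intros simp: rotation_matrix_def\<close>)
  then show ?thesis using inT[of t] T by (auto simp: T_def q_def)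
qed

text \<open>Closeness to the orbit in the reduced variables together with closeness of the spatial
  angular momentum is closeness to the stabilizer orbit. Otherwise a sequence of counterexamples
  would, by compactness of the attitudes and of the axial rotations, converge to a point whose
  spatial angular momentum is that of the equilibrium, and this point lies on the stabilizer
  orbit.\<close>

lemma near_stabilizer_orbit:
  assumes U: "neighborhood ((\<lambda>g. act_T g (mat 1, z\<^sub>0)) ` stabilizer (momentum (mat 1, z\<^sub>0))) U"
  shows "\<exists>e>0. \<forall>x\<in>phase_space. infdist (snd x) Orb < e \<longrightarrow> dist (fst x *v fst (snd (snd x))) m\<^sub>0 < e \<longrightarrow> x \<in> U"
proof (rule ccontr)
  assume "\<not> ?thesis"
  then have bad: "\<And>e. e > 0 \<Longrightarrow> \<exists>x\<in>phase_space. infdist (snd x) Orb < e \<and> dist (fst x *v fst (snd (snd x))) m\<^sub>0 < e \<and> x \<notin> U"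
    by blast
  have "\<exists>x N. x \<in> phase_space \<and> dist (fst x *v fst (snd (snd x))) m\<^sub>0 < 1 / real (Suc n) \<and> x \<notin> U
      \<and> N \<in> axial_rotations \<and> dist (snd x) (rot N z\<^sub>0) < 1 / real (Suc n)" for n
  proof -
    obtain x where x: "x \<in> phase_space" "infdist (snd x) Orb < 1 / real (Suc n)"
      "dist (fst x *v fst (snd (snd x))) m\<^sub>0 < 1 / real (Suc n)" "x \<notin> U"
      using bad[of "1 / real (Suc n)"] by auto
    obtain N where "N \<in> axial_rotations" "dist (snd x) (rot N z\<^sub>0) < 1 / real (Suc n)"
      using near_orbit[OF x(2)] .
    with x show ?thesis by blast
  qed
  then obtain x N where xN: "\<And>n. x n \<in> phase_space" "\<And>n. dist (fst (x n) *v fst (snd (snd (x n)))) m\<^sub>0 < 1 / real (Suc n)"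
    "\<And>n. x n \<notin> U" "\<And>n. N n \<in> axial_rotations" "\<And>n. dist (snd (x n)) (rot (N n) z\<^sub>0) < 1 / real (Suc n)"
    by metis
  have "(fst (x n), N n) \<in> Sigma {B. rotation_matrix B} (\<lambda>_. axial_rotations)" for n
    using xN(1,4)[of n] by (cases "x n") (auto simp: phase_space_def config_space_def)
  then obtain p r where p: "p \<in> Sigma {B. rotation_matrix B} (\<lambda>_. axial_rotations)" "strict_mono r"
    "(\<lambda>n. (fst (x (r n)), N (r n))) \<longlonglongrightarrow> p"
    using compact_Times[OF compact_rotation_matrix compact_axial_rotations, unfolded compact_def, rule_format,
        of "\<lambda>n. (fst (x n), N n)"] by (auto simp: o_def)
  obtain B M where BM: "p = (B, M)" by (cases p)
  have B: "rotation_matrix B" and M: "M \<in> axial_rotations" using p(1) BM by auto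
  have Mr: "rotation_matrix M" using M by (simp add: axial_rotations_def)
  have lB: "(\<lambda>n. fst (x (r n))) \<longlonglongrightarrow> B" and lN: "(\<lambda>n. N (r n)) \<longlonglongrightarrow> M"
    using tendsto_fst[OF p(3)] tendsto_snd[OF p(3)] by (simp_all add: BM)
  have inv0: "(\<lambda>n. 1 / real (Suc (r n))) \<longlonglongrightarrow> 0"
    using LIMSEQ_subseq_LIMSEQ[OF LIMSEQ_inverse_real_of_nat p(2)] by (simp add: o_def inverse_eq_divide)
  have lrot: "(\<lambda>n. rot (N (r n)) z\<^sub>0) \<longlonglongrightarrow> rot M z\<^sub>0"
    unfolding rot_def z\<^sub>0_def prod.case
    by (intro tendsto_Pair bounded_bilinear.tendsto[OF bounded_bilinear_matrix_vector_mult] lN tendsto_const)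
  have "(\<lambda>n. dist (snd (x (r n))) (rot (N (r n)) z\<^sub>0)) \<longlonglongrightarrow> 0"
    by (rule tendsto_sandwich[OF _ _ tendsto_const inv0]) (use xN(5) in \<open>auto intro!: always_eventually less_imp_le\<close>)
  then have "(\<lambda>n. snd (x (r n)) - rot (N (r n)) z\<^sub>0) \<longlonglongrightarrow> 0"
    unfolding dist_norm by (rule tendsto_norm_zero_cancel)
  with lrot have lz: "(\<lambda>n. snd (x (r n))) \<longlonglongrightarrow> rot M z\<^sub>0" by (rule Lim_transform)
  have lm: "(\<lambda>n. fst (x (r n)) *v fst (snd (snd (x (r n))))) \<longlonglongrightarrow> B *v fst (snd (rot M z\<^sub>0))"
    by (intro bounded_bilinear.tendsto[OF bounded_bilinear_matrix_vector_mult] lB tendsto_fst tendsto_snd lz)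
  have "(\<lambda>n. dist (fst (x (r n)) *v fst (snd (snd (x (r n))))) m\<^sub>0) \<longlonglongrightarrow> 0"
    by (rule tendsto_sandwich[OF _ _ tendsto_const inv0]) (use xN(2) in \<open>auto intro!: always_eventually less_imp_le\<close>)
  then have "(\<lambda>n. fst (x (r n)) *v fst (snd (snd (x (r n))))) \<longlonglongrightarrow> m\<^sub>0" by (rule tendsto_dist_iff[THEN iffD2])
  with lm have "B *v fst (snd (rot M z\<^sub>0)) = m\<^sub>0" by (rule LIMSEQ_unique)
  then have BMm: "(B ** M) *v m\<^sub>0 = m\<^sub>0" by (simp add: rot_def z\<^sub>0_def matrix_vector_mul_assoc)
  \<comment> \<open>The action multiplies the attitude by \<open>transpose M\<close> on the right;
    the factor \<open>B ** M\<close> on the left compensates, so that g sends the identity attitude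
    to B.\<close>
  define g where "g = (B ** M, M)"
  have "g \<in> stabilizer (momentum (mat 1, z\<^sub>0))"
    using axial_rotation_Gamma[OF M] BMm B Mr
    by (simp add: g_def stabilizer_def G_axi_def coadjoint_def momentum_def z\<^sub>0_def rotation_matrix_mul)
  moreover have "act_T g (mat 1, z\<^sub>0) = (B, rot M z\<^sub>0)"
    using rotation_matrix_mult_transpose[OF Mr]
    by (simp add: g_def act_T_def z\<^sub>0_def rot_def flip: matrix_mul_assoc)
  ultimately have "(B, rot M z\<^sub>0) \<in> (\<lambda>g. act_T g (mat 1, z\<^sub>0)) ` stabilizer (momentum (mat 1, z\<^sub>0))" by force
  moreover obtain W where W: "openin (top_of_set phase_space) W" "(\<lambda>g. act_T g (mat 1, z\<^sub>0)) ` stabilizer (momentum (mat 1, z\<^sub>0)) \<subseteq> W" "W \<subseteq> U"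
    using U unfolding neighborhood_def by blast
  moreover obtain V where V: "open V" "W = phase_space \<inter> V" using W(1) by (auto simp: openin_open)
  ultimately have "(B, rot M z\<^sub>0) \<in> V" by blast
  moreover have "(\<lambda>n. x (r n)) \<longlonglongrightarrow> (B, rot M z\<^sub>0)"
    using tendsto_Pair[OF lB lz] by simp
  ultimately have "\<forall>\<^sub>F n in sequentially. x (r n) \<in> V" using V(1) by (simp add: topological_tendstoD)
  then obtain n where "x (r n) \<in> V" by (auto simp: eventually_sequentially)
  then show False using xN(1,3) V(2) W(3) by blast
qed

theorem orbit_minimum_stable: "Gmu_stable (inertia_axi I\<^sub>1 I\<^sub>2) (mat 1, R\<^sub>0, m\<^sub>0, P\<^sub>0)"
  unfolding Gmu_stable_def z\<^sub>0_def[symmetric]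
proof (intro allI impI, elim conjE)
  fix U assume "neighborhood ((\<lambda>g. act_T g (mat 1, z\<^sub>0)) ` stabilizer (momentum (mat 1, z\<^sub>0))) U"
  from near_stabilizer_orbit[OF this] obtain e where e: "e > 0"
    "\<And>x. x \<in> phase_space \<Longrightarrow> infdist (snd x) Orb < e \<Longrightarrow> dist (fst x *v fst (snd (snd x))) m\<^sub>0 < e \<Longrightarrow> x \<in> U" by blast
  \<comment> \<open>The tube has to fit into the given neighbourhood U and to be narrow enough for
    the barrier.\<close>
  define d where "d = min e \<delta> / 2"
  have d: "0 < d" "d < \<delta>" "d < e" using e(1) \<delta>(1) by (auto simp: d_def)
  obtain \<eta> where \<eta>: "\<eta> > 0"
    "\<And>z. infdist z Orb = d \<Longrightarrow> \<not> (\<bar>norm (fst (snd z)) - norm m\<^sub>0\<bar> < \<eta> \<and> \<bar>l z - l z\<^sub>0\<bar> < \<eta> \<and> h z < h z\<^sub>0 + \<eta>)"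
    using barrier[OF d(1,2)] by blast
  define N where "N = {x \<in> phase_space. infdist (snd x) Orb < d \<and> \<bar>norm (fst (snd (snd x))) - norm m\<^sub>0\<bar> < \<eta>
     \<and> \<bar>l (snd x) - l z\<^sub>0\<bar> < \<eta> \<and> h (snd x) < h z\<^sub>0 + \<eta> \<and> dist (fst x *v fst (snd (snd x))) m\<^sub>0 < e}"
  have id: "mat 1 \<in> axial_rotations" by (simp add: axial_rotations_def rotation_matrix_def orthogonal_matrix_id)
  have z0: "z\<^sub>0 \<in> Orb"
    unfolding Orb_def by (rule image_eqI[OF _ id]) (simp add: rot_def z\<^sub>0_def)
  have pN: "(mat 1, z\<^sub>0) \<in> N"
    using z0 d(1) \<eta>(1) e(1) R0
    by (simp add: N_def phase_space_def config_space_def z\<^sub>0_def rotation_matrix_def orthogonal_matrix_id)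
  have conf: "infdist (snd (c t)) Orb < d \<and> rotation_matrix (fst (c t))
     \<and> fst (c t) *v fst (snd (snd (c t))) = fst (c 0) *v fst (snd (snd (c 0)))"
    if "c 0 \<in> N" "continuous_on UNIV c" "\<And>t. infdist (snd (c t)) Orb < d \<Longrightarrow> norm (fst (c t)) < 4 \<Longrightarrow>
       (c has_vector_derivative ambient (c t) (ham_vf (hamiltonian2 (inertia_axi I\<^sub>1 I\<^sub>2)) (c t))) (at t)" for c t
    using confined[OF d(1,2) \<eta>(2) that(2,3), of t] that(1)
    by (cases "c 0") (auto simp: N_def phase_space_def config_space_def)
  have ph: "c t \<in> phase_space" if "infdist (snd (c t)) Orb < d" "rotation_matrix (fst (c t))" for c :: "real \<Rightarrow> phase" and t
    using \<delta>(2)[of "snd (c t)"] that d R0 by (cases "c t") (auto simp: phase_space_def config_space_def)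
  show "\<exists>N. neighborhood {(mat 1, z\<^sub>0)} N \<and> (\<forall>x\<in>N. (\<exists>c. evolution (inertia_axi I\<^sub>1 I\<^sub>2) x c)
     \<and> (\<forall>c. evolution (inertia_axi I\<^sub>1 I\<^sub>2) x c \<longrightarrow> (\<forall>t. c t \<in> U)))"
  proof (intro exI[of _ N] conjI ballI allI impI)
    have cont: "continuous_on phase_space (\<lambda>x. infdist (snd x) Orb)"
      "continuous_on phase_space (\<lambda>x. \<bar>norm (fst (snd (snd x))) - norm m\<^sub>0\<bar>)"
      "continuous_on phase_space (\<lambda>x. \<bar>l (snd x) - l z\<^sub>0\<bar>)"
      "continuous_on phase_space (\<lambda>x. h (snd x))"
      "continuous_on phase_space (\<lambda>x. dist (fst x *v fst (snd (snd x))) m\<^sub>0)"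
      by (intro continuous_on_infdist continuous_intros continuous_on_compose2[OF continuous_l, of phase_space]
          continuous_on_compose2[OF continuous_h, of phase_space]
          bounded_bilinear.continuous_on[OF bounded_bilinear_matrix_vector_mult];
          force simp: phase_space_def config_space_def)+
    have op: "openin (top_of_set phase_space) {x \<in> phase_space. f x < b}" if "continuous_on phase_space f"
      for f :: "phase \<Rightarrow> real" and b
      using continuous_openin_preimage_gen[OF that open_lessThan[of b]] by (simp add: vimage_def Int_def)
    have "N = {x \<in> phase_space. infdist (snd x) Orb < d} \<inter> {x \<in> phase_space. \<bar>norm (fst (snd (snd x))) - norm m\<^sub>0\<bar> < \<eta>}
       \<inter> {x \<in> phase_space. \<bar>l (snd x) - l z\<^sub>0\<bar> < \<eta>} \<inter> {x \<in> phase_space. h (snd x) < h z\<^sub>0 + \<eta>}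
       \<inter> {x \<in> phase_space. dist (fst x *v fst (snd (snd x))) m\<^sub>0 < e}"
      by (auto simp: N_def)
    then have "openin (top_of_set phase_space) N" by (simp only:) (intro openin_Int op cont)
    then show "neighborhood {(mat 1, z\<^sub>0)} N" using pN by (auto simp: neighborhood_def N_def)
  next
    fix x assume x: "x \<in> N"
    obtain C where C: "\<And>z. z \<in> Orb \<Longrightarrow> norm z \<le> C" using compact_imp_bounded[OF compact_Orb(1)] by (auto simp: bounded_iff)
    \<comment> \<open>Clipping at K leaves the whole tube and all attitudes of norm below 4
      unchanged.\<close>
    define K where "K = max 4 (C + d)"
    have K: "norm (fst z) \<le> K" "norm (fst (snd z)) \<le> K" "norm (snd (snd z)) \<le> K" if z: "infdist z Orb < d" for z
    proof -
      obtain y where "y \<in> Orb" "infdist z Orb = dist z y" using infdist_attains_inf[OF compact_Orb(2,3)] by metis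
      then have "norm z \<le> K" using C[of y] z norm_triangle_sub[of z y] by (simp add: K_def dist_norm)
      then show "norm (fst z) \<le> K" "norm (fst (snd z)) \<le> K" "norm (snd (snd z)) \<le> K"
        using norm_fst_le[of "fst z" "snd z"] norm_snd_le[of "snd z" "fst z"]
          norm_fst_le[of "fst (snd z)" "snd (snd z)"] norm_snd_le[of "snd (snd z)" "fst (snd z)"] by simp_all
    qed
    have K0: "K \<ge> 0" by (simp add: K_def)
    have r0: "norm R\<^sub>0 / 2 > 0" using R0 by simp
    obtain F :: "phase \<Rightarrow> phase" where F: "bounded_lipschitz F"
      "\<And>B R m P. norm B \<le> K \<Longrightarrow> norm R \<le> K \<Longrightarrow> norm m \<le> K \<Longrightarrow> norm P \<le> K \<Longrightarrow> norm R\<^sub>0 / 2 \<le> norm R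
       \<Longrightarrow> F (B, R, m, P) = ambient (B, R, m, P) (ham_vf (hamiltonian2 (inertia_axi I\<^sub>1 I\<^sub>2)) (B, R, m, P))"
      using cutoff_field_exists[OF I K0 r0] by blast
    obtain c where c: "c 0 = x" "\<And>t. (c has_vector_derivative F (c t)) (at t)"
      using global_flow_bounded_lipschitz[OF F(1)] by blast
    have cc: "continuous_on UNIV c"
      using c(2) has_vector_derivative_continuous continuous_at_imp_continuous_on by blast
    have FH: "F y = ambient y (ham_vf (hamiltonian2 (inertia_axi I\<^sub>1 I\<^sub>2)) y)"
      if "infdist (snd y) Orb < d" "norm (fst y) < 4" for y
    proof -
      obtain B R m P where y: "y = (B, R, m, P)" by (cases y)
      have "norm R > norm R\<^sub>0 / 2" using \<delta>(2)[of "snd y"] that d by (simp add: y)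
      then show ?thesis using F(2)[of B R m P] K[OF that(1)] that(2) by (simp add: y K_def)
    qed
    \<comment> \<open>The cut-off solution never leaves the region where the two fields agree, so it
      is a true evolution, defined for all time.\<close>
    have cf: "infdist (snd (c t)) Orb < d \<and> rotation_matrix (fst (c t))" for t
      using conf[of c t] c(1) x cc c(2) FH by metis
    have "integral_curve (ham_vf (hamiltonian2 (inertia_axi I\<^sub>1 I\<^sub>2))) c"
      unfolding integral_curve_def
    proof (intro allI conjI)
      fix t
      show "c t \<in> phase_space" using ph cf by blast
      have "norm (fst (c t)) \<le> 3" using cf by (intro rotation_matrix_norm_le rotation_matrix_mult_transpose) auto
      then show "(c has_vector_derivative ambient (c t) (ham_vf (hamiltonian2 (inertia_axi I\<^sub>1 I\<^sub>2)) (c t))) (at t)"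
        using FH[of "c t"] cf[of t] c(2)[of t] by simp
    qed
    then show "\<exists>c. evolution (inertia_axi I\<^sub>1 I\<^sub>2) x c" using c(1) by (auto simp: evolution_def)
  next
    fix x c t assume x: "x \<in> N" and ev: "evolution (inertia_axi I\<^sub>1 I\<^sub>2) x c"
    have D: "(c has_vector_derivative ambient (c t) (ham_vf (hamiltonian2 (inertia_axi I\<^sub>1 I\<^sub>2)) (c t))) (at t)"
      and p: "c t \<in> phase_space" and c0: "c 0 = x" for t
      using ev by (auto simp: evolution_def integral_curve_def)
    have cc: "continuous_on UNIV c"
      using D has_vector_derivative_continuous continuous_at_imp_continuous_on by blast
    have "infdist (snd (c t)) Orb < d \<and> fst (c t) *v fst (snd (snd (c t))) = fst x *v fst (snd (snd x))"
      using conf[of c t] x c0 cc D by blast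
    then show "c t \<in> U" using e(2)[OF p] x d(3) by (auto simp: N_def)
  qed
qed

end

section \<open>Instability for oblate bodies\<close>

text \<open>Uniform continuity on the compact rectangle makes one bound on e work for all k at
  once.\<close>

lemma positive_near_compact_edge:
  fixes f :: "real \<times> real \<Rightarrow> real"
  assumes cont: "continuous_on (Sigma {0..ebd} (\<lambda>_. {k1..k2})) f" and ebd: "ebd > 0" and k: "k1 \<le> k2"
    and pos: "\<And>k. k1 \<le> k \<Longrightarrow> k \<le> k2 \<Longrightarrow> f (0, k) > 0"
  shows "\<exists>e2>0. e2 \<le> ebd \<and> (\<forall>e k. 0 \<le> e \<longrightarrow> e \<le> e2 \<longrightarrow> k1 \<le> k \<longrightarrow> k \<le> k2 \<longrightarrow> f (e, k) > 0)"
proof -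
  let ?D = "Sigma {0..ebd} (\<lambda>_. {k1..k2})"
  have cD: "compact ?D" by (intro compact_Times) auto
  have "continuous_on {k1..k2} (\<lambda>k. f (0, k))"
    by (rule continuous_on_compose2[OF cont]) (use ebd in \<open>auto intro!: continuous_intros\<close>)
  then obtain k0 where k0: "k0 \<in> {k1..k2}" "\<And>k. k \<in> {k1..k2} \<Longrightarrow> f (0, k0) \<le> f (0, k)"
    using continuous_attains_inf[of "{k1..k2}" "\<lambda>k. f (0, k)"] k by auto
  have m: "f (0, k0) > 0" using pos k0(1) by auto
  have "uniformly_continuous_on ?D f" by (rule compact_uniformly_continuous[OF cont cD])
  then obtain d where d: "d > 0" "\<And>x x'. x \<in> ?D \<Longrightarrow> x' \<in> ?D \<Longrightarrow> dist x' x < d \<Longrightarrow> dist (f x') (f x) < f (0, k0)"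
    using m unfolding uniformly_continuous_on_def by meson
  show ?thesis
  proof (intro exI[of _ "min ebd (d / 2)"] conjI allI impI)
    fix e k :: real
    assume e: "0 \<le> e" "e \<le> min ebd (d / 2)" and k: "k1 \<le> k" "k \<le> k2"
    have "dist (e, k) (0, k) < d" using e d(1) by (simp add: dist_Pair_Pair dist_norm)
    then have "dist (f (e, k)) (f (0, k)) < f (0, k0)" using d(2)[of "(0, k)" "(e, k)"] e ebd k by auto
    then show "f (e, k) > 0" using k0(2)[of k] k by (auto simp: dist_real_def)
  qed (use ebd d in auto)
qed

lemma cross3_cramer:
  fixes r1 r2 r3 :: "real^3" and b1 b2 b3 :: real
  defines "D \<equiv> r1 \<bullet> (r2 \<times> r3)"
  assumes "D \<noteq> 0"
  defines "u \<equiv> (1 / D) *\<^sub>R (b1 *\<^sub>R (r2 \<times> r3) + b2 *\<^sub>R (r3 \<times> r1) + b3 *\<^sub>R (r1 \<times> r2))"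
  shows "r1 \<bullet> u = b1" "r2 \<bullet> u = b2" "r3 \<bullet> u = b3"
proof -
  have 1: "r2 \<bullet> (r3 \<times> r1) = D" "r3 \<bullet> (r1 \<times> r2) = D" unfolding D_def by (simp_all add: cross3_simps)
  show "r1 \<bullet> u = b1" "r2 \<bullet> u = b2" "r3 \<bullet> u = b3"
    using assms(2) 1 unfolding u_def
    by (simp_all add: inner_add_right dot_cross_self D_def[symmetric])
qed

lemma singular_2x2:
  fixes a11 a12 a21 a22 :: real
  assumes "a11 * a22 - a12 * a21 = 0"
  shows "\<exists>y z. (y \<noteq> 0 \<or> z \<noteq> 0) \<and> a11 * y + a12 * z = 0 \<and> a21 * y + a22 * z = 0"
proof (cases "a11 = 0 \<and> a12 = 0")
  case True
  show ?thesis
  proof (cases "a21 = 0 \<and> a22 = 0")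
    case True
    then show ?thesis using \<open>a11 = 0 \<and> a12 = 0\<close> by (intro exI[of _ 1]) auto
  next
    case False
    then show ?thesis using \<open>a11 = 0 \<and> a12 = 0\<close> by (intro exI[of _ "- a22"] exI[of _ a21]) auto
  qed
next
  case False
  then show ?thesis using assms by (intro exI[of _ "- a12"] exI[of _ a11]) (auto simp: algebra_simps)
qed

text \<open>The rows \<open>r1\<close>, \<open>r2\<close>, \<open>r3\<close> are the equations of motion of the position with eigenvalue \<open>k\<close>, the
  vectors \<open>cy\<close>, \<open>cz\<close> their coupling to the rotations of the body about the second and third axis, and
  \<open>char\<close> is the determinant that remains after the position has been eliminated.\<close>

locale oblate_limit =
  fixes I\<^sub>2 a c s :: real
  assumes a: "a > 0" and I2: "I\<^sub>2 > 3 * a" and cs: "c\<^sup>2 + s\<^sup>2 = 1" and c: "c \<noteq> 0"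
begin

text \<open>The data of the equilibrium as functions of e alone, with k taken positive.
  \<open>DD\<close> is the axial spin minus \<open>I\<^sub>2\<close> times the axial rate, and
  \<open>g11\<close> to \<open>g33\<close> are the entries of the order e part of the second
  derivative of the potential.\<close>

definition "kk e = sqrt (1 + (3 - 9 * c\<^sup>2) / 2 * a * e)"
definition "AA e = 2 + (9 - 15 * c\<^sup>2) * a * e"
definition "w1 e = (1 + (3 - 15 * c\<^sup>2) / 2 * a * e) * s / kk e"
definition "w2 e = - AA e * c / (2 * kk e)"
definition "DD e = - 6 * a * s * kk e / AA e"
definition "WW e = (w1 e)\<^sup>2 + (w2 e)\<^sup>2"
definition "g11 = a * ((3 / 2 - 15 / 2 * c\<^sup>2) + (- 15 / 2 + 105 / 2 * c\<^sup>2) * c\<^sup>2 + 3 - 30 * c\<^sup>2)"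
definition "g12 = a * ((- 15 / 2 + 105 / 2 * c\<^sup>2) * c * s - 15 * c * s)"
definition "g22 = a * ((3 / 2 - 15 / 2 * c\<^sup>2) + (- 15 / 2 + 105 / 2 * c\<^sup>2) * s\<^sup>2)"
definition "g33 = a * (3 / 2 - 15 / 2 * c\<^sup>2)"
definition r1 :: "real \<Rightarrow> real \<Rightarrow> real^3" where
  "r1 e k = vector [k\<^sup>2 + (w1 e)\<^sup>2 - WW e + 1 - 3 * c\<^sup>2 + e * g11, w1 e * w2 e - 3 * c * s + e * g12, 2 * k * w2 e]"
definition r2 :: "real \<Rightarrow> real \<Rightarrow> real^3" where
  "r2 e k = vector [w1 e * w2 e - 3 * c * s + e * g12, k\<^sup>2 + (w2 e)\<^sup>2 - WW e + 1 - 3 * s\<^sup>2 + e * g22, - 2 * k * w1 e]"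
definition r3 :: "real \<Rightarrow> real \<Rightarrow> real^3" where
  "r3 e k = vector [- 2 * k * w2 e, 2 * k * w1 e, k\<^sup>2 - WW e + 1 + e * g33]"
definition cy :: "real^3" where "cy = vector [0, 0, - 3 * a * c]"
definition cz :: "real^3" where "cz = vector [3 * a * (s - 5 * c\<^sup>2 * s), 3 * a * (c - 5 * c * s\<^sup>2), 0]"
definition "m11 e k = k\<^sup>2 * I\<^sub>2 + w1 e * DD e - 3 * a * c\<^sup>2"
definition "m12 e k = k * (DD e - w1 e * I\<^sub>2)"
definition "m22 e k = I\<^sub>2 * k\<^sup>2 + w1 e * DD e + I\<^sub>2 * (w2 e)\<^sup>2 - 3 * a * (c\<^sup>2 - s\<^sup>2)"
definition "det3 e k = r1 e k \<bullet> (r2 e k \<times> r3 e k)"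
definition "uy e k = (1 / det3 e k) *\<^sub>R (cy$1 *\<^sub>R (r2 e k \<times> r3 e k) + cy$2 *\<^sub>R (r3 e k \<times> r1 e k) + cy$3 *\<^sub>R (r1 e k \<times> r2 e k))"
definition "uz e k = (1 / det3 e k) *\<^sub>R (cz$1 *\<^sub>R (r2 e k \<times> r3 e k) + cz$2 *\<^sub>R (r3 e k \<times> r1 e k) + cz$3 *\<^sub>R (r1 e k \<times> r2 e k))"
definition "char e k = (m11 e k - e * (cy \<bullet> uy e k)) * (m22 e k - e * (cz \<bullet> uz e k))
   - (m12 e k - e * (cy \<bullet> uz e k)) * (- m12 e k - e * (cz \<bullet> uy e k))"

lemma at_0: "kk 0 = 1" "AA 0 = 2" "w1 0 = s" "w2 0 = - c" "DD 0 = - 3 * a * s" "WW 0 = 1"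
  using cs by (simp_all add: kk_def AA_def w1_def w2_def DD_def WW_def add.commute)

text \<open>This is the characteristic polynomial of a circular Kepler orbit in the rotating frame,
  with roots 0 and plus or minus the imaginary unit, each double. It has no positive root, so the
  position can be eliminated there.\<close>

lemma det3_0: "det3 0 k = k\<^sup>2 * (k\<^sup>2 + 1)\<^sup>2"
proof -
  have "det3 0 k = (k\<^sup>2 + s\<^sup>2 - 3 * c\<^sup>2) * ((k\<^sup>2 + c\<^sup>2 - 3 * s\<^sup>2) * k\<^sup>2 + 4 * k\<^sup>2 * s\<^sup>2)
      + 4 * c * s * (- 4 * c * s * k\<^sup>2 + 4 * k\<^sup>2 * c * s) + (- 2 * k * c) * (- 8 * c * s\<^sup>2 * k - 2 * k * c * (k\<^sup>2 + c\<^sup>2 - 3 * s\<^sup>2))"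
    unfolding det3_def r1_def r2_def r3_def at_0
    by (simp add: inner_vec_def sum_3 cross_components power2_eq_square algebra_simps)
  also have "\<dots> = k\<^sup>2 * (k\<^sup>2 + 1)\<^sup>2" using cs by algebra
  finally show ?thesis .
qed

text \<open>The constant term is \<open>- 3 * a * c\<^sup>2 * (I\<^sub>2 - 3 * a)\<close>. Its
  negative sign against the positive leading term is the source of the instability.\<close>

lemma char_0: "char 0 k = (I\<^sub>2 * k\<^sup>2 - 3 * a) * (I\<^sub>2 * k\<^sup>2 + c\<^sup>2 * (I\<^sub>2 - 3 * a)) + k\<^sup>2 * s\<^sup>2 * (I\<^sub>2 + 3 * a)\<^sup>2"
  unfolding char_def m11_def m12_def m22_def at_0 using cs by simp algebra

text \<open>For fixed small e the function \<open>char e\<close> changes sign between two positive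
  numbers that do not depend on e. A zero gives a singular system for the rotations y and z, and
  Cramer's rule supplies the matching variation of the position.\<close>

lemma solution_exists:
  "\<exists>e0>0. \<forall>e. 0 < e \<and> e < e0 \<longrightarrow> (\<exists>k>0. \<exists>u y z. (y \<noteq> 0 \<or> z \<noteq> 0)
     \<and> r1 e k \<bullet> u + e * (y * cy$1 + z * cz$1) = 0
     \<and> r2 e k \<bullet> u + e * (y * cy$2 + z * cz$2) = 0
     \<and> r3 e k \<bullet> u + e * (y * cy$3 + z * cz$3) = 0
     \<and> y * m11 e k + z * m12 e k + cy \<bullet> u = 0
     \<and> - y * m12 e k + z * m22 e k + cz \<bullet> u = 0)"
proof -
  have I2_pos: "I\<^sub>2 > 0" using a I2 by linarith
  \<comment> \<open>Chosen so that the first factor in \<open>char_0\<close> equals 1; the remaining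
    terms are then positive or nonnegative.\<close>
  define k2 where "k2 = sqrt ((3 * a + 1) / I\<^sub>2)"
  have k2: "k2 > 0" "I\<^sub>2 * k2\<^sup>2 = 3 * a + 1" using a I2_pos by (simp_all add: k2_def)
  have c2: "c\<^sup>2 * (I\<^sub>2 - 3 * a) > 0" using c I2 by simp
  have pos2: "char 0 k2 > 0"
  proof -
    have "(I\<^sub>2 * k2\<^sup>2 - 3 * a) * (I\<^sub>2 * k2\<^sup>2 + c\<^sup>2 * (I\<^sub>2 - 3 * a)) > 0" using k2 c2 a by simp
    moreover have "k2\<^sup>2 * s\<^sup>2 * (I\<^sub>2 + 3 * a)\<^sup>2 \<ge> 0" by simp
    ultimately show ?thesis unfolding char_0 by linarith
  qed
  have "isCont (\<lambda>k. char 0 k) 0" unfolding char_0 by (intro continuous_intros)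
  moreover have "char 0 0 < 0"
    unfolding char_0 using a c2 by (simp add: mult_pos_pos)
  ultimately have "\<forall>\<^sub>F k in nhds 0. char 0 k < 0"
    using order_tendstoD(2)[of "\<lambda>k. char 0 k" "char 0 0" "nhds 0" 0] by (simp add: isCont_def tendsto_at_iff_tendsto_nhds)
  then obtain d where d: "d > 0" "\<And>k. dist k 0 < d \<Longrightarrow> char 0 k < 0" unfolding eventually_nhds_metric by blast
  \<comment> \<open>The lower end has to be positive: \<open>det3 0\<close> vanishes at k = 0, and
    the eigenvalue sought is positive.\<close>
  define k1 where "k1 = min (d / 2) (k2 / 2)"
  have k1: "k1 > 0" "k1 < k2" "char 0 k1 < 0" using d k2(1) by (auto simp: k1_def dist_real_def)
  have "\<exists>ebd>0. \<forall>e\<in>{0..ebd}. 1 + (3 - 9 * c\<^sup>2) / 2 * a * e > 0 \<and> AA e > 0"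
  proof -
    define q where "q = \<bar>(3 - 9 * c\<^sup>2) / 2 * a\<bar> + \<bar>(9 - 15 * c\<^sup>2) * a\<bar> + 1"
    have q: "q > 0" by (simp add: q_def)
    have "1 + x * e > 0" if "e \<in> {0..1 / (2 * q)}" "\<bar>x\<bar> \<le> q" for e x
    proof -
      have "\<bar>x * e\<bar> \<le> q * (1 / (2 * q))" unfolding abs_mult using that q by (intro mult_mono) auto
      then show ?thesis using q by simp
    qed
    note this[of _ "(3 - 9 * c\<^sup>2) / 2 * a"] this[of _ "(9 - 15 * c\<^sup>2) * a"]
    moreover have "\<bar>(3 - 9 * c\<^sup>2) / 2 * a\<bar> \<le> q" "\<bar>(9 - 15 * c\<^sup>2) * a\<bar> \<le> q" unfolding q_def by linarith+
    ultimately have "1 + (3 - 9 * c\<^sup>2) / 2 * a * e > 0 \<and> 1 + (9 - 15 * c\<^sup>2) * a * e > 0" if "e \<in> {0..1 / (2 * q)}" for e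
      using that by blast
    then show ?thesis using q by (intro exI[of _ "1 / (2 * q)"]) (fastforce simp: AA_def)
  qed
  then obtain ebd where ebd: "ebd > 0" "\<And>e. e \<in> {0..ebd} \<Longrightarrow> 1 + (3 - 9 * c\<^sup>2) / 2 * a * e > 0 \<and> AA e > 0" by blast
  have kpos: "kk e > 0" if "e \<in> {0..ebd}" for e using ebd(2)[OF that] by (simp add: kk_def)
  let ?D = "\<lambda>b. Sigma {0..b} (\<lambda>_. {k1..k2})"
  have base: "continuous_on (?D ebd) (\<lambda>x. kk (fst x))" "continuous_on (?D ebd) (\<lambda>x. AA (fst x))"
    unfolding kk_def AA_def by (intro continuous_intros)+
  have nz: "\<And>x. x \<in> ?D ebd \<Longrightarrow> kk (fst x) \<noteq> 0" "\<And>x. x \<in> ?D ebd \<Longrightarrow> AA (fst x) \<noteq> 0"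
    using kpos ebd(2) by (auto simp: less_imp_neq[symmetric] dest: less_imp_neq)
  have cw: "continuous_on (?D ebd) (\<lambda>x. w1 (fst x))" "continuous_on (?D ebd) (\<lambda>x. w2 (fst x))" "continuous_on (?D ebd) (\<lambda>x. DD (fst x))"
    unfolding w1_def w2_def DD_def using nz by (auto intro!: continuous_intros base)
  have cW: "continuous_on (?D ebd) (\<lambda>x. WW (fst x))" unfolding WW_def by (intro continuous_intros cw)
  have vec: "continuous_on T (\<lambda>x. vector [f x, g x, h x] :: real^3)" if "continuous_on T f" "continuous_on T g" "continuous_on T h"
    for T :: "(real \<times> real) set" and f g h :: "real \<times> real \<Rightarrow> real"
  proof -
    have "(\<lambda>x. vector [f x, g x, h x] :: real^3) = (\<lambda>x. f x *\<^sub>R axis 1 1 + g x *\<^sub>R axis 2 1 + h x *\<^sub>R axis 3 1)"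
      by (auto simp: fun_eq_iff vec_eq_iff forall_3 axis_def)
    then show ?thesis by (simp only:) (intro continuous_intros that)
  qed
  have cr: "continuous_on (?D ebd) (\<lambda>x. r1 (fst x) (snd x))" "continuous_on (?D ebd) (\<lambda>x. r2 (fst x) (snd x))" "continuous_on (?D ebd) (\<lambda>x. r3 (fst x) (snd x))"
    unfolding r1_def r2_def r3_def by (intro vec continuous_intros cw cW)+
  have cd: "continuous_on (?D ebd) (\<lambda>x. det3 (fst x) (snd x))"
    unfolding det3_def by (intro continuous_intros continuous_on_cross cr)
  have "\<exists>e2>0. e2 \<le> ebd \<and> (\<forall>e k. 0 \<le> e \<longrightarrow> e \<le> e2 \<longrightarrow> k1 \<le> k \<longrightarrow> k \<le> k2 \<longrightarrow> (\<lambda>x. det3 (fst x) (snd x)) (e, k) > 0)"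
  proof (rule positive_near_compact_edge[OF cd ebd(1)])
    show "0 < det3 (fst (0, k)) (snd (0, k))" if "k1 \<le> k" for k
    proof -
      have "k\<^sup>2 + 1 > 0" using zero_le_power2[of k] by linarith
      moreover have "k > 0" using k1(1) that by simp
      ultimately show ?thesis by (simp add: det3_0)
    qed
  qed (use k1 in auto)
  then obtain e2 where e2: "e2 > 0" "e2 \<le> ebd" "\<And>e k. 0 \<le> e \<Longrightarrow> e \<le> e2 \<Longrightarrow> k1 \<le> k \<Longrightarrow> k \<le> k2 \<Longrightarrow> det3 e k > 0"
    by auto
  have sub: "?D e2 \<subseteq> ?D ebd" using e2(2) by auto
  note cr' = cr[THEN continuous_on_subset, OF sub] and cw' = cw[THEN continuous_on_subset, OF sub]
    and cd' = cd[THEN continuous_on_subset, OF sub]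
  have dnz: "det3 (fst x) (snd x) \<noteq> 0" if "x \<in> ?D e2" for x using e2(3)[of "fst x" "snd x"] that by auto
  have cu: "continuous_on (?D e2) (\<lambda>x. uy (fst x) (snd x))" "continuous_on (?D e2) (\<lambda>x. uz (fst x) (snd x))"
    unfolding uy_def uz_def using dnz by (auto intro!: continuous_intros continuous_on_cross cr' cd')
  have cc: "continuous_on (?D e2) (\<lambda>x. char (fst x) (snd x))"
    unfolding char_def m11_def m12_def m22_def by (intro continuous_intros cu cw')
  \<comment> \<open>Only the signs at the two ends have to persist, so the rectangle is collapsed to
    one value of k; the factor \<sigma> treats both signs alike.\<close>
  have edge: "\<exists>e3>0. e3 \<le> e2 \<and> (\<forall>e. 0 \<le> e \<longrightarrow> e \<le> e3 \<longrightarrow> \<sigma> * char e k > 0)"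
    if "\<sigma> * char 0 k > 0" "k1 \<le> k" "k \<le> k2" for \<sigma> k
  proof -
    have "continuous_on (Sigma {0..e2} (\<lambda>_. {k..k})) (\<lambda>x. \<sigma> * char (fst x) (snd x))"
      by (intro continuous_intros continuous_on_subset[OF cc]) (use that in auto)
    from positive_near_compact_edge[OF this e2(1)] that(1) show ?thesis by fastforce
  qed
  obtain e3 where e3: "e3 > 0" "e3 \<le> e2" "\<And>e. 0 \<le> e \<Longrightarrow> e \<le> e3 \<Longrightarrow> char e k1 < 0"
    using edge[of "-1" k1] k1 by auto
  obtain e4 where e4: "e4 > 0" "e4 \<le> e2" "\<And>e. 0 \<le> e \<Longrightarrow> e \<le> e4 \<Longrightarrow> char e k2 > 0"
    using edge[of 1 k2] k1 pos2 by auto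
  show ?thesis
  proof (rule exI[of _ "min e3 e4"], intro conjI allI impI)
    show "0 < min e3 e4" using e3 e4 by simp
    fix e assume e: "0 < e \<and> e < min e3 e4"
    have "continuous_on {k1..k2} (\<lambda>k. char e k)"
    proof -
      have "continuous_on {k1..k2} (\<lambda>k. char (fst (e, k)) (snd (e, k)))"
      proof (rule continuous_on_compose2[OF cc])
        show "continuous_on {k1..k2} (\<lambda>k. (e, k))" by (intro continuous_intros)
        show "(\<lambda>k. (e, k)) ` {k1..k2} \<subseteq> ?D e2" using e e3 by auto
      qed
      then show ?thesis by simp
    qed
    then obtain k where k: "k1 \<le> k" "k \<le> k2" "char e k = 0"
      using IVT'[of "char e" k1 0 k2] e3(3)[of e] e4(3)[of e] e k1(2) by auto
    from singular_2x2[OF k(3)[unfolded char_def]] obtain y z where yz: "y \<noteq> 0 \<or> z \<noteq> 0"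
      "(m11 e k - e * (cy \<bullet> uy e k)) * y + (m12 e k - e * (cy \<bullet> uz e k)) * z = 0"
      "(- m12 e k - e * (cz \<bullet> uy e k)) * y + (m22 e k - e * (cz \<bullet> uz e k)) * z = 0" by blast
    \<comment> \<open>The position forced by the rotations y and z: \<open>uy\<close> and
      \<open>uz\<close> solve the three position equations with right-hand sides \<open>cy\<close>
      and \<open>cz\<close>.\<close>
    define u where "u = - (e * y) *\<^sub>R uy e k - (e * z) *\<^sub>R uz e k"
    have d: "det3 e k \<noteq> 0" using e2(3)[of e k] e e3 k by auto
    note Y = cross3_cramer[OF d[unfolded det3_def], folded det3_def, of "cy$1" "cy$2" "cy$3", folded uy_def]
    note Z = cross3_cramer[OF d[unfolded det3_def], folded det3_def, of "cz$1" "cz$2" "cz$3", folded uz_def]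
    have "k > 0" using k k1 by simp
    moreover have "r1 e k \<bullet> u + e * (y * cy$1 + z * cz$1) = 0" "r2 e k \<bullet> u + e * (y * cy$2 + z * cz$2) = 0"
      "r3 e k \<bullet> u + e * (y * cy$3 + z * cz$3) = 0"
      unfolding u_def by (simp_all add: inner_diff_right Y Z algebra_simps)
    moreover have "y * m11 e k + z * m12 e k + cy \<bullet> u = 0" "- y * m12 e k + z * m22 e k + cz \<bullet> u = 0"
      using yz(2,3) unfolding u_def by (simp_all add: inner_diff_right algebra_simps)
    ultimately show "\<exists>k>0. \<exists>u y z. (y \<noteq> 0 \<or> z \<noteq> 0)
     \<and> r1 e k \<bullet> u + e * (y * cy$1 + z * cz$1) = 0
     \<and> r2 e k \<bullet> u + e * (y * cy$2 + z * cz$2) = 0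
     \<and> r3 e k \<bullet> u + e * (y * cy$3 + z * cz$3) = 0
     \<and> y * m11 e k + z * m12 e k + cy \<bullet> u = 0
     \<and> - y * m12 e k + z * m22 e k + cz \<bullet> u = 0"
      using yz(1) by blast
  qed
qed

end

section \<open>Linearization and the symplectic slice\<close>

definition hess_potential :: "real \<Rightarrow> real^3 \<Rightarrow> real^3 \<Rightarrow> real^3" where
  "hess_potential a R h =
     (1 / norm R ^ 3 + 3 * a / 2 * (1 / norm R ^ 5) - 15 * a / 2 * ((e1 \<bullet> R)\<^sup>2 * (1 / norm R ^ 7))) *\<^sub>R h
     + (- 3 / norm R ^ 5 * (R \<bullet> h) + 3 * a / 2 * (- 5 / norm R ^ 7 * (R \<bullet> h))
        - 15 * a / 2 * ((e1 \<bullet> R)\<^sup>2 * (- 7 / norm R ^ 9 * (R \<bullet> h)) + 2 * (e1 \<bullet> R) * (e1 \<bullet> h) * (1 / norm R ^ 7))) *\<^sub>R R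
     + (3 * a * ((e1 \<bullet> R) * (- 5 / norm R ^ 7 * (R \<bullet> h)) + (e1 \<bullet> h) * (1 / norm R ^ 5))) *\<^sub>R e1"

lemma grad_potential_has_derivative:
  assumes R: "R \<noteq> 0"
  shows "(grad_potential a has_derivative hess_potential a R) (at R)"
proof -
  note N = has_derivative_inverse_norm_power[OF R]
  have N3: "((\<lambda>x :: real^3. 1 / norm x ^ 3) has_derivative (\<lambda>h. - 3 / norm R ^ 5 * (R \<bullet> h))) (at R)"
    and N5: "((\<lambda>x :: real^3. 1 / norm x ^ 5) has_derivative (\<lambda>h. - 5 / norm R ^ 7 * (R \<bullet> h))) (at R)"
    and N7: "((\<lambda>x :: real^3. 1 / norm x ^ 7) has_derivative (\<lambda>h. - 7 / norm R ^ 9 * (R \<bullet> h))) (at R)"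
    using N[of 3] N[of 5] N[of 7] by simp_all
  have e: "((\<lambda>x. (e1 \<bullet> x)\<^sup>2) has_derivative (\<lambda>h. 2 * (e1 \<bullet> R) * (e1 \<bullet> h))) (at R)"
    by (auto intro!: derivative_eq_intros)
  have e': "((\<lambda>x. e1 \<bullet> x) has_derivative (\<lambda>h. e1 \<bullet> h)) (at R)"
    by (auto intro!: derivative_eq_intros)
  have g: "grad_potential a = (\<lambda>x. (1 / norm x ^ 3 + 3 * a / 2 * (1 / norm x ^ 5) - 15 * a / 2 * ((e1 \<bullet> x)\<^sup>2 * (1 / norm x ^ 7))) *\<^sub>R x
      + (3 * a * ((e1 \<bullet> x) * (1 / norm x ^ 5))) *\<^sub>R e1)"
    by (simp add: fun_eq_iff grad_potential_def)
  have "((\<lambda>x. (1 / norm x ^ 3 + 3 * a / 2 * (1 / norm x ^ 5) - 15 * a / 2 * ((e1 \<bullet> x)\<^sup>2 * (1 / norm x ^ 7))) *\<^sub>R x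
      + (3 * a * ((e1 \<bullet> x) * (1 / norm x ^ 5))) *\<^sub>R e1) has_derivative
     (\<lambda>h. ((1 / norm R ^ 3 + 3 * a / 2 * (1 / norm R ^ 5) - 15 * a / 2 * ((e1 \<bullet> R)\<^sup>2 * (1 / norm R ^ 7))) *\<^sub>R h
     + (- 3 / norm R ^ 5 * (R \<bullet> h) + 3 * a / 2 * (- 5 / norm R ^ 7 * (R \<bullet> h))
        - 15 * a / 2 * ((e1 \<bullet> R)\<^sup>2 * (- 7 / norm R ^ 9 * (R \<bullet> h)) + 2 * (e1 \<bullet> R) * (e1 \<bullet> h) * (1 / norm R ^ 7))) *\<^sub>R R)
     + (3 * a * ((e1 \<bullet> R) * (- 5 / norm R ^ 7 * (R \<bullet> h)) + (e1 \<bullet> h) * (1 / norm R ^ 5))) *\<^sub>R e1)) (at R)"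
    by (intro has_derivative_add has_derivative_diff has_derivative_mult_right has_derivative_mult has_derivative_scaleR
         has_derivative_scaleR_left N3 N5 N7 e e' has_derivative_ident)
  then show ?thesis unfolding g hess_potential_def[abs_def] .
qed

text \<open>The closed formula for the augmented field holds on the open set of nonzero positions,
  where it may be differentiated in the ambient space. \<open>\<Delta>\<close> is the resulting
  variation of the body rate.\<close>

lemma linearization_formula:
  fixes R m P :: "real^3"
  assumes I: "I\<^sub>1 \<noteq> 0" "I\<^sub>2 \<noteq> 0" "I\<^sub>1 + 2 * I\<^sub>2 = 1" and R: "R \<noteq> 0"
  defines "\<Omega> \<equiv> body_rate I\<^sub>1 I\<^sub>2 R m P"
  defines "\<Delta> \<equiv> \<lambda>r q y. inertia_axi (1 / I\<^sub>1) (1 / I\<^sub>2) *v (q - (R \<times> y + r \<times> P))"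
  shows "linearization (ham_vf (\<lambda>x. hamiltonian2 (inertia_axi I\<^sub>1 I\<^sub>2) x - momentum x \<bullet> (\<xi>, \<eta>))) (mat 1, R, m, P) (\<theta>, r, q, y)
    = (\<Delta> r q y + \<theta> \<times> \<xi>, y - (\<Omega> \<times> r + \<Delta> r q y \<times> R) - \<eta> *\<^sub>R (e1 \<times> r),
       m \<times> \<Delta> r q y + q \<times> \<Omega> - \<eta> *\<^sub>R (e1 \<times> q), P \<times> \<Delta> r q y + y \<times> \<Omega> - hess_potential (I\<^sub>1 - I\<^sub>2) R r - \<eta> *\<^sub>R (e1 \<times> y))"
proof -
  define X where "X = ham_vf (\<lambda>x. hamiltonian2 (inertia_axi I\<^sub>1 I\<^sub>2) x - momentum x \<bullet> (\<xi>, \<eta>))"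
  define rr mm pp om where "rr x = fst (snd x)" and "mm x = fst (snd (snd x))" and "pp x = snd (snd (snd x))"
    and "om x = inertia_axi (1 / I\<^sub>1) (1 / I\<^sub>2) *v (fst (snd (snd x)) - fst (snd x) \<times> snd (snd (snd x)))" for x :: phase
  define Y where "Y x = (om x - transpose (fst x) *v \<xi> + \<eta> *\<^sub>R e1, pp x - om x \<times> rr x - \<eta> *\<^sub>R (e1 \<times> rr x),
       mm x \<times> om x - \<eta> *\<^sub>R (e1 \<times> mm x), pp x \<times> om x - grad_potential (I\<^sub>1 - I\<^sub>2) (rr x) - \<eta> *\<^sub>R (e1 \<times> pp x))" for x
  let ?p = "(mat 1, R, m, P) :: phase"
  define Ob where "Ob = {x :: phase. rr x \<noteq> 0}"
  have "open Ob"
  proof -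
    have "Ob = rr -` (- {0})" by (auto simp: Ob_def)
    moreover have "continuous_on UNIV rr" unfolding rr_def[abs_def] by (intro continuous_intros)
    ultimately show ?thesis by (simp add: continuous_on_open_vimage open_Compl)
  qed
  have XY: "Y x = X x" if "x \<in> Ob" for x
    using that by (cases x) (simp add: Ob_def rr_def mm_def pp_def om_def Y_def X_def ham_vf_augmented[OF I] body_rate_def)
  have D: "(rr has_derivative rr) (at ?p)" "(mm has_derivative mm) (at ?p)" "(pp has_derivative pp) (at ?p)"
    unfolding rr_def[abs_def] mm_def[abs_def] pp_def[abs_def] by (intro has_derivative_fst has_derivative_snd has_derivative_ident)+
  have v: "rr ?p = R" "mm ?p = m" "pp ?p = P" "om ?p = \<Omega>"
    by (simp_all add: rr_def mm_def pp_def om_def \<Omega>_def body_rate_def)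
  have omD: "(om has_derivative (\<lambda>h. \<Delta> (rr h) (mm h) (pp h))) (at ?p)"
  proof -
    have 1: "((\<lambda>x. mm x - rr x \<times> pp x) has_derivative (\<lambda>h. mm h - (R \<times> pp h + rr h \<times> P))) (at ?p)"
      using has_derivative_diff[OF D(2) has_derivative_cross3[OF D(1,3)]] unfolding v .
    have "bounded_linear ((*v) (inertia_axi (1 / I\<^sub>1) (1 / I\<^sub>2)))"
      by (simp add: matrix_vector_mul_linear linear_linear)
    from bounded_linear.has_derivative[OF this 1] show ?thesis
      unfolding om_def[abs_def] \<Delta>_def rr_def mm_def pp_def .
  qed
  have gD: "((\<lambda>x. grad_potential (I\<^sub>1 - I\<^sub>2) (rr x)) has_derivative (\<lambda>h. hess_potential (I\<^sub>1 - I\<^sub>2) R (rr h))) (at ?p)"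
    by (rule has_derivative_compose[OF D(1)]) (use grad_potential_has_derivative[OF R] in \<open>simp add: v\<close>)
  have tD: "((\<lambda>x. transpose (fst x) *v \<xi>) has_derivative (\<lambda>h. transpose (fst h) *v \<xi>)) (at ?p)"
  proof (rule bounded_linear_imp_has_derivative)
    have "bounded_linear (\<lambda>A :: real^3^3. A *v \<xi>)"
      by (rule bounded_bilinear.bounded_linear_left[OF bounded_bilinear_matrix_vector_mult])
    from bounded_linear_compose[OF this bounded_linear_compose[OF bounded_linear_transpose bounded_linear_fst]]
    show "bounded_linear (\<lambda>x :: phase. transpose (fst x) *v \<xi>)" .
  qed
  have eD: "((\<lambda>x. \<eta> *\<^sub>R (e1 \<times> f x)) has_derivative (\<lambda>h. \<eta> *\<^sub>R (e1 \<times> f' h))) (at ?p)" if "(f has_derivative f') (at ?p)" for f f'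
    using that by (intro has_derivative_scaleR_right bounded_linear.has_derivative[OF bounded_bilinear.bounded_linear_right[OF bounded_bilinear_cross3]])
  have "(Y has_derivative (\<lambda>h. (\<Delta> (rr h) (mm h) (pp h) - transpose (fst h) *v \<xi> + 0,
      pp h - (om ?p \<times> rr h + \<Delta> (rr h) (mm h) (pp h) \<times> rr ?p) - \<eta> *\<^sub>R (e1 \<times> rr h),
      (mm ?p \<times> \<Delta> (rr h) (mm h) (pp h) + mm h \<times> om ?p) - \<eta> *\<^sub>R (e1 \<times> mm h),
      (pp ?p \<times> \<Delta> (rr h) (mm h) (pp h) + pp h \<times> om ?p) - hess_potential (I\<^sub>1 - I\<^sub>2) R (rr h) - \<eta> *\<^sub>R (e1 \<times> pp h)))) (at ?p)"
    unfolding Y_def[abs_def]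
    by (intro has_derivative_Pair has_derivative_add has_derivative_diff has_derivative_const has_derivative_cross3 omD tD gD eD D)
  then have "(X has_derivative (\<lambda>h. (\<Delta> (rr h) (mm h) (pp h) - transpose (fst h) *v \<xi> + 0,
      pp h - (om ?p \<times> rr h + \<Delta> (rr h) (mm h) (pp h) \<times> rr ?p) - \<eta> *\<^sub>R (e1 \<times> rr h),
      (mm ?p \<times> \<Delta> (rr h) (mm h) (pp h) + mm h \<times> om ?p) - \<eta> *\<^sub>R (e1 \<times> mm h),
      (pp ?p \<times> \<Delta> (rr h) (mm h) (pp h) + pp h \<times> om ?p) - hess_potential (I\<^sub>1 - I\<^sub>2) R (rr h) - \<eta> *\<^sub>R (e1 \<times> pp h)))) (at ?p)"
    by (rule has_derivative_transform_within_open[OF _ \<open>open Ob\<close>]) (use R XY in \<open>auto simp: Ob_def rr_def\<close>)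
  from frechet_derivative_at[OF this, symmetric]
  have "directional X ?p (\<theta>, r, q, y) = (\<Delta> r q y - transpose (hat \<theta>) *v \<xi>, y - (\<Omega> \<times> r + \<Delta> r q y \<times> R) - \<eta> *\<^sub>R (e1 \<times> r),
       m \<times> \<Delta> r q y + q \<times> \<Omega> - \<eta> *\<^sub>R (e1 \<times> q), P \<times> \<Delta> r q y + y \<times> \<Omega> - hess_potential (I\<^sub>1 - I\<^sub>2) R r - \<eta> *\<^sub>R (e1 \<times> y))"
    unfolding directional_def v by (simp add: ambient_def rr_def mm_def pp_def del: transpose_matrix_vector)
  moreover have "transpose (hat \<theta>) *v \<xi> = - (\<theta> \<times> \<xi>)"
    by (simp add: transpose_hat matrix_vector_mult_minus hat_mult)
  ultimately show ?thesis by (simp add: linearization_def X_def[symmetric])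
qed

lemma directional_momentum:
  "directional momentum (mat 1, R, m, P) (\<theta>, r, q, y) = (q + \<theta> \<times> m, e1 \<bullet> (R \<times> y + r \<times> P) - e1 \<bullet> q)"
proof -
  let ?p = "(mat 1, R, m, P) :: phase"
  have M: "momentum = (\<lambda>x. (fst x *v fst (snd (snd x)), e1 \<bullet> (fst (snd x) \<times> snd (snd (snd x))) - e1 \<bullet> fst (snd (snd x))))"
    by (auto simp: fun_eq_iff momentum_def)
  have "(momentum has_derivative (\<lambda>h. (fst ?p *v fst (snd (snd h)) + fst h *v fst (snd (snd ?p)),
      e1 \<bullet> (fst (snd ?p) \<times> snd (snd (snd h)) + fst (snd h) \<times> snd (snd (snd ?p))) - e1 \<bullet> fst (snd (snd h))))) (at ?p)"
    unfolding M
    by (intro has_derivative_Pair has_derivative_diff has_derivative_inner_right has_derivative_cross3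
        has_derivative_matrix_vector_mult has_derivative_fst has_derivative_snd has_derivative_ident)
  from frechet_derivative_at[OF this, symmetric] show ?thesis
    by (simp add: directional_def ambient_def hat_mult)
qed

lemma hat_inject: "hat u = hat v \<Longrightarrow> u = v"
proof -
  assume "hat u = hat v"
  then have "u \<times> x = v \<times> x" for x by (metis hat_mult)
  from this[of "axis 1 1"] this[of "axis 2 1"] show "u = v"
    by (simp add: vec3_eq_iff cross_components axis_def)
qed

text \<open>Used to show that an eigenvector does not vanish in the quotient. The condition
  \<open>\<xi>' \<times> m = 0\<close> is the derivative at t = 0 of the statement that the subgroup
  fixes the spatial angular momentum.\<close>

lemma gmu_orbit_tangent_form:
  assumes w: "(\<theta>, r, q, y) \<in> gmu_orbit_tangent (mat 1, R, m, P)"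
  shows "\<exists>\<xi>' \<eta>'. \<xi>' \<times> m = 0 \<and> \<theta> = \<xi>' - \<eta>' *\<^sub>R e1 \<and> r = \<eta>' *\<^sub>R (e1 \<times> R) \<and> q = \<eta>' *\<^sub>R (e1 \<times> m) \<and> y = \<eta>' *\<^sub>R (e1 \<times> P)"
proof -
  obtain \<xi>' \<eta>' where z: "(\<xi>', \<eta>') \<in> stabilizer_algebra (momentum (mat 1, R, m, P))"
    and d: "((\<lambda>t. act_T (group_exp (t *\<^sub>R (\<xi>', \<eta>'))) (mat 1, R, m, P)) has_vector_derivative ambient (mat 1, R, m, P) (\<theta>, r, q, y)) (at 0)"
    using w unfolding gmu_orbit_tangent_def by force
  define M where "M t = mat_exp (t *\<^sub>R hat \<xi>')" for t
  define N where "N t = mat_exp (t *\<^sub>R hat (\<eta>' *\<^sub>R e1))" for t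
  have rot: "rotation_matrix (M t)" "rotation_matrix (N t)" for t
    by (simp_all add: M_def N_def rotation_matrix_mat_exp)
  have c: "act_T (group_exp (t *\<^sub>R (\<xi>', \<eta>'))) (mat 1, R, m, P) = (M t ** transpose (N t), N t *v R, N t *v m, N t *v P)" for t
    using rotation_matrix_mult_transpose(3)[OF rot(2)[of t]]
    by (simp add: act_T_def group_exp_def M_def N_def hat_scaleR)
  have DM: "(M has_vector_derivative hat \<xi>') (at 0)" and DN: "(N has_vector_derivative hat (\<eta>' *\<^sub>R e1)) (at 0)"
    using mat_exp_hat_has_vector_derivative[of \<xi>' 0] mat_exp_hat_has_vector_derivative[of "\<eta>' *\<^sub>R e1" 0]
    by (simp_all add: M_def[abs_def] N_def[abs_def])
  have MN0: "M 0 = mat 1" "N 0 = mat 1" by (simp_all add: M_def N_def)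
  have v: "((\<lambda>t. N t *v x) has_vector_derivative \<eta>' *\<^sub>R (e1 \<times> x)) (at 0)" for x
    using has_vector_derivative_matrix_vector_mult[OF DN has_vector_derivative_const[of x "at 0"]]
    by (simp add: hat_mult cross_mult_left)
  have "((\<lambda>t. M t ** transpose (N t)) has_vector_derivative
      M 0 ** transpose (hat (\<eta>' *\<^sub>R e1)) + hat \<xi>' ** transpose (N 0)) (at 0)"
    by (intro has_vector_derivative_matrix_matrix_mult DM bounded_linear.has_vector_derivative[OF bounded_linear_transpose DN])
  moreover have "M 0 ** transpose (hat (\<eta>' *\<^sub>R e1)) + hat \<xi>' ** transpose (N 0) = hat (\<xi>' - \<eta>' *\<^sub>R e1)"
    using hat_add[of \<xi>' "- (\<eta>' *\<^sub>R e1)"] hat_scaleR[of "-1" "\<eta>' *\<^sub>R e1"] by (simp add: MN0 transpose_hat)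
  ultimately have "((\<lambda>t. M t ** transpose (N t)) has_vector_derivative hat (\<xi>' - \<eta>' *\<^sub>R e1)) (at 0)" by simp
  then have "((\<lambda>t. (M t ** transpose (N t), N t *v R, N t *v m, N t *v P)) has_vector_derivative
      (hat (\<xi>' - \<eta>' *\<^sub>R e1), \<eta>' *\<^sub>R (e1 \<times> R), \<eta>' *\<^sub>R (e1 \<times> m), \<eta>' *\<^sub>R (e1 \<times> P))) (at 0)"
    by (intro has_vector_derivative_Pair v)
  from vector_derivative_unique_at[OF this d[unfolded c]]
  have "hat (\<xi>' - \<eta>' *\<^sub>R e1) = hat \<theta>" "r = \<eta>' *\<^sub>R (e1 \<times> R)" "q = \<eta>' *\<^sub>R (e1 \<times> m)" "y = \<eta>' *\<^sub>R (e1 \<times> P)"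
    by (simp_all add: ambient_def)
  moreover have "\<xi>' \<times> m = 0"
  proof -
    have "M t *v m = m" for t
    proof -
      have "group_exp (t *\<^sub>R (\<xi>', \<eta>')) \<in> stabilizer (momentum (mat 1, R, m, P))"
        using z unfolding stabilizer_algebra_def by blast
      then show ?thesis
        by (simp add: stabilizer_def coadjoint_def momentum_def group_exp_def M_def hat_scaleR)
    qed
    then have "((\<lambda>t. m) has_vector_derivative hat \<xi>' *v m) (at 0)"
      using has_vector_derivative_matrix_vector_mult[OF DM has_vector_derivative_const[of m "at 0"]] by simp
    then show ?thesis
      using vector_derivative_unique_at[OF _ has_vector_derivative_const[of m "at 0"]] by (simp add: hat_mult)
  qed
  ultimately show ?thesis using hat_inject by metis
qed

lemma zero_in_gmu_orbit_tangent: "0 \<in> gmu_orbit_tangent (mat 1, R, m, P)"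
proof -
  have "mat 1 \<in> axial_rotations" by (simp add: axial_rotations_def rotation_matrix_def orthogonal_matrix_id)
  then have s: "(mat 1, mat 1) \<in> stabilizer \<mu>" for \<mu>
    using axial_rotation_Gamma[of "mat 1"]
    by (cases \<mu>) (simp add: stabilizer_def G_axi_def coadjoint_def rotation_matrix_def orthogonal_matrix_id)
  have g: "group_exp (t *\<^sub>R (0, 0)) = (mat 1, mat 1)" for t
    using hat_scaleR[of 0 0] by (simp add: group_exp_def)
  then have "(0, 0) \<in> stabilizer_algebra (momentum (mat 1, R, m, P))" using s by (simp add: stabilizer_algebra_def del: scaleR_Pair)
  moreover have "((\<lambda>t. act_T (group_exp (t *\<^sub>R (0, 0))) (mat 1, R, m, P)) has_vector_derivative ambient (mat 1, R, m, P) 0) (at 0)"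
    proof -
    have "ambient (mat 1, R, m, P) 0 = 0"
      using hat_scaleR[of 0 0] by (simp add: zero_prod_def ambient_def)
    then show ?thesis unfolding g by (simp only: has_vector_derivative_const)
  qed
  ultimately show ?thesis unfolding gmu_orbit_tangent_def by blast
qed

text \<open>In an inertial frame the eigenvalue problem becomes a pair of second order equations for the
  variation \<open>u\<close> of the position and the infinitesimal rotation \<open>\<theta>\<close> of the body.\<close>

theorem unstable_criterion:
  fixes R m P u \<theta> :: "real^3"
  assumes I: "I\<^sub>1 \<noteq> 0" "I\<^sub>2 \<noteq> 0" "I\<^sub>1 + 2 * I\<^sub>2 = 1" and R: "R \<noteq> 0"
    and \<xi>: "\<xi> = body_rate I\<^sub>1 I\<^sub>2 R m P + \<eta> *\<^sub>R e1"
    and eqR: "P = \<xi> \<times> R" and eqm: "m \<times> \<xi> = 0" and eqP: "P \<times> \<xi> = g"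
    and k: "\<kappa> > 0" and m: "m \<noteq> 0" and \<xi>e: "e1 \<times> \<xi> \<noteq> 0" and \<theta>: "\<theta> \<noteq> 0"
  defines "F \<equiv> hess_potential (I\<^sub>1 - I\<^sub>2) R (u - \<theta> \<times> R) + \<theta> \<times> g"
  defines "W \<equiv> \<kappa> *\<^sub>R \<theta> + \<xi> \<times> \<theta>"
  defines "Z \<equiv> inertia_axi I\<^sub>1 I\<^sub>2 *v W + \<theta> \<times> (m - R \<times> P)"
  assumes U: "\<kappa>\<^sup>2 *\<^sub>R u + (2 * \<kappa>) *\<^sub>R (\<xi> \<times> u) + \<xi> \<times> (\<xi> \<times> u) + F = 0"
    and T: "\<kappa> *\<^sub>R Z + \<xi> \<times> Z = u \<times> g + R \<times> F"
    and A: "e1 \<bullet> W = 0"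
  shows "unstable (inertia_axi I\<^sub>1 I\<^sub>2) (\<xi>, \<eta>) (mat 1, R, m, P)"
proof -
  define \<Omega> where "\<Omega> = body_rate I\<^sub>1 I\<^sub>2 R m P"
  have \<Omega>: "\<Omega> = \<xi> - \<eta> *\<^sub>R e1" using \<xi> by (simp add: \<Omega>_def)
  define v where "v = \<kappa> *\<^sub>R u + \<xi> \<times> u"
  \<comment> \<open>From variations in the inertial frame to body variations. The choice of
    \<open>q\<close> keeps the spatial angular momentum fixed to first order, as membership in the
    kernel demands.\<close>
  define r q y where "r = u - \<theta> \<times> R" and "q = m \<times> \<theta>" and "y = v - \<theta> \<times> P"
  define w where "w = (\<theta>, r, q, y)"
  define L where "L = linearization (ham_vf (\<lambda>x. hamiltonian2 (inertia_axi I\<^sub>1 I\<^sub>2) x - momentum x \<bullet> (\<xi>, \<eta>))) (mat 1, R, m, P)"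
  have Fe: "F = - (\<kappa>\<^sup>2 *\<^sub>R u + (2 * \<kappa>) *\<^sub>R (\<xi> \<times> u) + \<xi> \<times> (\<xi> \<times> u))" using U by (metis add_eq_0_iff)
  \<comment> \<open>\<open>D\<close> is the variation of the total angular momentum. The two
    hypotheses give \<open>\<kappa> *\<^sub>R D + \<xi> \<times> D = 0\<close>, and the inner
    product with D removes the second term, so that D vanishes because \<kappa> is positive.\<close>
  define D where "D = Z + u \<times> P + R \<times> v"
  have "\<kappa> *\<^sub>R D + \<xi> \<times> D = (\<kappa> *\<^sub>R Z + \<xi> \<times> Z) + (\<kappa> *\<^sub>R (u \<times> P + R \<times> v) + \<xi> \<times> (u \<times> P + R \<times> v))"
    by (simp add: D_def cross_add_right scaleR_add_right)
  also have "\<dots> = 0"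
    unfolding T Fe eqP[symmetric] v_def eqR by (simp add: cross3_simps power2_eq_square)
  finally have "\<kappa> *\<^sub>R D + \<xi> \<times> D = 0" .
  then have "(\<kappa> *\<^sub>R D + \<xi> \<times> D) \<bullet> D = 0" by simp
  then have "\<kappa> * (D \<bullet> D) = 0" by (simp add: inner_add_left dot_cross_self)
  then have D0: "D = 0" using k by simp
  have JW: "q - (R \<times> y + r \<times> P) = inertia_axi I\<^sub>1 I\<^sub>2 *v W"
  proof -
    have "q - (R \<times> y + r \<times> P) = - (\<theta> \<times> (m - R \<times> P) + u \<times> P + R \<times> v)"
      by (simp add: q_def y_def r_def cross3_simps)
    also have "\<dots> = inertia_axi I\<^sub>1 I\<^sub>2 *v W - D" by (simp add: D_def Z_def algebra_simps)
    also have "\<dots> = inertia_axi I\<^sub>1 I\<^sub>2 *v W" using D0 by simp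
    finally show ?thesis .
  qed
  have inv: "inertia_axi (1 / I\<^sub>1) (1 / I\<^sub>2) *v (inertia_axi I\<^sub>1 I\<^sub>2 *v x) = x" for x
    using I by (simp add: vec3_eq_iff inertia_axi_mult inner_e1 field_simps)
  have Lw: "L w = \<kappa> *\<^sub>R w"
  proof -
    have 1: "W + \<theta> \<times> \<xi> = \<kappa> *\<^sub>R \<theta>" by (simp add: W_def cross_skew[of \<theta> \<xi>])
    have 2: "y - (\<Omega> \<times> r + W \<times> R) - \<eta> *\<^sub>R (e1 \<times> r) = \<kappa> *\<^sub>R r"
      unfolding \<Omega> y_def r_def v_def W_def eqR by (simp add: cross3_simps)
    have 3: "m \<times> W + q \<times> \<Omega> - \<eta> *\<^sub>R (e1 \<times> q) = \<kappa> *\<^sub>R q"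
    proof -
      have "m \<times> W + q \<times> \<Omega> - \<eta> *\<^sub>R (e1 \<times> q) = \<kappa> *\<^sub>R q + (m \<times> \<xi>) \<times> \<theta>"
        unfolding \<Omega> q_def W_def by (simp add: cross3_simps)
      then show ?thesis using eqm by simp
    qed
    have 4: "P \<times> W + y \<times> \<Omega> - hess_potential (I\<^sub>1 - I\<^sub>2) R r - \<eta> *\<^sub>R (e1 \<times> y) = \<kappa> *\<^sub>R y"
    proof -
      have h: "hess_potential (I\<^sub>1 - I\<^sub>2) R r = F - \<theta> \<times> g" by (simp add: F_def r_def)
      show ?thesis unfolding h Fe eqP[symmetric] \<Omega> y_def v_def W_def by (simp add: cross3_simps power2_eq_square)
    qed
    show ?thesis
      unfolding L_def w_def linearization_formula[OF I R] JW inv \<Omega>_def[symmetric] using 1 2 3 4 by simp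
  qed
  have wV: "w \<in> ker_dJ (mat 1, R, m, P)"
  proof -
    have "e1 \<bullet> (R \<times> y + r \<times> P) - e1 \<bullet> q = - (e1 \<bullet> (inertia_axi I\<^sub>1 I\<^sub>2 *v W))"
      unfolding JW[symmetric] by (simp add: inner_diff_right)
    also have "\<dots> = 0" using A by (simp add: inertia_axi_mult inner_e1)
    finally show ?thesis
      by (simp add: ker_dJ_def w_def directional_momentum q_def cross_skew[of m \<theta>] zero_prod_def)
  qed
  have zero: "0 \<in> ker_dJ (mat 1, R, m, P)" "L 0 = 0"
    unfolding L_def ker_dJ_def zero_prod_def mem_Collect_eq directional_momentum linearization_formula[OF I R]
    by (simp_all add: hess_potential_def)
  \<comment> \<open>A tangent vector of the orbit would satisfy
    \<open>\<kappa> *\<^sub>R \<theta> = \<xi>' \<times> \<xi>\<close>. Both factors on the right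
    are parallel to m or zero, so \<theta> would be 0.\<close>
  have wW: "w \<notin> gmu_orbit_tangent (mat 1, R, m, P)"
  proof
    assume "w \<in> gmu_orbit_tangent (mat 1, R, m, P)"
    from gmu_orbit_tangent_form[OF this[unfolded w_def]] obtain \<xi>' \<eta>' where
      f: "\<xi>' \<times> m = 0" "\<theta> = \<xi>' - \<eta>' *\<^sub>R e1" "r = \<eta>' *\<^sub>R (e1 \<times> R)" "q = \<eta>' *\<^sub>R (e1 \<times> m)" "y = \<eta>' *\<^sub>R (e1 \<times> P)" by blast
    have "q - (R \<times> y + r \<times> P) = \<eta>' *\<^sub>R (e1 \<times> (m - R \<times> P))"
      unfolding f by (simp add: cross3_simps)
    then have "inertia_axi I\<^sub>1 I\<^sub>2 *v W = \<eta>' *\<^sub>R (e1 \<times> (m - R \<times> P))" using JW by simp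
    then have "W = inertia_axi (1 / I\<^sub>1) (1 / I\<^sub>2) *v (\<eta>' *\<^sub>R (e1 \<times> (m - R \<times> P)))" using inv[of W] by simp
    also have "\<dots> = \<eta>' *\<^sub>R (e1 \<times> \<Omega>)"
      unfolding \<Omega>_def body_rate_def by (simp add: vec3_eq_iff inertia_axi_mult inner_e1 cross_components)
         (metis minus_diff_eq minus_divide_left mult_minus_right)
    also have "\<dots> = \<eta>' *\<^sub>R (e1 \<times> \<xi>)" unfolding \<Omega> by (simp add: Cross3.right_diff_distrib cross_mult_right)
    finally have "\<kappa> *\<^sub>R \<theta> = \<eta>' *\<^sub>R (e1 \<times> \<xi>) - \<xi> \<times> \<theta>" by (simp add: W_def algebra_simps)
    also have "\<dots> = \<xi>' \<times> \<xi>" unfolding f(2) by (simp add: cross3_simps)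
    finally have k\<theta>: "\<kappa> *\<^sub>R \<theta> = \<xi>' \<times> \<xi>" .
    have "collinear {0, m, \<xi>'}"
      unfolding cross_eq_0[symmetric] using f(1) by (subst cross_skew) simp
    then have "\<exists>a. \<xi>' = a *\<^sub>R m" using m unfolding collinear_lemma by (auto intro: exI[of _ 0])
    then obtain a where a: "\<xi>' = a *\<^sub>R m" by blast
    have "\<xi>' \<times> \<xi> = 0" unfolding a by (simp add: cross_mult_left eqm)
    then have "\<theta> = 0" using k\<theta> k by simp
    with \<theta> show False by simp
  qed
  show ?thesis
    unfolding unstable_def
  proof (intro exI[of _ "complex_of_real \<kappa>"] conjI)
    show "Re (complex_of_real \<kappa>) > 0" using k by simp
    show "quotient_eigenvalue (linearization (ham_vf (\<lambda>x. hamiltonian2 (inertia_axi I\<^sub>1 I\<^sub>2) x - momentum x \<bullet> (\<xi>, \<eta>))) (mat 1, R, m, P))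
        (ker_dJ (mat 1, R, m, P)) (gmu_orbit_tangent (mat 1, R, m, P)) (complex_of_real \<kappa>)"
      unfolding quotient_eigenvalue_def L_def[symmetric]
      using wV wW zero zero_in_gmu_orbit_tangent[of R m P] Lw
      by (intro bexI[of _ w] bexI[of _ 0]) simp_all
  qed
qed

section \<open>The eigenvalue problem at the conical equilibria\<close>

context conical
begin

definition n\<^sub>0 :: "real^3" where "n\<^sub>0 = vector [c, s, 0]"
definition g\<^sub>0 :: "real^3" where "g\<^sub>0 = vector [A * c / 2, f * s, 0]"
definition \<omega>\<^sub>0 :: "real^3" where "\<omega>\<^sub>0 = vector [\<omega>\<^sub>1, \<omega>\<^sub>2, 0]"
definition l\<^sub>0 :: "real^3" where "l\<^sub>0 = vector [L\<^sub>1, I\<^sub>2 * \<omega>\<^sub>2, 0]"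
definition hess\<^sub>0 :: "real^3 \<Rightarrow> real^3" where
  "hess\<^sub>0 r = f *\<^sub>R r + ((- 3 + \<epsilon> * a * (- 15 / 2 + 105 / 2 * c\<^sup>2)) * (n\<^sub>0 \<bullet> r) - 15 * c * \<epsilon> * a * r$1) *\<^sub>R n\<^sub>0
     + (\<epsilon> * a * (3 * r$1 - 15 * c * (n\<^sub>0 \<bullet> r))) *\<^sub>R e1"

lemma scaled_data:
  "R\<^sub>0 = S\<^sup>2 *\<^sub>R n\<^sub>0" "\<xi>\<^sub>0 = (1 / S ^ 3) *\<^sub>R \<omega>\<^sub>0" "grad_potential (I\<^sub>1 - I\<^sub>2) R\<^sub>0 = (1 / S ^ 4) *\<^sub>R g\<^sub>0"
  "m\<^sub>0 - R\<^sub>0 \<times> P\<^sub>0 = (1 / S ^ 3) *\<^sub>R l\<^sub>0"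
proof -
  show "R\<^sub>0 = S\<^sup>2 *\<^sub>R n\<^sub>0" "\<xi>\<^sub>0 = (1 / S ^ 3) *\<^sub>R \<omega>\<^sub>0"
    by (simp_all add: R\<^sub>0_def n\<^sub>0_def \<xi>\<^sub>0_def \<omega>\<^sub>0_def vec3_eq_iff)
  have "k * \<omega>\<^sub>1 = f * s" "k * \<omega>\<^sub>2 = - A * c / 2" using k_nz by (simp_all add: \<omega>\<^sub>1_def \<omega>\<^sub>2_def)
  then show "grad_potential (I\<^sub>1 - I\<^sub>2) R\<^sub>0 = (1 / S ^ 4) *\<^sub>R g\<^sub>0"
    unfolding P\<^sub>0_cross_\<xi>\<^sub>0[symmetric] using S
    by (simp add: P\<^sub>0_def \<xi>\<^sub>0_def g\<^sub>0_def vec3_eq_iff cross_components eval_nat_numeral mult_ac)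
  show "m\<^sub>0 - R\<^sub>0 \<times> P\<^sub>0 = (1 / S ^ 3) *\<^sub>R l\<^sub>0"
    using S by (simp add: m\<^sub>0_def R\<^sub>0_def P\<^sub>0_def l\<^sub>0_def vec3_eq_iff cross_components \<epsilon>_def field_simps eval_nat_numeral)
qed

lemma hess_scaled: "hess_potential (I\<^sub>1 - I\<^sub>2) R\<^sub>0 (S\<^sup>2 *\<^sub>R r) = (1 / S ^ 4) *\<^sub>R hess\<^sub>0 r"
proof -
  have e: "e1 \<bullet> R\<^sub>0 = S\<^sup>2 * c" "R\<^sub>0 \<bullet> (S\<^sup>2 *\<^sub>R r) = S ^ 4 * (n\<^sub>0 \<bullet> r)" "e1 \<bullet> (S\<^sup>2 *\<^sub>R r) = S\<^sup>2 * r$1"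
    by (simp_all add: scaled_data n\<^sub>0_def inner_e1 eval_nat_numeral)
  define N where "N = n\<^sub>0 \<bullet> r"
  have 1: "(1 / (S\<^sup>2) ^ 3 + 3 * a / 2 * (1 / (S\<^sup>2) ^ 5) - 15 * a / 2 * ((S\<^sup>2 * c)\<^sup>2 * (1 / (S\<^sup>2) ^ 7))) * S\<^sup>2 = f / S ^ 4"
    using S by (simp add: f_def \<epsilon>_def field_simps eval_nat_numeral)
  have 2: "(- 3 / (S\<^sup>2) ^ 5 * (S ^ 4 * N) + 3 * a / 2 * (- 5 / (S\<^sup>2) ^ 7 * (S ^ 4 * N))
        - 15 * a / 2 * ((S\<^sup>2 * c)\<^sup>2 * (- 7 / (S\<^sup>2) ^ 9 * (S ^ 4 * N)) + 2 * (S\<^sup>2 * c) * (S\<^sup>2 * r$1) * (1 / (S\<^sup>2) ^ 7))) * S\<^sup>2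
      = ((- 3 + \<epsilon> * a * (- 15 / 2 + 105 / 2 * c\<^sup>2)) * N - 15 * c * \<epsilon> * a * r$1) / S ^ 4"
    using S by (simp add: \<epsilon>_def field_simps eval_nat_numeral)
  have 3: "3 * a * ((S\<^sup>2 * c) * (- 5 / (S\<^sup>2) ^ 7 * (S ^ 4 * N)) + (S\<^sup>2 * r$1) * (1 / (S\<^sup>2) ^ 5))
      = \<epsilon> * a * (3 * r$1 - 15 * c * N) / S ^ 4"
    using S by (simp add: \<epsilon>_def field_simps eval_nat_numeral)
  show ?thesis
    unfolding hess_potential_def norm_R\<^sub>0 e a_def[symmetric] N_def[symmetric] 3 hess\<^sub>0_def
    using 1 2 unfolding scaled_data(1)
    by (simp add: scaleR_add_right N_def[symmetric])
qed

text \<open>In rescaled length and time S survives only in \<epsilon>, including the factor in front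
  of the rate of change of the spin: the spin is smaller than the orbital angular momentum by
  \<open>S ^ 4\<close>.\<close>

lemma unstable_scaled:
  fixes u \<theta> :: "real^3"
  assumes k: "\<kappa> > 0" and m: "m\<^sub>0 \<noteq> 0" and \<theta>: "\<theta> \<noteq> 0"
  defines "F \<equiv> hess\<^sub>0 (u - \<theta> \<times> n\<^sub>0) + \<theta> \<times> g\<^sub>0"
  defines "W \<equiv> \<kappa> *\<^sub>R \<theta> + \<omega>\<^sub>0 \<times> \<theta>"
  defines "Z \<equiv> inertia_axi I\<^sub>1 I\<^sub>2 *v W + \<theta> \<times> l\<^sub>0"
  assumes U: "\<kappa>\<^sup>2 *\<^sub>R u + (2 * \<kappa>) *\<^sub>R (\<omega>\<^sub>0 \<times> u) + \<omega>\<^sub>0 \<times> (\<omega>\<^sub>0 \<times> u) + F = 0"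
    and T: "\<epsilon> *\<^sub>R (\<kappa> *\<^sub>R Z + \<omega>\<^sub>0 \<times> Z) = u \<times> g\<^sub>0 + n\<^sub>0 \<times> F"
    and A0: "e1 \<bullet> W = 0"
  shows "unstable (inertia_axi I\<^sub>1 I\<^sub>2) (\<xi>\<^sub>0, \<eta>\<^sub>0) (mat 1, R\<^sub>0, m\<^sub>0, P\<^sub>0)"
proof -
  define g where "g = grad_potential (I\<^sub>1 - I\<^sub>2) R\<^sub>0"
  have g: "g = (1 / S ^ 4) *\<^sub>R g\<^sub>0" by (simp only: g_def scaled_data(3))
  have F': "hess_potential (I\<^sub>1 - I\<^sub>2) R\<^sub>0 (S\<^sup>2 *\<^sub>R u - \<theta> \<times> R\<^sub>0) + \<theta> \<times> g = (1 / S ^ 4) *\<^sub>R F"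
  proof -
    have "S\<^sup>2 *\<^sub>R u - \<theta> \<times> R\<^sub>0 = S\<^sup>2 *\<^sub>R (u - \<theta> \<times> n\<^sub>0)"
      by (simp add: scaled_data cross_mult_right scaleR_diff_right)
    then show ?thesis by (simp add: hess_scaled F_def g cross_mult_right scaleR_add_right)
  qed
  have W': "(\<kappa> / S ^ 3) *\<^sub>R \<theta> + \<xi>\<^sub>0 \<times> \<theta> = (1 / S ^ 3) *\<^sub>R W"
    by (simp add: W_def scaled_data cross_mult_left scaleR_add_right)
  have Z': "inertia_axi I\<^sub>1 I\<^sub>2 *v ((1 / S ^ 3) *\<^sub>R W) + \<theta> \<times> (m\<^sub>0 - R\<^sub>0 \<times> P\<^sub>0) = (1 / S ^ 3) *\<^sub>R Z"
    by (simp add: Z_def scaled_data(4) cross_mult_right scaleR_add_right matrix_vector_mult_scaleR)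
  have "e1 \<times> \<xi>\<^sub>0 \<noteq> 0"
    using S A_pos cs k_nz by (simp add: \<xi>\<^sub>0_def \<omega>\<^sub>2_def vec3_eq_iff cross_components)
  moreover have "\<kappa> / S ^ 3 > 0" using k S by simp
  moreover have "(\<kappa> / S ^ 3)\<^sup>2 *\<^sub>R (S\<^sup>2 *\<^sub>R u) + (2 * (\<kappa> / S ^ 3)) *\<^sub>R (\<xi>\<^sub>0 \<times> (S\<^sup>2 *\<^sub>R u))
      + \<xi>\<^sub>0 \<times> (\<xi>\<^sub>0 \<times> (S\<^sup>2 *\<^sub>R u)) + (1 / S ^ 4) *\<^sub>R F = 0"
  proof -
    have q: "(\<kappa> / S ^ 3)\<^sup>2 * S\<^sup>2 = 1 / S ^ 4 * \<kappa>\<^sup>2" "2 * (\<kappa> / S ^ 3) * (S\<^sup>2 / S ^ 3) = 1 / S ^ 4 * (2 * \<kappa>)"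
      "1 / S ^ 3 * (S\<^sup>2 / S ^ 3) = 1 / S ^ 4"
      using S by (simp_all add: field_simps eval_nat_numeral)
    have "(\<kappa> / S ^ 3)\<^sup>2 *\<^sub>R (S\<^sup>2 *\<^sub>R u) + (2 * (\<kappa> / S ^ 3)) *\<^sub>R (\<xi>\<^sub>0 \<times> (S\<^sup>2 *\<^sub>R u))
      + \<xi>\<^sub>0 \<times> (\<xi>\<^sub>0 \<times> (S\<^sup>2 *\<^sub>R u)) + (1 / S ^ 4) *\<^sub>R F
      = ((\<kappa> / S ^ 3)\<^sup>2 * S\<^sup>2) *\<^sub>R u + (2 * (\<kappa> / S ^ 3) * (S\<^sup>2 / S ^ 3)) *\<^sub>R (\<omega>\<^sub>0 \<times> u)
        + (1 / S ^ 3 * (S\<^sup>2 / S ^ 3)) *\<^sub>R (\<omega>\<^sub>0 \<times> (\<omega>\<^sub>0 \<times> u)) + (1 / S ^ 4) *\<^sub>R F"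
      by (simp add: scaled_data cross_mult_left cross_mult_right)
    also have "\<dots> = (1 / S ^ 4) *\<^sub>R (\<kappa>\<^sup>2 *\<^sub>R u + (2 * \<kappa>) *\<^sub>R (\<omega>\<^sub>0 \<times> u) + \<omega>\<^sub>0 \<times> (\<omega>\<^sub>0 \<times> u) + F)"
      unfolding q by (simp only: scaleR_add_right scaleR_scaleR)
    finally show ?thesis unfolding U by simp
  qed
  moreover have "(\<kappa> / S ^ 3) *\<^sub>R ((1 / S ^ 3) *\<^sub>R Z) + \<xi>\<^sub>0 \<times> ((1 / S ^ 3) *\<^sub>R Z)
      = (S\<^sup>2 *\<^sub>R u) \<times> g + R\<^sub>0 \<times> ((1 / S ^ 4) *\<^sub>R F)"
  proof -
    have q: "\<kappa> / S ^ 3 * (1 / S ^ 3) = 1 / S\<^sup>2 * \<epsilon> * \<kappa>" "1 / S ^ 3 * (1 / S ^ 3) = 1 / S\<^sup>2 * \<epsilon>"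
      "S\<^sup>2 * (1 / S ^ 4) = 1 / S\<^sup>2"
      using S by (simp_all add: \<epsilon>_def field_simps eval_nat_numeral)
    have "(\<kappa> / S ^ 3) *\<^sub>R ((1 / S ^ 3) *\<^sub>R Z) + \<xi>\<^sub>0 \<times> ((1 / S ^ 3) *\<^sub>R Z)
      = (\<kappa> / S ^ 3 * (1 / S ^ 3)) *\<^sub>R Z + (1 / S ^ 3 * (1 / S ^ 3)) *\<^sub>R (\<omega>\<^sub>0 \<times> Z)"
      by (simp add: scaled_data cross_mult_left cross_mult_right)
    also have "\<dots> = (1 / S\<^sup>2) *\<^sub>R (\<epsilon> *\<^sub>R (\<kappa> *\<^sub>R Z + \<omega>\<^sub>0 \<times> Z))"
      unfolding q by (simp add: scaleR_add_right)
    also have "\<dots> = (S\<^sup>2 * (1 / S ^ 4)) *\<^sub>R (u \<times> g\<^sub>0) + (S\<^sup>2 * (1 / S ^ 4)) *\<^sub>R (n\<^sub>0 \<times> F)"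
      unfolding T q by (simp add: scaleR_add_right)
    also have "\<dots> = (S\<^sup>2 *\<^sub>R u) \<times> g + R\<^sub>0 \<times> ((1 / S ^ 4) *\<^sub>R F)"
      by (simp add: scaled_data(1) g cross_mult_left cross_mult_right)
    finally show ?thesis .
  qed
  moreover have "e1 \<bullet> ((1 / S ^ 3) *\<^sub>R W) = 0" using A0 by simp
  moreover have "\<xi>\<^sub>0 = body_rate I\<^sub>1 I\<^sub>2 R\<^sub>0 m\<^sub>0 P\<^sub>0 + \<eta>\<^sub>0 *\<^sub>R e1" by (simp add: body_rate_0)
  moreover have "I\<^sub>1 \<noteq> 0" "I\<^sub>2 \<noteq> 0" using I by auto
  ultimately show ?thesis
    using unstable_criterion[of I\<^sub>1 I\<^sub>2 R\<^sub>0 \<xi>\<^sub>0 m\<^sub>0 P\<^sub>0 \<eta>\<^sub>0 g "\<kappa> / S ^ 3" \<theta> "S\<^sup>2 *\<^sub>R u", unfolded F' W' Z']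
      I(3) R\<^sub>0_nz P\<^sub>0_eq m\<^sub>0_cross_\<xi>\<^sub>0 P\<^sub>0_cross_\<xi>\<^sub>0[folded g_def] m \<theta> by blast
qed

text \<open>The equations of \<open>oblate_limit\<close> are written for positive k. The sign
  \<sigma> is absorbed into the third component of the position and the second of the rotation. The
  torque equations have a factor \<epsilon> on both sides, and cancelling it gives the last two
  equations of the hypothesis.\<close>

lemma oblate_unstable:
  fixes \<kappa> y' z :: real and v :: "real^3"
  assumes a: "a > 0" "I\<^sub>2 > 3 * a" and m: "m\<^sub>0 \<noteq> 0" and \<kappa>: "\<kappa> > 0" and nz: "y' \<noteq> 0 \<or> z \<noteq> 0"
    and v: "oblate_limit.r1 a c s \<epsilon> \<kappa> \<bullet> v + \<epsilon> * (y' * oblate_limit.cy a c $ 1 + z * oblate_limit.cz a c s $ 1) = 0"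
      "oblate_limit.r2 a c s \<epsilon> \<kappa> \<bullet> v + \<epsilon> * (y' * oblate_limit.cy a c $ 2 + z * oblate_limit.cz a c s $ 2) = 0"
      "oblate_limit.r3 a c s \<epsilon> \<kappa> \<bullet> v + \<epsilon> * (y' * oblate_limit.cy a c $ 3 + z * oblate_limit.cz a c s $ 3) = 0"
      "y' * oblate_limit.m11 I\<^sub>2 a c s \<epsilon> \<kappa> + z * oblate_limit.m12 I\<^sub>2 a c s \<epsilon> \<kappa> + oblate_limit.cy a c \<bullet> v = 0"
      "- y' * oblate_limit.m12 I\<^sub>2 a c s \<epsilon> \<kappa> + z * oblate_limit.m22 I\<^sub>2 a c s \<epsilon> \<kappa> + oblate_limit.cz a c s \<bullet> v = 0"
  shows "unstable (inertia_axi I\<^sub>1 I\<^sub>2) (\<xi>\<^sub>0, \<eta>\<^sub>0) (mat 1, R\<^sub>0, m\<^sub>0, P\<^sub>0)"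
proof -
  interpret Q: oblate_limit I\<^sub>2 a c s
    by unfold_locales (use a cs in \<open>auto simp: s2\<close>)
  define D where "D = L\<^sub>1 - I\<^sub>2 * \<omega>\<^sub>1"
  have \<sigma>s: "\<sigma> * \<sigma> = 1" "\<bar>k\<bar> = \<sigma> * k" "1 / \<sigma> = \<sigma>" "x / \<bar>k\<bar> = \<sigma> * (x / k)" for x
    using k_nz by (auto simp: \<sigma>_def sgn_if)
  have kk: "Q.kk \<epsilon> = \<bar>k\<bar>" unfolding Q.kk_def k2[symmetric] by simp
  have AA: "Q.AA \<epsilon> = A" by (simp add: Q.AA_def A_def)
  have w1: "Q.w1 \<epsilon> = \<sigma> * \<omega>\<^sub>1" unfolding Q.w1_def kk \<omega>\<^sub>1_def f_def[symmetric] \<sigma>s(4) ..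
  have w2: "Q.w2 \<epsilon> = \<sigma> * \<omega>\<^sub>2"
  proof -
    have "Q.w2 \<epsilon> = (- A * c / 2) / \<bar>k\<bar>" by (simp add: Q.w2_def kk AA)
    also have "\<dots> = \<sigma> * \<omega>\<^sub>2" unfolding \<sigma>s(4) by (simp add: \<omega>\<^sub>2_def)
    finally show ?thesis .
  qed
  have DD: "Q.DD \<epsilon> = \<sigma> * D" by (simp add: Q.DD_def kk AA \<sigma>s(2) D_def L\<^sub>1_def)
  have \<omega>D: "\<omega>\<^sub>2 * D = 3 * a * c * s"
    using A_pos k_nz by (simp add: D_def L\<^sub>1_def \<omega>\<^sub>2_def field_simps)
  have fA: "A / 2 - f = 3 * a * \<epsilon>" by (simp add: f_def A_def field_simps)
  define u1 u2 u3 y t where "u1 = v $ 1" and "u2 = v $ 2" and "u3 = \<sigma> * v $ 3" and "y = \<sigma> * y'"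
    \<comment> \<open>The rotation about the symmetry axis is chosen so that the variation of the
      axial body rate vanishes, as conservation of the axial spin requires.\<close>
    and "t = - z * \<omega>\<^sub>2 / \<kappa>"
  have hat: "v $ 1 = u1" "v $ 2 = u2" "v $ 3 = \<sigma> * u3" "y' = \<sigma> * y"
    by (simp_all add: u1_def u2_def u3_def y_def \<sigma>s(1) flip: mult.assoc)
  have t: "\<kappa> * t + \<omega>\<^sub>2 * z = 0" using \<kappa> by (simp add: t_def)
  have v1: "(\<kappa>\<^sup>2 - \<omega>\<^sub>2\<^sup>2 + 1 - 3 * c\<^sup>2 + \<epsilon> * Q.g11) * u1 + (\<omega>\<^sub>1 * \<omega>\<^sub>2 - 3 * c * s + \<epsilon> * Q.g12) * u2 + 2 * \<kappa> * \<omega>\<^sub>2 * u3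
      + \<epsilon> * z * (3 * a * (s - 5 * c\<^sup>2 * s)) = 0"
    using v(1) \<sigma>s(1) unfolding Q.r1_def Q.cy_def Q.cz_def Q.WW_def w1 w2
    by (simp add: inner_vec_def sum_3 hat) algebra
  have v2: "(\<omega>\<^sub>1 * \<omega>\<^sub>2 - 3 * c * s + \<epsilon> * Q.g12) * u1 + (\<kappa>\<^sup>2 - \<omega>\<^sub>1\<^sup>2 + 1 - 3 * s\<^sup>2 + \<epsilon> * Q.g22) * u2 - 2 * \<kappa> * \<omega>\<^sub>1 * u3
      + \<epsilon> * z * (3 * a * (c - 5 * c * s\<^sup>2)) = 0"
    using v(2) \<sigma>s(1) unfolding Q.r2_def Q.cy_def Q.cz_def Q.WW_def w1 w2
    by (simp add: inner_vec_def sum_3 hat) algebra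
  have v3: "- 2 * \<kappa> * \<omega>\<^sub>2 * u1 + 2 * \<kappa> * \<omega>\<^sub>1 * u2 + (\<kappa>\<^sup>2 - \<omega>\<^sub>1\<^sup>2 - \<omega>\<^sub>2\<^sup>2 + 1 + \<epsilon> * Q.g33) * u3 - \<epsilon> * y * (3 * a * c) = 0"
    using v(3) \<sigma>s(1) unfolding Q.r3_def Q.cy_def Q.cz_def Q.WW_def w1 w2
    by (simp add: inner_vec_def sum_3 hat) algebra
  have v4: "y * (\<kappa>\<^sup>2 * I\<^sub>2 + \<omega>\<^sub>1 * D - 3 * a * c\<^sup>2) + z * (\<kappa> * (D - \<omega>\<^sub>1 * I\<^sub>2)) - 3 * a * c * u3 = 0"
    using v(4) \<sigma>s(1) unfolding Q.m11_def Q.m12_def Q.cy_def w1 w2 DD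
    by (simp add: inner_vec_def sum_3 hat) algebra
  have v5: "- y * (\<kappa> * (D - \<omega>\<^sub>1 * I\<^sub>2)) + z * (I\<^sub>2 * \<kappa>\<^sup>2 + \<omega>\<^sub>1 * D + I\<^sub>2 * \<omega>\<^sub>2\<^sup>2 - 3 * a * (c\<^sup>2 - s\<^sup>2))
      + 3 * a * (s - 5 * c\<^sup>2 * s) * u1 + 3 * a * (c - 5 * c * s\<^sup>2) * u2 = 0"
    using v(5) \<sigma>s(1) unfolding Q.m12_def Q.m22_def Q.cz_def w1 w2 DD
    by (simp add: inner_vec_def sum_3 hat) algebra
  define u \<theta> :: "real^3" where "u = vector [u1, u2, u3]" and "\<theta> = vector [t, y, z]"
  define h1 h2 h3 where "h1 = (1 - 3 * c\<^sup>2 + \<epsilon> * Q.g11) * u1 + (- 3 * c * s + \<epsilon> * Q.g12) * u2 + \<epsilon> * z * (3 * a * (s - 5 * c\<^sup>2 * s))"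
    and "h2 = (- 3 * c * s + \<epsilon> * Q.g12) * u1 + (1 - 3 * s\<^sup>2 + \<epsilon> * Q.g22) * u2 + \<epsilon> * z * (3 * a * (c - 5 * c * s\<^sup>2))"
    and "h3 = f * u3 - \<epsilon> * y * (3 * a * c)"
  have F: "hess\<^sub>0 (u - \<theta> \<times> n\<^sub>0) + \<theta> \<times> g\<^sub>0 = vector [h1, h2, h3]"
  proof -
    have N: "n\<^sub>0 \<bullet> (u - \<theta> \<times> n\<^sub>0) = c * u1 + s * u2"
      by (simp add: n\<^sub>0_def u_def inner_vec_def sum_3 cross_components algebra_simps)
    have "(hess\<^sub>0 (u - \<theta> \<times> n\<^sub>0) + \<theta> \<times> g\<^sub>0) $ 1 = h1" "(hess\<^sub>0 (u - \<theta> \<times> n\<^sub>0) + \<theta> \<times> g\<^sub>0) $ 2 = h2"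
      "(hess\<^sub>0 (u - \<theta> \<times> n\<^sub>0) + \<theta> \<times> g\<^sub>0) $ 3 = h3"
      unfolding hess\<^sub>0_def N
      by (simp_all add: n\<^sub>0_def u_def \<theta>_def g\<^sub>0_def cross_components inner_e1 axis_def h1_def h2_def h3_def
          Q.g11_def Q.g12_def Q.g22_def f_def A_def field_simps power2_eq_square)
    then show ?thesis by (simp add: vec3_eq_iff)
  qed
  have W: "\<kappa> *\<^sub>R \<theta> + \<omega>\<^sub>0 \<times> \<theta> = vector [0, \<kappa> * y - \<omega>\<^sub>1 * z, \<kappa> * z + \<omega>\<^sub>1 * y - \<omega>\<^sub>2 * t]"
    using t by (simp add: \<theta>_def \<omega>\<^sub>0_def vec3_eq_iff cross_components)
  have Z: "inertia_axi I\<^sub>1 I\<^sub>2 *v (\<kappa> *\<^sub>R \<theta> + \<omega>\<^sub>0 \<times> \<theta>) + \<theta> \<times> l\<^sub>0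
      = vector [- z * I\<^sub>2 * \<omega>\<^sub>2, I\<^sub>2 * \<kappa> * y + z * D, I\<^sub>2 * \<kappa> * z - y * D]"
    unfolding W by (simp add: \<theta>_def l\<^sub>0_def vec3_eq_iff cross_components inertia_axi_mult inner_e1 D_def algebra_simps)
  have g33: "f = 1 + \<epsilon> * Q.g33" by (simp add: f_def Q.g33_def field_simps)
  show ?thesis
  proof (rule unstable_scaled[of \<kappa> \<theta> u])
    show "\<theta> \<noteq> 0" using nz \<sigma>s(1) by (auto simp: \<theta>_def y_def vec3_eq_iff)
    have U1: "\<kappa>\<^sup>2 * u1 + 2 * \<kappa> * \<omega>\<^sub>2 * u3 - \<omega>\<^sub>2 * (\<omega>\<^sub>2 * u1 - \<omega>\<^sub>1 * u2) + h1 = 0"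
      using v1 unfolding h1_def by algebra
    have U2: "\<kappa>\<^sup>2 * u2 - 2 * \<kappa> * \<omega>\<^sub>1 * u3 + \<omega>\<^sub>1 * (\<omega>\<^sub>2 * u1 - \<omega>\<^sub>1 * u2) + h2 = 0"
      using v2 unfolding h2_def by algebra
    have U3: "\<kappa>\<^sup>2 * u3 + 2 * \<kappa> * (\<omega>\<^sub>1 * u2 - \<omega>\<^sub>2 * u1) - (\<omega>\<^sub>1\<^sup>2 + \<omega>\<^sub>2\<^sup>2) * u3 + h3 = 0"
      using v3 unfolding h3_def g33 by algebra
    show "\<kappa>\<^sup>2 *\<^sub>R u + (2 * \<kappa>) *\<^sub>R (\<omega>\<^sub>0 \<times> u) + \<omega>\<^sub>0 \<times> (\<omega>\<^sub>0 \<times> u) + (hess\<^sub>0 (u - \<theta> \<times> n\<^sub>0) + \<theta> \<times> g\<^sub>0) = 0"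
      unfolding F using U1 U2 U3
      by (simp add: u_def \<omega>\<^sub>0_def vec3_eq_iff cross_components algebra_simps power2_eq_square)
    \<comment> \<open>The torque about the symmetry axis balances identically by
      \<open>\<omega>D\<close>; it imposes no equation on the unknowns.\<close>
    have T1: "\<epsilon> * (- \<omega>\<^sub>2 * D * y) = - u3 * (f * s) + s * h3"
      using \<omega>D unfolding h3_def by algebra
    \<comment> \<open>The right side is of order \<epsilon> because
      \<open>A / 2 - f = 3 * a * \<epsilon>\<close>: the leading central force exerts no net torque
      on the body.\<close>
    have T2: "\<epsilon> * (\<kappa> * (I\<^sub>2 * \<kappa> * y + z * D) - \<omega>\<^sub>1 * (I\<^sub>2 * \<kappa> * z - y * D)) = u3 * (A * c / 2) - c * h3"
    proof -
      have "u3 * (A * c / 2) - c * h3 = c * u3 * (A / 2 - f) + 3 * a * \<epsilon> * c\<^sup>2 * y"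
        unfolding h3_def by (simp add: algebra_simps power2_eq_square)
      then show ?thesis unfolding fA using v4 by algebra
    qed
    have T3: "\<epsilon> * (\<kappa> * (I\<^sub>2 * \<kappa> * z - y * D) + \<omega>\<^sub>1 * (I\<^sub>2 * \<kappa> * y + z * D) + \<omega>\<^sub>2 * (z * I\<^sub>2 * \<omega>\<^sub>2))
        = u1 * (f * s) - u2 * (A * c / 2) + (c * h2 - s * h1)"
    proof -
      have g: "c * Q.g12 - s * Q.g11 = a * (- 9 / 2 * s + 45 / 2 * c\<^sup>2 * s)"
        "c * Q.g22 - s * Q.g12 = a * (3 / 2 * c - 15 / 2 * c * c\<^sup>2 + 15 * c * s\<^sup>2)"
        unfolding Q.g11_def Q.g12_def Q.g22_def by (simp_all add: algebra_simps power2_eq_square)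
      have hs: "c * h2 - s * h1 = u1 * (- s + \<epsilon> * (c * Q.g12 - s * Q.g11)) + u2 * (c + \<epsilon> * (c * Q.g22 - s * Q.g12))
          + 3 * a * \<epsilon> * z * (c\<^sup>2 - s\<^sup>2)"
        unfolding h1_def h2_def using s2 by algebra
      have fA': "f = 1 + \<epsilon> * a * (3 / 2 - 15 / 2 * c\<^sup>2)" "A / 2 = 1 + \<epsilon> * a * (9 / 2 - 15 / 2 * c\<^sup>2)"
        by (simp_all add: f_def A_def field_simps)
      have "u1 * (f * s) - u2 * (A / 2 * c) + (c * h2 - s * h1)
        = \<epsilon> * (- (3 * a * (s - 5 * c\<^sup>2 * s) * u1 + 3 * a * (c - 5 * c * s\<^sup>2) * u2) + 3 * a * z * (c\<^sup>2 - s\<^sup>2))"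
        unfolding hs g fA' by (simp add: algebra_simps power2_eq_square)
      also have "\<dots> = \<epsilon> * (\<kappa> * (I\<^sub>2 * \<kappa> * z - y * D) + \<omega>\<^sub>1 * (I\<^sub>2 * \<kappa> * y + z * D) + \<omega>\<^sub>2 * (z * I\<^sub>2 * \<omega>\<^sub>2))"
        using v5 by algebra
      finally show ?thesis by simp
    qed
    show "\<epsilon> *\<^sub>R (\<kappa> *\<^sub>R (inertia_axi I\<^sub>1 I\<^sub>2 *v (\<kappa> *\<^sub>R \<theta> + \<omega>\<^sub>0 \<times> \<theta>) + \<theta> \<times> l\<^sub>0)
        + \<omega>\<^sub>0 \<times> (inertia_axi I\<^sub>1 I\<^sub>2 *v (\<kappa> *\<^sub>R \<theta> + \<omega>\<^sub>0 \<times> \<theta>) + \<theta> \<times> l\<^sub>0))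
        = u \<times> g\<^sub>0 + n\<^sub>0 \<times> (hess\<^sub>0 (u - \<theta> \<times> n\<^sub>0) + \<theta> \<times> g\<^sub>0)"
      unfolding Z F using T1 T2 T3
      by (simp add: u_def \<omega>\<^sub>0_def n\<^sub>0_def g\<^sub>0_def vec3_eq_iff cross_components algebra_simps)
    show "e1 \<bullet> (\<kappa> *\<^sub>R \<theta> + \<omega>\<^sub>0 \<times> \<theta>) = 0" unfolding W by (simp add: inner_e1)
  qed (use \<kappa> m in auto)
qed

end

section \<open>The limit of large radius\<close>

context reduced_energy
begin

text \<open>The equilibrium as a function of e alone, with k taken positive. Free of S and
  \<Lambda>, it allows the bound on e to be chosen before the radius.\<close>

definition "kc \<psi> e = sqrt (1 + (3 - 9 * (cos \<psi>)\<^sup>2) / 2 * a * e)"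
definition "Ac \<psi> e = 2 + (9 - 15 * (cos \<psi>)\<^sup>2) * a * e"
definition "Lc \<psi> e = I\<^sub>2 * ((1 + (3 - 15 * (cos \<psi>)\<^sup>2) / 2 * a * e) * sin \<psi> / kc \<psi> e) - 6 * a * sin \<psi> * kc \<psi> e / Ac \<psi> e"
definition "\<tau>c \<psi> e = I\<^sub>2 * (- Ac \<psi> e * cos \<psi> / (2 * kc \<psi> e))"
definition "mc \<psi> e = sqrt ((kc \<psi> e + e * ga (Lc \<psi> e) \<psi> (\<tau>c \<psi> e))\<^sup>2 + e\<^sup>2 * (al (Lc \<psi> e) \<psi> (\<tau>c \<psi> e))\<^sup>2)"
definition "equilibrium_curve \<psi> e = (e, mc \<psi> e, Lc \<psi> e, 1 :: real, \<psi>, \<tau>c \<psi> e)"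

lemma equilibrium_curve_tendsto: "((\<lambda>e. equilibrium_curve \<psi> e) \<longlongrightarrow> centre \<psi>) (at 0)"
proof -
  have k: "isCont (kc \<psi>) 0" unfolding kc_def[abs_def] by (intro continuous_intros)
  have A: "isCont (Ac \<psi>) 0" unfolding Ac_def[abs_def] by (intro continuous_intros)
  have 0: "kc \<psi> 0 = 1" "Ac \<psi> 0 = 2" by (simp_all add: kc_def Ac_def)
  have L: "isCont (Lc \<psi>) 0" unfolding Lc_def[abs_def] by (intro continuous_intros k A) (simp_all add: 0)
  have t: "isCont (\<tau>c \<psi>) 0" unfolding \<tau>c_def[abs_def] by (intro continuous_intros k A) (simp_all add: 0)
  have "isCont (mc \<psi>) 0" unfolding mc_def[abs_def] al_def ga_def by (intro continuous_intros k L t)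
  then have "isCont (equilibrium_curve \<psi>) 0"
    unfolding equilibrium_curve_def[abs_def] by (intro continuous_intros L t)
  moreover have "equilibrium_curve \<psi> 0 = centre \<psi>"
    by (simp add: equilibrium_curve_def centre_def mc_def Lc_def \<tau>c_def 0 algebra_simps)
  ultimately show ?thesis by (simp add: isCont_def)
qed

end

text \<open>Reversing the sign of \<Lambda> reverses k and the rescaled spin components, but after
  multiplication by \<sigma> the data depend on \<epsilon> and \<psi> only. Both square roots for
  \<lambda> therefore lie on one curve.\<close>

lemma (in conical) x\<^sub>r_on_curve: "x\<^sub>r = E.equilibrium_curve \<psi> \<epsilon>"
proof -
  have \<sigma>k: "\<bar>k\<bar> = \<sigma> * k" "x / \<bar>k\<bar> = \<sigma> * (x / k)" for x
    using k_nz by (auto simp: \<sigma>_def sgn_if)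
  have k: "E.kc \<psi> \<epsilon> = \<bar>k\<bar>" unfolding E.kc_def k2[symmetric] by simp
  have A: "E.Ac \<psi> \<epsilon> = A" by (simp add: E.Ac_def A_def)
  have "(1 + (3 - 15 * c\<^sup>2) / 2 * a * \<epsilon>) * s / \<bar>k\<bar> = \<sigma> * \<omega>\<^sub>1"
    unfolding f_def[symmetric] \<sigma>k(2) \<omega>\<^sub>1_def ..
  then have L: "E.Lc \<psi> \<epsilon> = L\<^sub>r"
    unfolding E.Lc_def k A by (simp add: L\<^sub>r_def L\<^sub>1_def \<sigma>k(1) algebra_simps)
  have "- A * c / (2 * \<bar>k\<bar>) = (- A * c / 2) / \<bar>k\<bar>" by simp
  also have "\<dots> = \<sigma> * \<omega>\<^sub>2" unfolding \<sigma>k(2) by (simp add: \<omega>\<^sub>2_def)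
  finally have \<tau>: "E.\<tau>c \<psi> \<epsilon> = \<tau>\<^sub>r" unfolding E.\<tau>c_def k A by (simp add: \<tau>\<^sub>r_def mult_ac)
  have "m\<^sub>r \<ge> 0" using S by (simp add: m\<^sub>r_def)
  then have "E.mc \<psi> \<epsilon> = m\<^sub>r" unfolding E.mc_def L \<tau> k m\<^sub>r_sq[symmetric] by simp
  then show ?thesis by (simp add: x\<^sub>r_def E.equilibrium_curve_def L \<tau>)
qed

text \<open>The quantities of \<open>oblate_limit\<close> do not mention S or \<Lambda>, so the
  threshold for e is uniform in both.\<close>

lemma oblate_unstable_limit:
  assumes I: "0 < I\<^sub>1" "0 < I\<^sub>2" "I\<^sub>1 > I\<^sub>2" "4 * I\<^sub>2 > 3 * I\<^sub>1" and c: "cos \<psi> \<noteq> 0"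
  shows "\<exists>e0>0. \<forall>S \<Lambda>. conical I\<^sub>1 I\<^sub>2 \<psi> S \<Lambda> \<longrightarrow> 1 / S ^ 4 < e0 \<longrightarrow> conical.m\<^sub>0 I\<^sub>1 I\<^sub>2 \<psi> S \<Lambda> \<noteq> 0 \<longrightarrow>
    unstable (inertia_axi I\<^sub>1 I\<^sub>2) (conical_velocity I\<^sub>1 I\<^sub>2 \<psi> (S\<^sup>2) (\<Lambda> / S ^ 5))
      (conical_point I\<^sub>1 I\<^sub>2 \<psi> (S\<^sup>2) (\<Lambda> / S ^ 5))"
proof -
  interpret Q: oblate_limit I\<^sub>2 "I\<^sub>1 - I\<^sub>2" "cos \<psi>" "sin \<psi>"
    by unfold_locales (use I c in auto)
  obtain e0 where e0: "e0 > 0" and sol: "\<And>e. 0 < e \<Longrightarrow> e < e0 \<Longrightarrow> (\<exists>k>0. \<exists>u y z. (y \<noteq> 0 \<or> z \<noteq> 0)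
     \<and> Q.r1 e k \<bullet> u + e * (y * Q.cy$1 + z * Q.cz$1) = 0
     \<and> Q.r2 e k \<bullet> u + e * (y * Q.cy$2 + z * Q.cz$2) = 0
     \<and> Q.r3 e k \<bullet> u + e * (y * Q.cy$3 + z * Q.cz$3) = 0
     \<and> y * Q.m11 e k + z * Q.m12 e k + Q.cy \<bullet> u = 0
     \<and> - y * Q.m12 e k + z * Q.m22 e k + Q.cz \<bullet> u = 0)"
    using Q.solution_exists by blast
  show ?thesis
  proof (intro exI[of _ e0] conjI allI impI)
    fix S \<Lambda> assume K: "conical I\<^sub>1 I\<^sub>2 \<psi> S \<Lambda>" and e: "1 / S ^ 4 < e0" and m: "conical.m\<^sub>0 I\<^sub>1 I\<^sub>2 \<psi> S \<Lambda> \<noteq> 0"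
    interpret C: conical I\<^sub>1 I\<^sub>2 \<psi> S \<Lambda> by fact
    have "C.a > 0" "I\<^sub>2 > 3 * C.a" using I by (simp_all add: C.a_def)
    moreover have "C.\<epsilon> < e0" using e by (simp add: C.\<epsilon>_def)
    ultimately show "unstable (inertia_axi I\<^sub>1 I\<^sub>2) (conical_velocity I\<^sub>1 I\<^sub>2 \<psi> (S\<^sup>2) (\<Lambda> / S ^ 5))
        (conical_point I\<^sub>1 I\<^sub>2 \<psi> (S\<^sup>2) (\<Lambda> / S ^ 5))"
      unfolding C.conical_velocity_eq C.conical_point_eq
      using sol[OF C.\<epsilon>_pos] C.oblate_unstable[OF _ _ m] unfolding C.a_def[symmetric] by blast
  qed (fact e0)
qed

theorem proposition4p13:
  fixes I\<^sub>1 I\<^sub>2 \<psi> :: real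
  assumes "I\<^sub>1 \<noteq> I\<^sub>2"
    and "0 < I\<^sub>1" "I\<^sub>1 < 1/2" "0 < I\<^sub>2" "I\<^sub>2 < 1/2"
    and "I\<^sub>1 + 2 * I\<^sub>2 = 1"
    and "- pi < \<psi>" "\<psi> \<le> pi"
    and "\<psi> \<notin> {0, pi/2, - pi/2, pi}"
  shows "\<exists>R\<^sub>0 > 0. \<forall>R > R\<^sub>0. \<forall>l. l\<^sup>2 = conical_lambda_squared I\<^sub>1 I\<^sub>2 \<psi> R \<longrightarrow>
     relative_equilibrium (inertia_axi I\<^sub>1 I\<^sub>2) (conical_velocity I\<^sub>1 I\<^sub>2 \<psi> R l)
       (conical_point I\<^sub>1 I\<^sub>2 \<psi> R l)
     \<and> (I\<^sub>1 < I\<^sub>2 \<longrightarrow>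
          Gmu_stable (inertia_axi I\<^sub>1 I\<^sub>2) (conical_point I\<^sub>1 I\<^sub>2 \<psi> R l))
     \<and> (I\<^sub>1 > I\<^sub>2 \<and> 4 * I\<^sub>2 > 3 * I\<^sub>1 \<longrightarrow>
          unstable (inertia_axi I\<^sub>1 I\<^sub>2) (conical_velocity I\<^sub>1 I\<^sub>2 \<psi> R l)
            (conical_point I\<^sub>1 I\<^sub>2 \<psi> R l))"
proof -
  define a where "a = I\<^sub>1 - I\<^sub>2"
  have cs: "cos \<psi> \<noteq> 0" "sin \<psi> \<noteq> 0"
  proof -
    have "0 < \<psi> \<and> \<psi> < pi \<or> 0 < - \<psi> \<and> - \<psi> < pi" using assms(7-9) by auto
    then show "sin \<psi> \<noteq> 0" using sin_gt_zero[of \<psi>] sin_gt_zero[of "- \<psi>"] by auto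
    show "cos \<psi> \<noteq> 0"
    proof
      assume "cos \<psi> = 0"
      then have "\<bar>\<psi>\<bar> = pi / 2" using cos_inj_pi[of "\<bar>\<psi>\<bar>" "pi / 2"] assms(7,8) by auto
      then show False using assms(9) by auto
    qed
  qed
  interpret E: reduced_energy I\<^sub>2 a by unfold_locales (use assms in simp)
  \<comment> \<open>The bound d <= 1 serves to exclude a vanishing angular momentum, since its
    rescaled norm is 1 at the centre. If a is not negative, \<open>good\<close> is not claimed and
    the radius 1 is a default.\<close>
  obtain d where d: "d > 0" "d \<le> 1" and good: "a < 0 \<Longrightarrow> x \<in> ball (E.centre \<psi>) d \<Longrightarrow> E.good x" for x
  proof (cases "a < 0")
    case True
    then obtain r where "r > 0" "\<And>x. dist x (E.centre \<psi>) < r \<Longrightarrow> E.good x"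
      using E.good_near_centre cs unfolding eventually_nhds_metric by meson
    then show thesis by (intro that[of "min r 1"]) (auto simp: dist_commute)
  qed (use that[of 1] in auto)
  have "\<forall>\<^sub>F e in at_right 0. E.equilibrium_curve \<psi> e \<in> ball (E.centre \<psi>) d"
    using E.equilibrium_curve_tendsto[of \<psi>] d(1)
    by (intro tendstoD[THEN eventually_mono, OF filterlim_mono[OF _ order_refl at_le]]) (auto simp: dist_commute)
  moreover have "\<forall>\<^sub>F e in at_right 0. 2 + b * a * e > 0" for b
  proof -
    have "((\<lambda>e. 2 + b * a * e) \<longlongrightarrow> 2 + b * a * 0) (at_right 0)" by (intro tendsto_intros)
    then show ?thesis by (rule order_tendstoD) simp
  qed
  note this[of "9 - 15 * (cos \<psi>)\<^sup>2"] this[of "3 - 9 * (cos \<psi>)\<^sup>2"]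
  ultimately have "\<forall>\<^sub>F e in at_right 0. E.equilibrium_curve \<psi> e \<in> ball (E.centre \<psi>) d
      \<and> 2 + (9 - 15 * (cos \<psi>)\<^sup>2) * a * e > 0 \<and> 2 + (3 - 9 * (cos \<psi>)\<^sup>2) * a * e > 0"
    by (intro eventually_conj)
  then obtain b where b: "b > 0" and near: "\<And>e. 0 < e \<Longrightarrow> e < b \<Longrightarrow> E.equilibrium_curve \<psi> e \<in> ball (E.centre \<psi>) d
      \<and> 2 + (9 - 15 * (cos \<psi>)\<^sup>2) * a * e > 0 \<and> 2 + (3 - 9 * (cos \<psi>)\<^sup>2) * a * e > 0"
    unfolding eventually_at_right_field by auto
  \<comment> \<open>The case distinction sits inside the existential so that a single radius can be
    chosen for all bodies; outside the oblate case 1 is a default value.\<close>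
  have "\<exists>e0>0. I\<^sub>1 > I\<^sub>2 \<and> 4 * I\<^sub>2 > 3 * I\<^sub>1 \<longrightarrow>
      (\<forall>S \<Lambda>. conical I\<^sub>1 I\<^sub>2 \<psi> S \<Lambda> \<longrightarrow> 1 / S ^ 4 < e0 \<longrightarrow> conical.m\<^sub>0 I\<^sub>1 I\<^sub>2 \<psi> S \<Lambda> \<noteq> 0 \<longrightarrow>
        unstable (inertia_axi I\<^sub>1 I\<^sub>2) (conical_velocity I\<^sub>1 I\<^sub>2 \<psi> (S\<^sup>2) (\<Lambda> / S ^ 5))
          (conical_point I\<^sub>1 I\<^sub>2 \<psi> (S\<^sup>2) (\<Lambda> / S ^ 5)))"
  proof (cases "I\<^sub>1 > I\<^sub>2 \<and> 4 * I\<^sub>2 > 3 * I\<^sub>1")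
    case True
    then show ?thesis using oblate_unstable_limit[of I\<^sub>1 I\<^sub>2 \<psi>] assms(2,4) cs(1) by blast
  qed (auto intro: exI[of _ 1])
  then obtain e0 where e0: "e0 > 0" and oblate: "\<And>S \<Lambda>. I\<^sub>1 > I\<^sub>2 \<and> 4 * I\<^sub>2 > 3 * I\<^sub>1 \<Longrightarrow> conical I\<^sub>1 I\<^sub>2 \<psi> S \<Lambda> \<Longrightarrow>
      1 / S ^ 4 < e0 \<Longrightarrow> conical.m\<^sub>0 I\<^sub>1 I\<^sub>2 \<psi> S \<Lambda> \<noteq> 0 \<Longrightarrow>
        unstable (inertia_axi I\<^sub>1 I\<^sub>2) (conical_velocity I\<^sub>1 I\<^sub>2 \<psi> (S\<^sup>2) (\<Lambda> / S ^ 5))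
          (conical_point I\<^sub>1 I\<^sub>2 \<psi> (S\<^sup>2) (\<Lambda> / S ^ 5))" by blast
  \<comment> \<open>With \<epsilon> = \<open>1 / R\<^sup>2\<close>, a radius above this value means
    that \<epsilon> lies below both thresholds.\<close>
  define R\<^sub>0 where "R\<^sub>0 = 1 / sqrt (min e0 b)"
  have R\<^sub>0: "R\<^sub>0 > 0" using e0 b by (simp add: R\<^sub>0_def)
  show ?thesis
  proof (rule exI[of _ R\<^sub>0], intro conjI[OF R\<^sub>0] allI impI)
    fix R l assume R: "R > R\<^sub>0" and l: "l\<^sup>2 = conical_lambda_squared I\<^sub>1 I\<^sub>2 \<psi> R"
    define S \<Lambda> where "S = sqrt R" and "\<Lambda> = l * S ^ 5"
    have R_pos: "R > 0" using R R\<^sub>0 by simp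
    then have S: "S > 0" "S\<^sup>2 = R" "\<Lambda> / S ^ 5 = l" by (simp_all add: S_def \<Lambda>_def)
    have S4: "S ^ 4 = R\<^sup>2" unfolding S(2)[symmetric] by simp
    have "1 / R\<^sup>2 < 1 / R\<^sub>0\<^sup>2"
      using R R\<^sub>0 by (intro divide_strict_left_mono power_strict_mono) auto
    also have "\<dots> = min e0 b" using e0 b by (simp add: R\<^sub>0_def power_divide)
    finally have e: "0 < 1 / S ^ 4" "1 / S ^ 4 < e0" "1 / S ^ 4 < b" using R_pos by (simp_all add: S4)
    interpret C: conical I\<^sub>1 I\<^sub>2 \<psi> S \<Lambda>
    proof
      show "2 + (9 - 15 * (cos \<psi>)\<^sup>2) * (I\<^sub>1 - I\<^sub>2) / S ^ 4 > 0" "2 + (3 - 9 * (cos \<psi>)\<^sup>2) * (I\<^sub>1 - I\<^sub>2) / S ^ 4 > 0"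
        using near[OF e(1,3)] by (simp_all add: a_def)
      \<comment> \<open>Powers of R are pulled out of the given formula for \<lambda> squared: its
        weight in R is cancelled by \<open>S ^ 10 = R ^ 5\<close>, which is why \<Lambda> is l times
        \<open>S ^ 5\<close>.\<close>
      define p q where "p = (9 - 15 * (cos \<psi>)\<^sup>2) * (I\<^sub>1 - I\<^sub>2)" and "q = (3 - 9 * (cos \<psi>)\<^sup>2) * (I\<^sub>1 - I\<^sub>2)"
      have q: "2 + q / S ^ 4 > 0" using near[OF e(1,3)] by (simp add: a_def q_def)
      have eq: "2 * R\<^sup>2 + p = R\<^sup>2 * (2 + p / S ^ 4)" "2 * R\<^sup>2 + q = R\<^sup>2 * (2 + q / S ^ 4)"
        using R_pos by (simp_all add: S4 field_simps)
      have "S ^ 10 = R ^ 5" unfolding S(2)[symmetric] by simp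
      then have "\<Lambda>\<^sup>2 = R ^ 5 * l\<^sup>2" by (simp add: \<Lambda>_def power_mult_distrib flip: power_mult)
      also have "\<dots> = R ^ 5 * ((cos \<psi>)\<^sup>2 * (R\<^sup>2 * (2 + p / S ^ 4))\<^sup>2 / (2 * R ^ 7 * (sin \<psi>)\<^sup>2 * (R\<^sup>2 * (2 + q / S ^ 4))))"
        unfolding l conical_lambda_squared_def p_def[symmetric] q_def[symmetric] eq ..
      also have "\<dots> = (cos \<psi>)\<^sup>2 * X\<^sup>2 / (2 * (sin \<psi>)\<^sup>2 * Y)" if "Y > 0" "X = 2 + p / S ^ 4" "Y = 2 + q / S ^ 4" for X Y
        unfolding that(2,3)[symmetric] using R_pos cs that(1) by (simp add: field_simps eval_nat_numeral)
      finally show "\<Lambda>\<^sup>2 = (cos \<psi>)\<^sup>2 * (2 + (9 - 15 * (cos \<psi>)\<^sup>2) * (I\<^sub>1 - I\<^sub>2) / S ^ 4)\<^sup>2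
          / (2 * (sin \<psi>)\<^sup>2 * (2 + (3 - 9 * (cos \<psi>)\<^sup>2) * (I\<^sub>1 - I\<^sub>2) / S ^ 4))"
        using q unfolding p_def q_def by blast
    qed (use assms cs S in auto)
    have Ca: "C.a = a" by (simp add: C.a_def a_def)
    have x: "C.x\<^sub>r \<in> ball (E.centre \<psi>) d"
      using near[OF e(1,3)] C.x\<^sub>r_on_curve unfolding Ca C.\<epsilon>_def by simp
    \<comment> \<open>If the angular momentum vanished, the second coordinate alone would put the
      equilibrium at distance at least 1 from the centre, outside the ball.\<close>
    have m: "C.m\<^sub>0 \<noteq> 0"
    proof
      assume "C.m\<^sub>0 = 0"
      then have "C.m\<^sub>r = 0" by (simp add: C.m\<^sub>r_def)
      have "1 = dist (fst (snd (E.centre \<psi>))) (fst (snd C.x\<^sub>r))"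
        by (simp add: E.centre_def C.x\<^sub>r_def \<open>C.m\<^sub>r = 0\<close>)
      also have "\<dots> \<le> dist (E.centre \<psi>) C.x\<^sub>r"
        by (rule order_trans[OF dist_fst_le dist_snd_le])
      finally show False using x d(2) by simp
    qed
    have eq: "relative_equilibrium (inertia_axi I\<^sub>1 I\<^sub>2) (conical_velocity I\<^sub>1 I\<^sub>2 \<psi> R l) (conical_point I\<^sub>1 I\<^sub>2 \<psi> R l)"
      using C.conical_relative_equilibrium C.conical_point_eq C.conical_velocity_eq by (simp add: S)
    have stable: "Gmu_stable (inertia_axi I\<^sub>1 I\<^sub>2) (conical_point I\<^sub>1 I\<^sub>2 \<psi> R l)" if "I\<^sub>1 < I\<^sub>2"
    proof -
      have "a < 0" using that by (simp add: a_def)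
      then have "orbit_minimum I\<^sub>1 I\<^sub>2 C.R\<^sub>0 C.m\<^sub>0 C.P\<^sub>0"
        using C.conical_local_minimum[unfolded Ca, OF good x] C.R\<^sub>0_nz assms(2,4,6) by unfold_locales auto
      then show ?thesis using orbit_minimum.orbit_minimum_stable C.conical_point_eq by (simp add: S)
    qed
    show "relative_equilibrium (inertia_axi I\<^sub>1 I\<^sub>2) (conical_velocity I\<^sub>1 I\<^sub>2 \<psi> R l) (conical_point I\<^sub>1 I\<^sub>2 \<psi> R l)
     \<and> (I\<^sub>1 < I\<^sub>2 \<longrightarrow> Gmu_stable (inertia_axi I\<^sub>1 I\<^sub>2) (conical_point I\<^sub>1 I\<^sub>2 \<psi> R l))
     \<and> (I\<^sub>1 > I\<^sub>2 \<and> 4 * I\<^sub>2 > 3 * I\<^sub>1 \<longrightarrow>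
          unstable (inertia_axi I\<^sub>1 I\<^sub>2) (conical_velocity I\<^sub>1 I\<^sub>2 \<psi> R l) (conical_point I\<^sub>1 I\<^sub>2 \<psi> R l))"
      using eq stable oblate[OF _ C.conical_axioms e(2) m] unfolding S by blast
  qed
qed

end
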